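(* Let $A$ and $B$ be stably finite, simple, unital, nuclear (or exact), separable, infinite dimensional $C^*$-algebras and let $\phi:A\to B$ be a tracially sequentially-split $*$-homomorphism. If $B$ satisfies the strict comparison property, then so does $A$.
   Context: For a $C^*$-algebra $A$, let $A^+$ be its cone of positive elements (including $0$), $c_0(\mathbb{N},A)=\{(a_n)_n: \lim_n\|a_n\|=0\}$, $l^\infty(\mathbb{N},A)=\{(a_n)_n: (\|a_n\|)_n \text{ bounded}\}$, and $A_\infty=l^\infty(\mathbb{N},A)/c_0(\mathbb{N},A)$. $A$ is embedded in $A_\infty$ as constant sequences, and $A_\infty\cap A'$ is the central sequence algebra. Let $A_\infty^{++}$ be the set of $x\in A_\infty^+$, $x=[(x_n)_n]$, for which there is no strictly increasing sequence $(k_n)$ of natural numbers with $\lim_n x_{k_n}=0$. Definition. Let $A,B$ be separable $C^*$-algebras with $A$ unital. A $*$-homomorphism $\phi:A\to B$ is tracially sequentially-split if for every nonzero $z\in A_\infty^{++}$ there exist a $*$-homomorphism $\psi:B\to A_\infty$ and a nonzero projection $g\in A_\infty\cap A'$ such that (1) $\psi(\phi(a))=ag$ for each $a\in A$, and (2) $1_{A_\infty}-g$ is Murray-von Neumann equivalent in $A_\infty$ to a projection in the hereditary $C^*$-subalgebra $\overline{zA_\infty z}$. Strict comparison: for a unital $C^*$-algebra $A$, let $T(A)$ be the set of normalized traces (tracial states), $M_\infty(A)=\bigcup_n M_n(A)$ (embeddings $a\mapsto a\oplus 0$), and for $\tau\in T(A)$ (extended to matrices) and $a\in M_\infty(A)_+$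 set $d_\tau(a)=\lim_n\tau(a^{1/n})$. For positive $a,b$, write $a\lesssim b$ (Cuntz subequivalence) if there are sequences $(r_n),(s_n)$ with $r_nbs_n\to a$ in norm. $A$ has strict comparison if $a\lesssim b$ whenever $d_\tau(a)<d_\tau(b)$ for every $\tau\in T(A)$. *)

theory Defs
  imports "HOL-Analysis.Infinite_Sum" "HOL-Algebra.QuotRing" "HOL-Algebra.Module"
begin

section \<open>Unital \<open>C\<^sup>*\<close>-algebras\<close>

text \<open>All the \<open>C\<^sup>*\<close>-algebras that occur below are unital.  They are represented by records with
  an explicit carrier, since \<open>n \<times> n\<close> matrix algebras are needed with \<open>n\<close> varying inside formulas.\<close>

record 'a cstar = "(complex, 'a) module" +
  star :: "'a \<Rightarrow> 'a"
  nrm :: "'a \<Rightarrow> real"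

definition complex_ring :: "complex ring" where
  "complex_ring = \<lparr>carrier = UNIV, mult = (*), one = 1, zero = 0, add = (+)\<rparr>"

definition converges_to :: "('a, 'm) cstar_scheme \<Rightarrow> (nat \<Rightarrow> 'a) \<Rightarrow> 'a \<Rightarrow> bool" where
  "converges_to A X a \<longleftrightarrow> (\<lambda>n. nrm A (X n \<ominus>\<^bsub>A\<^esub> a)) \<longlonglongrightarrow> 0"

locale unital_cstar_algebra = Module.module complex_ring A + ring A for A (structure) +
  assumes smult_mult_left:
      "\<lbrakk>x \<in> carrier A; y \<in> carrier A\<rbrakk> \<Longrightarrow> (c \<odot> x) \<otimes> y = c \<odot> (x \<otimes> y)"
    and smult_mult_right:
      "\<lbrakk>x \<in> carrier A; y \<in> carrier A\<rbrakk> \<Longrightarrow> x \<otimes> (c \<odot> y) = c \<odot> (x \<otimes> y)"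
    and star_closed: "x \<in> carrier A \<Longrightarrow> star A x \<in> carrier A"
    and star_star: "x \<in> carrier A \<Longrightarrow> star A (star A x) = x"
    and star_add:
      "\<lbrakk>x \<in> carrier A; y \<in> carrier A\<rbrakk> \<Longrightarrow> star A (x \<oplus> y) = star A x \<oplus> star A y"
    and star_smult: "x \<in> carrier A \<Longrightarrow> star A (c \<odot> x) = cnj c \<odot> star A x"
    and star_mult:
      "\<lbrakk>x \<in> carrier A; y \<in> carrier A\<rbrakk> \<Longrightarrow> star A (x \<otimes> y) = star A y \<otimes> star A x"
    and nrm_nonneg: "x \<in> carrier A \<Longrightarrow> 0 \<le> nrm A x"
    and nrm_eq_zero: "x \<in> carrier A \<Longrightarrow> nrm A x = 0 \<longleftrightarrow> x = \<zero>"
    and nrm_triangle: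
      "\<lbrakk>x \<in> carrier A; y \<in> carrier A\<rbrakk> \<Longrightarrow> nrm A (x \<oplus> y) \<le> nrm A x + nrm A y"
    and nrm_smult: "x \<in> carrier A \<Longrightarrow> nrm A (c \<odot> x) = cmod c * nrm A x"
    and nrm_mult:
      "\<lbrakk>x \<in> carrier A; y \<in> carrier A\<rbrakk> \<Longrightarrow> nrm A (x \<otimes> y) \<le> nrm A x * nrm A y"
    and cstar_identity: "x \<in> carrier A \<Longrightarrow> nrm A (star A x \<otimes> x) = (nrm A x)\<^sup>2"
    and nrm_complete:
      "\<lbrakk>\<And>n. X n \<in> carrier A;
        \<And>e. e > 0 \<Longrightarrow> \<exists>N. \<forall>m\<ge>N. \<forall>n\<ge>N. nrm A (X m \<ominus> X n) < e\<rbrakk>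
       \<Longrightarrow> \<exists>x\<in>carrier A. converges_to A X x"

definition closure_in :: "('a, 'm) cstar_scheme \<Rightarrow> 'a set \<Rightarrow> 'a set" where
  "closure_in A S = {a \<in> carrier A. \<exists>X. (\<forall>n. X n \<in> S) \<and> converges_to A X a}"

definition positive :: "('a, 'm) cstar_scheme \<Rightarrow> 'a \<Rightarrow> bool" where
  "positive A a \<longleftrightarrow> a \<in> carrier A \<and> (\<exists>b\<in>carrier A. a = star A b \<otimes>\<^bsub>A\<^esub> b)"

definition projection :: "('a, 'm) cstar_scheme \<Rightarrow> 'a \<Rightarrow> bool" where
  "projection A p \<longleftrightarrow> p \<in> carrier A \<and> star A p = p \<and> p \<otimes>\<^bsub>A\<^esub> p = p"

definition murray_von_neumann :: "('a, 'm) cstar_scheme \<Rightarrow> 'a \<Rightarrow> 'a \<Rightarrow> bool" where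
  "murray_von_neumann A p q \<longleftrightarrow> projection A p \<and> projection A q \<and>
     (\<exists>v\<in>carrier A. star A v \<otimes>\<^bsub>A\<^esub> v = p \<and> v \<otimes>\<^bsub>A\<^esub> star A v = q)"

definition separable_cstar :: "('a, 'm) cstar_scheme \<Rightarrow> bool" where
  "separable_cstar A \<longleftrightarrow>
     (\<exists>D. countable D \<and> D \<subseteq> carrier A \<and>
        (\<forall>a\<in>carrier A. \<forall>e>0. \<exists>d\<in>D. nrm A (a \<ominus>\<^bsub>A\<^esub> d) < e))"

definition finite_dim_cstar :: "('a, 'm) cstar_scheme \<Rightarrow> bool" where
  "finite_dim_cstar A \<longleftrightarrow>
     (\<exists>S. finite S \<and> S \<subseteq> carrier A \<and>
        (\<forall>a\<in>carrier A. \<exists>c. a = (\<Oplus>\<^bsub>A\<^esub>s\<in>S. c s \<odot>\<^bsub>A\<^esub> s)))"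

text \<open>Ring ideals of a unital algebra are automatically linear subspaces.\<close>

definition simple_cstar :: "('a, 'm) cstar_scheme \<Rightarrow> bool" where
  "simple_cstar A \<longleftrightarrow> carrier A \<noteq> {\<zero>\<^bsub>A\<^esub>} \<and>
     (\<forall>I. ideal I A \<and> closure_in A I = I \<longrightarrow> I = {\<zero>\<^bsub>A\<^esub>} \<or> I = carrier A)"

text \<open>Homomorphisms are not required to preserve the unit.\<close>

definition linear_map ::
  "('a, 'm) cstar_scheme \<Rightarrow> ('b, 'n) cstar_scheme \<Rightarrow> ('a \<Rightarrow> 'b) \<Rightarrow> bool" where
  "linear_map A B f \<longleftrightarrow> f ` carrier A \<subseteq> carrier B \<and>
     (\<forall>x\<in>carrier A. \<forall>y\<in>carrier A. f (x \<oplus>\<^bsub>A\<^esub> y) = f x \<oplus>\<^bsub>B\<^esub> f y) \<and>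
     (\<forall>c. \<forall>x\<in>carrier A. f (c \<odot>\<^bsub>A\<^esub> x) = c \<odot>\<^bsub>B\<^esub> f x)"

definition star_hom ::
  "('a, 'm) cstar_scheme \<Rightarrow> ('b, 'n) cstar_scheme \<Rightarrow> ('a \<Rightarrow> 'b) \<Rightarrow> bool" where
  "star_hom A B f \<longleftrightarrow> linear_map A B f \<and>
     (\<forall>x\<in>carrier A. \<forall>y\<in>carrier A. f (x \<otimes>\<^bsub>A\<^esub> y) = f x \<otimes>\<^bsub>B\<^esub> f y) \<and>
     (\<forall>x\<in>carrier A. f (star A x) = star B (f x))"


section \<open>Matrices\<close>

text \<open>A matrix over \<open>A\<close> is a function on \<open>\<nat> \<times> \<nat>\<close> with finite support, and \<open>M\<^sub>n(A)\<close> consists of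
  those supported in \<open>{0..<n} \<times> {0..<n}\<close>.  Hence the embedding \<open>a \<mapsto> a \<oplus> 0\<close> of \<open>M\<^sub>n(A)\<close> into
  \<open>M\<^sub>m(A)\<close>, \<open>n \<le> m\<close>, is an inclusion of sets, and the operations do not depend on \<open>n\<close>.\<close>

type_synonym 'a mat = "nat \<Rightarrow> nat \<Rightarrow> 'a"

definition mats :: "('a, 'm) cstar_scheme \<Rightarrow> nat \<Rightarrow> 'a mat set" where
  "mats A n = {M. \<forall>i j. M i j \<in> carrier A \<and> (\<not> (i < n \<and> j < n) \<longrightarrow> M i j = \<zero>\<^bsub>A\<^esub>)}"

definition mat_mult :: "('a, 'm) cstar_scheme \<Rightarrow> 'a mat \<Rightarrow> 'a mat \<Rightarrow> 'a mat" where
  "mat_mult A M N =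
     (\<lambda>i j. \<Oplus>\<^bsub>A\<^esub>k\<in>{k. M i k \<noteq> \<zero>\<^bsub>A\<^esub>}. M i k \<otimes>\<^bsub>A\<^esub> N k j)"

text \<open>The \<open>C\<^sup>*\<close>-norm of \<open>M\<^sub>n(A)\<close> is the operator norm of its action on the Hilbert module \<open>A\<^sup>n\<close>,
  whose norm is \<open>\<parallel>x\<parallel> = \<parallel>\<Sum>\<^sub>i x\<^sub>i\<^sup>* x\<^sub>i\<parallel>\<^sup>1\<^sup>/\<^sup>2\<close>.  Finitely supported columns of arbitrary length
  give the same supremum.\<close>

definition cols :: "('a, 'm) cstar_scheme \<Rightarrow> (nat \<Rightarrow> 'a) set" where
  "cols A = {x. (\<forall>i. x i \<in> carrier A) \<and> finite {i. x i \<noteq> \<zero>\<^bsub>A\<^esub>}}"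

definition col_norm :: "('a, 'm) cstar_scheme \<Rightarrow> (nat \<Rightarrow> 'a) \<Rightarrow> real" where
  "col_norm A x =
     sqrt (nrm A (\<Oplus>\<^bsub>A\<^esub>i\<in>{i. x i \<noteq> \<zero>\<^bsub>A\<^esub>}. star A (x i) \<otimes>\<^bsub>A\<^esub> x i))"

definition mat_col :: "('a, 'm) cstar_scheme \<Rightarrow> 'a mat \<Rightarrow> (nat \<Rightarrow> 'a) \<Rightarrow> nat \<Rightarrow> 'a" where
  "mat_col A M x = (\<lambda>i. \<Oplus>\<^bsub>A\<^esub>k\<in>{k. M i k \<noteq> \<zero>\<^bsub>A\<^esub>}. M i k \<otimes>\<^bsub>A\<^esub> x k)"

definition mat_norm :: "('a, 'm) cstar_scheme \<Rightarrow> 'a mat \<Rightarrow> real" where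
  "mat_norm A M = Sup {col_norm A (mat_col A M x) | x. x \<in> cols A \<and> col_norm A x \<le> 1}"

definition mat_alg :: "('a, 'm) cstar_scheme \<Rightarrow> nat \<Rightarrow> 'a mat cstar" where
  "mat_alg A n =
     \<lparr>carrier = mats A n,
      mult = mat_mult A,
      one = (\<lambda>i j. if i = j \<and> i < n then \<one>\<^bsub>A\<^esub> else \<zero>\<^bsub>A\<^esub>),
      zero = (\<lambda>i j. \<zero>\<^bsub>A\<^esub>),
      add = (\<lambda>M N i j. M i j \<oplus>\<^bsub>A\<^esub> N i j),
      smult = (\<lambda>c M i j. c \<odot>\<^bsub>A\<^esub> M i j),
      star = (\<lambda>M i j. star A (M j i)),
      nrm = mat_norm A\<rparr>"

text \<open>The union \<open>M\<^sub>\<infinity>(A)\<close> has no unit: the component \<^term>\<open>one\<close> of this record is meaningless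
  and must not be used.\<close>

definition mat_inf :: "('a, 'm) cstar_scheme \<Rightarrow> 'a mat cstar" where
  "mat_inf A = (mat_alg A 0)\<lparr>carrier := (\<Union>n. mats A n)\<rparr>"

definition finite_cstar :: "('a, 'm) cstar_scheme \<Rightarrow> bool" where
  "finite_cstar A \<longleftrightarrow> (\<forall>p. murray_von_neumann A \<one>\<^bsub>A\<^esub> p \<longrightarrow> p = \<one>\<^bsub>A\<^esub>)"

definition stably_finite :: "('a, 'm) cstar_scheme \<Rightarrow> bool" where
  "stably_finite A \<longleftrightarrow> (\<forall>n. finite_cstar (mat_alg A n))"


section \<open>Nuclearity and exactness\<close>

text \<open>Nuclear maps, nuclear and exact \<open>C\<^sup>*\<close>-algebras are defined as in Brown and Ozawa,
  \<open>C\<^sup>*\<close>-algebras and finite-dimensional approximations, Definitions 2.1.1, 2.3.1 and 2.3.2.\<close>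

definition complex_cstar :: "complex cstar" where
  "complex_cstar =
     \<lparr>carrier = UNIV, mult = (*), one = 1, zero = 0, add = (+),
      smult = (*), star = cnj, nrm = cmod\<rparr>"

definition contractive_cp_map ::
  "('a, 'm) cstar_scheme \<Rightarrow> ('b, 'n) cstar_scheme \<Rightarrow> ('a \<Rightarrow> 'b) \<Rightarrow> bool" where
  "contractive_cp_map A B f \<longleftrightarrow> linear_map A B f \<and>
     (\<forall>x\<in>carrier A. nrm B (f x) \<le> nrm A x) \<and>
     (\<forall>n M. positive (mat_alg A n) M \<longrightarrow> positive (mat_alg B n) (\<lambda>i j. f (M i j)))"

text \<open>A net of maps \<open>A \<rightarrow> M\<^sub>k(\<complex>) \<rightarrow> C\<close> converging to \<open>\<theta>\<close> in the point-norm topology exists iff every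
  basic point-norm neighbourhood of \<open>\<theta>\<close> contains such a map.\<close>

definition nuclear_map ::
  "('a, 'm) cstar_scheme \<Rightarrow> ('b, 'n) cstar_scheme \<Rightarrow> ('a \<Rightarrow> 'b) \<Rightarrow> bool" where
  "nuclear_map A C \<theta> \<longleftrightarrow>
     (\<forall>F e. finite F \<and> F \<subseteq> carrier A \<and> e > 0 \<longrightarrow>
        (\<exists>k f g. contractive_cp_map A (mat_alg complex_cstar k) f \<and>
           contractive_cp_map (mat_alg complex_cstar k) C g \<and>
           (\<forall>a\<in>F. nrm C (g (f a) \<ominus>\<^bsub>C\<^esub> \<theta> a) < e)))"

definition nuclear_cstar :: "('a, 'm) cstar_scheme \<Rightarrow> bool" where
  "nuclear_cstar A \<longleftrightarrow> nuclear_map A A (\<lambda>a. a)"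

text \<open>The Hilbert space \<open>\<ell>\<^sup>2('i)\<close> and the algebra of bounded operators on it.  Operators are
  extended by \<open>0\<close> outside \<open>\<ell>\<^sup>2('i)\<close>.\<close>

definition ell2 :: "('i \<Rightarrow> complex) set" where
  "ell2 = {x. (\<lambda>i. (cmod (x i))\<^sup>2) summable_on UNIV}"

definition ell2_inner :: "('i \<Rightarrow> complex) \<Rightarrow> ('i \<Rightarrow> complex) \<Rightarrow> complex" where
  "ell2_inner x y = (\<Sum>\<^sub>\<infinity>i. x i * cnj (y i))"

definition ell2_norm :: "('i \<Rightarrow> complex) \<Rightarrow> real" where
  "ell2_norm x = sqrt (\<Sum>\<^sub>\<infinity>i. (cmod (x i))\<^sup>2)"

definition bounded_ops :: "(('i \<Rightarrow> complex) \<Rightarrow> ('i \<Rightarrow> complex)) set" where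
  "bounded_ops =
     {T. (\<forall>x\<in>ell2. T x \<in> ell2) \<and> (\<forall>x. x \<notin> ell2 \<longrightarrow> T x = (\<lambda>i. 0)) \<and>
         (\<forall>x\<in>ell2. \<forall>y\<in>ell2. T (\<lambda>i. x i + y i) = (\<lambda>i. T x i + T y i)) \<and>
         (\<forall>c. \<forall>x\<in>ell2. T (\<lambda>i. c * x i) = (\<lambda>i. c * T x i)) \<and>
         (\<exists>K. \<forall>x\<in>ell2. ell2_norm (T x) \<le> K * ell2_norm x)}"

definition bounded_ops_cstar :: "(('i \<Rightarrow> complex) \<Rightarrow> ('i \<Rightarrow> complex)) cstar" where
  "bounded_ops_cstar =
     \<lparr>carrier = bounded_ops,
      mult = (\<lambda>S T x. S (T x)),
      one = (\<lambda>x. if x \<in> ell2 then x else (\<lambda>i. 0)),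
      zero = (\<lambda>x i. 0),
      add = (\<lambda>S T x i. S x i + T x i),
      smult = (\<lambda>c T x i. c * T x i),
      star = (\<lambda>T. THE S. S \<in> bounded_ops \<and>
                (\<forall>x\<in>ell2. \<forall>y\<in>ell2. ell2_inner (T x) y = ell2_inner x (S y))),
      nrm = (\<lambda>T. Sup {ell2_norm (T x) | x. x \<in> ell2 \<and> ell2_norm x \<le> 1})\<rparr>"

text \<open>HOL has no quantifier over all Hilbert spaces, but \<open>\<ell>\<^sup>2('a)\<close> is large enough, \<open>'a\<close> being the
  type of the elements of a nonzero \<open>A\<close>: a faithful nuclear representation of \<open>A\<close> stays nuclear
  when compressed to a reducing subspace, it has a reducing subspace of dimension at most the
  cardinality of \<open>A\<close> on which it is faithful, and a zero summand may be added.\<close>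

definition exact_cstar :: "('a, 'm) cstar_scheme \<Rightarrow> bool" where
  "exact_cstar A \<longleftrightarrow>
     (\<exists>\<pi> :: 'a \<Rightarrow> (('a \<Rightarrow> complex) \<Rightarrow> ('a \<Rightarrow> complex)).
        star_hom A bounded_ops_cstar \<pi> \<and> inj_on \<pi> (carrier A) \<and>
        nuclear_map A bounded_ops_cstar \<pi>)"


section \<open>The sequence algebra \<open>A\<^sub>\<infinity>\<close>\<close>

definition linf :: "('a, 'm) cstar_scheme \<Rightarrow> (nat \<Rightarrow> 'a) cstar" where
  "linf A =
     \<lparr>carrier = {x. (\<forall>n. x n \<in> carrier A) \<and> (\<exists>K. \<forall>n. nrm A (x n) \<le> K)},
      mult = (\<lambda>x y n. x n \<otimes>\<^bsub>A\<^esub> y n),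
      one = (\<lambda>n. \<one>\<^bsub>A\<^esub>),
      zero = (\<lambda>n. \<zero>\<^bsub>A\<^esub>),
      add = (\<lambda>x y n. x n \<oplus>\<^bsub>A\<^esub> y n),
      smult = (\<lambda>c x n. c \<odot>\<^bsub>A\<^esub> x n),
      star = (\<lambda>x n. star A (x n)),
      nrm = (\<lambda>x. SUP n. nrm A (x n))\<rparr>"

definition c0 :: "('a, 'm) cstar_scheme \<Rightarrow> (nat \<Rightarrow> 'a) set" where
  "c0 A = {x. (\<forall>n. x n \<in> carrier A) \<and> (\<lambda>n. nrm A (x n)) \<longlonglongrightarrow> 0}"

text \<open>In the quotient, \<open>c \<odot> X\<close> is the coset containing all \<open>c \<odot> x\<close>, \<open>x \<in> X\<close>; for \<open>c = 0\<close> it is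
  larger than the image of \<open>X\<close>.\<close>

definition cstar_quotient :: "('a, 'm) cstar_scheme \<Rightarrow> 'a set \<Rightarrow> 'a set cstar" where
  "cstar_quotient A I =
     \<lparr>carrier = carrier (A Quot I),
      mult = mult (A Quot I),
      one = one (A Quot I),
      zero = zero (A Quot I),
      add = add (A Quot I),
      smult = (\<lambda>c X. \<Union>x\<in>X. I +>\<^bsub>A\<^esub> (c \<odot>\<^bsub>A\<^esub> x)),
      star = (\<lambda>X. star A ` X),
      nrm = (\<lambda>X. Inf (nrm A ` X))\<rparr>"

definition seq_alg :: "('a, 'm) cstar_scheme \<Rightarrow> (nat \<Rightarrow> 'a) set cstar" where
  "seq_alg A = cstar_quotient (linf A) (c0 A)"

definition const_seq :: "('a, 'm) cstar_scheme \<Rightarrow> 'a \<Rightarrow> (nat \<Rightarrow> 'a) set" where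
  "const_seq A a = c0 A +>\<^bsub>linf A\<^esub> (\<lambda>n. a)"

definition central_seq_alg :: "('a, 'm) cstar_scheme \<Rightarrow> (nat \<Rightarrow> 'a) set set" where
  "central_seq_alg A =
     {X \<in> carrier (seq_alg A). \<forall>a\<in>carrier A.
        const_seq A a \<otimes>\<^bsub>seq_alg A\<^esub> X = X \<otimes>\<^bsub>seq_alg A\<^esub> const_seq A a}"

text \<open>Elements \<open>X\<close> of \<^term>\<open>seq_alg A\<close> are cosets, so \<open>x \<in> X\<close> says that \<open>X = [(x\<^sub>n)\<^sub>n]\<close>; the condition
  does not depend on the choice of \<open>x\<close>.\<close>

definition seq_alg_pp :: "('a, 'm) cstar_scheme \<Rightarrow> (nat \<Rightarrow> 'a) set set" where
  "seq_alg_pp A =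
     {X. positive (seq_alg A) X \<and>
         (\<forall>x\<in>X. \<not> (\<exists>k::nat \<Rightarrow> nat. strict_mono k \<and> (\<lambda>n. nrm A (x (k n))) \<longlonglongrightarrow> 0))}"

definition hereditary :: "('a, 'm) cstar_scheme \<Rightarrow> 'a \<Rightarrow> 'a set" where
  "hereditary A z = closure_in A ((\<lambda>y. z \<otimes>\<^bsub>A\<^esub> y \<otimes>\<^bsub>A\<^esub> z) ` carrier A)"

definition tracially_sequentially_split ::
  "('a, 'm) cstar_scheme \<Rightarrow> ('b, 'n) cstar_scheme \<Rightarrow> ('a \<Rightarrow> 'b) \<Rightarrow> bool" where
  "tracially_sequentially_split A B \<phi> \<longleftrightarrow> star_hom A B \<phi> \<and>
     (\<forall>z\<in>seq_alg_pp A. z \<noteq> \<zero>\<^bsub>seq_alg A\<^esub> \<longrightarrow>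
        (\<exists>\<psi> g. star_hom B (seq_alg A) \<psi> \<and>
           projection (seq_alg A) g \<and> g \<noteq> \<zero>\<^bsub>seq_alg A\<^esub> \<and> g \<in> central_seq_alg A \<and>
           (\<forall>a\<in>carrier A. \<psi> (\<phi> a) = const_seq A a \<otimes>\<^bsub>seq_alg A\<^esub> g) \<and>
           (\<exists>p\<in>hereditary (seq_alg A) z. projection (seq_alg A) p \<and>
              murray_von_neumann (seq_alg A) (\<one>\<^bsub>seq_alg A\<^esub> \<ominus>\<^bsub>seq_alg A\<^esub> g) p)))"


section \<open>Strict comparison\<close>

definition tracial_states :: "('a, 'm) cstar_scheme \<Rightarrow> ('a \<Rightarrow> complex) set" where
  "tracial_states A =
     {\<tau>. (\<forall>x\<in>carrier A. \<forall>y\<in>carrier A. \<tau> (x \<oplus>\<^bsub>A\<^esub> y) = \<tau> x + \<tau> y) \<and>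
         (\<forall>c. \<forall>x\<in>carrier A. \<tau> (c \<odot>\<^bsub>A\<^esub> x) = c * \<tau> x) \<and>
         (\<forall>x. positive A x \<longrightarrow> \<tau> x \<in> \<real> \<and> 0 \<le> Re (\<tau> x)) \<and>
         \<tau> \<one>\<^bsub>A\<^esub> = 1 \<and>
         (\<forall>x\<in>carrier A. \<forall>y\<in>carrier A. \<tau> (x \<otimes>\<^bsub>A\<^esub> y) = \<tau> (y \<otimes>\<^bsub>A\<^esub> x))}"

text \<open>The (non-normalized) extension of a trace to \<open>M\<^sub>\<infinity>(A)\<close>\<close>

definition mat_trace :: "('a, 'm) cstar_scheme \<Rightarrow> ('a \<Rightarrow> complex) \<Rightarrow> 'a mat \<Rightarrow> complex" where
  "mat_trace A \<tau> M = (\<Sum>i\<in>{i. M i i \<noteq> \<zero>\<^bsub>A\<^esub>}. \<tau> (M i i))"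

text \<open>\<open>a\<^sup>1\<^sup>/\<^sup>k\<close> for \<open>k \<ge> 1\<close> is the unique positive \<open>k\<close>-th root of a positive \<open>a \<in> M\<^sub>\<infinity>(A)\<close>.  The power
  is taken in \<open>M\<^sub>m(A)\<close> because \<^term>\<open>(\<lambda>b. b [^]\<^bsub>mat_inf A\<^esub> (k::nat))\<close> would involve the unit of
  \<^term>\<open>mat_inf A\<close>.\<close>

definition mat_root :: "('a, 'm) cstar_scheme \<Rightarrow> 'a mat \<Rightarrow> nat \<Rightarrow> 'a mat" where
  "mat_root A a k =
     (THE b. \<exists>m. positive (mat_alg A m) b \<and> b [^]\<^bsub>mat_alg A m\<^esub> k = a)"

text \<open>The values \<open>\<tau>(a\<^sup>1\<^sup>/\<^sup>k)\<close> are nonnegative reals.\<close>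

definition dim_fun :: "('a, 'm) cstar_scheme \<Rightarrow> ('a \<Rightarrow> complex) \<Rightarrow> 'a mat \<Rightarrow> real" where
  "dim_fun A \<tau> a = lim (\<lambda>k. Re (mat_trace A \<tau> (mat_root A a k)))"

definition cuntz_below :: "('a, 'm) cstar_scheme \<Rightarrow> 'a \<Rightarrow> 'a \<Rightarrow> bool" where
  "cuntz_below A a b \<longleftrightarrow>
     (\<exists>r s. (\<forall>n. r n \<in> carrier A \<and> s n \<in> carrier A) \<and>
        converges_to A (\<lambda>n. r n \<otimes>\<^bsub>A\<^esub> b \<otimes>\<^bsub>A\<^esub> s n) a)"

definition strict_comparison :: "('a, 'm) cstar_scheme \<Rightarrow> bool" where
  "strict_comparison A \<longleftrightarrow>
     (\<forall>a b. positive (mat_inf A) a \<and> positive (mat_inf A) b \<and>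
        (\<forall>\<tau>\<in>tracial_states A. dim_fun A \<tau> a < dim_fun A \<tau> b) \<longrightarrow>
        cuntz_below (mat_inf A) a b)"

end

theory Submission
  imports Defs "HOL-Analysis.Weierstrass_Theorems" "HOL-Computational_Algebra.Fundamental_Theorem_Algebra" "HOL-Analysis.Function_Topology"
begin

text \<open>Let \<open>a, b\<close> be \<open>n \<times> n\<close> matrices over \<open>A\<close> with \<open>d\<^sub>\<tau>(a) < d\<^sub>\<tau>(b)\<close> for all traces.  Since \<open>T(A)\<close> is
  compact, the cut-down \<open>a' = (a - \<epsilon>)\<^sub>+\<close> satisfies \<open>d\<^sub>\<tau>(a') + \<eta> \<le> d\<^sub>\<tau>(b)\<close> with a uniform \<open>\<eta> > 0\<close>.
  As \<open>A\<close> is simple and infinite dimensional, there is a nonzero \<open>z \<ge> 0\<close> with \<open>n d\<^sub>\<tau>(z) < \<eta>\<close> that is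
  dominated so strongly by a diagonal entry of \<open>b\<close> that \<open>t b u = z \<otimes> 1\<^sub>n\<close> for some matrices \<open>t, u\<close>.
  A trace of \<open>B\<close> pulls back along \<open>\<phi>\<close> to a positive multiple of a trace of \<open>A\<close>, so strict comparison
  in \<open>B\<close> gives \<open>r \<phi>(b) s \<approx> \<phi>(a') \<oplus> \<phi>(z) \<otimes> 1\<^sub>n\<close>.  Now split \<open>A\<^sub>\<infinity>\<close> by the central projection \<open>g\<close> belonging
  to \<open>z\<close>.  Applying \<open>\<psi>\<close> to the blocks of \<open>r\<close> and \<open>s\<close> handles the corner of \<open>g\<close>, where also
  \<open>z \<otimes> 1\<^sub>n\<close> is recovered, while \<open>t\<close> and \<open>u\<close> recover it in the corner of \<open>1 - g\<close>.  Thus both \<open>a' g\<close> and all of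
  \<open>z \<otimes> 1\<^sub>n\<close> are obtained from the same \<open>b\<close>, and \<open>a' (1 - g)\<close> is factored through \<open>z \<otimes> 1\<^sub>n\<close> because
  \<open>1 - g\<close> is equivalent to a projection in the hereditary subalgebra of \<open>z\<close>.  Hence \<open>a' \<lesssim> b\<close>.\<close>

section \<open>Calculus in unital \<open>C\<^sup>*\<close>-algebras\<close>

text \<open>The element \<open>z\<close> has to be chosen before the splitting, since
  \<open>g\<close> and \<open>\<psi>\<close> are supplied only for a given \<open>z\<close>; hence
  its dimension is made small uniformly over all traces. The remainder a'(1 - g) cannot be charged
  to a second copy of b, and a sum of two elements below b need not be below b. Comparison in B is
  therefore applied to the block sum of both targets: its off-diagonal zeros make the two pairs of
  factors approximately orthogonal. The map \<phi> need not be unital; a trace \<tau> of B restricts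
  to c \<sigma> with c = \<tau>(\<phi>(1)), which is positive because \<phi>(1) is nonzero and B is
  simple, and c cancels from the inequality of dimensions. Dimension functions are only lower
  semicontinuous in the trace, so a uniform gap appears only after the cut-down. Functional calculus
  is built from the axioms by approximation on all of [-\<parallel>h\<parallel>,
  \<parallel>h\<parallel>], without spectra. The sequence algebra serves only as a ring with
  involution; norm estimates are made on representing sequences at large indices.\<close>

context unital_cstar_algebra
begin

section \<open>Module laws in ordinary complex arithmetic instead of
  \<open>complex_ring\<close>\<close>

lemma smult_carrier [simp, intro]: "x \<in> carrier A \<Longrightarrow> c \<odot> x \<in> carrier A"
  using smult_closed[of c x] by (simp add: complex_ring_def)

lemma smult_plus: "x \<in> carrier A \<Longrightarrow> (c + d) \<odot> x = c \<odot> x \<oplus> d \<odot> x"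
  using smult_l_distr[of c d x] by (simp add: complex_ring_def)

lemma smult_add: "\<lbrakk>x \<in> carrier A; y \<in> carrier A\<rbrakk> \<Longrightarrow> c \<odot> (x \<oplus> y) = c \<odot> x \<oplus> c \<odot> y"
  using smult_r_distr[of c x y] by (simp add: complex_ring_def)

lemma smult_smult [simp]: "x \<in> carrier A \<Longrightarrow> c \<odot> (d \<odot> x) = (c * d) \<odot> x"
  using smult_assoc1[of c d x] by (simp add: complex_ring_def)

lemma smult_1 [simp]: "x \<in> carrier A \<Longrightarrow> 1 \<odot> x = x"
  using smult_one[of x] by (simp add: complex_ring_def)

lemma smult_0 [simp]: "x \<in> carrier A \<Longrightarrow> 0 \<odot> x = \<zero>"
  using smult_l_null[of x] by (simp add: complex_ring_def)

lemma smult_zero [simp]: "c \<odot> \<zero> = \<zero>"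
  using smult_r_null[of c] by (simp add: complex_ring_def)

lemma smult_uminus: "x \<in> carrier A \<Longrightarrow> (- c) \<odot> x = \<ominus> (c \<odot> x)"
  using smult_plus[of x c "- c"] by (intro minus_equality[symmetric]) (simp_all add: a_comm)

lemma smult_a_inv: "x \<in> carrier A \<Longrightarrow> c \<odot> (\<ominus> x) = \<ominus> (c \<odot> x)"
  using smult_add[of x "\<ominus> x" c] by (intro minus_equality[symmetric]) (simp_all add: r_neg a_comm)

lemma smult_minus: "\<lbrakk>x \<in> carrier A; y \<in> carrier A\<rbrakk> \<Longrightarrow> c \<odot> (x \<ominus> y) = c \<odot> x \<ominus> c \<odot> y"
  by (simp add: a_minus_def smult_add smult_a_inv)

lemma smult_diff: "x \<in> carrier A \<Longrightarrow> (c - d) \<odot> x = c \<odot> x \<ominus> d \<odot> x"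
  using smult_plus[of x c "- d"] by (simp add: a_minus_def smult_uminus)

lemma a_inv_smult: "x \<in> carrier A \<Longrightarrow> \<ominus> x = (- 1) \<odot> x"
  by (simp add: smult_uminus)

lemma smult_double: "x \<in> carrier A \<Longrightarrow> x \<oplus> x = 2 \<odot> x"
  using smult_plus[of x 1 1] by simp

lemma smult_one_mult [simp]:
  "x \<in> carrier A \<Longrightarrow> (c \<odot> \<one>) \<otimes> x = c \<odot> x" "x \<in> carrier A \<Longrightarrow> x \<otimes> (c \<odot> \<one>) = c \<odot> x"
  by (simp_all add: smult_mult_left smult_mult_right)

lemma smult_eq_zero_iff: "x \<in> carrier A \<Longrightarrow> c \<odot> x = \<zero> \<longleftrightarrow> c = 0 \<or> x = \<zero>"
  using nrm_eq_zero[of "c \<odot> x"] nrm_eq_zero[of x] by (simp add: nrm_smult)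

lemmas star_carrier [simp, intro] = star_closed

lemma star_zero [simp]: "star A \<zero> = \<zero>"
  using star_smult[of \<zero> 0] by simp

lemma star_one [simp]: "star A \<one> = \<one>"
proof -
  have "star A \<one> = star A \<one> \<otimes> star A (star A \<one>)" by (simp add: star_star)
  also have "\<dots> = star A (star A \<one> \<otimes> \<one>)" by (simp add: star_mult del: r_one)
  also have "\<dots> = \<one>" by (simp add: star_star)
  finally show ?thesis .
qed

lemma star_a_inv: "x \<in> carrier A \<Longrightarrow> star A (\<ominus> x) = \<ominus> star A x"
  by (simp add: a_inv_smult star_smult)

lemma star_minus: "\<lbrakk>x \<in> carrier A; y \<in> carrier A\<rbrakk> \<Longrightarrow> star A (x \<ominus> y) = star A x \<ominus> star A y"
  by (simp add: a_minus_def star_add star_a_inv)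

lemma nrm_zero [simp]: "nrm A \<zero> = 0"
  by (simp add: nrm_eq_zero)

lemma nrm_a_inv [simp]: "x \<in> carrier A \<Longrightarrow> nrm A (\<ominus> x) = nrm A x"
  by (simp add: a_inv_smult nrm_smult)

lemma nrm_minus_le: "\<lbrakk>x \<in> carrier A; y \<in> carrier A\<rbrakk> \<Longrightarrow> nrm A (x \<ominus> y) \<le> nrm A x + nrm A y"
  using nrm_triangle[of x "\<ominus> y"] by (simp add: a_minus_def)

lemma nrm_minus_commute: "\<lbrakk>x \<in> carrier A; y \<in> carrier A\<rbrakk> \<Longrightarrow> nrm A (x \<ominus> y) = nrm A (y \<ominus> x)"
proof -
  assume c: "x \<in> carrier A" "y \<in> carrier A"
  then have "x \<ominus> y = \<ominus> (y \<ominus> x)" by algebra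
  with c show ?thesis by simp
qed

lemma nrm_minus_triangle:
  assumes "x \<in> carrier A" "y \<in> carrier A" "z \<in> carrier A"
  shows "nrm A (x \<ominus> z) \<le> nrm A (x \<ominus> y) + nrm A (y \<ominus> z)"
proof -
  have "x \<ominus> z = (x \<ominus> y) \<oplus> (y \<ominus> z)" using assms by algebra
  with assms show ?thesis by (simp add: nrm_triangle)
qed

lemma nrm_le_minus:
  assumes "x \<in> carrier A" "y \<in> carrier A"
  shows "nrm A x \<le> nrm A y + nrm A (x \<ominus> y)"
proof -
  have "x = y \<oplus> (x \<ominus> y)" using assms by algebra
  with assms nrm_triangle[of y "x \<ominus> y"] show ?thesis by simp
qed

lemma minus_eq_zero_iff: "\<lbrakk>x \<in> carrier A; y \<in> carrier A\<rbrakk> \<Longrightarrow> x \<ominus> y = \<zero> \<longleftrightarrow> x = y"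
  by (metis a_minus_def minus_closed minus_equality minus_minus r_neg a_inv_closed)

lemma eqI_nrm: "\<lbrakk>x \<in> carrier A; y \<in> carrier A; nrm A (x \<ominus> y) \<le> 0\<rbrakk> \<Longrightarrow> x = y"
  using nrm_eq_zero[of "x \<ominus> y"] nrm_nonneg[of "x \<ominus> y"] by (simp add: minus_eq_zero_iff)

text \<open>The C*-identity gives \<parallel>y\<parallel>^2 = \<parallel>y^* y\<parallel> \<le>
  \<parallel>y^*\<parallel> \<parallel>y\<parallel>; cancel \<parallel>y\<parallel> and use the
  result for x and for its adjoint.\<close>

lemma nrm_star [simp]:
  assumes "x \<in> carrier A" shows "nrm A (star A x) = nrm A x"
proof -
  have le: "nrm A y \<le> nrm A (star A y)" if y: "y \<in> carrier A" for y
  proof (cases "nrm A y = 0")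
    case False
    have "nrm A y * nrm A y \<le> nrm A (star A y) * nrm A y"
      using cstar_identity[OF y] nrm_mult[of "star A y" y] y by (simp add: power2_eq_square)
    with False nrm_nonneg[OF y] show ?thesis by simp
  qed (use y nrm_nonneg in simp)
  from le[OF assms] le[of "star A x"] assms show ?thesis by (simp add: star_star)
qed

lemma star_mult_self_eq_zero: "\<lbrakk>x \<in> carrier A; star A x \<otimes> x = \<zero>\<rbrakk> \<Longrightarrow> x = \<zero>"
  using cstar_identity[of x] by (simp add: nrm_eq_zero)

text \<open>Only an inequality: in the zero algebra, which occurs as \<open>mat_alg A 0\<close>, the
  unit has norm 0.\<close>

lemma nrm_one_le: "nrm A \<one> \<le> 1"
proof (rule ccontr)
  assume "\<not> ?thesis"
  then have "nrm A \<one> < nrm A \<one> ^ 2" by (simp add: power2_eq_square)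
  with cstar_identity[of \<one>] show False by simp
qed

lemma nrm_smult_one_le: "nrm A (c \<odot> \<one>) \<le> cmod c"
  using mult_left_mono[OF nrm_one_le, of "cmod c"] by (simp add: nrm_smult)

lemma nrm_mult_le:
  assumes "x \<in> carrier A" "y \<in> carrier A" "nrm A x \<le> s" "nrm A y \<le> t"
  shows "nrm A (x \<otimes> y) \<le> s * t"
  using nrm_mult[OF assms(1,2)] mult_mono[OF assms(3,4)] nrm_nonneg[OF assms(1)] nrm_nonneg[OF assms(2)] assms(3)
  by linarith

section \<open>Norm convergence\<close>

lemma converges_const [simp]: "a \<in> carrier A \<Longrightarrow> converges_to A (\<lambda>_. a) a"
  by (simp add: converges_to_def a_minus_def r_neg)

lemma converges_unique:
  assumes "\<And>n. X n \<in> carrier A" "a \<in> carrier A" "b \<in> carrier A"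
    and "converges_to A X a" "converges_to A X b"
  shows "a = b"
proof -
  have "(\<lambda>n. nrm A (X n \<ominus> a) + nrm A (X n \<ominus> b)) \<longlonglongrightarrow> 0 + 0"
    using assms(4,5) unfolding converges_to_def by (intro tendsto_add)
  moreover have "nrm A (a \<ominus> b) \<le> nrm A (X n \<ominus> a) + nrm A (X n \<ominus> b)" for n
    using nrm_minus_triangle[of a "X n" b] nrm_minus_commute[of a "X n"] assms by simp
  ultimately have "nrm A (a \<ominus> b) \<le> 0 + 0" by (intro LIMSEQ_le_const) auto
  then show ?thesis using assms by (intro eqI_nrm) auto
qed

lemma converges_add:
  assumes "\<And>n. X n \<in> carrier A" "a \<in> carrier A" "\<And>n. Y n \<in> carrier A" "b \<in> carrier A"
    and "converges_to A X a" "converges_to A Y b"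
  shows "converges_to A (\<lambda>n. X n \<oplus> Y n) (a \<oplus> b)"
proof -
  have "(\<lambda>n. nrm A (X n \<ominus> a) + nrm A (Y n \<ominus> b)) \<longlonglongrightarrow> 0 + 0"
    using assms(5,6) unfolding converges_to_def by (intro tendsto_add)
  then have l: "(\<lambda>n. nrm A (X n \<ominus> a) + nrm A (Y n \<ominus> b)) \<longlonglongrightarrow> 0" by simp
  have "nrm A ((X n \<oplus> Y n) \<ominus> (a \<oplus> b)) \<le> nrm A (X n \<ominus> a) + nrm A (Y n \<ominus> b)" for n
  proof -
    have "(X n \<oplus> Y n) \<ominus> (a \<oplus> b) = (X n \<ominus> a) \<oplus> (Y n \<ominus> b)"
      using assms(1)[of n] assms(3)[of n] assms(2,4) by algebra
    then show ?thesis using assms by (simp add: nrm_triangle)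
  qed
  then show ?thesis unfolding converges_to_def
    by (intro tendsto_sandwich[OF _ _ tendsto_const l]) (auto simp: assms nrm_nonneg)
qed

lemma converges_smult:
  assumes "\<And>n. X n \<in> carrier A" "a \<in> carrier A" and "converges_to A X a"
  shows "converges_to A (\<lambda>n. c \<odot> X n) (c \<odot> a)"
proof -
  have "(\<lambda>n. cmod c * nrm A (X n \<ominus> a)) \<longlonglongrightarrow> cmod c * 0"
    using assms(3) unfolding converges_to_def by (intro tendsto_mult tendsto_const)
  then show ?thesis using assms unfolding converges_to_def
    by (simp flip: smult_minus nrm_smult)
qed

lemma converges_star:
  assumes "\<And>n. X n \<in> carrier A" "a \<in> carrier A" and "converges_to A X a"
  shows "converges_to A (\<lambda>n. star A (X n)) (star A a)"
  using assms unfolding converges_to_def by (simp flip: star_minus)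

lemma converges_minus:
  assumes "\<And>n. X n \<in> carrier A" "a \<in> carrier A" "\<And>n. Y n \<in> carrier A" "b \<in> carrier A"
    and "converges_to A X a" "converges_to A Y b"
  shows "converges_to A (\<lambda>n. X n \<ominus> Y n) (a \<ominus> b)"
  using converges_add[OF assms(1,2) _ _ assms(5) converges_smult[OF assms(3,4,6), of "-1"]] assms(1-4)
  by (simp add: a_minus_def flip: a_inv_smult)

lemma converges_nrm:
  assumes "\<And>n. X n \<in> carrier A" "a \<in> carrier A" and "converges_to A X a"
  shows "(\<lambda>n. nrm A (X n)) \<longlonglongrightarrow> nrm A a"
proof -
  have "\<bar>nrm A (X n) - nrm A a\<bar> \<le> nrm A (X n \<ominus> a)" for n
    using nrm_le_minus[of "X n" a] nrm_le_minus[of a "X n"] nrm_minus_commute[of a "X n"] assms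
    by simp
  then have "(\<lambda>n. nrm A (X n) - nrm A a) \<longlonglongrightarrow> 0"
    by (intro tendsto_rabs_zero_cancel[OF tendsto_sandwich[OF _ _ tendsto_const
        assms(3)[unfolded converges_to_def]]]) simp_all
  then show ?thesis using LIM_zero_iff by blast
qed

lemma converges_bound:
  assumes "\<And>n. X n \<in> carrier A" "a \<in> carrier A" and "converges_to A X a"
    and "\<And>n. nrm A (X n) \<le> t"
  shows "nrm A a \<le> t"
  using LIMSEQ_le_const2[OF converges_nrm[OF assms(1-3)]] assms(4) by blast

lemma converges_mult:
  assumes "\<And>n. X n \<in> carrier A" "a \<in> carrier A" "\<And>n. Y n \<in> carrier A" "b \<in> carrier A"
    and "converges_to A X a" "converges_to A Y b"
  shows "converges_to A (\<lambda>n. X n \<otimes> Y n) (a \<otimes> b)"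
proof -
  have "(\<lambda>n. nrm A (X n) * nrm A (Y n \<ominus> b) + nrm A (X n \<ominus> a) * nrm A b)
      \<longlonglongrightarrow> nrm A a * 0 + 0 * nrm A b"
    using assms(5,6) converges_nrm[OF assms(1,2,5)] unfolding converges_to_def
    by (intro tendsto_intros)
  then have l: "(\<lambda>n. nrm A (X n) * nrm A (Y n \<ominus> b) + nrm A (X n \<ominus> a) * nrm A b) \<longlonglongrightarrow> 0"
    by simp
  have "nrm A (X n \<otimes> Y n \<ominus> a \<otimes> b)
      \<le> nrm A (X n) * nrm A (Y n \<ominus> b) + nrm A (X n \<ominus> a) * nrm A b" for n
  proof -
    have "X n \<otimes> Y n \<ominus> a \<otimes> b = X n \<otimes> (Y n \<ominus> b) \<oplus> (X n \<ominus> a) \<otimes> b"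
      using assms(1)[of n] assms(3)[of n] assms(2,4) by algebra
    then show ?thesis
      using assms nrm_triangle[of "X n \<otimes> (Y n \<ominus> b)" "(X n \<ominus> a) \<otimes> b"]
        nrm_mult[of "X n" "Y n \<ominus> b"] nrm_mult[of "X n \<ominus> a" b]
      by simp
  qed
  then show ?thesis unfolding converges_to_def
    by (intro tendsto_sandwich[OF _ _ tendsto_const l]) (auto simp: assms nrm_nonneg)
qed

lemma converges_cong_le:
  assumes "\<And>n. nrm A (X n \<ominus> a) \<le> e n" "e \<longlonglongrightarrow> 0" "\<And>n. X n \<in> carrier A" "a \<in> carrier A"
  shows "converges_to A X a"
  unfolding converges_to_def
  by (rule tendsto_sandwich[OF _ _ tendsto_const assms(2)]) (auto simp: assms nrm_nonneg)

lemma Cauchy_converges: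
  assumes "\<And>n. X n \<in> carrier A" "\<And>m n. m \<le> n \<Longrightarrow> nrm A (X n \<ominus> X m) \<le> e m" "e \<longlonglongrightarrow> 0"
  obtains x where "x \<in> carrier A" "converges_to A X x"
proof -
  have "\<exists>N. \<forall>m\<ge>N. \<forall>n\<ge>N. nrm A (X m \<ominus> X n) < d" if d0: "d > 0" for d
  proof -
    obtain N where N: "\<And>n. n \<ge> N \<Longrightarrow> norm (e n - 0) < d"
      using LIMSEQ_D[OF assms(3) d0] by blast
    have "nrm A (X m \<ominus> X n) < d" if mn: "N \<le> m" "N \<le> n" for m n
    proof (cases "m \<le> n")
      case True
      then show ?thesis
        using assms(2)[OF True] N[OF mn(1)] nrm_minus_commute[OF assms(1) assms(1), of m n] by simp
    next
      case False
      then show ?thesis using assms(2)[of n m] N[OF mn(2)] by simp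
    qed
    then show ?thesis by blast
  qed
  then have "\<exists>x\<in>carrier A. converges_to A X x" by (rule nrm_complete[OF assms(1)])
  then show ?thesis using that by (elim bexE)
qed

end

section \<open>Positive elements\<close>

definition self_adjoint :: "('a, 'm) cstar_scheme \<Rightarrow> 'a set" where
  "self_adjoint A = {x \<in> carrier A. star A x = x}"

text \<open>\<open>\<parallel>t - x\<parallel> \<le> t\<close> says that the spectrum of \<open>x\<close> lies in \<open>[0, 2t]\<close>.  In this form closedness under
  addition needs no spectral theory.\<close>

definition psd :: "('a, 'm) cstar_scheme \<Rightarrow> 'a set" where
  "psd A = {x \<in> self_adjoint A. \<exists>t\<ge>0. nrm A (of_real t \<odot>\<^bsub>A\<^esub> \<one>\<^bsub>A\<^esub> \<ominus>\<^bsub>A\<^esub> x) \<le> t}"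

text \<open>The limit \<open>s\<close> satisfies \<open>(1 - s)\<^sup>2 = 1 - a\<close>.\<close>

primrec sqrt_iter :: "('a, 'm) cstar_scheme \<Rightarrow> 'a \<Rightarrow> nat \<Rightarrow> 'a" where
  "sqrt_iter A a 0 = \<zero>\<^bsub>A\<^esub>"
| "sqrt_iter A a (Suc n) = (1/2) \<odot>\<^bsub>A\<^esub> (a \<oplus>\<^bsub>A\<^esub> sqrt_iter A a n \<otimes>\<^bsub>A\<^esub> sqrt_iter A a n)"

text \<open>The same iteration for the scalar a = 1. If \<parallel>a\<parallel> \<le> 1, it
  majorizes the norms of \<open>sqrt_iter\<close>, and its increments majorize those of
  \<open>sqrt_iter\<close>.\<close>

primrec real_sqrt_iter :: "nat \<Rightarrow> real" where
  "real_sqrt_iter 0 = 0"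
| "real_sqrt_iter (Suc n) = (1 + real_sqrt_iter n * real_sqrt_iter n) / 2"

lemma real_sqrt_iter_bounds: "0 \<le> real_sqrt_iter n \<and> real_sqrt_iter n \<le> 1"
proof (induction n)
  case (Suc n)
  then have "real_sqrt_iter n * real_sqrt_iter n \<le> 1" by (simp add: mult_le_one)
  with Suc show ?case by simp
qed simp

lemma real_sqrt_iter_Suc: "real_sqrt_iter n \<le> real_sqrt_iter (Suc n)"
  using sum_squares_bound[of "real_sqrt_iter n" 1] by (simp add: power2_eq_square)

lemma of_real_sqrt_mult: "t \<ge> 0 \<Longrightarrow> of_real (sqrt t) * of_real (sqrt t) = (of_real t :: complex)"
  by (metis of_real_mult real_sqrt_mult_self abs_of_nonneg)

context unital_cstar_algebra
begin

lemma self_adjointI: "\<lbrakk>x \<in> carrier A; star A x = x\<rbrakk> \<Longrightarrow> x \<in> self_adjoint A"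
  by (simp add: self_adjoint_def)

lemma self_adjoint_carrier [simp]: "x \<in> self_adjoint A \<Longrightarrow> x \<in> carrier A"
  and self_adjoint_star [simp]: "x \<in> self_adjoint A \<Longrightarrow> star A x = x"
  by (simp_all add: self_adjoint_def)

lemma self_adjoint_zero [simp]: "\<zero> \<in> self_adjoint A"
  and self_adjoint_one [simp]: "\<one> \<in> self_adjoint A"
  and self_adjoint_add [simp]:
    "\<lbrakk>x \<in> self_adjoint A; y \<in> self_adjoint A\<rbrakk> \<Longrightarrow> x \<oplus> y \<in> self_adjoint A"
  and self_adjoint_minus [simp]:
    "\<lbrakk>x \<in> self_adjoint A; y \<in> self_adjoint A\<rbrakk> \<Longrightarrow> x \<ominus> y \<in> self_adjoint A"
  and self_adjoint_a_inv [simp]: "x \<in> self_adjoint A \<Longrightarrow> \<ominus> x \<in> self_adjoint A"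
  and self_adjoint_smult [simp]: "x \<in> self_adjoint A \<Longrightarrow> of_real r \<odot> x \<in> self_adjoint A"
  and self_adjoint_square [simp]: "x \<in> self_adjoint A \<Longrightarrow> x \<otimes> x \<in> self_adjoint A"
  by (auto intro!: self_adjointI simp: star_add star_minus star_a_inv star_smult star_mult)

lemma self_adjoint_smult' [simp]:
  "x \<in> self_adjoint A \<Longrightarrow> numeral w \<odot> x \<in> self_adjoint A"
  "x \<in> self_adjoint A \<Longrightarrow> (1 / numeral w) \<odot> x \<in> self_adjoint A"
  using self_adjoint_smult[of x "numeral w"] self_adjoint_smult[of x "1 / numeral w"] by auto

lemma self_adjoint_mult:
  "\<lbrakk>x \<in> self_adjoint A; y \<in> self_adjoint A; x \<otimes> y = y \<otimes> x\<rbrakk> \<Longrightarrow> x \<otimes> y \<in> self_adjoint A"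
  by (auto intro!: self_adjointI simp: star_mult)

lemma self_adjoint_limit:
  assumes "\<And>n. X n \<in> self_adjoint A" "x \<in> carrier A" "converges_to A X x"
  shows "x \<in> self_adjoint A"
proof -
  have "converges_to A (\<lambda>n. star A (X n)) (star A x)"
    using assms by (intro converges_star) auto
  then have "converges_to A X (star A x)" using assms(1) by simp
  with assms have "x = star A x" by (intro converges_unique[of X]) auto
  with assms(2) show ?thesis by (intro self_adjointI) auto
qed

lemma commute_limit:
  assumes "\<And>n. X n \<in> carrier A" "x \<in> carrier A" "converges_to A X x"
    and "y \<in> carrier A" "\<And>n. y \<otimes> X n = X n \<otimes> y"
  shows "y \<otimes> x = x \<otimes> y"
proof -
  have "converges_to A (\<lambda>n. y \<otimes> X n) (y \<otimes> x)" "converges_to A (\<lambda>n. X n \<otimes> y) (x \<otimes> y)"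
    using assms(1,2,4) by (auto intro: converges_mult[OF _ _ _ _ converges_const assms(3)]
        converges_mult[OF _ _ _ _ assms(3) converges_const])
  with assms(5) show ?thesis
    using assms(1,2,4) by (auto intro: converges_unique[of "\<lambda>n. X n \<otimes> y"])
qed

lemma sqrt_iter_carrier [simp]: "a \<in> carrier A \<Longrightarrow> sqrt_iter A a n \<in> carrier A"
  by (induction n) auto

lemma sqrt_iter_commute:
  assumes "a \<in> carrier A" "y \<in> carrier A" "y \<otimes> a = a \<otimes> y"
  shows "y \<otimes> sqrt_iter A a n = sqrt_iter A a n \<otimes> y"
proof (induction n)
  case (Suc n)
  let ?s = "sqrt_iter A a n"
  have "y \<otimes> (?s \<otimes> ?s) = ?s \<otimes> ?s \<otimes> y"
    using Suc assms by (metis m_assoc sqrt_iter_carrier)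
  with assms show ?case
    by (simp add: smult_mult_left smult_mult_right r_distr l_distr)
qed (use assms in simp)

text \<open>Convergence is by majorant: the increments are bounded by those of
  \<open>real_sqrt_iter\<close>, which is increasing and bounded. This covers
  \<parallel>a\<parallel> = 1, where no geometric rate is available. Whatever commutes with a
  commutes with every iterate and hence with the limit.\<close>

lemma sqrt_exists:
  assumes a: "a \<in> self_adjoint A" and n1: "nrm A a \<le> 1"
  obtains s where "s \<in> self_adjoint A" "nrm A s \<le> 1" "(\<one> \<ominus> s) \<otimes> (\<one> \<ominus> s) = \<one> \<ominus> a"
    "\<And>y. \<lbrakk>y \<in> carrier A; y \<otimes> a = a \<otimes> y\<rbrakk> \<Longrightarrow> y \<otimes> s = s \<otimes> y"
proof -
  let ?s = "sqrt_iter A a" and ?r = real_sqrt_iter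
  have ac [simp]: "a \<in> carrier A" using a by simp
  have sa: "?s n \<in> self_adjoint A" for n
    by (induction n) (use a in simp_all)
  have bd: "nrm A (?s n) \<le> ?r n" for n
  proof (induction n)
    case (Suc n)
    have "nrm A (a \<oplus> ?s n \<otimes> ?s n) \<le> 1 + ?r n * ?r n"
      using nrm_triangle[of a "?s n \<otimes> ?s n"] n1 nrm_mult_le[OF _ _ Suc Suc] by simp
    then show ?case by (simp add: nrm_smult)
  qed simp
  have comm: "?s m \<otimes> ?s n = ?s n \<otimes> ?s m" for m n
    by (rule sqrt_iter_commute) (auto simp: sqrt_iter_commute[symmetric])
  have step: "nrm A (?s (Suc n) \<ominus> ?s n) \<le> ?r (Suc n) - ?r n" for n
  proof (induction n)
    case 0
    then show ?case using n1 by (simp add: nrm_smult a_minus_def)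
  next
    case (Suc n)
    let ?u = "?s (Suc n)" and ?v = "?s n"
    have "?s (Suc (Suc n)) \<ominus> ?u = (1/2) \<odot> ((a \<oplus> ?u \<otimes> ?u) \<ominus> (a \<oplus> ?v \<otimes> ?v))"
      by (simp add: smult_minus del: sqrt_iter.simps(2)) (simp add: sqrt_iter.simps(2))
    \<comment> \<open>The iterates commute with one another, so the difference of their squares
      factors.\<close>
    also have "(a \<oplus> ?u \<otimes> ?u) \<ominus> (a \<oplus> ?v \<otimes> ?v) = (?u \<ominus> ?v) \<otimes> (?u \<oplus> ?v)"
    proof -
      have c: "?u \<in> carrier A" "?v \<in> carrier A" by simp_all
      have "(?u \<ominus> ?v) \<otimes> (?u \<oplus> ?v) = (a \<oplus> ?u \<otimes> ?u) \<ominus> (a \<oplus> ?v \<otimes> ?v) \<oplus> (?u \<otimes> ?v \<ominus> ?v \<otimes> ?u)"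
        using c ac by algebra
      also have "?u \<otimes> ?v \<ominus> ?v \<otimes> ?u = \<zero>"
        using comm[of "Suc n" n] c by (subst minus_eq_zero_iff) auto
      finally show ?thesis using c ac by simp
    qed
    also have "nrm A ((1/2) \<odot> ((?u \<ominus> ?v) \<otimes> (?u \<oplus> ?v)))
        \<le> (1/2) * ((?r (Suc n) - ?r n) * (?r (Suc n) + ?r n))"
    proof -
      have "nrm A (?u \<oplus> ?v) \<le> ?r (Suc n) + ?r n"
        using nrm_triangle[of ?u ?v] bd[of "Suc n"] bd[of n] by (simp del: sqrt_iter.simps(2) real_sqrt_iter.simps(2))
      then show ?thesis
        using nrm_mult_le[OF _ _ Suc, of "?u \<oplus> ?v" "?r (Suc n) + ?r n"]
        by (simp add: nrm_smult del: sqrt_iter.simps(2) real_sqrt_iter.simps(2))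
    qed
    also have "\<dots> = ?r (Suc (Suc n)) - ?r (Suc n)"
      by (simp only: real_sqrt_iter.simps(2)[of "Suc n"]) (simp add: field_simps)
    finally show ?case .
  qed
  have tel: "nrm A (?s n \<ominus> ?s m) \<le> ?r n - ?r m" if "m \<le> n" for m n
    using that
  proof (induction rule: dec_induct)
    case base
    then show ?case by (simp add: a_minus_def r_neg)
  next
    case (step k)
    then show ?case
      using nrm_minus_triangle[of "?s (Suc k)" "?s k" "?s m"] \<open>\<And>n. nrm A (?s (Suc n) \<ominus> ?s n) \<le> ?r (Suc n) - ?r n\<close>[of k]
      by (simp del: sqrt_iter.simps(2) real_sqrt_iter.simps(2))
  qed
  have "incseq ?r" by (rule incseq_SucI) (rule real_sqrt_iter_Suc)
  then obtain L where L: "?r \<longlonglongrightarrow> L" "\<And>i. ?r i \<le> L"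
    using incseq_convergent[of ?r 1] real_sqrt_iter_bounds by blast
  obtain s where s [simp]: "s \<in> carrier A" and lim: "converges_to A ?s s"
  proof (rule Cauchy_converges[of ?s "\<lambda>m. L - ?r m"])
    show "nrm A (?s n \<ominus> ?s m) \<le> L - ?r m" if "m \<le> n" for m n
      using tel[OF that] L(2)[of n] by simp
    show "(\<lambda>m. L - ?r m) \<longlonglongrightarrow> 0"
      using tendsto_diff[OF tendsto_const[of L] L(1)] by simp
  qed auto
  have "converges_to A (\<lambda>n. ?s (Suc n)) ((1/2) \<odot> (a \<oplus> s \<otimes> s))"
    using lim by (auto intro!: converges_smult converges_add converges_mult)
  moreover have "converges_to A (\<lambda>n. ?s (Suc n)) s"
    using lim unfolding converges_to_def by (rule LIMSEQ_Suc)
  ultimately have fixp: "(1/2) \<odot> (a \<oplus> s \<otimes> s) = s"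
    by (intro converges_unique[of "\<lambda>n. ?s (Suc n)"]) (auto simp del: sqrt_iter.simps(2))
  then have "2 \<odot> ((1/2) \<odot> (a \<oplus> s \<otimes> s)) = 2 \<odot> s" by simp
  then have ss: "a \<oplus> s \<otimes> s = s \<oplus> s" by (simp add: smult_double)
  have eq: "(\<one> \<ominus> s) \<otimes> (\<one> \<ominus> s) = \<one> \<ominus> a"
  proof -
    have rearrange: "(e \<ominus> s) \<otimes> (e \<ominus> s)
        = e \<otimes> e \<ominus> a \<oplus> ((a \<oplus> s \<otimes> s) \<ominus> (e \<otimes> s \<oplus> s \<otimes> e))" if "e \<in> carrier A" for e
      using s ac that by algebra
    have "(\<one> \<ominus> s) \<otimes> (\<one> \<ominus> s) = \<one> \<ominus> a \<oplus> ((a \<oplus> s \<otimes> s) \<ominus> (s \<oplus> s))"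
      using rearrange[of \<one>] s ac by simp
    then show ?thesis by (simp add: ss a_minus_def r_neg)
  qed
  show thesis
  proof (rule that[OF _ _ eq])
    show "s \<in> self_adjoint A" by (rule self_adjoint_limit[OF sa s lim])
    show "nrm A s \<le> 1"
      by (rule converges_bound[OF _ s lim]) (auto intro: order_trans[OF bd] simp: real_sqrt_iter_bounds)
    show "y \<otimes> s = s \<otimes> y" if "y \<in> carrier A" "y \<otimes> a = a \<otimes> y" for y
      by (rule commute_limit[OF _ s lim]) (use that sqrt_iter_commute in auto)
  qed
qed

text \<open>The element \<open>s + i u\<close> is a multiple of a unitary.\<close>

lemma nrm_le_of_square_sum:
  assumes "s \<in> self_adjoint A" "u \<in> self_adjoint A" "s \<otimes> u = u \<otimes> s"
    and "s \<otimes> s \<oplus> u \<otimes> u = of_real r \<odot> \<one>" "0 \<le> r"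
  shows "nrm A u \<le> sqrt r"
proof -
  define w where "w = s \<oplus> \<i> \<odot> u"
  have c: "s \<in> carrier A" "u \<in> carrier A" "w \<in> carrier A"
    using assms(1,2) by (auto simp: w_def)
  have st: "star A w = s \<ominus> \<i> \<odot> u"
    using assms(1,2) c by (simp add: w_def star_add star_smult a_minus_def smult_uminus)
  have "star A w \<otimes> w = s \<otimes> s \<oplus> (s \<otimes> (\<i> \<odot> u) \<ominus> (\<i> \<odot> u) \<otimes> s) \<ominus> (\<i> \<odot> u) \<otimes> (\<i> \<odot> u)"
    unfolding st using c unfolding w_def
    by (simp add: a_minus_def l_distr r_distr a_ac l_minus r_minus minus_add)
  also have "\<dots> = of_real r \<odot> \<one>"
    using c assms(3) by (simp add: smult_mult_left smult_mult_right a_minus_def r_neg smult_uminus assms(4))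
  finally have "(nrm A w)\<^sup>2 \<le> r"
    using cstar_identity[OF c(3)] nrm_smult_one_le[of "of_real r"] assms(5) by simp
  then have nw: "nrm A w \<le> sqrt r" by (rule real_le_rsqrt)
  have "w \<ominus> star A w = (\<i> \<odot> u) \<oplus> (\<i> \<odot> u)"
    unfolding st using c unfolding w_def
    by (simp add: a_minus_def a_ac minus_add r_neg1 r_neg2 r_neg)
  also have "\<dots> = (2 * \<i>) \<odot> u" using c by (simp add: smult_double)
  finally have "2 * nrm A u = nrm A (w \<ominus> star A w)" using c by (simp add: nrm_smult norm_mult)
  also have "\<dots> \<le> 2 * sqrt r"
    using nrm_minus_le[of w "star A w"] c nw by simp
  finally show ?thesis by simp
qed

lemma psdI: "\<lbrakk>x \<in> self_adjoint A; nrm A (of_real t \<odot> \<one> \<ominus> x) \<le> t\<rbrakk> \<Longrightarrow> x \<in> psd A"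
  using order_trans[OF nrm_nonneg[of "of_real t \<odot> \<one> \<ominus> x"]]
  by (auto simp: psd_def intro!: exI[of _ t])

lemma psdE:
  assumes "x \<in> psd A"
  obtains t where "t \<ge> 0" "nrm A (of_real t \<odot> \<one> \<ominus> x) \<le> t"
  using assms by (auto simp: psd_def)

lemma psd_self_adjoint [simp]: "x \<in> psd A \<Longrightarrow> x \<in> self_adjoint A"
  by (simp add: psd_def)

lemma nrm_square: "s \<in> self_adjoint A \<Longrightarrow> nrm A (s \<otimes> s) = (nrm A s)\<^sup>2"
  using cstar_identity[of s] by simp

text \<open>After division by t, 1 - s^2/t is a square (1 - w)^2 with w commuting with s, so t - s^2
  = u^2 with u commuting with s. Then s^2 + u^2 = t bounds \<parallel>u\<parallel>, and with it the
  norm of u^2.\<close>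

lemma nrm_const_minus_square:
  assumes s: "s \<in> self_adjoint A" and t: "(nrm A s)\<^sup>2 \<le> t"
  shows "nrm A (of_real t \<odot> \<one> \<ominus> s \<otimes> s) \<le> t"
proof (cases "t = 0")
  case True
  then have "s = \<zero>" using t s by (simp add: nrm_eq_zero)
  with True show ?thesis by (simp add: a_minus_def)
next
  case False
  then have t0: "t > 0" using t zero_le_power2[of "nrm A s"] by linarith
  define a where "a = of_real (1/t) \<odot> (s \<otimes> s)"
  have a: "a \<in> self_adjoint A" using s unfolding a_def by (intro self_adjoint_smult) simp
  have "nrm A a \<le> 1" using s t t0 by (simp add: a_def nrm_smult nrm_square norm_divide)
  from sqrt_exists[OF a this] obtain w where w: "w \<in> self_adjoint A"
    "(\<one> \<ominus> w) \<otimes> (\<one> \<ominus> w) = \<one> \<ominus> a"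
    and comm: "\<And>y. \<lbrakk>y \<in> carrier A; y \<otimes> a = a \<otimes> y\<rbrakk> \<Longrightarrow> y \<otimes> w = w \<otimes> y" by metis
  define u where "u = of_real (sqrt t) \<odot> (\<one> \<ominus> w)"
  have c: "s \<in> carrier A" "w \<in> carrier A" using s w by auto
  have u: "u \<in> self_adjoint A" using w unfolding u_def by (intro self_adjoint_smult) simp
  have "s \<otimes> w = w \<otimes> s"
    using c by (intro comm) (auto simp: a_def smult_mult_left smult_mult_right m_assoc)
  then have su: "s \<otimes> u = u \<otimes> s"
    using c by (simp add: u_def smult_mult_left smult_mult_right a_minus_def r_distr l_distr l_minus r_minus)
  have "u \<otimes> u = of_real t \<odot> (\<one> \<ominus> a)"
    using c t0 by (simp add: u_def smult_mult_left smult_mult_right w(2) of_real_sqrt_mult self_adjoint_carrier[OF a])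
  also have "\<dots> = of_real t \<odot> \<one> \<ominus> s \<otimes> s"
    using c t0 by (simp add: a_def smult_minus)
  finally have uu: "u \<otimes> u = of_real t \<odot> \<one> \<ominus> s \<otimes> s" .
  have "nrm A u \<le> sqrt t"
  proof (rule nrm_le_of_square_sum[OF s u su])
    show "s \<otimes> s \<oplus> u \<otimes> u = of_real t \<odot> \<one>"
      unfolding uu using c smult_carrier[of \<one> "of_real t"] by algebra
  qed (use t0 in simp)
  then have "(nrm A u)\<^sup>2 \<le> (sqrt t)\<^sup>2" using nrm_nonneg[of u] u by (intro power_mono) auto
  then show ?thesis using t0 u by (simp flip: uu add: nrm_square)
qed

lemma psd_square [simp]: "s \<in> self_adjoint A \<Longrightarrow> s \<otimes> s \<in> psd A"
  by (rule psdI[OF _ nrm_const_minus_square[OF _ order_refl]]) auto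

text \<open>Dividing \<parallel>t - x\<parallel> \<le> t by t puts 1 - x/t into the unit ball, and
  \<open>sqrt_exists\<close> yields (1 - w)^2 = x/t. The bound \<parallel>w\<parallel> \<le> 1 makes
  the root positive as well.\<close>

lemma psd_sqrt:
  assumes x: "x \<in> psd A"
  obtains s where "s \<in> psd A" "s \<otimes> s = x"
    "\<And>y. \<lbrakk>y \<in> carrier A; y \<otimes> x = x \<otimes> y\<rbrakk> \<Longrightarrow> y \<otimes> s = s \<otimes> y"
proof -
  obtain t where t: "t \<ge> 0" "nrm A (of_real t \<odot> \<one> \<ominus> x) \<le> t" using psdE[OF x] by blast
  have xc: "x \<in> carrier A" using x by simp
  show ?thesis
  proof (cases "t = 0")
    case True
    then have "nrm A x \<le> 0" using t xc by (simp add: a_minus_def)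
    then have "x = \<zero>" using nrm_nonneg[OF xc] nrm_eq_zero[OF xc] by simp
    then show ?thesis using that[of \<zero>] psdI[of \<zero> 0] by (simp add: a_minus_def)
  next
    case False
    with t have t0: "t > 0" by simp
    define a where "a = \<one> \<ominus> of_real (1/t) \<odot> x"
    have a: "a \<in> self_adjoint A" using x unfolding a_def by (intro self_adjoint_minus self_adjoint_smult) auto
    have "of_real (1/t) \<odot> (of_real t \<odot> \<one> \<ominus> x) = a"
      using t0 xc by (simp add: a_def smult_minus)
    then have "nrm A a = (1/t) * nrm A (of_real t \<odot> \<one> \<ominus> x)"
      using xc t0 by (metis nrm_smult minus_closed smult_carrier one_closed norm_of_real abs_of_pos zero_less_divide_1_iff)
    then have "t * nrm A a \<le> t * 1" using t t0 by simp
    then have "nrm A a \<le> 1" using t0 by (simp only: mult_le_cancel_left_pos)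
    from sqrt_exists[OF a this] obtain w where w: "w \<in> self_adjoint A" "nrm A w \<le> 1"
      "(\<one> \<ominus> w) \<otimes> (\<one> \<ominus> w) = \<one> \<ominus> a"
      and comm: "\<And>y. \<lbrakk>y \<in> carrier A; y \<otimes> a = a \<otimes> y\<rbrakk> \<Longrightarrow> y \<otimes> w = w \<otimes> y" by metis
    define s where "s = of_real (sqrt t) \<odot> (\<one> \<ominus> w)"
    have wc: "w \<in> carrier A" using w by simp
    have s: "s \<in> self_adjoint A" using w unfolding s_def by (intro self_adjoint_smult) simp
    have oa: "\<one> \<ominus> a = of_real (1/t) \<odot> x"
      unfolding a_def using xc smult_carrier[OF xc, of "of_real (1/t)"] by algebra
    show ?thesis
    proof (rule that)
      have "of_real (sqrt t) \<odot> \<one> \<ominus> s = of_real (sqrt t) \<odot> (\<one> \<ominus> (\<one> \<ominus> w))"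
        using wc by (simp add: s_def smult_minus)
      also have "\<one> \<ominus> (\<one> \<ominus> w) = w" using wc by algebra
      finally show "s \<in> psd A"
        using w t0 wc by (intro psdI[OF s, of "sqrt t"]) (simp add: nrm_smult)
      show "s \<otimes> s = x"
        using wc xc t0 by (simp add: s_def smult_mult_left smult_mult_right w(3) oa of_real_sqrt_mult)
      show "y \<otimes> s = s \<otimes> y" if y: "y \<in> carrier A" "y \<otimes> x = x \<otimes> y" for y
      proof -
        have "y \<otimes> w = w \<otimes> y"
          using y xc by (intro comm) (auto simp: a_def smult_mult_left smult_mult_right
              a_minus_def r_distr l_distr l_minus r_minus)
        then show ?thesis
          using y wc by (simp add: s_def smult_mult_left smult_mult_right
              a_minus_def r_distr l_distr l_minus r_minus)
      qed
    qed
  qed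
qed

lemma psd_add [simp]:
  assumes "x \<in> psd A" "y \<in> psd A" shows "x \<oplus> y \<in> psd A"
proof -
  obtain s t where st: "nrm A (of_real s \<odot> \<one> \<ominus> x) \<le> s" "nrm A (of_real t \<odot> \<one> \<ominus> y) \<le> t"
    using psdE[OF assms(1)] psdE[OF assms(2)] by metis
  have c: "x \<in> carrier A" "y \<in> carrier A" "of_real s \<odot> \<one> \<in> carrier A" "of_real t \<odot> \<one> \<in> carrier A"
    using assms by auto
  have "of_real (s + t) \<odot> \<one> \<ominus> (x \<oplus> y) = (of_real s \<odot> \<one> \<oplus> of_real t \<odot> \<one>) \<ominus> (x \<oplus> y)"
    by (simp add: smult_plus)
  also have "\<dots> = (of_real s \<odot> \<one> \<ominus> x) \<oplus> (of_real t \<odot> \<one> \<ominus> y)"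
    using c by algebra
  finally show ?thesis
    using assms st c nrm_triangle[of "of_real s \<odot> \<one> \<ominus> x" "of_real t \<odot> \<one> \<ominus> y"]
    by (intro psdI[of _ "s + t"]) auto
qed

lemma psd_smult [simp]:
  assumes "x \<in> psd A" "r \<ge> 0" shows "of_real r \<odot> x \<in> psd A"
proof -
  obtain s where s: "nrm A (of_real s \<odot> \<one> \<ominus> x) \<le> s"
    using psdE[OF assms(1)] by blast
  have "of_real (r * s) \<odot> \<one> \<ominus> of_real r \<odot> x = of_real r \<odot> (of_real s \<odot> \<one> \<ominus> x)"
    using assms by (simp add: smult_minus)
  then show ?thesis using assms s
    by (intro psdI[of _ "r * s"]) (auto simp: nrm_smult mult_left_mono)
qed

lemma psd_zero [simp]: "\<zero> \<in> psd A" and psd_one [simp]: "\<one> \<in> psd A"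
  using psd_square[of \<zero>] psd_square[of \<one>] by simp_all

text \<open>The roots of commuting positive elements commute, so the product is the square of a
  self-adjoint element.\<close>

lemma psd_mult:
  assumes "x \<in> psd A" "y \<in> psd A" "x \<otimes> y = y \<otimes> x"
  shows "x \<otimes> y \<in> psd A"
proof -
  obtain s where s: "s \<in> psd A" "s \<otimes> s = x"
    "\<And>z. \<lbrakk>z \<in> carrier A; z \<otimes> x = x \<otimes> z\<rbrakk> \<Longrightarrow> z \<otimes> s = s \<otimes> z" using psd_sqrt[OF assms(1)] by metis
  obtain t where t: "t \<in> psd A" "t \<otimes> t = y"
    "\<And>z. \<lbrakk>z \<in> carrier A; z \<otimes> y = y \<otimes> z\<rbrakk> \<Longrightarrow> z \<otimes> t = t \<otimes> z" using psd_sqrt[OF assms(2)] by metis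
  have c: "s \<in> carrier A" "t \<in> carrier A" using s t by auto
  have "y \<otimes> s = s \<otimes> y" using s(3)[of y] assms by simp
  then have st: "s \<otimes> t = t \<otimes> s" using t(3)[of s] c by simp
  have "x \<otimes> y = (s \<otimes> t) \<otimes> (s \<otimes> t)"
    using c st s(2) t(2) by (metis m_assoc m_closed)
  then show ?thesis using st s t by (simp add: self_adjoint_mult)
qed

lemma psd_const_minus:
  "\<lbrakk>x \<in> self_adjoint A; nrm A x \<le> t\<rbrakk> \<Longrightarrow> of_real t \<odot> \<one> \<ominus> x \<in> psd A"
  "\<lbrakk>x \<in> self_adjoint A; nrm A x \<le> t\<rbrakk> \<Longrightarrow> of_real t \<odot> \<one> \<oplus> x \<in> psd A"
proof -
  assume x: "x \<in> self_adjoint A" "nrm A x \<le> t"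
  have c: "x \<in> carrier A" "of_real t \<odot> \<one> \<in> carrier A" using x by auto
  have "of_real t \<odot> \<one> \<ominus> (of_real t \<odot> \<one> \<ominus> x) = x" "of_real t \<odot> \<one> \<ominus> (of_real t \<odot> \<one> \<oplus> x) = \<ominus> x"
    using c by algebra+
  then show "of_real t \<odot> \<one> \<ominus> x \<in> psd A" "of_real t \<odot> \<one> \<oplus> x \<in> psd A"
    using x by (auto intro!: psdI[of _ t])
qed

text \<open>From -t \<le> x \<le> t the commuting product (t - x)(t + x) = t^2 - x^2 is positive,
  hence equal to s^2 with s commuting with x; then s^2 + x^2 = t^2 and
  \<open>nrm_le_of_square_sum\<close> applies.\<close>

lemma nrm_le_of_psd:
  assumes x: "x \<in> carrier A" and p: "of_real t \<odot> \<one> \<ominus> x \<in> psd A" "of_real t \<odot> \<one> \<oplus> x \<in> psd A" and t: "0 \<le> t"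
  shows "nrm A x \<le> t"
proof -
  let ?t = "of_real t \<odot> \<one>"
  have tc: "?t \<in> carrier A" "?t \<in> self_adjoint A" by auto
  \<comment> \<open>Self-adjointness of x is read off from t + x.\<close>
  have "(?t \<oplus> x) \<ominus> ?t = x" using x tc(1) by algebra
  then have xs: "x \<in> self_adjoint A" using p(2) tc by (metis psd_self_adjoint self_adjoint_minus)
  have tx: "?t \<otimes> x = x \<otimes> ?t" using x by simp
  have e1: "(?t \<ominus> x) \<otimes> (?t \<oplus> x) = (?t \<otimes> ?t \<ominus> x \<otimes> x) \<oplus> (?t \<otimes> x \<ominus> x \<otimes> ?t)"
    and e2: "(?t \<oplus> x) \<otimes> (?t \<ominus> x) = (?t \<otimes> ?t \<ominus> x \<otimes> x) \<oplus> (x \<otimes> ?t \<ominus> ?t \<otimes> x)"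
    using x tc(1) by algebra+
  have z: "?t \<otimes> x \<ominus> x \<otimes> ?t = \<zero>" "x \<otimes> ?t \<ominus> ?t \<otimes> x = \<zero>"
    using x tc(1) tx by (simp_all add: a_minus_def r_neg)
  have "(?t \<ominus> x) \<otimes> (?t \<oplus> x) \<in> psd A"
    using p e1 e2 z by (intro psd_mult) auto
  then have "?t \<otimes> ?t \<ominus> x \<otimes> x \<in> psd A" using e1 z x tc by simp
  then obtain s where s: "s \<in> psd A" "s \<otimes> s = ?t \<otimes> ?t \<ominus> x \<otimes> x"
    "\<And>y. \<lbrakk>y \<in> carrier A; y \<otimes> (?t \<otimes> ?t \<ominus> x \<otimes> x) = (?t \<otimes> ?t \<ominus> x \<otimes> x) \<otimes> y\<rbrakk> \<Longrightarrow> y \<otimes> s = s \<otimes> y"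
    using psd_sqrt by metis
  have "x \<otimes> s = s \<otimes> x"
    using x by (intro s(3)) (auto simp: a_minus_def r_distr l_distr l_minus r_minus m_assoc smult_mult_right)
  moreover have "s \<otimes> s \<oplus> x \<otimes> x = of_real (t\<^sup>2) \<odot> \<one>"
  proof -
    have "s \<otimes> s \<oplus> x \<otimes> x = ?t \<otimes> ?t" unfolding s(2) using x tc(1) by algebra
    then show ?thesis by (simp add: power2_eq_square)
  qed
  ultimately have "nrm A x \<le> sqrt (t\<^sup>2)"
    using s(1) xs by (intro nrm_le_of_square_sum[of s]) auto
  then show ?thesis using t by simp
qed

end

section \<open>Continuous functional calculus\<close>

definition peval :: "('a, 'm) cstar_scheme \<Rightarrow> 'a \<Rightarrow> real poly \<Rightarrow> 'a" where
  "peval A h p = fold_coeffs (\<lambda>a y. of_real a \<odot>\<^bsub>A\<^esub> \<one>\<^bsub>A\<^esub> \<oplus>\<^bsub>A\<^esub> h \<otimes>\<^bsub>A\<^esub> y) p \<zero>\<^bsub>A\<^esub>"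

text \<open>Approximation on all of \<open>[-\<parallel>h\<parallel>, \<parallel>h\<parallel>]\<close> instead of the spectrum suffices here; \<open>f\<close> has to be
  continuous and \<open>h\<close> self-adjoint for the description to be satisfiable.\<close>

definition cfc :: "('a, 'm) cstar_scheme \<Rightarrow> 'a \<Rightarrow> (real \<Rightarrow> real) \<Rightarrow> 'a" where
  "cfc A h f = (THE y. y \<in> carrier A \<and>
     (\<forall>p d. (\<forall>x. \<bar>x\<bar> \<le> nrm A h \<longrightarrow> \<bar>f x - poly p x\<bar> \<le> d) \<longrightarrow> nrm A (peval A h p \<ominus>\<^bsub>A\<^esub> y) \<le> d))"

lemma poly_of_real_add:
  fixes z :: complex
  shows "poly (map_poly of_real (p + q)) z = poly (map_poly of_real p) z + poly (map_poly of_real q) z"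
  by (induction p q rule: poly_induct2) (simp_all add: map_poly_pCons algebra_simps)

lemma poly_of_real_smult:
  fixes z :: complex
  shows "poly (map_poly of_real (smult c p)) z = of_real c * poly (map_poly of_real p) z"
  by (induction p) (simp_all add: map_poly_pCons algebra_simps)

lemma poly_of_real_mult:
  fixes z :: complex
  shows "poly (map_poly of_real (p * q)) z = poly (map_poly of_real p) z * poly (map_poly of_real q) z"
  by (induction p) (simp_all add: map_poly_pCons poly_of_real_add poly_of_real_smult algebra_simps)

text \<open>Take a complex root z. A real root gives a linear factor. Otherwise p is divided by the
  quadratic with roots z and its conjugate; the remainder vanishes at z, and c + d z = 0 with Im z
  nonzero forces c = d = 0.\<close>

lemma real_poly_factor:
  fixes p :: "real poly"
  assumes "degree p > 0"
  obtains r q where "p = [:- r, 1:] * q"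
  | u v q where "v \<noteq> 0" "p = ([:- u, 1:] * [:- u, 1:] + [:v * v:]) * q"
proof -
  let ?c = "map_poly of_real p :: complex poly"
  have "degree ?c = degree p" by (rule map_poly_degree_eq) (use assms in auto)
  then have "\<not> constant (poly ?c)" using assms by (simp add: constant_degree)
  then obtain z where z: "poly ?c z = 0" using fundamental_theorem_of_algebra by blast
  show ?thesis
  proof (cases "Im z = 0")
    case True
    then have "z = of_real (Re z)" by (simp add: complex_eq_iff)
    then have "poly ?c (of_real (Re z)) = 0" using z by simp
    moreover have "poly ?c (of_real x) = of_real (poly p x)" for x
      by (induction p) (simp_all add: map_poly_pCons)
    ultimately have "poly p (Re z) = 0" by simp
    then have "[:- Re z, 1:] dvd p" by (simp add: poly_eq_0_iff_dvd)
    then show ?thesis using that(1) by (elim dvdE)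
  next
    case False
    define u v where "u = Re z" and "v = Im z"
    define Q where "Q = [:- u, 1:] * [:- u, 1:] + [:v * v:]"
    have Q: "Q = [:u * u + v * v, - 2 * u, 1:]" by (simp add: Q_def)
    have Qz: "poly (map_poly of_real Q) z = 0"
      by (simp add: Q map_poly_pCons complex_eq_iff u_def v_def algebra_simps)
    have dQ: "degree Q = 2" by (simp add: Q)
    define r where "r = p mod Q"
    have "Q \<noteq> 0" using dQ by auto
    then have "degree r < 2"
      using degree_mod_less[of Q p] dQ by (auto simp: r_def)
    then obtain c d where r: "r = [:c, d:]"
      by (metis degree_eq_zeroE less_2_cases_iff degree_pCons_eq_if pCons_cases less_Suc_eq_le
          One_nat_def Suc_inject zero_neq_one pCons_0_0)
    have "p = p div Q * Q + r" by (simp add: r_def)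
    then have "poly (map_poly of_real r) z = 0"
      using z Qz by (metis poly_of_real_add poly_of_real_mult mult_zero_right add_0)
    then have "of_real c + of_real d * z = (0 :: complex)" by (simp add: r map_poly_pCons mult.commute)
    then have "d * Im z = 0" "c + d * Re z = 0" by (auto simp: complex_eq_iff)
    then have "r = 0" using False by (simp add: r)
    then have "p = Q * (p div Q)" using \<open>p = p div Q * Q + r\<close> by (simp add: mult.commute)
    then show ?thesis using that(2)[of v u] False unfolding Q_def v_def by blast
  qed
qed

context unital_cstar_algebra
begin

lemma peval_0 [simp]: "peval A h 0 = \<zero>"
  by (simp add: peval_def)

lemma peval_pCons [simp]:
  "h \<in> carrier A \<Longrightarrow> peval A h (pCons a p) = of_real a \<odot> \<one> \<oplus> h \<otimes> peval A h p"
  by (cases "p = 0 \<and> a = 0") (auto simp: peval_def)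

lemma peval_carrier [simp, intro]: "h \<in> carrier A \<Longrightarrow> peval A h p \<in> carrier A"
  by (induction p) auto

lemma peval_add: "h \<in> carrier A \<Longrightarrow> peval A h (p + q) = peval A h p \<oplus> peval A h q"
  by (induction p q rule: poly_induct2) (simp_all add: smult_plus r_distr a_ac)

lemma peval_smult: "h \<in> carrier A \<Longrightarrow> peval A h (smult c p) = of_real c \<odot> peval A h p"
  by (induction p) (simp_all add: smult_add smult_mult_right)

lemma peval_mult: "h \<in> carrier A \<Longrightarrow> peval A h (p * q) = peval A h p \<otimes> peval A h q"
  by (induction p) (simp_all add: peval_add peval_smult l_distr m_assoc)

lemma peval_minus: "h \<in> carrier A \<Longrightarrow> peval A h (p - q) = peval A h p \<ominus> peval A h q"
  using peval_add[of h p "- q"] peval_smult[of h "- 1" q] by (simp add: a_minus_def smult_uminus)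

lemma peval_intertwine:
  assumes "h \<in> carrier A" "k \<in> carrier A" "y \<in> carrier A" "y \<otimes> h = k \<otimes> y"
  shows "y \<otimes> peval A h p = peval A k p \<otimes> y"
proof (induction p)
  case (pCons a p)
  have "y \<otimes> (h \<otimes> peval A h p) = k \<otimes> peval A k p \<otimes> y"
    using assms pCons by (metis m_assoc peval_carrier)
  then show ?case using assms by (simp add: l_distr r_distr)
qed (use assms in simp)

lemma peval_commute: "h \<in> carrier A \<Longrightarrow> peval A h p \<otimes> peval A h q = peval A h q \<otimes> peval A h p"
  by (metis peval_mult mult.commute)

lemma peval_self_adjoint [simp]: "h \<in> self_adjoint A \<Longrightarrow> peval A h p \<in> self_adjoint A"
proof (induction p)
  case (pCons a p)
  then have "h \<otimes> peval A h p \<in> self_adjoint A"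
    by (intro self_adjoint_mult peval_intertwine) auto
  with pCons show ?case by simp
qed simp

text \<open>This replaces the spectral mapping theorem. By strict positivity the real roots r lie
  outside [-T, T], so a linear factor is up to sign r - h or h - r, which is positive because
  \<parallel>h\<parallel> \<le> T. A quadratic factor is a sum of squares. All factors commute, so
  their product is positive.\<close>

lemma peval_pos:
  assumes h: "h \<in> self_adjoint A" and T: "nrm A h \<le> T"
  shows "(\<And>x. \<bar>x\<bar> \<le> T \<Longrightarrow> poly p x > 0) \<Longrightarrow> peval A h p \<in> psd A"
proof (induction "degree p" arbitrary: p rule: less_induct)
  case less
  have hc: "h \<in> carrier A" using h by simp
  have T0: "T \<ge> 0" using T nrm_nonneg[OF hc] by simp
  have prod: "peval A h (f * q) \<in> psd A"
    if "p = f * q" "degree f > 0" "peval A h f \<in> psd A" "\<And>x. \<bar>x\<bar> \<le> T \<Longrightarrow> poly f x > 0" for f q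
  proof -
    have "q \<noteq> 0" using less.prems[of 0] that(1) T0 by auto
    moreover have "f \<noteq> 0" using that(2) by auto
    ultimately have "degree q < degree p" using that by (simp add: degree_mult_eq)
    moreover have "poly q x > 0" if x: "\<bar>x\<bar> \<le> T" for x
      using less.prems[OF x] \<open>\<And>x. \<bar>x\<bar> \<le> T \<Longrightarrow> poly f x > 0\<close>[OF x] \<open>p = f * q\<close>
      by (simp add: zero_less_mult_iff)
    ultimately have "peval A h q \<in> psd A" by (rule less.hyps)
    then show ?thesis using that(3) hc by (simp add: peval_mult psd_mult peval_commute)
  qed
  show ?case
  proof (cases "degree p = 0")
    case True
    then obtain c where c: "p = [:c:]" by (metis degree_eq_zeroE)
    have "c > 0" using less.prems[of 0] T0 c by simp
    then show ?thesis using c hc by simp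
  next
    case False
    then have "degree p > 0" by simp
    then show ?thesis
    proof (cases rule: real_poly_factor)
      case (1 r q)
      have nr: "\<bar>r\<bar> > T" using less.prems[of r] 1 by fastforce
      show ?thesis
      proof (cases "r > 0")
        case True
        have "(of_real r \<odot> \<one>) \<ominus> h \<in> psd A" using nr T h True by (intro psd_const_minus) auto
        then have "peval A h [:r, -1:] \<in> psd A"
          using hc by (simp add: a_minus_def smult_uminus r_minus)
        \<comment> \<open>The sign is moved to the cofactor, so that both factors are positive on
          the interval and the induction hypothesis applies.\<close>
        then have "peval A h ([:r, -1:] * (- q)) \<in> psd A"
          using nr True 1 by (intro prod) auto
        moreover have "[:r, -1:] = - [:- r, 1:]" by simp
        ultimately show ?thesis using 1 by (simp only: minus_mult_minus)
      next
        case False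
        have "(of_real (- r) \<odot> \<one>) \<oplus> h \<in> psd A" using nr T h False by (intro psd_const_minus) auto
        then have "peval A h ([:- r, 1:] * q) \<in> psd A"
          using nr False 1 hc by (intro prod) auto
        then show ?thesis using 1 by simp
      qed
    next
      case (2 u v q)
      let ?l = "[:- u, 1:]"
      have "peval A h (?l * ?l) \<in> psd A"
        unfolding peval_mult[OF hc] by (rule psd_square) (rule peval_self_adjoint[OF h])
      moreover have "peval A h [:v * v:] \<in> psd A" using hc by (simp del: of_real_mult)
      ultimately have "peval A h (?l * ?l + [:v * v:]) \<in> psd A"
        by (simp only: peval_add[OF hc] psd_add)
      moreover have "poly (?l * ?l + [:v * v:]) x > 0" for x
      proof -
        have "poly (?l * ?l + [:v * v:]) x = (x - u) * (x - u) + v * v" by (simp add: algebra_simps)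
        moreover have "(x - u) * (x - u) + v * v > 0"
          using 2(1) by (intro add_nonneg_pos) (auto simp: zero_less_mult_iff linorder_neq_iff)
        ultimately show ?thesis by (simp only:)
      qed
      ultimately have "peval A h ((?l * ?l + [:v * v:]) * q) \<in> psd A"
        using 2 by (intro prod) auto
      then show ?thesis using 2 by simp
    qed
  qed
qed

text \<open>Apply \<open>peval_pos\<close> to M + e + p and M + e - p; the extra e provides strict
  positivity.\<close>

lemma nrm_peval_le:
  assumes h: "h \<in> self_adjoint A" and M: "\<And>x. \<bar>x\<bar> \<le> nrm A h \<Longrightarrow> \<bar>poly p x\<bar> \<le> M"
  shows "nrm A (peval A h p) \<le> M"
proof (rule field_le_epsilon)
  fix e :: real assume e: "e > 0"
  have hc: "h \<in> carrier A" using h by simp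
  have M0: "M \<ge> 0" using M[of 0] nrm_nonneg[OF hc] by simp
  have "peval A h ([:M + e:] - p) \<in> psd A" "peval A h ([:M + e:] + p) \<in> psd A"
    using M e by (intro peval_pos[OF h order_refl]; fastforce simp: abs_le_iff)+
  then show "nrm A (peval A h p) \<le> M + e"
    using hc M0 e by (intro nrm_le_of_psd) (auto simp: peval_add peval_minus)
qed

lemma poly_approx:
  fixes f :: "real \<Rightarrow> real"
  assumes "continuous_on UNIV f" "e > 0"
  obtains p where "\<And>x. \<bar>x\<bar> \<le> T \<Longrightarrow> \<bar>f x - poly p x\<bar> \<le> e"
proof -
  obtain g where g: "real_polynomial_function g" "\<And>x. x \<in> {-T..T} \<Longrightarrow> \<bar>f x - g x\<bar> < e"
    using Stone_Weierstrass_real_polynomial_function[of "{-T..T}" f e] assms continuous_on_subset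
    by blast
  then obtain a n where a: "g = (\<lambda>x. \<Sum>i\<le>n. a i * x ^ i)"
    using real_polynomial_function_iff_sum by blast
  have "poly (\<Sum>i\<le>n. monom (a i) i) x = g x" for x
    by (simp add: a poly_sum poly_monom)
  then show ?thesis using g(2) by (intro that[of "\<Sum>i\<le>n. monom (a i) i"]) (smt (verit) atLeastAtMost_iff)
qed

lemma poly_approx_inverse:
  fixes f :: "real \<Rightarrow> real"
  assumes "continuous_on UNIV f"
  obtains P where "\<And>n x. \<bar>x\<bar> \<le> T \<Longrightarrow> \<bar>f x - poly (P n) x\<bar> \<le> inverse (real (Suc n))"
proof -
  have "\<exists>p. \<forall>x. \<bar>x\<bar> \<le> T \<longrightarrow> \<bar>f x - poly p x\<bar> \<le> inverse (real (Suc n))" for n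
    using poly_approx[OF assms, of "inverse (real (Suc n))" T] by (metis inverse_positive_iff_positive of_nat_0_less_iff zero_less_Suc)
  then show ?thesis using that by metis
qed

lemma poly_approx_seq:
  fixes f :: "real \<Rightarrow> real"
  assumes "continuous_on UNIV f"
  obtains P e where "\<And>n x. \<bar>x\<bar> \<le> T \<Longrightarrow> \<bar>f x - poly (P n) x\<bar> \<le> e n" "e \<longlonglongrightarrow> (0::real)"
proof -
  obtain P where P: "\<And>n x. \<bar>x\<bar> \<le> T \<Longrightarrow> \<bar>f x - poly (P n) x\<bar> \<le> inverse (real (Suc n))"
    using poly_approx_inverse[OF assms] by blast
  show ?thesis
    by (rule that[of P "\<lambda>n. inverse (real (Suc n))"]) (fact P LIMSEQ_inverse_real_of_nat)+
qed

lemma nrm_peval_minus_le: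
  assumes h: "h \<in> self_adjoint A"
    and "\<And>x. \<bar>x\<bar> \<le> nrm A h \<Longrightarrow> \<bar>f x - poly p x\<bar> \<le> d"
    and "\<And>x. \<bar>x\<bar> \<le> nrm A h \<Longrightarrow> \<bar>f x - poly q x\<bar> \<le> e"
  shows "nrm A (peval A h p \<ominus> peval A h q) \<le> d + e"
proof -
  have "nrm A (peval A h (p - q)) \<le> d + e"
  proof (rule nrm_peval_le[OF h])
    fix x assume x: "\<bar>x\<bar> \<le> nrm A h"
    have "\<bar>poly (p - q) x\<bar> = \<bar>(f x - poly q x) - (f x - poly p x)\<bar>" by simp
    also have "\<dots> \<le> e + d" by (rule order_trans[OF abs_triangle_ineq4 add_mono[OF assms(3)[OF x] assms(2)[OF x]]])
    finally show "\<bar>poly (p - q) x\<bar> \<le> d + e" by simp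
  qed
  then show ?thesis using h by (simp add: peval_minus)
qed

text \<open>The value is the limit of P(h) along polynomials approximating f. The bound for an
  arbitrary p follows by comparing p with that sequence, and the same bound makes the sequence
  converge to any other candidate.\<close>

lemma cfc_exists:
  assumes h: "h \<in> self_adjoint A" and f: "continuous_on UNIV f"
  shows "\<exists>!y. y \<in> carrier A \<and>
     (\<forall>p d. (\<forall>x. \<bar>x\<bar> \<le> nrm A h \<longrightarrow> \<bar>f x - poly p x\<bar> \<le> d) \<longrightarrow> nrm A (peval A h p \<ominus> y) \<le> d)"
    (is "\<exists>!y. ?P y")
proof -
  have hc: "h \<in> carrier A" using h by simp
  obtain P where P: "\<And>n x. \<bar>x\<bar> \<le> nrm A h \<Longrightarrow> \<bar>f x - poly (P n) x\<bar> \<le> inverse (real (Suc n))"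
    using poly_approx_inverse[OF f] by blast
  have lim0: "(\<lambda>n. inverse (real (Suc n))) \<longlonglongrightarrow> 0" by (rule LIMSEQ_inverse_real_of_nat)
  obtain y where y: "y \<in> carrier A" "converges_to A (\<lambda>n. peval A h (P n)) y"
  proof (rule Cauchy_converges[of "\<lambda>n. peval A h (P n)" "\<lambda>m. 2 * inverse (real (Suc m))"])
    fix m n :: nat assume "m \<le> n"
    then have "inverse (real (Suc n)) \<le> inverse (real (Suc m))" by simp
    then show "nrm A (peval A h (P n) \<ominus> peval A h (P m)) \<le> 2 * inverse (real (Suc m))"
      using nrm_peval_minus_le[OF h P P, of n m] by linarith
  next
    show "(\<lambda>m. 2 * inverse (real (Suc m))) \<longlonglongrightarrow> 0"
      using tendsto_mult[OF tendsto_const[of 2] lim0] by simp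
  qed (use hc in auto)
  show ?thesis
  proof (rule ex1I[of _ y])
    have "nrm A (peval A h p \<ominus> y) \<le> d"
      if pd: "\<And>x. \<bar>x\<bar> \<le> nrm A h \<Longrightarrow> \<bar>f x - poly p x\<bar> \<le> d" for p d
    proof -
      have "converges_to A (\<lambda>n. peval A h p \<ominus> peval A h (P n)) (peval A h p \<ominus> y)"
        by (rule converges_minus) (use hc y in auto)
      then have "(\<lambda>n. nrm A (peval A h p \<ominus> peval A h (P n))) \<longlonglongrightarrow> nrm A (peval A h p \<ominus> y)"
        by (rule converges_nrm[rotated 2]) (use hc y in auto)
      moreover have "(\<lambda>n. d + inverse (real (Suc n))) \<longlonglongrightarrow> d + 0"
        by (intro tendsto_intros lim0)
      moreover have "nrm A (peval A h p \<ominus> peval A h (P n)) \<le> d + inverse (real (Suc n))" for n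
        by (rule nrm_peval_minus_le[OF h pd P])
      ultimately show ?thesis by (intro LIMSEQ_le[of _ _ _ "d"]) auto
    qed
    then show "?P y" using y by blast
    fix y' assume y': "?P y'"
    have "converges_to A (\<lambda>n. peval A h (P n)) y'"
      by (rule converges_cong_le[OF _ lim0]) (use y' P hc in auto)
    then show "y' = y"
      by (rule converges_unique[rotated 3]) (use y y' hc in auto)
  qed
qed

lemma
  assumes "h \<in> self_adjoint A" "continuous_on UNIV f"
  shows cfc_carrier [simp]: "cfc A h f \<in> carrier A"
    and nrm_peval_cfc:
      "(\<And>x. \<bar>x\<bar> \<le> nrm A h \<Longrightarrow> \<bar>f x - poly p x\<bar> \<le> d) \<Longrightarrow> nrm A (peval A h p \<ominus> cfc A h f) \<le> d"
  using theI'[OF cfc_exists[OF assms]] unfolding cfc_def by blast+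

lemma peval_converges_cfc:
  assumes "h \<in> self_adjoint A" "continuous_on UNIV f" "nrm A h \<le> T"
    and "\<And>n x. \<bar>x\<bar> \<le> T \<Longrightarrow> \<bar>f x - poly (P n) x\<bar> \<le> e n" "e \<longlonglongrightarrow> 0"
  shows "converges_to A (\<lambda>n. peval A h (P n)) (cfc A h f)"
  by (rule converges_cong_le[OF nrm_peval_cfc assms(5)]) (use assms in auto)

lemma cfc_eqI:
  assumes "h \<in> self_adjoint A" "continuous_on UNIV f"
    and "\<And>n x. \<bar>x\<bar> \<le> nrm A h \<Longrightarrow> \<bar>f x - poly (P n) x\<bar> \<le> e n" "e \<longlonglongrightarrow> 0"
    and "converges_to A (\<lambda>n. peval A h (P n)) y" "y \<in> carrier A"
  shows "cfc A h f = y"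
  by (rule converges_unique[OF _ _ _ peval_converges_cfc[OF assms(1,2) order_refl assms(3,4)] assms(5)])
    (use assms in auto)

lemma cfc_poly: "h \<in> self_adjoint A \<Longrightarrow> cfc A h (poly p) = peval A h p"
  by (rule cfc_eqI[of _ _ "\<lambda>_. p" "\<lambda>_. 0"]) (auto intro: continuous_intros)

lemma cfc_const: "h \<in> self_adjoint A \<Longrightarrow> cfc A h (\<lambda>_. c) = of_real c \<odot> \<one>"
  using cfc_poly[of h "[:c:]"] by (simp add: fun_eq_iff[THEN iffD2, of "poly [:c:]" "\<lambda>_. c"])

lemma cfc_id: "h \<in> self_adjoint A \<Longrightarrow> cfc A h (\<lambda>x. x) = h"
  using cfc_poly[of h "[:0, 1:]"] by (simp add: fun_eq_iff[THEN iffD2, of "poly [:0, 1:]" "\<lambda>x. x"])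

lemma cfc_cong:
  assumes "h \<in> self_adjoint A" "continuous_on UNIV f" "continuous_on UNIV g"
    and "\<And>x. \<bar>x\<bar> \<le> nrm A h \<Longrightarrow> f x = g x"
  shows "cfc A h f = cfc A h g"
proof -
  obtain P e where P: "\<And>n x. \<bar>x\<bar> \<le> nrm A h \<Longrightarrow> \<bar>g x - poly (P n) x\<bar> \<le> e n" "e \<longlonglongrightarrow> 0"
    using poly_approx_seq[OF assms(3), of "nrm A h"] by metis
  show ?thesis
    by (rule cfc_eqI[OF assms(1,2) _ P(2) peval_converges_cfc[OF assms(1,3) order_refl P]])
      (use P assms in auto)
qed

lemma cfc_self_adjoint [simp]:
  assumes "h \<in> self_adjoint A" "continuous_on UNIV f"
  shows "cfc A h f \<in> self_adjoint A"
proof -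
  obtain P e where P: "\<And>n x. \<bar>x\<bar> \<le> nrm A h \<Longrightarrow> \<bar>f x - poly (P n) x\<bar> \<le> e n" "e \<longlonglongrightarrow> 0"
    using poly_approx_seq[OF assms(2), of "nrm A h"] by metis
  show ?thesis
    by (rule self_adjoint_limit[OF _ _ peval_converges_cfc[OF assms order_refl P]]) (use assms in auto)
qed

lemma cfc_add:
  assumes "h \<in> self_adjoint A" "continuous_on UNIV f" "continuous_on UNIV g"
  shows "cfc A h (\<lambda>x. f x + g x) = cfc A h f \<oplus> cfc A h g"
proof -
  obtain P e where P: "\<And>n x. \<bar>x\<bar> \<le> nrm A h \<Longrightarrow> \<bar>f x - poly (P n) x\<bar> \<le> e n" "e \<longlonglongrightarrow> 0"
    using poly_approx_seq[OF assms(2), of "nrm A h"] by metis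
  obtain Q d where Q: "\<And>n x. \<bar>x\<bar> \<le> nrm A h \<Longrightarrow> \<bar>g x - poly (Q n) x\<bar> \<le> d n" "d \<longlonglongrightarrow> 0"
    using poly_approx_seq[OF assms(3), of "nrm A h"] by metis
  have hc: "h \<in> carrier A" using assms by simp
  show ?thesis
  proof (rule cfc_eqI[of _ _ "\<lambda>n. P n + Q n" "\<lambda>n. e n + d n"])
    show "\<bar>f x + g x - poly (P n + Q n) x\<bar> \<le> e n + d n" if "\<bar>x\<bar> \<le> nrm A h" for n x
      using P(1)[OF that, of n] Q(1)[OF that, of n] by simp
    show "(\<lambda>n. e n + d n) \<longlonglongrightarrow> 0" using tendsto_add[OF P(2) Q(2)] by simp
    show "converges_to A (\<lambda>n. peval A h (P n + Q n)) (cfc A h f \<oplus> cfc A h g)"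
      unfolding peval_add[OF hc]
      by (rule converges_add[OF _ _ _ _ peval_converges_cfc[OF assms(1,2) order_refl P]
          peval_converges_cfc[OF assms(1,3) order_refl Q]]) (use assms in auto)
  qed (use assms in \<open>auto intro: continuous_intros\<close>)
qed

lemma cfc_mult:
  assumes "h \<in> self_adjoint A" "continuous_on UNIV f" "continuous_on UNIV g"
  shows "cfc A h (\<lambda>x. f x * g x) = cfc A h f \<otimes> cfc A h g"
proof -
  obtain P e where P: "\<And>n x. \<bar>x\<bar> \<le> nrm A h \<Longrightarrow> \<bar>f x - poly (P n) x\<bar> \<le> e n" "e \<longlonglongrightarrow> 0"
    using poly_approx_seq[OF assms(2), of "nrm A h"] by metis
  obtain Q d where Q: "\<And>n x. \<bar>x\<bar> \<le> nrm A h \<Longrightarrow> \<bar>g x - poly (Q n) x\<bar> \<le> d n" "d \<longlonglongrightarrow> 0"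
    using poly_approx_seq[OF assms(3), of "nrm A h"] by metis
  have hc: "h \<in> carrier A" using assms by simp
  have bd: "\<exists>F\<ge>0. \<forall>x. \<bar>x\<bar> \<le> nrm A h \<longrightarrow> \<bar>k x\<bar> \<le> F" if "continuous_on UNIV k" for k :: "real \<Rightarrow> real"
  proof -
    have "compact (k ` {- nrm A h..nrm A h})"
      using that by (intro compact_continuous_image continuous_on_subset[OF that]) auto
    then obtain F where "\<And>y. y \<in> k ` {- nrm A h..nrm A h} \<Longrightarrow> \<bar>y\<bar> \<le> F"
      using compact_imp_bounded bounded_iff real_norm_def by metis
    then have "\<bar>k x\<bar> \<le> F" if "\<bar>x\<bar> \<le> nrm A h" for x using that by (simp add: abs_le_iff)
    then show ?thesis by (intro exI[of _ "max F 0"]) (simp add: le_max_iff_disj)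
  qed
  obtain F where F: "F \<ge> 0" "\<And>x. \<bar>x\<bar> \<le> nrm A h \<Longrightarrow> \<bar>f x\<bar> \<le> F" using bd[OF assms(2)] by blast
  obtain G where G: "G \<ge> 0" "\<And>x. \<bar>x\<bar> \<le> nrm A h \<Longrightarrow> \<bar>g x\<bar> \<le> G" using bd[OF assms(3)] by blast
  show ?thesis
  proof (rule cfc_eqI[of _ _ "\<lambda>n. P n * Q n" "\<lambda>n. F * d n + e n * (G + d n)"])
    fix n x assume x: "\<bar>x\<bar> \<le> nrm A h"
    have "f x * g x - poly (P n * Q n) x
        = f x * (g x - poly (Q n) x) + (f x - poly (P n) x) * poly (Q n) x"
      by (simp add: algebra_simps)
    also have "\<bar>\<dots>\<bar> \<le> \<bar>f x * (g x - poly (Q n) x)\<bar> + \<bar>(f x - poly (P n) x) * poly (Q n) x\<bar>"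
      by (rule abs_triangle_ineq)
    also have "\<bar>f x * (g x - poly (Q n) x)\<bar> \<le> F * d n"
      unfolding abs_mult using F(1) F(2)[OF x] Q(1)[OF x] by (intro mult_mono) auto
    also have "\<bar>(f x - poly (P n) x) * poly (Q n) x\<bar> \<le> e n * (G + d n)"
      unfolding abs_mult using P(1)[OF x, of n] Q(1)[OF x, of n] G(2)[OF x]
      by (intro mult_mono) auto
    finally show "\<bar>f x * g x - poly (P n * Q n) x\<bar> \<le> F * d n + e n * (G + d n)" by simp
  next
    have "(\<lambda>n. F * d n + e n * (G + d n)) \<longlonglongrightarrow> F * 0 + 0 * (G + 0)"
      by (intro tendsto_intros P Q)
    then show "(\<lambda>n. F * d n + e n * (G + d n)) \<longlonglongrightarrow> 0" by simp
    show "converges_to A (\<lambda>n. peval A h (P n * Q n)) (cfc A h f \<otimes> cfc A h g)"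
      unfolding peval_mult[OF hc]
      by (rule converges_mult[OF _ _ _ _ peval_converges_cfc[OF assms(1,2) order_refl P]
          peval_converges_cfc[OF assms(1,3) order_refl Q]]) (use assms in auto)
  qed (use assms in \<open>auto intro: continuous_intros\<close>)
qed

lemma cfc_smult:
  assumes "h \<in> self_adjoint A" "continuous_on UNIV f"
  shows "cfc A h (\<lambda>x. c * f x) = of_real c \<odot> cfc A h f"
  using cfc_mult[OF assms(1) continuous_on_const assms(2), of c] assms by (simp add: cfc_const)

lemma cfc_minus:
  assumes "h \<in> self_adjoint A" "continuous_on UNIV f" "continuous_on UNIV g"
  shows "cfc A h (\<lambda>x. f x - g x) = cfc A h f \<ominus> cfc A h g"
proof -
  have "continuous_on UNIV (\<lambda>x. (- 1) * g x)" using assms(3) by (intro continuous_intros)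
  from cfc_add[OF assms(1,2) this] show ?thesis
    using assms cfc_smult[OF assms(1,3), of "-1"]
    by (simp add: a_minus_def smult_uminus)
qed

lemma cfc_intertwine:
  assumes "h \<in> self_adjoint A" "k \<in> self_adjoint A" "continuous_on UNIV f"
    and "y \<in> carrier A" "y \<otimes> h = k \<otimes> y"
  shows "y \<otimes> cfc A h f = cfc A k f \<otimes> y"
proof -
  let ?T = "max (nrm A h) (nrm A k)"
  obtain P e where P: "\<And>n x. \<bar>x\<bar> \<le> ?T \<Longrightarrow> \<bar>f x - poly (P n) x\<bar> \<le> e n" "e \<longlonglongrightarrow> 0"
    using poly_approx_seq[OF assms(3), of ?T] by metis
  have "converges_to A (\<lambda>n. y \<otimes> peval A h (P n)) (y \<otimes> cfc A h f)"
    by (rule converges_mult[OF _ _ _ _ converges_const peval_converges_cfc[OF assms(1,3) _ P, rotated]])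
      (use assms in auto)
  moreover have "converges_to A (\<lambda>n. peval A k (P n) \<otimes> y) (cfc A k f \<otimes> y)"
    by (rule converges_mult[OF _ _ _ _ peval_converges_cfc[OF assms(2,3) _ P, rotated] converges_const])
      (use assms in auto)
  moreover have "y \<otimes> peval A h p = peval A k p \<otimes> y" for p
    using assms by (intro peval_intertwine) auto
  ultimately show ?thesis
    using assms by (intro converges_unique[of "\<lambda>n. y \<otimes> peval A h (P n)"]) simp_all
qed

lemma nrm_cfc_le:
  assumes "h \<in> self_adjoint A" "continuous_on UNIV f"
    and "\<And>x. \<bar>x\<bar> \<le> nrm A h \<Longrightarrow> \<bar>f x\<bar> \<le> M"
  shows "nrm A (cfc A h f) \<le> M"
  using nrm_peval_cfc[OF assms(1,2), of 0 M] assms by (simp add: a_minus_def)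

text \<open>On the interval f is the square of sqrt |f|, which is continuous on the whole
  line.\<close>

lemma cfc_psd:
  assumes "h \<in> self_adjoint A" "continuous_on UNIV f"
    and "\<And>x. \<bar>x\<bar> \<le> nrm A h \<Longrightarrow> 0 \<le> f x"
  shows "cfc A h f \<in> psd A"
proof -
  have c: "continuous_on UNIV (\<lambda>x. sqrt \<bar>f x\<bar>)"
    using assms(2) by (intro continuous_intros)
  have "cfc A h f = cfc A h (\<lambda>x. sqrt \<bar>f x\<bar> * sqrt \<bar>f x\<bar>)"
    using assms c by (intro cfc_cong) (auto intro: continuous_intros)
  then show ?thesis using cfc_mult[OF assms(1) c c] c assms(1) by simp
qed

lemma peval_cfc:
  assumes "h \<in> self_adjoint A" "continuous_on UNIV g"
  shows "peval A (cfc A h g) p = cfc A h (\<lambda>x. poly p (g x))"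
proof (induction p)
  case (pCons a p)
  have "cfc A h (\<lambda>x. a + g x * poly p (g x))
      = cfc A h (\<lambda>_. a) \<oplus> cfc A h (\<lambda>x. g x * poly p (g x))"
    using assms by (intro cfc_add continuous_intros)
  also have "cfc A h (\<lambda>x. g x * poly p (g x)) = cfc A h g \<otimes> cfc A h (\<lambda>x. poly p (g x))"
    using assms by (intro cfc_mult continuous_intros)
  finally show ?case using pCons assms by (simp add: cfc_const)
qed (use assms cfc_const[of h 0] in simp)

text \<open>A bound T for g on the interval also bounds the norm of g(h), so polynomials close to f
  on [-T, T] approximate both sides.\<close>

lemma cfc_compose:
  assumes h: "h \<in> self_adjoint A" and f: "continuous_on UNIV f" and g: "continuous_on UNIV g"
  shows "cfc A (cfc A h g) f = cfc A h (\<lambda>x. f (g x))"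
proof -
  have "compact (g ` {- nrm A h..nrm A h})"
    using g by (intro compact_continuous_image continuous_on_subset[OF g]) auto
  then obtain T where T: "\<And>y. y \<in> g ` {- nrm A h..nrm A h} \<Longrightarrow> \<bar>y\<bar> \<le> T"
    using compact_imp_bounded bounded_iff real_norm_def by metis
  then have T: "\<bar>g x\<bar> \<le> T" if "\<bar>x\<bar> \<le> nrm A h" for x using that by (auto simp: abs_le_iff)
  have nT: "nrm A (cfc A h g) \<le> T" by (rule nrm_cfc_le[OF h g T])
  have fg: "continuous_on UNIV (\<lambda>x. f (g x))"
    using continuous_on_compose2[OF f g] by auto
  have pg: "continuous_on UNIV (\<lambda>x. poly p (g x))" for p using g by (intro continuous_intros)
  obtain P e where P: "\<And>n x. \<bar>x\<bar> \<le> T \<Longrightarrow> \<bar>f x - poly (P n) x\<bar> \<le> e n" "e \<longlonglongrightarrow> 0"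
    using poly_approx_seq[OF f, of T] by metis
  have "converges_to A (\<lambda>n. peval A (cfc A h g) (P n)) (cfc A (cfc A h g) f)"
    by (rule peval_converges_cfc[OF _ f nT P]) (use h g in auto)
  moreover have "converges_to A (\<lambda>n. cfc A h (\<lambda>x. poly (P n) (g x))) (cfc A h (\<lambda>x. f (g x)))"
  proof (rule converges_cong_le[OF _ P(2)])
    fix n
    have "nrm A (cfc A h (\<lambda>x. poly (P n) (g x) - f (g x))) \<le> e n"
      using P(1)[OF T, of _ n] pg fg h
      by (intro nrm_cfc_le) (auto intro: continuous_intros simp: abs_minus_commute)
    then show "nrm A (cfc A h (\<lambda>x. poly (P n) (g x)) \<ominus> cfc A h (\<lambda>x. f (g x))) \<le> e n"
      using cfc_minus[OF h pg fg] by simp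
  qed (use h fg pg in auto)
  ultimately show ?thesis
    using h f g fg pg by (intro converges_unique[of "\<lambda>n. cfc A h (\<lambda>x. poly (P n) (g x))"])
      (auto simp: peval_cfc)
qed

lemma psd_square_root_cfc:
  assumes "h \<in> psd A"
  obtains s where "s \<in> self_adjoint A" "cfc A s (\<lambda>x. x * x) = h" "(nrm A s)\<^sup>2 = nrm A h"
proof -
  obtain s where s: "s \<in> psd A" "s \<otimes> s = h" using psd_sqrt[OF assms] by metis
  have "cfc A s (\<lambda>x. x * x) = h"
    using s cfc_mult[of s "\<lambda>x. x" "\<lambda>x. x"] by (simp add: cfc_id continuous_on_id)
  then show ?thesis using that[of s] s nrm_square[of s] by simp
qed

text \<open>The calculus looks at the symmetric interval. Writing h = s^2 turns f(h) into the
  function f(x^2) of s, which sees f only on [0, \<parallel>h\<parallel>].\<close>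

lemma cfc_cong_psd:
  assumes h: "h \<in> psd A" and "continuous_on UNIV f" "continuous_on UNIV g"
    and eq: "\<And>x. \<lbrakk>0 \<le> x; x \<le> nrm A h\<rbrakk> \<Longrightarrow> f x = g x"
  shows "cfc A h f = cfc A h g"
proof -
  obtain s where s: "s \<in> self_adjoint A" "cfc A s (\<lambda>x. x * x) = h" "(nrm A s)\<^sup>2 = nrm A h"
    using psd_square_root_cfc[OF h] .
  have sq: "continuous_on UNIV (\<lambda>x::real. x * x)" by (intro continuous_intros)
  have c: "continuous_on UNIV (\<lambda>x. f (x * x))" "continuous_on UNIV (\<lambda>x. g (x * x))"
    using continuous_on_compose2[OF assms(2) sq] continuous_on_compose2[OF assms(3) sq] by auto
  have "cfc A s (\<lambda>x. f (x * x)) = cfc A s (\<lambda>x. g (x * x))"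
  proof (rule cfc_cong[OF s(1) c])
    fix x assume "\<bar>x\<bar> \<le> nrm A s"
    then have "\<bar>x\<bar>\<^sup>2 \<le> (nrm A s)\<^sup>2" by (intro power_mono) auto
    then show "f (x * x) = g (x * x)" using s(3) by (intro eq) (auto simp: power2_eq_square)
  qed
  then show ?thesis using cfc_compose[OF s(1) assms(2) sq] cfc_compose[OF s(1) assms(3) sq] s(2) by simp
qed

lemma continuous_on_abs_UNIV: "continuous_on UNIV (abs :: real \<Rightarrow> real)"
  by (intro continuous_intros)

text \<open>Extends estimates known on [0, \<parallel>h\<parallel>] to the symmetric interval
  required by the general lemmas.\<close>

lemma cfc_abs:
  assumes "h \<in> psd A" "continuous_on UNIV f"
  shows "cfc A h f = cfc A h (\<lambda>x. f \<bar>x\<bar>)"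
  using assms continuous_on_compose2[OF assms(2) continuous_on_abs_UNIV]
  by (intro cfc_cong_psd) (auto intro: continuous_intros)

lemma cfc_psd_psd:
  assumes h: "h \<in> psd A" and "continuous_on UNIV f"
    and "\<And>x. \<lbrakk>0 \<le> x; x \<le> nrm A h\<rbrakk> \<Longrightarrow> 0 \<le> f x"
  shows "cfc A h f \<in> psd A"
  unfolding cfc_abs[OF assms(1,2)]
  using assms continuous_on_compose2[OF assms(2) continuous_on_abs_UNIV]
  by (intro cfc_psd) (auto intro: continuous_intros)

lemma nrm_cfc_psd_le:
  assumes h: "h \<in> psd A" and "continuous_on UNIV f"
    and "\<And>x. \<lbrakk>0 \<le> x; x \<le> nrm A h\<rbrakk> \<Longrightarrow> \<bar>f x\<bar> \<le> M"
  shows "nrm A (cfc A h f) \<le> M"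
  unfolding cfc_abs[OF assms(1,2)]
  using assms continuous_on_compose2[OF assms(2) continuous_on_abs_UNIV]
  by (intro nrm_cfc_le) (auto intro: continuous_intros)

end

section \<open>Order and positive functionals\<close>

text \<open>Real-valued and real-linear, so that real parts of traces and \<open>trace_fun\<close>
  fit.\<close>

definition positive_functional :: "('a, 'm) cstar_scheme \<Rightarrow> ('a \<Rightarrow> real) \<Rightarrow> bool" where
  "positive_functional A F \<longleftrightarrow>
     (\<forall>x\<in>carrier A. \<forall>y\<in>carrier A. F (x \<oplus>\<^bsub>A\<^esub> y) = F x + F y) \<and>
     (\<forall>c. \<forall>x\<in>carrier A. F (of_real c \<odot>\<^bsub>A\<^esub> x) = c * F x) \<and>
     (\<forall>x\<in>psd A. 0 \<le> F x)"

text \<open>The dimension function attached to F inside a single algebra; \<open>dim_fun\<close> is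
  the case of a matrix algebra with F = \<open>trace_fun \<tau> n\<close>.\<close>

definition rank_fun :: "('a, 'm) cstar_scheme \<Rightarrow> ('a \<Rightarrow> real) \<Rightarrow> 'a \<Rightarrow> real" where
  "rank_fun A F x = lim (\<lambda>k. F (cfc A x (root k)))"

lemma continuous_on_root [continuous_intros]: "continuous_on S (root k)"
  using continuous_on_real_root[OF continuous_on_id] by simp

context unital_cstar_algebra
begin

lemma star_mult_self_self_adjoint [simp]: "x \<in> carrier A \<Longrightarrow> star A x \<otimes> x \<in> self_adjoint A"
  by (intro self_adjointI) (auto simp: star_mult star_star)

lemma cartesian_decomposition:
  assumes "y \<in> carrier A"
  obtains u v where "u \<in> self_adjoint A" "v \<in> self_adjoint A" "y = u \<oplus> \<i> \<odot> v"
proof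
  let ?u = "(1/2) \<odot> (y \<oplus> star A y)" and ?v = "(- \<i>/2) \<odot> (y \<ominus> star A y)"
  show "?u \<in> self_adjoint A"
    using assms by (intro self_adjointI) (auto simp: star_smult star_add star_star a_comm)
  have "star A ?v = (\<i>/2) \<odot> (star A y \<ominus> y)"
    using assms by (simp add: star_smult star_minus star_star)
  also have "star A y \<ominus> y = \<ominus> (y \<ominus> star A y)" using assms star_closed[OF assms] by algebra
  also have "(\<i>/2) \<odot> (\<ominus> (y \<ominus> star A y)) = ?v" using assms by (simp add: smult_a_inv smult_uminus)
  finally show "?v \<in> self_adjoint A" using assms by (intro self_adjointI) auto
  have "?u \<oplus> \<i> \<odot> ?v = (1/2) \<odot> ((y \<oplus> star A y) \<oplus> (y \<ominus> star A y))"
    using assms by (simp add: smult_add)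
  also have "(y \<oplus> star A y) \<oplus> (y \<ominus> star A y) = y \<oplus> y" using assms star_closed[OF assms] by algebra
  finally show "y = ?u \<oplus> \<i> \<odot> ?v" using assms by (simp add: smult_double)
qed

text \<open>With y = u + i v one has y y^* + y^* y = 2 (u^2 + v^2), which is positive; adding the
  positive element -y^* y leaves y y^*.\<close>

lemma mult_star_self_psd_of_neg:
  assumes y: "y \<in> carrier A" and n: "\<ominus> (star A y \<otimes> y) \<in> psd A"
  shows "y \<otimes> star A y \<in> psd A"
proof -
  obtain u v where uv: "u \<in> self_adjoint A" "v \<in> self_adjoint A" "y = u \<oplus> \<i> \<odot> v"
    using cartesian_decomposition[OF y] .
  define w where "w = \<i> \<odot> v"
  have c: "u \<in> carrier A" "w \<in> carrier A" "v \<in> carrier A" using uv by (auto simp: w_def)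
  have yw: "y = u \<oplus> w" "star A y = u \<ominus> w"
    using uv c by (simp_all add: w_def star_add star_smult a_minus_def smult_uminus)
  have "y \<otimes> star A y \<oplus> star A y \<otimes> y = (u \<oplus> w) \<otimes> (u \<ominus> w) \<oplus> (u \<ominus> w) \<otimes> (u \<oplus> w)"
    by (simp only: yw(2)) (simp only: yw(1))
  also have "\<dots> = (u \<otimes> u \<oplus> u \<otimes> u) \<ominus> (w \<otimes> w \<oplus> w \<otimes> w)"
    using c(1,2) by algebra
  also have "w \<otimes> w = \<ominus> (v \<otimes> v)" using c by (simp add: w_def smult_mult_left smult_mult_right smult_uminus)
  also have "(u \<otimes> u \<oplus> u \<otimes> u) \<ominus> (\<ominus> (v \<otimes> v) \<oplus> \<ominus> (v \<otimes> v)) = (u \<otimes> u \<oplus> u \<otimes> u) \<oplus> (v \<otimes> v \<oplus> v \<otimes> v)"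
    using c(1,3) by algebra
  finally have "y \<otimes> star A y \<oplus> star A y \<otimes> y \<in> psd A" using uv by simp
  then have "(y \<otimes> star A y \<oplus> star A y \<otimes> y) \<oplus> \<ominus> (star A y \<otimes> y) \<in> psd A" using n by (rule psd_add)
  moreover have "(y \<otimes> star A y \<oplus> star A y \<otimes> y) \<oplus> \<ominus> (star A y \<otimes> y) = y \<otimes> star A y"
    using y star_closed[OF y] by algebra
  ultimately show ?thesis by simp
qed

text \<open>Let n be the negative part of h = x^* x. For y = x n^(1/2) one finds y^* y = -n^2, so y
  y^* is positive by the preceding lemma. Now y intertwines y^* y and y y^*, hence also their
  negative parts, which are n^2 and 0. So y n^2 = 0, and multiplying by y^* gives n^4 = 0, whence n
  = 0.\<close>

lemma star_mult_self_psd [simp]: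
  assumes x: "x \<in> carrier A" shows "star A x \<otimes> x \<in> psd A"
proof -
  define h where "h = star A x \<otimes> x"
  have h: "h \<in> self_adjoint A" using x by (simp add: h_def)
  have hc: "h \<in> carrier A" using h by simp
  let ?n = "\<lambda>t::real. max 0 (- t)"
  have cn: "continuous_on UNIV ?n" by (intro continuous_intros)
  have cs: "continuous_on UNIV (\<lambda>t. sqrt (?n t))" by (intro continuous_intros)
  define r where "r = cfc A h (\<lambda>t. sqrt (?n t))"
  have r: "r \<in> self_adjoint A" using h cs by (simp add: r_def)
  define y where "y = x \<otimes> r"
  have y: "y \<in> carrier A" using x r by (simp add: y_def)
  have rc: "r \<in> carrier A" using r by simp
  have "star A y \<otimes> y = r \<otimes> h \<otimes> r"
    using x r rc by (simp add: y_def star_mult h_def m_assoc)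
  also have "\<dots> = cfc A h (\<lambda>t. sqrt (?n t) * t * sqrt (?n t))"
    using h cs by (simp add: r_def cfc_mult cfc_id continuous_on_mult continuous_on_id)
  also have "(\<lambda>t. sqrt (?n t) * t * sqrt (?n t)) = (\<lambda>t. (- 1) * (?n t * ?n t))"
  proof (rule ext)
    fix t :: real
    have "sqrt (?n t) * t * sqrt (?n t) = t * (sqrt (?n t) * sqrt (?n t))" by (simp only: ac_simps)
    also have "\<dots> = t * ?n t" by simp
    finally have e: "sqrt (?n t) * t * sqrt (?n t) = t * ?n t" .
    show "sqrt (?n t) * t * sqrt (?n t) = (- 1) * (?n t * ?n t)" unfolding e by (simp add: max_def)
  qed
  finally have yy: "star A y \<otimes> y = cfc A h (\<lambda>t. (- 1) * (?n t * ?n t))" .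
  define m where "m = cfc A h ?n \<otimes> cfc A h ?n"
  have ym: "star A y \<otimes> y = \<ominus> m"
    unfolding yy m_def using h cn cfc_smult[OF h continuous_on_mult[OF cn cn], of "-1"]
    by (simp add: cfc_mult smult_uminus)
  have m: "m \<in> psd A" using h cn by (simp add: m_def)
  then have mc: "m \<in> carrier A" by simp
  define k where "k = y \<otimes> star A y"
  have k: "k \<in> psd A" unfolding k_def using y m mc by (intro mult_star_self_psd_of_neg) (simp_all add: ym)
  have ksa: "\<ominus> m \<in> self_adjoint A" using m by simp
  have "y \<otimes> cfc A (\<ominus> m) ?n = cfc A k ?n \<otimes> y"
    by (rule cfc_intertwine[OF ksa _ cn y])
      (use k y in \<open>simp_all add: k_def m_assoc flip: ym\<close>)
  also have "cfc A k ?n = cfc A k (\<lambda>_. 0)" by (rule cfc_cong_psd[OF k cn]) auto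
  also have "\<dots> = \<zero>" using k by (simp add: cfc_const)
  also have "cfc A (\<ominus> m) ?n = m"
  proof -
    have cm: "continuous_on UNIV (\<lambda>t::real. - t)" by (intro continuous_intros)
    have "cfc A m (\<lambda>t. - t) = \<ominus> m"
      using cfc_smult[of m "\<lambda>t. t" "-1"] m by (simp add: cfc_id continuous_on_id smult_uminus)
    then have "cfc A (\<ominus> m) ?n = cfc A m (\<lambda>t. ?n (- t))" using cfc_compose[OF _ cn cm, of m] m by simp
    also have "\<dots> = cfc A m (\<lambda>t. t)"
      by (rule cfc_cong_psd[OF m]) (auto intro!: continuous_intros)
    also have "\<dots> = m" using m by (simp add: cfc_id)
    finally show ?thesis .
  qed
  finally have "y \<otimes> m = \<zero>" using y by simp
  then have "star A y \<otimes> (y \<otimes> m) = \<zero>" using y by simp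
  then have "(\<ominus> m) \<otimes> m = \<zero>" using y mc ym m_assoc[of "star A y" y m] by simp
  then have "m \<otimes> m = \<zero>" using mc by (simp add: l_minus)
  then have "m = \<zero>" using nrm_square[of m] m nrm_eq_zero[OF mc] by simp
  then have "cfc A h ?n = \<zero>"
    using nrm_square[of "cfc A h ?n"] h cn nrm_eq_zero[of "cfc A h ?n"] by (simp add: m_def)
  moreover have "h = cfc A h (\<lambda>t. max 0 t - ?n t)"
  proof -
    have "cfc A h (\<lambda>t. t) = cfc A h (\<lambda>t. max 0 t - ?n t)"
      by (rule cfc_cong[OF h]) ((intro continuous_intros)+, simp add: max_def)
    then show ?thesis using cfc_id[OF h] by simp
  qed
  moreover have "cfc A h (\<lambda>t. max 0 t - ?n t) = cfc A h (\<lambda>t. max 0 t) \<ominus> cfc A h ?n"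
    by (intro cfc_minus[OF h] continuous_intros)
  moreover have "cfc A h (\<lambda>t. max 0 t) \<in> psd A" by (rule cfc_psd[OF h]) (auto intro!: continuous_intros)
  ultimately show ?thesis by (simp add: h_def[symmetric] a_minus_def)
qed

lemma mult_star_self_psd [simp]: "x \<in> carrier A \<Longrightarrow> x \<otimes> star A x \<in> psd A"
  using star_mult_self_psd[of "star A x"] by (simp add: star_star)

text \<open>The bridge to the definition by b^* b: one direction is the preceding result, the other
  the square root.\<close>

lemma positive_iff_psd: "positive A a \<longleftrightarrow> a \<in> psd A"
proof
  assume "a \<in> psd A"
  then obtain s where "s \<in> psd A" "s \<otimes> s = a" using psd_sqrt by metis
  then show "positive A a" using self_adjoint_star[of s]
    by (auto simp: positive_def intro!: bexI[of _ s])
qed (auto simp: positive_def)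

lemma conj_psd [simp]:
  assumes "a \<in> psd A" "c \<in> carrier A"
  shows "star A c \<otimes> a \<otimes> c \<in> psd A"
proof -
  obtain s where s: "s \<in> psd A" "s \<otimes> s = a" using psd_sqrt[OF assms(1)] by metis
  have "star A c \<otimes> a \<otimes> c = star A (s \<otimes> c) \<otimes> (s \<otimes> c)"
    using s(1) assms(2) by (simp add: star_mult m_assoc flip: s(2))
  then show ?thesis using s(1) assms(2) by simp
qed

lemma conj_psd_le:
  assumes "y \<ominus> x \<in> psd A" "x \<in> carrier A" "y \<in> carrier A" "c \<in> carrier A"
  shows "star A c \<otimes> y \<otimes> c \<ominus> star A c \<otimes> x \<otimes> c \<in> psd A"
proof -
  have "star A c \<otimes> y \<otimes> c \<ominus> star A c \<otimes> x \<otimes> c = star A c \<otimes> (y \<ominus> x) \<otimes> c"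
    using assms(2-4) star_closed[OF assms(4)] by algebra
  then show ?thesis using assms by simp
qed

lemma psd_le_trans:
  assumes "y \<ominus> x \<in> psd A" "z \<ominus> y \<in> psd A" "x \<in> carrier A" "y \<in> carrier A" "z \<in> carrier A"
  shows "z \<ominus> x \<in> psd A"
proof -
  have "z \<ominus> x = (z \<ominus> y) \<oplus> (y \<ominus> x)" using assms(3-5) by algebra
  then show ?thesis using assms by simp
qed

text \<open>x lies between 0 and y \<le> \<parallel>y\<parallel>, hence between
  -\<parallel>y\<parallel> and \<parallel>y\<parallel>.\<close>

lemma nrm_mono:
  assumes "x \<in> psd A" "y \<ominus> x \<in> psd A" "y \<in> carrier A"
  shows "nrm A x \<le> nrm A y"
proof (rule nrm_le_of_psd)
  have x: "x \<in> carrier A" using assms by simp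
  have "(y \<ominus> x) \<oplus> x = y" using x assms(3) by algebra
  then have "y \<in> psd A" using assms psd_add by metis
  then show "of_real (nrm A y) \<odot> \<one> \<ominus> x \<in> psd A"
    using assms x by (intro psd_le_trans[OF assms(2) psd_const_minus(1)]) auto
  show "of_real (nrm A y) \<odot> \<one> \<oplus> x \<in> psd A"
    using assms nrm_nonneg[of y] by (intro psd_add psd_smult) auto
qed (use assms nrm_nonneg in auto)

lemma conj_psd_le_nrm:
  assumes "a \<in> psd A" "nrm A a \<le> t" "c \<in> carrier A"
  shows "of_real t \<odot> (star A c \<otimes> c) \<ominus> star A c \<otimes> a \<otimes> c \<in> psd A"
  using conj_psd_le[OF psd_const_minus(1)[of a t], of c] assms
  by (simp add: smult_mult_left smult_mult_right)

lemma psd_minus_square: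
  assumes "f \<in> psd A" "nrm A f \<le> 1" shows "f \<ominus> f \<otimes> f \<in> psd A"
proof -
  have f: "f \<in> carrier A" using assms by simp
  have "f \<otimes> (\<one> \<ominus> f) = f \<ominus> f \<otimes> f" "(\<one> \<ominus> f) \<otimes> f = f \<ominus> f \<otimes> f"
    using f by (simp_all add: a_minus_def r_distr l_distr l_minus r_minus)
  moreover have "\<one> \<ominus> f \<in> psd A" using psd_const_minus(1)[of f 1] assms by simp
  ultimately show ?thesis using psd_mult[OF assms(1), of "\<one> \<ominus> f"] by simp
qed

text \<open>By monotonicity of the norm s^2 \<le> s gives \<parallel>s\<parallel>^2 \<le>
  \<parallel>s\<parallel>, so \<parallel>s\<parallel> \<le> 1.\<close>

lemma psd_le_one_of_square:
  assumes "s \<in> psd A" "s \<ominus> s \<otimes> s \<in> psd A" shows "\<one> \<ominus> s \<in> psd A"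
proof -
  have s: "s \<in> carrier A" using assms by simp
  have "nrm A (s \<otimes> s) \<le> nrm A s" using assms s by (intro nrm_mono) auto
  then have "(nrm A s)\<^sup>2 \<le> nrm A s" using nrm_square[of s] assms by simp
  then have "nrm A s * nrm A s \<le> nrm A s * 1" by (simp add: power2_eq_square)
  then have "nrm A s \<le> 1" using nrm_nonneg[OF s] by (cases "nrm A s = 0") (auto simp: mult_le_cancel_left)
  then show ?thesis using psd_const_minus(1)[of s 1] assms by simp
qed

lemma positive_functional_minus:
  assumes "positive_functional A F" "x \<in> carrier A" "y \<in> carrier A"
  shows "F (x \<ominus> y) = F x - F y"
proof -
  have "F (x \<ominus> y) = F x + F (of_real (- 1) \<odot> y)"
    using assms by (simp add: positive_functional_def a_minus_def smult_uminus)
  then show ?thesis using assms by (simp add: positive_functional_def del: of_real_minus)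
qed

lemma positive_functional_mono:
  assumes "positive_functional A F" "y \<ominus> x \<in> psd A" "x \<in> carrier A" "y \<in> carrier A"
  shows "F x \<le> F y"
  using positive_functional_minus[OF assms(1,4,3)] assms(1,2) by (auto simp: positive_functional_def)

lemma positive_functional_cfc_mono:
  assumes F: "positive_functional A F" and "x \<in> psd A" "continuous_on UNIV f" "continuous_on UNIV g"
    and "\<And>t. \<lbrakk>0 \<le> t; t \<le> nrm A x\<rbrakk> \<Longrightarrow> f t \<le> g t"
  shows "F (cfc A x f) \<le> F (cfc A x g)"
proof (rule positive_functional_mono[OF F])
  have "cfc A x (\<lambda>t. g t - f t) \<in> psd A"
    by (rule cfc_psd_psd[OF assms(2)]) (use assms in \<open>auto intro: continuous_intros\<close>)
  then show "cfc A x g \<ominus> cfc A x f \<in> psd A" using assms by (simp add: cfc_minus)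
qed (use assms in auto)

lemma positive_functional_smult:
  "\<lbrakk>positive_functional A F; x \<in> carrier A\<rbrakk> \<Longrightarrow> F (of_real c \<odot> x) = c * F x"
  by (simp add: positive_functional_def)

text \<open>After rescaling by T the relevant interval is [0, 1], where t^(1/k) increases with k and
  stays below 1; so F of the rescaled roots increases to a limit, while T^(1/k) tends to 1. The
  second claim bounds the rank from below by a single root.\<close>

lemma rank_fun:
  assumes F: "positive_functional A F" and x: "x \<in> psd A" and T: "nrm A x \<le> T" "0 < T"
  shows rank_fun_tendsto: "(\<lambda>k. F (cfc A x (root k))) \<longlonglongrightarrow> rank_fun A F x"
    and rank_fun_ge: "k \<ge> 1 \<Longrightarrow> F (cfc A x (root k)) \<le> root k T * rank_fun A F x"
proof -
  define u where "u k = F (cfc A x (\<lambda>t. root k (t / T)))" for k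
  have ct: "continuous_on UNIV (\<lambda>t. root k (t / T))" for k
    using T by (intro continuous_intros) auto
  have xs: "x \<in> self_adjoint A" using x by simp
  have Fu: "F (cfc A x (root k)) = root k T * u k" for k
  proof -
    have "cfc A x (root k) = cfc A x (\<lambda>t. root k T * root k (t / T))"
      using T by (simp flip: real_root_mult)
    also have "\<dots> = of_real (root k T) \<odot> cfc A x (\<lambda>t. root k (t / T))"
      by (rule cfc_smult[OF xs ct])
    finally show ?thesis using F xs ct unfolding u_def by (simp add: positive_functional_smult)
  qed
  have mono: "u k \<le> u (Suc k)" if "k \<ge> 1" for k
    unfolding u_def using that T
    by (intro positive_functional_cfc_mono[OF F x ct ct] real_root_increasing) auto
  have bd: "u (Suc k) \<le> F \<one>" for k
  proof -
    have "u (Suc k) \<le> F (cfc A x (\<lambda>_. 1))"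
      unfolding u_def using T
      by (intro positive_functional_cfc_mono[OF F x ct]) auto
    then show ?thesis using xs by (simp add: cfc_const)
  qed
  have "incseq (\<lambda>k. u (Suc k))" by (rule incseq_SucI) (simp add: mono)
  then obtain d where d: "(\<lambda>k. u (Suc k)) \<longlonglongrightarrow> d" "\<And>k. u (Suc k) \<le> d"
    using incseq_convergent[of "\<lambda>k. u (Suc k)" "F \<one>"] bd by blast
  have "u \<longlonglongrightarrow> d" using d(1) by (rule LIMSEQ_imp_Suc)
  then have "(\<lambda>k. root k T * u k) \<longlonglongrightarrow> 1 * d"
    using LIMSEQ_root_const[OF T(2)] by (rule tendsto_mult[rotated])
  then have lim: "(\<lambda>k. F (cfc A x (root k))) \<longlonglongrightarrow> d" by (simp add: Fu)
  then have r: "rank_fun A F x = d" unfolding rank_fun_def by (rule limI)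
  show "(\<lambda>k. F (cfc A x (root k))) \<longlonglongrightarrow> rank_fun A F x" using lim r by simp
  show "F (cfc A x (root k)) \<le> root k T * rank_fun A F x" if "k \<ge> 1"
    unfolding Fu r using d(2)[of "k - 1"] that T by (intro mult_left_mono) auto
qed

text \<open>Where t > e one has (t/e)^(1/k) \<ge> 1, which dominates the j-th root of the cut-down
  up to a factor T^(1/j). Letting j grow with k fixed bounds a rank from above by F at one root of
  x, a quantity that is continuous in F.\<close>

lemma rank_fun_cut_le:
  assumes F: "positive_functional A F" and x: "x \<in> psd A" and e: "e > 0" and k: "k \<ge> 1"
  shows "rank_fun A F (cfc A x (\<lambda>t. max 0 (t - e))) \<le> root k (1 / e) * F (cfc A x (root k))"
proof -
  define y where "y = cfc A x (\<lambda>t. max 0 (t - e))"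
  have c: "continuous_on UNIV (\<lambda>t. max 0 (t - e))" by (intro continuous_intros)
  have xs: "x \<in> self_adjoint A" using x by simp
  have y: "y \<in> psd A" unfolding y_def using c by (intro cfc_psd_psd[OF x]) auto
  define T where "T = max 1 (nrm A x)"
  have ck: "continuous_on UNIV (\<lambda>t. root k (1 / e) * root k t)" by (intro continuous_intros)
  have "F (cfc A y (root j)) \<le> root j T * (root k (1 / e) * F (cfc A x (root k)))" if j: "j \<ge> 1" for j
  proof -
    have "cfc A y (root j) = cfc A x (\<lambda>t. root j (max 0 (t - e)))"
      unfolding y_def using xs c by (intro cfc_compose continuous_intros) auto
    also have "F \<dots> \<le> F (cfc A x (\<lambda>t. root j T * (root k (1 / e) * root k t)))"
    proof (rule positive_functional_cfc_mono[OF F x])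
      fix t assume t: "0 \<le> t" "t \<le> nrm A x"
      have T1: "root j T \<ge> 0" by (simp add: T_def real_root_ge_zero)
      show "root j (max 0 (t - e)) \<le> root j T * (root k (1 / e) * root k t)"
      proof (cases "t \<le> e")
        case True
        then have "max 0 (t - e) = 0" by simp
        moreover have "0 \<le> root j T * (root k (1 / e) * root k t)"
          using t e T1 by (intro mult_nonneg_nonneg[OF T1] mult_nonneg_nonneg real_root_ge_zero) auto
        ultimately show ?thesis by simp
      next
        case False
        have "1 \<le> t / e" using False e by simp
        then have "1 \<le> root k (1 / e * t)" using k by simp
        then have 1: "1 \<le> root k (1 / e) * root k t" by (simp only: real_root_mult)
        have "root j (max 0 (t - e)) \<le> root j T" using t e j False by (simp add: T_def)
        also have "\<dots> \<le> root j T * (root k (1 / e) * root k t)"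
          using mult_left_mono[OF 1 T1] by simp
        finally show ?thesis .
      qed
    qed (intro continuous_intros)+
    also have "\<dots> = root j T * (root k (1 / e) * F (cfc A x (root k)))"
      using F xs by (subst cfc_smult[OF xs ck], subst cfc_smult[OF xs continuous_on_root])
        (simp add: positive_functional_smult continuous_on_root del: of_real_mult smult_smult)
    finally show ?thesis .
  qed
  moreover have "(\<lambda>j. root j T * (root k (1 / e) * F (cfc A x (root k))))
      \<longlonglongrightarrow> 1 * (root k (1 / e) * F (cfc A x (root k)))"
    by (intro tendsto_intros LIMSEQ_root_const) (simp add: T_def)
  moreover have "(\<lambda>j. F (cfc A y (root j))) \<longlonglongrightarrow> rank_fun A F y"
    by (rule rank_fun_tendsto[OF F y, of "max 1 (nrm A y)"]) auto
  ultimately show ?thesis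
    unfolding y_def[symmetric] by (intro LIMSEQ_le[of _ "rank_fun A F y"]) auto
qed

text \<open>Since \<open>z (1 - f) = 0\<close>, also \<open>z\<^sup>1\<^sup>/\<^sup>k (1 - f) = 0\<close>, whence \<open>z\<^sup>1\<^sup>/\<^sup>k = f z\<^sup>1\<^sup>/\<^sup>k f \<le> f\<^sup>2 \<le> f\<close>.\<close>

lemma cfc_root_le:
  assumes z: "z \<in> psd A" "nrm A z \<le> 1" and f: "f \<in> psd A" "nrm A f \<le> 1" "f \<otimes> z = z" and k: "k \<ge> 1"
  shows "f \<ominus> cfc A z (root k) \<in> psd A"
proof -
  define r where "r = cfc A z (root k)"
  have zs: "z \<in> self_adjoint A" using z by simp
  have c: "z \<in> carrier A" "f \<in> carrier A" using z f by auto
  have r: "r \<in> psd A" unfolding r_def using z by (intro cfc_psd_psd continuous_intros) (auto simp: real_root_ge_zero)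
  have rc: "r \<in> carrier A" using r by simp
  have nr: "nrm A r \<le> 1" unfolding r_def using z k
    by (intro nrm_cfc_psd_le continuous_intros) (auto simp: real_root_ge_zero)
  have "z \<otimes> f = star A (f \<otimes> z)" using c z f(1) by (simp add: star_mult)
  also have "\<dots> = z" using z f(3) by simp
  finally have zf: "z \<otimes> f = z" .
  have z0: "(\<one> \<ominus> f) \<otimes> \<zero> = z \<otimes> (\<one> \<ominus> f)"
    using c zf by (simp add: a_minus_def r_distr r_minus r_neg)
  have "(\<one> \<ominus> f) \<otimes> cfc A \<zero> (root k) = r \<otimes> (\<one> \<ominus> f)"
    unfolding r_def using c by (intro cfc_intertwine[OF self_adjoint_zero zs continuous_on_root _ z0]) simp
  moreover have "cfc A \<zero> (root k) = \<zero>"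
    using cfc_cong[of \<zero> "root k" "\<lambda>_. 0"] continuous_on_root cfc_const[of \<zero> 0] by simp
  ultimately have "r \<otimes> (\<one> \<ominus> f) = \<zero>" using c by simp
  then have "r \<ominus> r \<otimes> f = \<zero>" using c rc by (simp add: a_minus_def r_distr r_minus)
  then have rf: "r \<otimes> f = r" using c rc by (simp add: minus_eq_zero_iff)
  have "f \<otimes> r = star A (r \<otimes> f)" using c rc r f(1) by (simp add: star_mult)
  also have "\<dots> = r" using r rf by simp
  finally have fr: "f \<otimes> r = r" .
  have "of_real 1 \<odot> (star A f \<otimes> f) \<ominus> star A f \<otimes> r \<otimes> f \<in> psd A"
    by (rule conj_psd_le_nrm[OF r nr c(2)])
  then have "f \<otimes> f \<ominus> r \<in> psd A" using c f rf fr by simp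
  then show ?thesis using psd_le_trans[OF _ psd_minus_square[OF f(1,2)]] c rc unfolding r_def by simp
qed

end

section \<open>Matrix algebras\<close>

text \<open>Sums over an initial segment by recursion, free of the finiteness conditions of
  \<open>finsum\<close>; sums over supports are converted by \<open>finsum_eq_nsum\<close>.\<close>

primrec nsum :: "('a, 'm) ring_scheme \<Rightarrow> (nat \<Rightarrow> 'a) \<Rightarrow> nat \<Rightarrow> 'a" where
  "nsum R f 0 = \<zero>\<^bsub>R\<^esub>"
| "nsum R f (Suc n) = nsum R f n \<oplus>\<^bsub>R\<^esub> f n"

context ring
begin

lemma nsum_closed [simp, intro]: "(\<And>k. f k \<in> carrier R) \<Longrightarrow> nsum R f n \<in> carrier R"
  by (induction n) auto

lemma nsum_zero [simp]: "nsum R (\<lambda>_. \<zero>) n = \<zero>"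
  by (induction n) auto

lemma nsum_cong: "(\<And>k. k < n \<Longrightarrow> f k = g k) \<Longrightarrow> nsum R f n = nsum R g n"
  by (induction n) auto

lemma nsum_add:
  "\<lbrakk>\<And>k. f k \<in> carrier R; \<And>k. g k \<in> carrier R\<rbrakk>
   \<Longrightarrow> nsum R (\<lambda>k. f k \<oplus> g k) n = nsum R f n \<oplus> nsum R g n"
  by (induction n) (simp_all add: a_ac)

lemma nsum_rdistr:
  "\<lbrakk>\<And>k. f k \<in> carrier R; x \<in> carrier R\<rbrakk> \<Longrightarrow> x \<otimes> nsum R f n = nsum R (\<lambda>k. x \<otimes> f k) n"
  by (induction n) (simp_all add: r_distr)

lemma nsum_ldistr:
  "\<lbrakk>\<And>k. f k \<in> carrier R; x \<in> carrier R\<rbrakk> \<Longrightarrow> nsum R f n \<otimes> x = nsum R (\<lambda>k. f k \<otimes> x) n"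
  by (induction n) (simp_all add: l_distr)

lemma nsum_swap:
  "(\<And>i j. f i j \<in> carrier R)
   \<Longrightarrow> nsum R (\<lambda>i. nsum R (\<lambda>j. f i j) m) n = nsum R (\<lambda>j. nsum R (\<lambda>i. f i j) n) m"
  by (induction n) (simp_all add: nsum_add)

lemma nsum_extend:
  assumes "\<And>k. f k \<in> carrier R" "m \<le> n" "\<And>k. m \<le> k \<Longrightarrow> f k = \<zero>"
  shows "nsum R f n = nsum R f m"
  using assms(2)
proof (induction rule: dec_induct)
  case (step k)
  then show ?case using assms by simp
qed simp

lemma nsum_delta:
  "x \<in> carrier R \<Longrightarrow> nsum R (\<lambda>k. if k = i then x else \<zero>) n = (if i < n then x else \<zero>)"
  by (induction n) (auto simp: less_Suc_eq)

lemma nsum_delta':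
  "(\<And>k. f k \<in> carrier R) \<Longrightarrow> nsum R (\<lambda>k. if k = i then f k else \<zero>) n = (if i < n then f i else \<zero>)"
  by (induction n) (auto simp: less_Suc_eq)

lemma finsum_eq_nsum:
  assumes "S \<subseteq> {..<n}" "\<And>k. f k \<in> carrier R" "\<And>k. k \<notin> S \<Longrightarrow> f k = \<zero>"
  shows "finsum R f S = nsum R f n"
proof -
  have "finsum R f {..<n} = nsum R f n"
    using assms(2) by (induction n) (simp_all add: lessThan_Suc a_comm Pi_def)
  moreover have "finsum R f S = finsum R f {..<n}"
    using assms by (intro add.finprod_mono_neutral_cong_left) auto
  ultimately show ?thesis by simp
qed

end

section \<open>The ring of matrices of a fixed size\<close>

lemma mat_alg_simps [simp]:
  "carrier (mat_alg A n) = mats A n"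
  "mult (mat_alg A n) = mat_mult A"
  "one (mat_alg A n) = (\<lambda>i j. if i = j \<and> i < n then \<one>\<^bsub>A\<^esub> else \<zero>\<^bsub>A\<^esub>)"
  "zero (mat_alg A n) = (\<lambda>i j. \<zero>\<^bsub>A\<^esub>)"
  "add (mat_alg A n) = (\<lambda>M N i j. M i j \<oplus>\<^bsub>A\<^esub> N i j)"
  "module.smult (mat_alg A n) = (\<lambda>c M i j. c \<odot>\<^bsub>A\<^esub> M i j)"
  "star (mat_alg A n) = (\<lambda>M i j. star A (M j i))"
  "nrm (mat_alg A n) = mat_norm A"
  by (simp_all add: mat_alg_def)

context unital_cstar_algebra
begin

lemma complex_cring: "cring complex_ring"
  by (rule R.is_cring)

lemma mats_carrier: "M \<in> mats A n \<Longrightarrow> M i j \<in> carrier A"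
  by (simp add: mats_def)

lemma mats_zero: "\<lbrakk>M \<in> mats A n; \<not> (i < n \<and> j < n)\<rbrakk> \<Longrightarrow> M i j = \<zero>"
  unfolding mats_def by blast

lemma matsI:
  "\<lbrakk>\<And>i j. M i j \<in> carrier A; \<And>i j. \<not> (i < n \<and> j < n) \<Longrightarrow> M i j = \<zero>\<rbrakk> \<Longrightarrow> M \<in> mats A n"
  by (auto simp: mats_def)

lemma mats_mono: "\<lbrakk>M \<in> mats A m; m \<le> n\<rbrakk> \<Longrightarrow> M \<in> mats A n"
  by (auto simp: mats_def)

lemma mats_eqI:
  assumes "M \<in> mats A n" "N \<in> mats A n" "\<And>i j. \<lbrakk>i < n; j < n\<rbrakk> \<Longrightarrow> M i j = N i j"
  shows "M = N"
proof (intro ext)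
  fix i j show "M i j = N i j"
    using assms(3)[of i j] mats_zero[OF assms(1), of i j] mats_zero[OF assms(2), of i j]
    by (cases "i < n \<and> j < n") auto
qed

lemma mat_mult_nsum:
  assumes "M \<in> mats A n" "\<And>k. N k j \<in> carrier A"
  shows "mat_mult A M N i j = nsum A (\<lambda>k. M i k \<otimes> N k j) n"
  unfolding mat_mult_def
proof (rule finsum_eq_nsum)
  show "{k. M i k \<noteq> \<zero>} \<subseteq> {..<n}" using mats_zero[OF assms(1)] by auto
qed (use assms(2) mats_carrier[OF assms(1)] in auto)

lemma mat_col_nsum:
  assumes "M \<in> mats A n" "\<And>k. x k \<in> carrier A"
  shows "mat_col A M x i = nsum A (\<lambda>k. M i k \<otimes> x k) n"
  unfolding mat_col_def
proof (rule finsum_eq_nsum)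
  show "{k. M i k \<noteq> \<zero>} \<subseteq> {..<n}" using mats_zero[OF assms(1)] by auto
qed (use assms(2) mats_carrier[OF assms(1)] in auto)

lemma mats_mult [simp, intro]:
  assumes "M \<in> mats A n" "N \<in> mats A n" shows "mat_mult A M N \<in> mats A n"
proof (rule matsI)
  note [simp] = mats_carrier[OF assms(1)] mats_carrier[OF assms(2)]
  fix i j
  show "mat_mult A M N i j \<in> carrier A" by (simp add: mat_mult_nsum[OF assms(1)])
  assume "\<not> (i < n \<and> j < n)"
  then have "M i k \<otimes> N k j = \<zero>" for k
    using mats_zero[OF assms(1), of i k] mats_zero[OF assms(2), of k j] by auto
  then show "mat_mult A M N i j = \<zero>" by (simp add: mat_mult_nsum[OF assms(1)])
qed

text \<open>The right factor P need not be finitely supported: with P constant in its column index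
  this is associativity of the action on columns.\<close>

lemma mat_mult_assoc:
  assumes "M \<in> mats A n" "N \<in> mats A n" "\<And>k j. P k j \<in> carrier A"
  shows "mat_mult A (mat_mult A M N) P i j = mat_mult A M (mat_mult A N P) i j"
proof -
  note [simp] = mats_carrier[OF assms(1)] mats_carrier[OF assms(2)] assms(3)
  have c: "mat_mult A N P k j \<in> carrier A" for k
    by (simp add: mat_mult_nsum[OF assms(2)])
  have "mat_mult A (mat_mult A M N) P i j = nsum A (\<lambda>k. nsum A (\<lambda>l. M i l \<otimes> N l k) n \<otimes> P k j) n"
    by (simp add: mat_mult_nsum[OF mats_mult[OF assms(1,2)]] mat_mult_nsum[OF assms(1)])
  also have "\<dots> = nsum A (\<lambda>k. nsum A (\<lambda>l. M i l \<otimes> (N l k \<otimes> P k j)) n) n"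
    by (simp add: nsum_ldistr m_assoc)
  also have "\<dots> = nsum A (\<lambda>l. nsum A (\<lambda>k. M i l \<otimes> (N l k \<otimes> P k j)) n) n"
    by (intro nsum_swap) auto
  also have "\<dots> = nsum A (\<lambda>l. M i l \<otimes> nsum A (\<lambda>k. N l k \<otimes> P k j) n) n"
    by (simp add: nsum_rdistr)
  also have "\<dots> = mat_mult A M (mat_mult A N P) i j"
    using c by (simp add: mat_mult_nsum[OF assms(1)] mat_mult_nsum[OF assms(2)])
  finally show ?thesis .
qed

lemma mat_col_eq_mult: "mat_col A M x i = mat_mult A M (\<lambda>k _. x k) i j"
  by (simp add: mat_col_def mat_mult_def)

lemma mat_col_mult:
  assumes "M \<in> mats A n" "N \<in> mats A n" "\<And>k. x k \<in> carrier A"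
  shows "mat_col A (mat_mult A M N) x = mat_col A M (mat_col A N x)"
proof
  fix i
  have "mat_col A (mat_mult A M N) x i = mat_mult A M (mat_mult A N (\<lambda>k _. x k)) i 0"
    unfolding mat_col_eq_mult[of _ _ _ 0] using assms by (intro mat_mult_assoc) auto
  also have "\<dots> = mat_col A M (mat_col A N x) i"
    by (simp add: mat_col_def mat_mult_def)
  finally show "mat_col A (mat_mult A M N) x i = mat_col A M (mat_col A N x) i" .
qed

lemma mat_one_mult:
  assumes "M \<in> mats A n"
  shows "mat_mult A (\<lambda>i j. if i = j \<and> i < n then \<one> else \<zero>) M = M"
    and "mat_mult A M (\<lambda>i j. if i = j \<and> i < n then \<one> else \<zero>) = M"
proof -
  note [simp] = mats_carrier[OF assms]
  have o: "(\<lambda>i j. if i = j \<and> i < n then \<one> else \<zero>) \<in> mats A n" by (rule matsI) auto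
  show "mat_mult A (\<lambda>i j. if i = j \<and> i < n then \<one> else \<zero>) M = M"
  proof (rule mats_eqI[OF mats_mult[OF o assms] assms])
    fix i j assume ij: "i < n" "j < n"
    have "nsum A (\<lambda>k. (if i = k \<and> i < n then \<one> else \<zero>) \<otimes> M k j) n
        = nsum A (\<lambda>k. if k = i then M k j else \<zero>) n"
      using ij by (intro nsum_cong) auto
    then show "mat_mult A (\<lambda>i j. if i = j \<and> i < n then \<one> else \<zero>) M i j = M i j"
      using ij by (simp add: mat_mult_nsum[OF o] nsum_delta')
  qed
  show "mat_mult A M (\<lambda>i j. if i = j \<and> i < n then \<one> else \<zero>) = M"
  proof (rule mats_eqI[OF mats_mult[OF assms o] assms])
    fix i j assume ij: "i < n" "j < n"
    have "nsum A (\<lambda>k. M i k \<otimes> (if k = j \<and> k < n then \<one> else \<zero>)) n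
        = nsum A (\<lambda>k. if k = j then M i k else \<zero>) n"
      using ij by (intro nsum_cong) auto
    then show "mat_mult A M (\<lambda>i j. if i = j \<and> i < n then \<one> else \<zero>) i j = M i j"
      using ij by (simp add: mat_mult_nsum[OF assms] nsum_delta')
  qed
qed

lemma mats_one [simp]: "(\<lambda>i j. if i = j \<and> i < n then \<one> else \<zero>) \<in> mats A n"
  by (rule matsI) auto

lemma mat_ring: "ring (mat_alg A n)"
proof (rule ringI)
  show "abelian_group (mat_alg A n)"
  proof (rule abelian_groupI)
    fix M assume M: "M \<in> carrier (mat_alg A n)"
    show "\<exists>N\<in>carrier (mat_alg A n). N \<oplus>\<^bsub>mat_alg A n\<^esub> M = \<zero>\<^bsub>mat_alg A n\<^esub>"
      using M by (intro bexI[of _ "\<lambda>i j. \<ominus> M i j"]) (auto simp: mats_def l_neg)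
  qed (auto simp: mats_def a_ac)
  show "monoid (mat_alg A n)"
  proof (rule monoidI)
    fix M N P assume *: "M \<in> carrier (mat_alg A n)" "N \<in> carrier (mat_alg A n)" "P \<in> carrier (mat_alg A n)"
    then show "M \<otimes>\<^bsub>mat_alg A n\<^esub> N \<otimes>\<^bsub>mat_alg A n\<^esub> P = M \<otimes>\<^bsub>mat_alg A n\<^esub> (N \<otimes>\<^bsub>mat_alg A n\<^esub> P)"
      using mats_carrier[of P n] by (intro ext) (simp add: mat_mult_assoc[of M n])
  qed (auto simp: mat_one_mult)
next
  fix M N P assume *: "M \<in> carrier (mat_alg A n)" "N \<in> carrier (mat_alg A n)" "P \<in> carrier (mat_alg A n)"
  then have [simp]: "M i j \<in> carrier A" "N i j \<in> carrier A" "P i j \<in> carrier A" for i j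
    by (auto simp: mats_carrier)
  have s: "(\<lambda>i j. M i j \<oplus> N i j) \<in> mats A n" using * by (auto simp: mats_def)
  show "(M \<oplus>\<^bsub>mat_alg A n\<^esub> N) \<otimes>\<^bsub>mat_alg A n\<^esub> P
      = M \<otimes>\<^bsub>mat_alg A n\<^esub> P \<oplus>\<^bsub>mat_alg A n\<^esub> N \<otimes>\<^bsub>mat_alg A n\<^esub> P"
    using * by (intro ext) (simp add: mat_mult_nsum[OF s] mat_mult_nsum[of M n] mat_mult_nsum[of N n]
        l_distr nsum_add)
  show "P \<otimes>\<^bsub>mat_alg A n\<^esub> (M \<oplus>\<^bsub>mat_alg A n\<^esub> N)
      = P \<otimes>\<^bsub>mat_alg A n\<^esub> M \<oplus>\<^bsub>mat_alg A n\<^esub> P \<otimes>\<^bsub>mat_alg A n\<^esub> N"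
    using * by (intro ext) (simp add: mat_mult_nsum[of P n] r_distr nsum_add)
qed

lemma mat_a_inv: "M \<in> mats A n \<Longrightarrow> \<ominus>\<^bsub>mat_alg A n\<^esub> M = (\<lambda>i j. \<ominus> M i j)"
  by (rule abelian_group.minus_equality[OF ring.is_abelian_group[OF mat_ring]])
    (auto simp: mats_def l_neg)

lemma mat_minus:
  "N \<in> mats A n \<Longrightarrow> M \<ominus>\<^bsub>mat_alg A n\<^esub> N = (\<lambda>i j. M i j \<ominus> N i j)"
  by (simp add: a_minus_def mat_a_inv)

section \<open>The Hilbert module of columns\<close>

definition col_inner :: "nat \<Rightarrow> (nat \<Rightarrow> 'a) \<Rightarrow> (nat \<Rightarrow> 'a) \<Rightarrow> 'a" where
  "col_inner n x y = nsum A (\<lambda>i. star A (x i) \<otimes> y i) n"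

text \<open>Arbitrary sequences, of which \<open>col_inner n\<close> and \<open>cnorm n\<close> read
  only the first n entries; \<open>mat_norm_set\<close> makes the connection with the finitely
  supported \<open>cols\<close>.\<close>

abbreviation columns :: "(nat \<Rightarrow> 'a) set" where
  "columns \<equiv> {x. \<forall>i. x i \<in> carrier A}"

lemma col_inner_carrier [simp]: "\<lbrakk>x \<in> columns; y \<in> columns\<rbrakk> \<Longrightarrow> col_inner n x y \<in> carrier A"
  by (simp add: col_inner_def)

lemma star_nsum: "(\<And>k. f k \<in> carrier A) \<Longrightarrow> star A (nsum A f n) = nsum A (\<lambda>k. star A (f k)) n"
  by (induction n) (simp_all add: star_add)

lemma nsum_a_inv: "(\<And>k. f k \<in> carrier A) \<Longrightarrow> nsum A (\<lambda>k. \<ominus> f k) n = \<ominus> nsum A f n"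
  by (induction n) (simp_all add: minus_add a_comm)

lemma nsum_minus:
  "\<lbrakk>\<And>k. f k \<in> carrier A; \<And>k. g k \<in> carrier A\<rbrakk>
   \<Longrightarrow> nsum A (\<lambda>k. f k \<ominus> g k) n = nsum A f n \<ominus> nsum A g n"
  by (simp add: a_minus_def nsum_add nsum_a_inv)

lemma nsum_smult:
  "(\<And>k. f k \<in> carrier A) \<Longrightarrow> nsum A (\<lambda>k. c \<odot> f k) n = c \<odot> nsum A f n"
  by (induction n) (simp_all add: smult_add)

lemma nsum_psd: "(\<And>k. f k \<in> psd A) \<Longrightarrow> nsum A f n \<in> psd A"
  by (induction n) auto

lemma nrm_nsum_le:
  "(\<And>k. f k \<in> carrier A) \<Longrightarrow> nrm A (nsum A f n) \<le> (\<Sum>k<n. nrm A (f k))"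
  by (induction n) (auto intro: order_trans[OF nrm_triangle])

lemma col_inner_star: "\<lbrakk>x \<in> columns; y \<in> columns\<rbrakk> \<Longrightarrow> star A (col_inner n x y) = col_inner n y x"
  by (simp add: col_inner_def star_nsum star_mult star_star)

lemma col_inner_psd [simp]: "x \<in> columns \<Longrightarrow> col_inner n x x \<in> psd A"
  by (simp add: col_inner_def nsum_psd)

text \<open>Cauchy-Schwarz in the Hilbert module: expand \<open>\<langle>xs - y, xs - y\<rangle> \<ge> 0\<close> for \<open>s = \<langle>x, y\<rangle>/m\<close>.\<close>

lemma col_inner_Cauchy_Schwarz_aux:
  assumes x: "x \<in> columns" and y: "y \<in> columns"
    and m: "nrm A (col_inner n x x) \<le> m" "m > 0"
  shows "(nrm A (col_inner n x y))\<^sup>2 \<le> m * nrm A (col_inner n y y)"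
proof -
  define X Y t s where "X = col_inner n x x" and "Y = col_inner n y y" and "t = col_inner n x y"
    and "s = of_real (1/m) \<odot> t"
  have c: "X \<in> carrier A" "Y \<in> carrier A" "t \<in> carrier A" "s \<in> carrier A" "star A s \<in> carrier A" "star A t \<in> carrier A"
    using x y by (auto simp: X_def Y_def t_def s_def)
  let ?w = "\<lambda>i. x i \<otimes> s \<ominus> y i"
  have w: "?w \<in> columns" using x y c by auto
  have e: "star A (?w i) \<otimes> ?w i
      = ((star A s \<otimes> (star A (x i) \<otimes> x i) \<otimes> s \<ominus> star A s \<otimes> (star A (x i) \<otimes> y i))
        \<ominus> (star A (y i) \<otimes> x i) \<otimes> s) \<oplus> star A (y i) \<otimes> y i" for i
  proof -
    have d: "x i \<in> carrier A" "y i \<in> carrier A" "star A (x i) \<in> carrier A" "star A (y i) \<in> carrier A"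
      using x y by auto
    have st: "star A (?w i) = star A s \<otimes> star A (x i) \<ominus> star A (y i)"
      using d c by (simp add: star_minus star_mult)
    show ?thesis unfolding st using d c by algebra
  qed
  have cc: "star A (x i) \<otimes> y i \<in> carrier A" "star A (y i) \<otimes> x i \<in> carrier A"
     "star A (x i) \<otimes> x i \<in> carrier A" "star A (y i) \<otimes> y i \<in> carrier A" for i
    using x y by auto
  have "col_inner n ?w ?w = ((star A s \<otimes> X \<otimes> s \<ominus> star A s \<otimes> t) \<ominus> star A t \<otimes> s) \<oplus> Y"
    unfolding col_inner_star[OF x y, of n, folded t_def]
    unfolding X_def Y_def t_def col_inner_def e using cc c
    by (simp add: nsum_add nsum_minus flip: nsum_ldistr nsum_rdistr)
  then have p: "((star A s \<otimes> X \<otimes> s \<ominus> star A s \<otimes> t) \<ominus> star A t \<otimes> s) \<oplus> Y \<in> psd A"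
    using col_inner_psd[OF w] by metis
  define q where "q = of_real (1/m) \<odot> (star A t \<otimes> t)"
  have q: "q \<in> psd A" unfolding q_def using m c by (intro psd_smult) auto
  have qc: "q \<in> carrier A" using q by simp
  have st: "star A s \<otimes> t = q" "star A t \<otimes> s = q"
    using c by (simp_all add: s_def q_def star_smult smult_mult_left smult_mult_right)
  have "of_real m \<odot> (star A s \<otimes> s) \<ominus> star A s \<otimes> X \<otimes> s \<in> psd A"
    using x m c by (intro conj_psd_le_nrm) (auto simp: X_def)
  moreover have "of_real m \<odot> (star A s \<otimes> s) = q"
    using c m by (simp add: s_def q_def star_smult smult_mult_left smult_mult_right)
  ultimately have "q \<ominus> star A s \<otimes> X \<otimes> s \<in> psd A" by simp
  then have "(q \<ominus> star A s \<otimes> X \<otimes> s) \<oplus> (((star A s \<otimes> X \<otimes> s \<ominus> q) \<ominus> q) \<oplus> Y) \<in> psd A"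
    using p unfolding st by (rule psd_add)
  moreover have "(q \<ominus> star A s \<otimes> X \<otimes> s) \<oplus> (((star A s \<otimes> X \<otimes> s \<ominus> q) \<ominus> q) \<oplus> Y) = Y \<ominus> q"
    using c qc by algebra
  ultimately have "nrm A q \<le> nrm A Y" using q c by (intro nrm_mono) auto
  moreover have "nrm A q = (nrm A t)\<^sup>2 / m"
    using c m by (simp add: q_def nrm_smult cstar_identity norm_divide)
  ultimately show ?thesis using m by (simp add: X_def Y_def t_def field_simps)
qed

lemma col_inner_Cauchy_Schwarz:
  assumes x: "x \<in> columns" and y: "y \<in> columns"
  shows "(nrm A (col_inner n x y))\<^sup>2 \<le> nrm A (col_inner n x x) * nrm A (col_inner n y y)"
proof (rule field_le_epsilon)
  fix e :: real assume e: "e > 0"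
  let ?X = "nrm A (col_inner n x x)" and ?Y = "nrm A (col_inner n y y)"
  have nn: "?X \<ge> 0" "?Y \<ge> 0" using x y by (auto intro: nrm_nonneg)
  \<comment> \<open>The auxiliary lemma asks for m > 0. The excess e / (Y + 1), where Y is the norm
    of the inner square of y, has a denominator that never vanishes and contributes at most e after
    multiplication by Y.\<close>
  define m where "m = ?X + e / (?Y + 1)"
  have "e / (?Y + 1) > 0" using e nn by simp
  then have "m > 0" "?X \<le> m" using nn by (auto simp: m_def)
  then have "(nrm A (col_inner n x y))\<^sup>2 \<le> m * ?Y" by (intro col_inner_Cauchy_Schwarz_aux[OF x y])
  also have "\<dots> = ?X * ?Y + e * (?Y / (?Y + 1))" by (simp add: m_def algebra_simps)
  also have "e * (?Y / (?Y + 1)) \<le> e * 1" using e nn by (intro mult_left_mono) auto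
  finally show "(nrm A (col_inner n x y))\<^sup>2 \<le> ?X * ?Y + e" by simp
qed

definition cnorm :: "nat \<Rightarrow> (nat \<Rightarrow> 'a) \<Rightarrow> real" where
  "cnorm n x = sqrt (nrm A (col_inner n x x))"

lemma cnorm_nonneg [simp]: "x \<in> columns \<Longrightarrow> 0 \<le> cnorm n x"
  by (simp add: cnorm_def nrm_nonneg)

lemma cnorm_power2: "x \<in> columns \<Longrightarrow> (cnorm n x)\<^sup>2 = nrm A (col_inner n x x)"
  by (simp add: cnorm_def nrm_nonneg)

lemma nrm_col_inner_le:
  assumes "x \<in> columns" "y \<in> columns"
  shows "nrm A (col_inner n x y) \<le> cnorm n x * cnorm n y"
proof (rule power2_le_imp_le)
  show "(nrm A (col_inner n x y))\<^sup>2 \<le> (cnorm n x * cnorm n y)\<^sup>2"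
    using col_inner_Cauchy_Schwarz[OF assms] assms by (simp add: power_mult_distrib cnorm_power2)
qed (use assms in simp)

lemma nsum_term_le:
  "\<lbrakk>\<And>k. f k \<in> psd A; k < n\<rbrakk> \<Longrightarrow> nsum A f n \<ominus> f k \<in> psd A"
proof (induction n)
  case (Suc n)
  have c: "nsum A f n \<in> carrier A" "f n \<in> carrier A" "f k \<in> carrier A" using Suc by auto
  show ?case
  proof (cases "k = n")
    case True
    have "nsum A f (Suc n) \<ominus> f n = nsum A f n" using c by simp algebra
    then show ?thesis using True Suc nsum_psd[of f] by simp
  next
    case False
    have "nsum A f (Suc n) \<ominus> f k = (nsum A f n \<ominus> f k) \<oplus> f n" using c by simp algebra
    then show ?thesis using False Suc by simp
  qed
qed simp

lemma nrm_entry_le_cnorm: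
  assumes "x \<in> columns" "k < n" shows "nrm A (x k) \<le> cnorm n x"
proof (rule power2_le_imp_le)
  have "nrm A (star A (x k) \<otimes> x k) \<le> nrm A (col_inner n x x)"
    using nsum_term_le[of "\<lambda>i. star A (x i) \<otimes> x i" k n] assms unfolding col_inner_def
    by (intro nrm_mono) auto
  then show "(nrm A (x k))\<^sup>2 \<le> (cnorm n x)\<^sup>2"
    using assms by (simp add: cnorm_power2 cstar_identity)
qed (use assms in simp)

lemma cnorm_le_sum:
  assumes "x \<in> columns" shows "cnorm n x \<le> (\<Sum>k<n. nrm A (x k))"
proof -
  have nn: "0 \<le> nrm A (x k)" for k using assms by (simp add: nrm_nonneg)
  have "nrm A (col_inner n x x) \<le> (\<Sum>k<n. (nrm A (x k))\<^sup>2)"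
    using nrm_nsum_le[of "\<lambda>i. star A (x i) \<otimes> x i" n] assms
    by (simp add: col_inner_def cstar_identity)
  also have "\<dots> \<le> (\<Sum>k<n. nrm A (x k))\<^sup>2"
  proof (induction n)
    case (Suc n)
    then show ?case
      using mult_nonneg_nonneg[OF sum_nonneg[of "{..<n}" "\<lambda>k. nrm A (x k)"] nn[of n]] nn
      by (simp add: power2_sum)
  qed simp
  finally show ?thesis unfolding cnorm_def using nn by (intro real_le_lsqrt sum_nonneg) auto
qed

lemma cnorm_smult:
  assumes "x \<in> columns" shows "cnorm n (\<lambda>i. c \<odot> x i) = cmod c * cnorm n x"
proof -
  have "col_inner n (\<lambda>i. c \<odot> x i) (\<lambda>i. c \<odot> x i) = (c * cnj c) \<odot> col_inner n x x"
    using assms by (simp add: col_inner_def star_smult smult_mult_left smult_mult_right flip: nsum_smult)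
  then show ?thesis using assms
    by (simp add: cnorm_def nrm_smult norm_mult real_sqrt_mult)
qed

lemma cnorm_triangle:
  assumes "x \<in> columns" "y \<in> columns"
  shows "cnorm n (\<lambda>i. x i \<oplus> y i) \<le> cnorm n x + cnorm n y"
proof (rule power2_le_imp_le)
  have "col_inner n (\<lambda>i. x i \<oplus> y i) (\<lambda>i. x i \<oplus> y i)
      = (col_inner n x x \<oplus> col_inner n x y) \<oplus> (col_inner n y x \<oplus> col_inner n y y)"
    using assms by (simp add: col_inner_def star_add l_distr r_distr nsum_add a_ac)
  also have "nrm A \<dots> \<le> (nrm A (col_inner n x x) + nrm A (col_inner n x y))
      + (nrm A (col_inner n y x) + nrm A (col_inner n y y))"
    using assms by (intro order_trans[OF nrm_triangle] add_mono nrm_triangle) auto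
  also have "\<dots> \<le> ((cnorm n x)\<^sup>2 + cnorm n x * cnorm n y) + (cnorm n y * cnorm n x + (cnorm n y)\<^sup>2)"
    using assms by (intro add_mono nrm_col_inner_le) (auto simp: cnorm_power2)
  also have "\<dots> = (cnorm n x + cnorm n y)\<^sup>2" by (simp add: power2_sum)
  finally show "(cnorm n (\<lambda>i. x i \<oplus> y i))\<^sup>2 \<le> (cnorm n x + cnorm n y)\<^sup>2"
    using assms by (simp add: cnorm_power2)
qed (use assms in simp)

section \<open>The operator norm of a matrix\<close>

lemma mat_col_columns:
  assumes M: "M \<in> mats A n" and x: "x \<in> columns" shows "mat_col A M x \<in> columns"
proof -
  have "mat_col A M x i \<in> carrier A" for i
    using x mats_carrier[OF M] by (simp add: mat_col_nsum[OF M])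
  then show ?thesis by simp
qed

text \<open>A crude bound: it makes the supremum in \<open>mat_norm\<close> finite and lets
  convergence of entries imply convergence of matrices.\<close>

lemma cnorm_mat_col_le:
  assumes M: "M \<in> mats A n" and x: "x \<in> columns"
  shows "cnorm n (mat_col A M x) \<le> (\<Sum>i<n. \<Sum>k<n. nrm A (M i k)) * cnorm n x"
proof -
  have "cnorm n (mat_col A M x) \<le> (\<Sum>i<n. nrm A (mat_col A M x i))"
    by (intro cnorm_le_sum mat_col_columns[OF assms])
  also have "\<dots> \<le> (\<Sum>i<n. \<Sum>k<n. nrm A (M i k) * cnorm n x)"
  proof (intro sum_mono)
    fix i
    have "nrm A (mat_col A M x i) \<le> (\<Sum>k<n. nrm A (M i k \<otimes> x k))"
      using x mats_carrier[OF M] nrm_nsum_le[of "\<lambda>k. M i k \<otimes> x k" n] by (simp add: mat_col_nsum[OF M])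
    also have "\<dots> \<le> (\<Sum>k<n. nrm A (M i k) * cnorm n x)"
      using x mats_carrier[OF M] by (intro sum_mono nrm_mult_le nrm_entry_le_cnorm) auto
    finally show "nrm A (mat_col A M x i) \<le> (\<Sum>k<n. nrm A (M i k) * cnorm n x)" .
  qed
  finally show ?thesis by (simp add: sum_distrib_right)
qed

lemma col_norm_eq_cnorm:
  assumes "x \<in> columns" "\<And>i. n \<le> i \<Longrightarrow> x i = \<zero>"
  shows "col_norm A x = cnorm n x"
proof -
  have "(\<Oplus>i\<in>{i. x i \<noteq> \<zero>}. star A (x i) \<otimes> x i) = nsum A (\<lambda>i. star A (x i) \<otimes> x i) n"
    using assms by (intro finsum_eq_nsum) (auto, metis not_less)
  then show ?thesis by (simp add: col_norm_def cnorm_def col_inner_def)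
qed

lemma cnorm_mono:
  assumes "x \<in> columns" "m \<le> n" shows "cnorm m x \<le> cnorm n x"
proof -
  have "nsum A f n \<ominus> nsum A f m \<in> psd A" if "\<And>k. f k \<in> psd A" for f
    using assms(2)
  proof (induction rule: dec_induct)
    case base
    then show ?case using that by (simp add: a_minus_def r_neg)
  next
    case (step k)
    have "nsum A f k \<in> carrier A" "f k \<in> carrier A" "nsum A f m \<in> carrier A" using that by auto
    then have "nsum A f (Suc k) \<ominus> nsum A f m = (nsum A f k \<ominus> nsum A f m) \<oplus> f k" by simp algebra
    then show ?case using step that by simp
  qed
  from this[of "\<lambda>i. star A (x i) \<otimes> x i"] show ?thesis using assms
    unfolding cnorm_def col_inner_def by (intro real_sqrt_le_mono nrm_mono nsum_psd) auto
qed

lemma mat_col_zero: "\<lbrakk>M \<in> mats A n; n \<le> i; x \<in> columns\<rbrakk> \<Longrightarrow> mat_col A M x i = \<zero>"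
  using mats_zero[of M n i] by (simp add: mat_col_nsum)

text \<open>Entries of x beyond n do not affect M x, and dropping them does not increase the norm;
  so the supremum may run over all columns measured by their first n entries.\<close>

lemma mat_norm_set:
  assumes M: "M \<in> mats A n"
  shows "{col_norm A (mat_col A M x) | x. x \<in> cols A \<and> col_norm A x \<le> 1}
    = {cnorm n (mat_col A M x) | x. x \<in> columns \<and> cnorm n x \<le> 1}" (is "?L = ?R")
proof (intro equalityI subsetI)
  fix r assume "r \<in> ?L"
  then obtain x where x: "x \<in> cols A" "col_norm A x \<le> 1" "r = col_norm A (mat_col A M x)" by blast
  have xc: "x \<in> columns" using x by (simp add: cols_def)
  obtain N where N: "\<And>i. N \<le> i \<Longrightarrow> x i = \<zero>"
    using x(1) finite_nat_set_iff_bounded[of "{i. x i \<noteq> \<zero>}"] unfolding cols_def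
    by simp (metis not_less)
  have "col_norm A x = cnorm (max n N) x" using xc N by (intro col_norm_eq_cnorm) auto
  then have "cnorm n x \<le> 1" using cnorm_mono[OF xc, of n "max n N"] x by simp
  moreover have "r = cnorm n (mat_col A M x)"
    using x(3) col_norm_eq_cnorm[OF mat_col_columns[OF M xc] mat_col_zero[OF M _ xc]] by simp
  ultimately show "r \<in> ?R" using xc by blast
next
  fix r assume "r \<in> ?R"
  then obtain x where x: "x \<in> columns" "cnorm n x \<le> 1" "r = cnorm n (mat_col A M x)" by blast
  define y where "y = (\<lambda>i. if i < n then x i else \<zero>)"
  have y: "y \<in> columns" using x by (simp add: y_def)
  have "y \<in> cols A" using y finite_subset[of "{i. y i \<noteq> \<zero>}" "{..<n}"]
    by (auto simp: cols_def y_def)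
  moreover have "col_norm A y = cnorm n x"
    using y col_norm_eq_cnorm[of y n]
    by (simp add: cnorm_def col_inner_def y_def cong: nsum_cong)
  moreover have "mat_col A M y = mat_col A M x"
    using x(1) y mats_carrier[OF M] by (intro ext) (simp add: mat_col_nsum[OF M], auto simp: y_def intro!: nsum_cong)
  moreover have "col_norm A (mat_col A M x) = cnorm n (mat_col A M x)"
    by (rule col_norm_eq_cnorm[OF mat_col_columns[OF M x(1)] mat_col_zero[OF M _ x(1)]])
  ultimately show "r \<in> ?L" using x by force
qed

lemma mat_norm_bdd:
  assumes M: "M \<in> mats A n"
  shows "bdd_above {cnorm n (mat_col A M x) | x. x \<in> columns \<and> cnorm n x \<le> 1}"
proof (rule bdd_aboveI)
  fix r assume "r \<in> {cnorm n (mat_col A M x) | x. x \<in> columns \<and> cnorm n x \<le> 1}"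
  then obtain x where x: "x \<in> columns" "cnorm n x \<le> 1" "r = cnorm n (mat_col A M x)" by blast
  have "(\<Sum>i<n. \<Sum>k<n. nrm A (M i k)) \<ge> 0" using mats_carrier[OF M] by (intro sum_nonneg nrm_nonneg)
  then show "r \<le> (\<Sum>i<n. \<Sum>k<n. nrm A (M i k))"
    using cnorm_mat_col_le[OF M x(1)] x mult_left_mono[OF x(2)] by fastforce
qed

lemma cnorm_zero [simp]: "cnorm n (\<lambda>_. \<zero>) = 0"
  by (simp add: cnorm_def col_inner_def)

lemma mat_col_const_zero: "M \<in> mats A n \<Longrightarrow> mat_col A M (\<lambda>_. \<zero>) = (\<lambda>_. \<zero>)"
  by (intro ext) (simp add: mat_col_nsum mats_carrier[of M n])

lemma mat_norm_nonneg: "M \<in> mats A n \<Longrightarrow> 0 \<le> mat_norm A M"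
proof -
  assume M: "M \<in> mats A n"
  have "0 \<in> {cnorm n (mat_col A M x) | x. x \<in> columns \<and> cnorm n x \<le> 1}"
    using M by (auto intro!: exI[of _ "\<lambda>_. \<zero>"] simp: mat_col_const_zero)
  then show ?thesis unfolding mat_norm_def mat_norm_set[OF M] using mat_norm_bdd[OF M]
    by (intro cSup_upper)
qed

lemma cnorm_mat_col_le_mat_norm:
  assumes M: "M \<in> mats A n" and x: "x \<in> columns"
  shows "cnorm n (mat_col A M x) \<le> mat_norm A M * cnorm n x"
proof (cases "cnorm n x = 0")
  case True
  then show ?thesis using cnorm_mat_col_le[OF M x] by simp
next
  case False
  then have pos: "cnorm n x > 0" using cnorm_nonneg[OF x, of n] by linarith
  let ?c = "of_real (1 / cnorm n x) :: complex"
  let ?y = "\<lambda>i. ?c \<odot> x i"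
  have y: "?y \<in> columns" using x by simp
  have "cnorm n ?y = 1" using x pos by (subst cnorm_smult) (auto simp: norm_divide)
  then have "cnorm n (mat_col A M ?y) \<le> mat_norm A M"
    unfolding mat_norm_def mat_norm_set[OF M] using y by (intro cSup_upper mat_norm_bdd[OF M]) auto
  moreover have "mat_col A M ?y = (\<lambda>i. ?c \<odot> mat_col A M x i)"
    using x y mats_carrier[OF M] by (intro ext) (simp add: mat_col_nsum[OF M] smult_mult_right nsum_smult)
  moreover have "cnorm n (\<lambda>i. ?c \<odot> mat_col A M x i) = cnorm n (mat_col A M x) / cnorm n x"
    using mat_col_columns[OF M x] pos by (subst cnorm_smult) (auto simp: norm_divide)
  ultimately have "cnorm n (mat_col A M x) / cnorm n x \<le> mat_norm A M" by (simp only:)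
  then show ?thesis using pos by (simp add: pos_divide_le_eq)
qed

lemma mat_norm_le:
  assumes M: "M \<in> mats A n" and "0 \<le> c"
    and "\<And>x. x \<in> columns \<Longrightarrow> cnorm n (mat_col A M x) \<le> c * cnorm n x"
  shows "mat_norm A M \<le> c"
  unfolding mat_norm_def mat_norm_set[OF M]
proof (rule cSup_least)
  show "{cnorm n (mat_col A M x) |x. x \<in> columns \<and> cnorm n x \<le> 1} \<noteq> {}"
    by (auto intro!: exI[of _ "\<lambda>_. \<zero>"])
  fix r assume "r \<in> {cnorm n (mat_col A M x) |x. x \<in> columns \<and> cnorm n x \<le> 1}"
  then obtain x where "x \<in> columns" "cnorm n x \<le> 1" "r = cnorm n (mat_col A M x)" by blast
  then show "r \<le> c" using assms(3)[of x] mult_left_le[of "cnorm n x" c] assms(2) by linarith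
qed

lemma mat_norm_le_sum:
  assumes M: "M \<in> mats A n" shows "mat_norm A M \<le> (\<Sum>i<n. \<Sum>k<n. nrm A (M i k))"
  using mats_carrier[OF M] by (intro mat_norm_le[OF M] cnorm_mat_col_le[OF M] sum_nonneg nrm_nonneg)

text \<open>Apply M to the j-th unit column, whose norm is at most 1. With
  \<open>mat_norm_le_sum\<close> this makes norm convergence of matrices equivalent to entrywise
  convergence.\<close>

lemma nrm_entry_le_mat_norm:
  assumes M: "M \<in> mats A n" shows "nrm A (M i j) \<le> mat_norm A M"
proof (cases "i < n \<and> j < n")
  case True
  define e where "e = (\<lambda>k. if k = j then \<one> else \<zero>)"
  have e: "e \<in> columns" by (simp add: e_def)
  have "nsum A (\<lambda>k. star A (e k) \<otimes> e k) n = nsum A (\<lambda>k. if k = j then \<one> else \<zero>) n"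
    by (intro nsum_cong) (auto simp: e_def)
  then have "cnorm n e \<le> 1"
    using True nrm_one_le by (simp add: cnorm_def col_inner_def nsum_delta)
  have "nsum A (\<lambda>k. M i k \<otimes> e k) n = nsum A (\<lambda>k. if k = j then M i k else \<zero>) n"
    using mats_carrier[OF M] by (intro nsum_cong) (auto simp: e_def)
  then have "mat_col A M e i = M i j"
    using True e mats_carrier[OF M] by (simp add: mat_col_nsum[OF M] nsum_delta')
  then have "nrm A (M i j) \<le> cnorm n (mat_col A M e)"
    using nrm_entry_le_cnorm[OF mat_col_columns[OF M e], of i n] True by simp
  also have "\<dots> \<le> mat_norm A M * 1"
    using cnorm_mat_col_le_mat_norm[OF M e] \<open>cnorm n e \<le> 1\<close> mat_norm_nonneg[OF M]
    by (meson mult_left_mono order_trans)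
  finally show ?thesis by simp
next
  case False
  then show ?thesis using mats_zero[OF M False] mat_norm_nonneg[OF M] by simp
qed

lemma mat_col_add:
  assumes "M \<in> mats A n" "N \<in> mats A n" "x \<in> columns"
  shows "mat_col A (\<lambda>i j. M i j \<oplus> N i j) x = (\<lambda>i. mat_col A M x i \<oplus> mat_col A N x i)"
proof
  fix i
  have s: "(\<lambda>i j. M i j \<oplus> N i j) \<in> mats A n" using assms by (auto simp: mats_def)
  show "mat_col A (\<lambda>i j. M i j \<oplus> N i j) x i = mat_col A M x i \<oplus> mat_col A N x i"
    using assms(3) mats_carrier[OF assms(1)] mats_carrier[OF assms(2)]
    by (simp add: mat_col_nsum[OF s] mat_col_nsum[OF assms(1)] mat_col_nsum[OF assms(2)] l_distr nsum_add)
qed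

lemma mat_col_smult:
  assumes "M \<in> mats A n" "x \<in> columns"
  shows "mat_col A (\<lambda>i j. c \<odot> M i j) x = (\<lambda>i. c \<odot> mat_col A M x i)"
proof
  fix i
  have s: "(\<lambda>i j. c \<odot> M i j) \<in> mats A n" using assms by (auto simp: mats_def)
  show "mat_col A (\<lambda>i j. c \<odot> M i j) x i = c \<odot> mat_col A M x i"
    using assms(2) mats_carrier[OF assms(1)]
    by (simp add: mat_col_nsum[OF s] mat_col_nsum[OF assms(1)] smult_mult_left nsum_smult)
qed

lemma mats_star: "M \<in> mats A n \<Longrightarrow> (\<lambda>i j. star A (M j i)) \<in> mats A n"
  by (auto simp: mats_def)

lemma col_inner_adjoint:
  assumes M: "M \<in> mats A n" and x: "x \<in> columns" and y: "y \<in> columns"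
  shows "col_inner n (mat_col A M x) y = col_inner n x (mat_col A (\<lambda>i j. star A (M j i)) y)"
proof -
  have [simp]: "M i j \<in> carrier A" "x i \<in> carrier A" "y i \<in> carrier A" for i j
    using mats_carrier[OF M] x y by auto
  have "col_inner n (mat_col A M x) y
      = nsum A (\<lambda>i. nsum A (\<lambda>k. star A (x k) \<otimes> (star A (M i k) \<otimes> y i)) n) n"
    by (simp add: col_inner_def mat_col_nsum[OF M] star_nsum nsum_ldistr star_mult m_assoc)
  also have "\<dots> = nsum A (\<lambda>k. nsum A (\<lambda>i. star A (x k) \<otimes> (star A (M i k) \<otimes> y i)) n) n"
    by (rule nsum_swap) simp
  also have "\<dots> = col_inner n x (mat_col A (\<lambda>i j. star A (M j i)) y)"
    by (simp add: col_inner_def mat_col_nsum[OF mats_star[OF M]] nsum_rdistr)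
  finally show ?thesis .
qed

lemma mat_norm_triangle:
  assumes M: "M \<in> mats A n" and N: "N \<in> mats A n"
  shows "mat_norm A (\<lambda>i j. M i j \<oplus> N i j) \<le> mat_norm A M + mat_norm A N"
proof (rule mat_norm_le)
  show "(\<lambda>i j. M i j \<oplus> N i j) \<in> mats A n" using assms by (auto simp: mats_def)
  fix x assume x: "x \<in> columns"
  have "cnorm n (mat_col A (\<lambda>i j. M i j \<oplus> N i j) x) \<le> cnorm n (mat_col A M x) + cnorm n (mat_col A N x)"
    unfolding mat_col_add[OF M N x] by (intro cnorm_triangle mat_col_columns[OF M x] mat_col_columns[OF N x])
  then show "cnorm n (mat_col A (\<lambda>i j. M i j \<oplus> N i j) x) \<le> (mat_norm A M + mat_norm A N) * cnorm n x"
    using cnorm_mat_col_le_mat_norm[OF M x] cnorm_mat_col_le_mat_norm[OF N x] by (simp add: algebra_simps)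
qed (use mat_norm_nonneg[OF M] mat_norm_nonneg[OF N] in simp)

lemma mat_norm_smult_le:
  assumes M: "M \<in> mats A n" shows "mat_norm A (\<lambda>i j. c \<odot> M i j) \<le> cmod c * mat_norm A M"
proof (rule mat_norm_le)
  show "(\<lambda>i j. c \<odot> M i j) \<in> mats A n" using assms by (auto simp: mats_def)
  fix x assume x: "x \<in> columns"
  show "cnorm n (mat_col A (\<lambda>i j. c \<odot> M i j) x) \<le> cmod c * mat_norm A M * cnorm n x"
    unfolding mat_col_smult[OF M x] cnorm_smult[OF mat_col_columns[OF M x]]
    using mult_left_mono[OF cnorm_mat_col_le_mat_norm[OF M x], of "cmod c"] by (simp add: mult.assoc)
qed (use mat_norm_nonneg[OF M] in simp)

lemma mat_norm_smult:
  assumes M: "M \<in> mats A n" shows "mat_norm A (\<lambda>i j. c \<odot> M i j) = cmod c * mat_norm A M"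
proof (cases "c = 0")
  case True
  have "(\<lambda>i j. c \<odot> M i j) \<in> mats A n" using M by (auto simp: mats_def)
  then show ?thesis using mat_norm_smult_le[OF M, of c] mat_norm_nonneg True by fastforce
next
  case False
  have cM: "(\<lambda>i j. c \<odot> M i j) \<in> mats A n" using M by (auto simp: mats_def)
  have "(\<lambda>i j. (1 / c) \<odot> (c \<odot> M i j)) = M" using False mats_carrier[OF M] by simp
  then have "mat_norm A M \<le> cmod (1 / c) * mat_norm A (\<lambda>i j. c \<odot> M i j)"
    using mat_norm_smult_le[OF cM, of "1 / c"] by simp
  then have "cmod c * mat_norm A M \<le> mat_norm A (\<lambda>i j. c \<odot> M i j)"
    using False by (simp add: norm_divide field_simps)
  then show ?thesis using mat_norm_smult_le[OF M, of c] by simp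
qed

lemma mat_norm_mult:
  assumes M: "M \<in> mats A n" and N: "N \<in> mats A n"
  shows "mat_norm A (mat_mult A M N) \<le> mat_norm A M * mat_norm A N"
proof (rule mat_norm_le[OF mats_mult[OF M N]])
  fix x assume x: "x \<in> columns"
  have "cnorm n (mat_col A M (mat_col A N x)) \<le> mat_norm A M * cnorm n (mat_col A N x)"
    by (rule cnorm_mat_col_le_mat_norm[OF M mat_col_columns[OF N x]])
  also have "\<dots> \<le> mat_norm A M * (mat_norm A N * cnorm n x)"
    by (intro mult_left_mono cnorm_mat_col_le_mat_norm[OF N x] mat_norm_nonneg[OF M])
  finally show "cnorm n (mat_col A (mat_mult A M N) x) \<le> mat_norm A M * mat_norm A N * cnorm n x"
    using x by (simp add: mat_col_mult[OF M N] mult.assoc)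
qed (use mat_norm_nonneg[OF M] mat_norm_nonneg[OF N] in simp)

text \<open>The essential half comes from Cauchy-Schwarz: the square of \<parallel>Mx\<parallel> is
  the norm of the inner product of x with M^* M x, hence at most \<parallel>M^* M\<parallel>
  \<parallel>x\<parallel>^2. As in \<open>nrm_star\<close> this bounds the norm of M^* by that of M,
  which gives the other half.\<close>

lemma mat_norm_cstar:
  assumes M: "M \<in> mats A n"
  shows "mat_norm A (mat_mult A (\<lambda>i j. star A (M j i)) M) = (mat_norm A M)\<^sup>2"
proof -
  have le: "(mat_norm A M)\<^sup>2 \<le> mat_norm A (mat_mult A (\<lambda>i j. star A (M j i)) M)"
    if M: "M \<in> mats A n" for M
  proof -
    let ?S = "\<lambda>i j. star A (M j i)"
    have S: "?S \<in> mats A n" by (rule mats_star[OF M])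
    let ?K = "mat_norm A (mat_mult A ?S M)"
    have K: "0 \<le> ?K" by (rule mat_norm_nonneg[OF mats_mult[OF S M]])
    have "mat_norm A M \<le> sqrt ?K"
    proof (rule mat_norm_le[OF M])
      fix x assume x: "x \<in> columns"
      have "(cnorm n (mat_col A M x))\<^sup>2 = nrm A (col_inner n x (mat_col A (mat_mult A ?S M) x))"
        using x mat_col_columns[OF M x]
        by (simp add: cnorm_power2 col_inner_adjoint[OF M x mat_col_columns[OF M x]] mat_col_mult[OF S M])
      also have "\<dots> \<le> cnorm n x * cnorm n (mat_col A (mat_mult A ?S M) x)"
        by (intro nrm_col_inner_le x mat_col_columns[OF mats_mult[OF S M]])
      also have "\<dots> \<le> cnorm n x * (?K * cnorm n x)"
        by (intro mult_left_mono cnorm_mat_col_le_mat_norm[OF mats_mult[OF S M] x] cnorm_nonneg[OF x])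
      also have "\<dots> = (sqrt ?K * cnorm n x)\<^sup>2" using K by (simp add: power_mult_distrib power2_eq_square)
      finally show "cnorm n (mat_col A M x) \<le> sqrt ?K * cnorm n x"
        by (rule power2_le_imp_le) (use K cnorm_nonneg[OF x] in simp)
    qed (use K in simp)
    then have "(mat_norm A M)\<^sup>2 \<le> (sqrt ?K)\<^sup>2" using mat_norm_nonneg[OF M] by (rule power_mono)
    then show ?thesis using K by simp
  qed
  let ?S = "\<lambda>M i j. star A (M j i)"
  have sle: "mat_norm A M \<le> mat_norm A (?S M)" if M: "M \<in> mats A n" for M
  proof (cases "mat_norm A M = 0")
    case True
    then show ?thesis using mat_norm_nonneg[OF mats_star[OF M]] by simp
  next
    case False
    have "mat_norm A M * mat_norm A M \<le> mat_norm A (?S M) * mat_norm A M"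
      using le[OF M] mat_norm_mult[OF mats_star[OF M] M] by (simp add: power2_eq_square)
    then show ?thesis using False mat_norm_nonneg[OF M] by simp
  qed
  have "?S (?S M) = M" using mats_carrier[OF M] by (simp add: star_star)
  then have "mat_norm A (?S M) \<le> mat_norm A M" using sle[OF mats_star[OF M]] by simp
  then have "mat_norm A (?S M) * mat_norm A M \<le> mat_norm A M * mat_norm A M"
    using mat_norm_nonneg[OF M] by (intro mult_right_mono)
  then show ?thesis using le[OF M] mat_norm_mult[OF mats_star[OF M] M] by (simp add: power2_eq_square)
qed

lemma mat_norm_eq_zero:
  assumes M: "M \<in> mats A n" shows "mat_norm A M = 0 \<longleftrightarrow> M = (\<lambda>i j. \<zero>)"
proof
  assume "mat_norm A M = 0"
  then have "nrm A (M i j) = 0" for i j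
    using nrm_entry_le_mat_norm[OF M, of i j] nrm_nonneg[OF mats_carrier[OF M]]
    by (metis order_antisym)
  then show "M = (\<lambda>i j. \<zero>)" using nrm_eq_zero mats_carrier[OF M] by blast
next
  assume "M = (\<lambda>i j. \<zero>)"
  then show "mat_norm A M = 0" using mat_norm_le_sum[OF M] mat_norm_nonneg[OF M] by simp
qed

lemma mat_converges:
  assumes "\<And>m. X m \<in> mats A n" "L \<in> mats A n"
    and "\<And>i j. \<lbrakk>i < n; j < n\<rbrakk> \<Longrightarrow> converges_to A (\<lambda>m. X m i j) (L i j)"
  shows "converges_to (mat_alg A n) X L"
proof -
  have l: "(\<lambda>m. \<Sum>i<n. \<Sum>j<n. nrm A (X m i j \<ominus> L i j)) \<longlonglongrightarrow> (\<Sum>i<n. \<Sum>j<n. 0)"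
    using assms(3) unfolding converges_to_def by (intro tendsto_sum) auto
  have d: "(\<lambda>i j. X m i j \<ominus> L i j) \<in> mats A n" for m
    using assms(1)[of m] assms(2) by (auto simp: mats_def a_minus_def)
  show ?thesis unfolding converges_to_def
  proof (rule tendsto_sandwich[OF _ _ tendsto_const])
    show "(\<lambda>m. \<Sum>i<n. \<Sum>j<n. nrm A (X m i j \<ominus> L i j)) \<longlonglongrightarrow> 0" using l by simp
  qed (simp_all add: mat_minus[OF assms(2)] mat_norm_le_sum[OF d] mat_norm_nonneg[OF d])
qed

text \<open>Completeness is checked on entries. The case n = 0, the zero algebra, is
  included.\<close>

lemma mat_cstar: "unital_cstar_algebra (mat_alg A n)"
proof (intro unital_cstar_algebra.intro unital_cstar_algebra_axioms.intro)
  show "Module.module complex_ring (mat_alg A n)"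
  proof (rule moduleI[OF complex_cring ring.is_abelian_group[OF mat_ring]])
    fix c d :: complex and M assume "M \<in> carrier (mat_alg A n)"
    then have M: "M \<in> mats A n" by simp
    note c [simp] = mats_carrier[OF M]
    show "c \<odot>\<^bsub>mat_alg A n\<^esub> M \<in> carrier (mat_alg A n)" using M by (auto simp: mats_def)
    show "(c \<oplus>\<^bsub>complex_ring\<^esub> d) \<odot>\<^bsub>mat_alg A n\<^esub> M
        = c \<odot>\<^bsub>mat_alg A n\<^esub> M \<oplus>\<^bsub>mat_alg A n\<^esub> d \<odot>\<^bsub>mat_alg A n\<^esub> M"
      by (simp add: complex_ring_def smult_plus)
    show "(c \<otimes>\<^bsub>complex_ring\<^esub> d) \<odot>\<^bsub>mat_alg A n\<^esub> M
        = c \<odot>\<^bsub>mat_alg A n\<^esub> (d \<odot>\<^bsub>mat_alg A n\<^esub> M)"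
      by (simp add: complex_ring_def)
    show "\<one>\<^bsub>complex_ring\<^esub> \<odot>\<^bsub>mat_alg A n\<^esub> M = M"
      by (simp add: complex_ring_def)
  qed (auto simp: mats_carrier smult_add)
  show "ring (mat_alg A n)" by (rule mat_ring)
next
  fix X :: "nat \<Rightarrow> nat \<Rightarrow> nat \<Rightarrow> 'a"
  assume X: "\<And>m. X m \<in> carrier (mat_alg A n)"
    and Cau: "\<And>e. 0 < e \<Longrightarrow> \<exists>N. \<forall>k\<ge>N. \<forall>m\<ge>N. nrm (mat_alg A n) (X k \<ominus>\<^bsub>mat_alg A n\<^esub> X m) < e"
  have Xm: "X m \<in> mats A n" for m using X by simp
  have "\<exists>x\<in>carrier A. converges_to A (\<lambda>m. X m i j) x" for i j
  proof (rule nrm_complete[OF mats_carrier[OF Xm]])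
    fix e :: real assume "e > 0"
    then obtain N where N: "\<And>k m. \<lbrakk>k \<ge> N; m \<ge> N\<rbrakk> \<Longrightarrow> mat_norm A (\<lambda>i j. X k i j \<ominus> X m i j) < e"
      using Cau[of e] unfolding mat_minus[OF Xm] mat_alg_simps by blast
    have d: "(\<lambda>i j. X k i j \<ominus> X m i j) \<in> mats A n" for k m
      using Xm[of k] Xm[of m] by (auto simp: mats_def a_minus_def)
    show "\<exists>N. \<forall>k\<ge>N. \<forall>m\<ge>N. nrm A (X k i j \<ominus> X m i j) < e"
      using N nrm_entry_le_mat_norm[OF d] by (blast intro: le_less_trans)
  qed
  then obtain L where L: "\<And>i j. L i j \<in> carrier A" "\<And>i j. converges_to A (\<lambda>m. X m i j) (L i j)"
    by metis
  let ?L = "\<lambda>i j. if i < n \<and> j < n then L i j else \<zero>"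
  have "?L \<in> mats A n" using L by (auto simp: mats_def)
  moreover have "converges_to (mat_alg A n) X ?L"
    using Xm \<open>?L \<in> mats A n\<close> L by (intro mat_converges) auto
  ultimately show "\<exists>x\<in>carrier (mat_alg A n). converges_to (mat_alg A n) X x" by auto
next
  fix M N and c :: complex assume "M \<in> carrier (mat_alg A n)" "N \<in> carrier (mat_alg A n)"
  then have M: "M \<in> mats A n" and N: "N \<in> mats A n" by simp_all
  note c [simp] = mats_carrier[OF M] mats_carrier[OF N]
  have cM: "(\<lambda>i j. c \<odot> M i j) \<in> mats A n" using M by (auto simp: mats_def)
  show "(c \<odot>\<^bsub>mat_alg A n\<^esub> M) \<otimes>\<^bsub>mat_alg A n\<^esub> N = c \<odot>\<^bsub>mat_alg A n\<^esub> (M \<otimes>\<^bsub>mat_alg A n\<^esub> N)"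
    by (intro ext) (simp add: mat_mult_nsum[OF M] mat_mult_nsum[OF cM] smult_mult_left nsum_smult)
  show "M \<otimes>\<^bsub>mat_alg A n\<^esub> (c \<odot>\<^bsub>mat_alg A n\<^esub> N) = c \<odot>\<^bsub>mat_alg A n\<^esub> (M \<otimes>\<^bsub>mat_alg A n\<^esub> N)"
    by (intro ext) (simp add: mat_mult_nsum[OF M] smult_mult_right nsum_smult)
  show "star (mat_alg A n) (M \<otimes>\<^bsub>mat_alg A n\<^esub> N)
      = star (mat_alg A n) N \<otimes>\<^bsub>mat_alg A n\<^esub> star (mat_alg A n) M"
    by (intro ext) (simp add: mat_mult_nsum[OF M] mat_mult_nsum[OF mats_star[OF N]] star_nsum star_mult)
  show "nrm (mat_alg A n) (M \<oplus>\<^bsub>mat_alg A n\<^esub> N) \<le> nrm (mat_alg A n) M + nrm (mat_alg A n) N"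
    by (simp add: mat_norm_triangle[OF M N])
  show "nrm (mat_alg A n) (M \<otimes>\<^bsub>mat_alg A n\<^esub> N) \<le> nrm (mat_alg A n) M * nrm (mat_alg A n) N"
    by (simp add: mat_norm_mult[OF M N])
  show "star (mat_alg A n) (M \<oplus>\<^bsub>mat_alg A n\<^esub> N)
      = star (mat_alg A n) M \<oplus>\<^bsub>mat_alg A n\<^esub> star (mat_alg A n) N"
    by (simp add: star_add)
next
  fix M and c :: complex assume "M \<in> carrier (mat_alg A n)"
  then have M: "M \<in> mats A n" by simp
  note c [simp] = mats_carrier[OF M]
  show "star (mat_alg A n) M \<in> carrier (mat_alg A n)" using mats_star[OF M] by simp
  show "star (mat_alg A n) (star (mat_alg A n) M) = M" by (simp add: star_star)
  show "star (mat_alg A n) (c \<odot>\<^bsub>mat_alg A n\<^esub> M) = cnj c \<odot>\<^bsub>mat_alg A n\<^esub> star (mat_alg A n) M"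
    by (simp add: star_smult)
  show "0 \<le> nrm (mat_alg A n) M" by (simp add: mat_norm_nonneg[OF M])
  show "nrm (mat_alg A n) M = 0 \<longleftrightarrow> M = \<zero>\<^bsub>mat_alg A n\<^esub>" by (simp add: mat_norm_eq_zero[OF M])
  show "nrm (mat_alg A n) (c \<odot>\<^bsub>mat_alg A n\<^esub> M) = cmod c * nrm (mat_alg A n) M"
    by (simp add: mat_norm_smult[OF M])
  show "nrm (mat_alg A n) (star (mat_alg A n) M \<otimes>\<^bsub>mat_alg A n\<^esub> M) = (nrm (mat_alg A n) M)\<^sup>2"
    by (simp add: mat_norm_cstar[OF M])
qed

section \<open>Roots, traces and dimension functions\<close>

lemma cfc_pow:
  assumes "h \<in> self_adjoint A" shows "cfc A h (\<lambda>t. t ^ k) = h [^] k"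
proof (induction k)
  case 0
  then show ?case using cfc_const[OF assms, of 1] assms by simp
next
  case (Suc k)
  have "cfc A h (\<lambda>t. t ^ k * t) = cfc A h (\<lambda>t. t ^ k) \<otimes> cfc A h (\<lambda>t. t)"
    by (rule cfc_mult[OF assms]) (intro continuous_intros)+
  then show ?case using Suc assms by (simp add: cfc_id mult.commute)
qed

lemma cfc_root_psd [simp]: "a \<in> psd A \<Longrightarrow> cfc A a (root k) \<in> psd A"
  by (intro cfc_psd_psd continuous_intros) (auto simp: real_root_ge_zero)

lemma cfc_root_pow:
  assumes "a \<in> psd A" "k \<ge> 1" shows "cfc A a (root k) [^] k = a"
proof -
  have "cfc A a (root k) [^] k = cfc A (cfc A a (root k)) (\<lambda>t. t ^ k)"
    using assms by (simp add: cfc_pow)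
  also have "\<dots> = cfc A a (\<lambda>t. root k t ^ k)"
    using assms by (intro cfc_compose continuous_intros) auto
  also have "\<dots> = cfc A a (\<lambda>t. t)"
    using assms by (intro cfc_cong_psd continuous_intros) auto
  finally show ?thesis using assms by (simp add: cfc_id)
qed

lemma cfc_root_unique:
  assumes "b \<in> psd A" "k \<ge> 1" shows "cfc A (b [^] k) (root k) = b"
proof -
  have "cfc A (b [^] k) (root k) = cfc A b (\<lambda>t. root k (t ^ k))"
    using assms by (subst cfc_pow[symmetric]) (auto intro!: cfc_compose continuous_intros)
  also have "\<dots> = cfc A b (\<lambda>t. t)"
    using assms by (intro cfc_cong_psd continuous_intros) (auto simp: real_root_power_cancel)
  finally show ?thesis using assms by (simp add: cfc_id)
qed

lemma mat_psd_iff: "M \<in> psd (mat_alg A n) \<longleftrightarrow> positive (mat_alg A n) M"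
  by (simp add: unital_cstar_algebra.positive_iff_psd[OF mat_cstar])

lemma mat_psd_mats: "M \<in> psd (mat_alg A n) \<Longrightarrow> M \<in> mats A n"
  by (simp add: mat_psd_iff positive_def)

lemma mat_psd_mono: "\<lbrakk>M \<in> psd (mat_alg A m); m \<le> n\<rbrakk> \<Longrightarrow> M \<in> psd (mat_alg A n)"
  unfolding mat_psd_iff positive_def by (auto intro: mats_mono)

lemma positive_mat_inf_iff: "positive (mat_inf A) M \<longleftrightarrow> (\<exists>n. M \<in> psd (mat_alg A n))"
proof
  assume "positive (mat_inf A) M"
  then obtain N n where "N \<in> mats A n" "M = mat_mult A (\<lambda>i j. star A (N j i)) N"
    unfolding positive_def mat_inf_def by auto
  then have "M \<in> psd (mat_alg A n)"
    unfolding mat_psd_iff positive_def by (auto intro!: mats_star)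
  then show "\<exists>n. M \<in> psd (mat_alg A n)" ..
next
  assume "\<exists>n. M \<in> psd (mat_alg A n)"
  then show "positive (mat_inf A) M"
    unfolding mat_psd_iff positive_def mat_inf_def by auto
qed

text \<open>The power k = 0 is excluded because it is the unit, which depends on the size.\<close>

lemma mat_pow_indep:
  fixes k :: nat
  assumes "M \<in> mats A m" "m \<le> n" "k \<ge> 1"
  shows "M [^]\<^bsub>mat_alg A m\<^esub> k = M [^]\<^bsub>mat_alg A n\<^esub> k"
  using assms(3)
proof (induction k rule: dec_induct)
  case base
  then show ?case
    using mat_one_mult(1)[OF assms(1)] mat_one_mult(1)[OF mats_mono[OF assms(1,2)]] by (simp add: nat_pow_def)
next
  case (step k)
  then show ?case by (simp add: nat_pow_def)
qed

text \<open>The description of \<open>mat_root\<close> ranges over all sizes, so uniqueness must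
  too: a root in size m and the calculus root in size n are compared in the larger of the two
  sizes.\<close>

lemma mat_root_eq:
  assumes a: "a \<in> psd (mat_alg A n)" and k: "k \<ge> 1"
  shows "mat_root A a k = cfc (mat_alg A n) a (root k)"
  unfolding mat_root_def
proof (rule the_equality)
  interpret M: unital_cstar_algebra "mat_alg A n" by (rule mat_cstar)
  show "\<exists>m. positive (mat_alg A m) (cfc (mat_alg A n) a (root k)) \<and>
      cfc (mat_alg A n) a (root k) [^]\<^bsub>mat_alg A m\<^esub> k = a"
    using a M.cfc_root_pow[OF a k] by (intro exI[of _ n]) (simp flip: mat_psd_iff)
  have uniq: "b = cfc (mat_alg A N) a (root k)"
    if b: "b \<in> psd (mat_alg A m)" "b [^]\<^bsub>mat_alg A m\<^esub> k = a" and N: "m \<le> N" for b m N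
  proof -
    have "b [^]\<^bsub>mat_alg A N\<^esub> k = a"
      using mat_pow_indep[OF mat_psd_mats[OF b(1)] N k] b(2) by simp
    then show ?thesis
      using unital_cstar_algebra.cfc_root_unique[OF mat_cstar mat_psd_mono[OF b(1) N] k] by simp
  qed
  fix b assume "\<exists>m. positive (mat_alg A m) b \<and> b [^]\<^bsub>mat_alg A m\<^esub> k = a"
  then obtain m where m: "b \<in> psd (mat_alg A m)" "b [^]\<^bsub>mat_alg A m\<^esub> k = a" by (auto simp: mat_psd_iff)
  have "b = cfc (mat_alg A (max m n)) a (root k)" by (rule uniq[OF m]) simp
  moreover have "cfc (mat_alg A n) a (root k) = cfc (mat_alg A (max m n)) a (root k)"
    by (rule uniq[OF M.cfc_root_psd[OF a] M.cfc_root_pow[OF a k]]) simp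
  ultimately show "b = cfc (mat_alg A n) a (root k)" by simp
qed

lemma mat_psd_diag:
  assumes "M \<in> psd (mat_alg A n)" shows "M i i \<in> psd A"
proof -
  obtain N where N: "N \<in> mats A n" "M = mat_mult A (\<lambda>i j. star A (N j i)) N"
    using assms unfolding mat_psd_iff positive_def by auto
  show ?thesis unfolding N(2) using mats_carrier[OF N(1)]
    by (simp add: mat_mult_nsum[OF mats_star[OF N(1)]] nsum_psd)
qed

end

text \<open>The unnormalized trace, real part only. Summation over a fixed range instead of the
  support of the diagonal makes additivity in M immediate.\<close>

definition trace_fun :: "('a \<Rightarrow> complex) \<Rightarrow> nat \<Rightarrow> 'a mat \<Rightarrow> real" where
  "trace_fun \<tau> n M = (\<Sum>i<n. Re (\<tau> (M i i)))"

context unital_cstar_algebra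
begin

lemma tracial_stateD:
  assumes "\<tau> \<in> tracial_states A"
  shows tracial_state_add: "\<lbrakk>x \<in> carrier A; y \<in> carrier A\<rbrakk> \<Longrightarrow> \<tau> (x \<oplus> y) = \<tau> x + \<tau> y"
    and tracial_state_smult: "x \<in> carrier A \<Longrightarrow> \<tau> (c \<odot> x) = c * \<tau> x"
    and tracial_state_real: "x \<in> psd A \<Longrightarrow> \<tau> x \<in> \<real>"
    and tracial_state_nonneg: "x \<in> psd A \<Longrightarrow> 0 \<le> Re (\<tau> x)"
    and tracial_state_one: "\<tau> \<one> = 1"
    and tracial_state_mult_commute: "\<lbrakk>x \<in> carrier A; y \<in> carrier A\<rbrakk> \<Longrightarrow> \<tau> (x \<otimes> y) = \<tau> (y \<otimes> x)"
  using assms by (auto simp: tracial_states_def positive_iff_psd)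

lemma tracial_state_zero: "\<tau> \<in> tracial_states A \<Longrightarrow> \<tau> \<zero> = 0"
  using tracial_state_smult[of \<tau> \<zero> 0] by simp

lemma tracial_state_functional: "\<tau> \<in> tracial_states A \<Longrightarrow> positive_functional A (\<lambda>x. Re (\<tau> x))"
  by (auto simp: positive_functional_def tracial_stateD)

lemma mat_trace_eq:
  assumes t: "\<tau> \<in> tracial_states A" and M: "M \<in> mats A n"
  shows "Re (mat_trace A \<tau> M) = trace_fun \<tau> n M"
proof -
  have "(\<Sum>i\<in>{i. M i i \<noteq> \<zero>}. \<tau> (M i i)) = (\<Sum>i<n. \<tau> (M i i))"
    using mats_zero[OF M] tracial_state_zero[OF t] by (intro sum.mono_neutral_left) auto
  then show ?thesis by (simp add: mat_trace_def trace_fun_def Re_sum)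
qed

lemma trace_fun_functional:
  assumes t: "\<tau> \<in> tracial_states A" shows "positive_functional (mat_alg A n) (trace_fun \<tau> n)"
  unfolding positive_functional_def
proof (intro conjI ballI allI)
  fix M N assume "M \<in> carrier (mat_alg A n)" "N \<in> carrier (mat_alg A n)"
  then show "trace_fun \<tau> n (M \<oplus>\<^bsub>mat_alg A n\<^esub> N) = trace_fun \<tau> n M + trace_fun \<tau> n N"
    by (simp add: trace_fun_def tracial_state_add[OF t] mats_carrier sum.distrib)
next
  fix c M assume "M \<in> carrier (mat_alg A n)"
  then show "trace_fun \<tau> n (of_real c \<odot>\<^bsub>mat_alg A n\<^esub> M) = c * trace_fun \<tau> n M"
    by (simp add: trace_fun_def tracial_state_smult[OF t] mats_carrier sum_distrib_left)
next
  fix M assume "M \<in> psd (mat_alg A n)"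
  then show "0 \<le> trace_fun \<tau> n M"
    unfolding trace_fun_def by (intro sum_nonneg tracial_state_nonneg[OF t] mat_psd_diag)
qed

lemma dim_fun_tendsto:
  assumes t: "\<tau> \<in> tracial_states A" and a: "a \<in> psd (mat_alg A n)"
  shows "(\<lambda>k. trace_fun \<tau> n (cfc (mat_alg A n) a (root k))) \<longlonglongrightarrow> dim_fun A \<tau> a"
    and "dim_fun A \<tau> a = rank_fun (mat_alg A n) (trace_fun \<tau> n) a"
proof -
  interpret M: unital_cstar_algebra "mat_alg A n" by (rule mat_cstar)
  let ?r = "rank_fun (mat_alg A n) (trace_fun \<tau> n) a"
  have l: "(\<lambda>k. trace_fun \<tau> n (cfc (mat_alg A n) a (root k))) \<longlonglongrightarrow> ?r"
    by (rule M.rank_fun_tendsto[OF trace_fun_functional[OF t] a, of "max 1 (nrm (mat_alg A n) a)"]) auto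
  \<comment> \<open>Only eventually: \<open>mat_root_eq\<close> describes the roots from k = 1
    on.\<close>
  have "\<forall>\<^sub>F k in sequentially. trace_fun \<tau> n (cfc (mat_alg A n) a (root k)) = Re (mat_trace A \<tau> (mat_root A a k))"
    using mat_root_eq[OF a] mat_trace_eq[OF t mat_psd_mats[OF M.cfc_root_psd[OF a]]]
    by (intro eventually_sequentiallyI[of 1]) simp
  with l have "(\<lambda>k. Re (mat_trace A \<tau> (mat_root A a k))) \<longlonglongrightarrow> ?r"
    by (rule Lim_transform_eventually)
  then show *: "dim_fun A \<tau> a = ?r" unfolding dim_fun_def by (rule limI)
  show "(\<lambda>k. trace_fun \<tau> n (cfc (mat_alg A n) a (root k))) \<longlonglongrightarrow> dim_fun A \<tau> a"
    using l * by simp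
qed

end

section \<open>Homomorphisms, roots and dimension functions\<close>

lemma star_homD:
  assumes "star_hom A B f"
  shows star_hom_carrier: "x \<in> carrier A \<Longrightarrow> f x \<in> carrier B"
    and star_hom_add: "\<lbrakk>x \<in> carrier A; y \<in> carrier A\<rbrakk> \<Longrightarrow> f (x \<oplus>\<^bsub>A\<^esub> y) = f x \<oplus>\<^bsub>B\<^esub> f y"
    and star_hom_smult: "x \<in> carrier A \<Longrightarrow> f (c \<odot>\<^bsub>A\<^esub> x) = c \<odot>\<^bsub>B\<^esub> f x"
    and star_hom_mult: "\<lbrakk>x \<in> carrier A; y \<in> carrier A\<rbrakk> \<Longrightarrow> f (x \<otimes>\<^bsub>A\<^esub> y) = f x \<otimes>\<^bsub>B\<^esub> f y"
    and star_hom_star: "x \<in> carrier A \<Longrightarrow> f (star A x) = star B (f x)"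
  using assms by (auto simp: star_hom_def linear_map_def)

locale cstar_hom = dom: unital_cstar_algebra A + cod: unital_cstar_algebra B
  for A :: "('a, 'm) cstar_scheme" and B :: "('b, 'n) cstar_scheme" +
  fixes f assumes hom: "star_hom A B f"
begin

lemmas hom_carrier [simp] = star_hom_carrier[OF hom]
  and hom_add = star_hom_add[OF hom] and hom_smult = star_hom_smult[OF hom]
  and hom_mult = star_hom_mult[OF hom] and hom_star = star_hom_star[OF hom]

lemma hom_zero [simp]: "f \<zero>\<^bsub>A\<^esub> = \<zero>\<^bsub>B\<^esub>"
  using hom_smult[of "\<zero>\<^bsub>A\<^esub>" 0] by simp

lemma hom_psd: "x \<in> psd A \<Longrightarrow> f x \<in> psd B"
  unfolding dom.positive_iff_psd[symmetric] cod.positive_iff_psd[symmetric]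
  by (auto simp: positive_def hom_mult hom_star)

text \<open>The zeroth power is excluded since f need not preserve the unit.\<close>

lemma hom_pow: "\<lbrakk>x \<in> carrier A; k \<ge> 1\<rbrakk> \<Longrightarrow> f (x [^]\<^bsub>A\<^esub> (k::nat)) = f x [^]\<^bsub>B\<^esub> k"
proof (induction k)
  case (Suc k)
  then show ?case by (cases "k = 0") (auto simp: hom_mult)
qed simp

text \<open>The image of a root is a positive root of the image, and positive roots are unique; no
  continuity of f enters.\<close>

lemma hom_cfc_root:
  assumes "x \<in> psd A" "k \<ge> 1" shows "f (cfc A x (root k)) = cfc B (f x) (root k)"
proof -
  have "f (cfc A x (root k)) [^]\<^bsub>B\<^esub> k = f x"
    using hom_pow[of "cfc A x (root k)" k] dom.cfc_root_pow[OF assms] dom.cfc_root_psd[OF assms(1)] assms(2)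
    by simp
  then show ?thesis
    using cod.cfc_root_unique[OF hom_psd[OF dom.cfc_root_psd[OF assms(1)]] assms(2), of k] by simp
qed

lemma hom_nsum: "(\<And>k. g k \<in> carrier A) \<Longrightarrow> f (nsum A g n) = nsum B (\<lambda>k. f (g k)) n"
  by (induction n) (simp_all add: hom_add)

lemma hom_mats: "M \<in> mats A n \<Longrightarrow> (\<lambda>i j. f (M i j)) \<in> mats B n"
  by (auto simp: mats_def)

lemma hom_mat_mult:
  assumes "M \<in> mats A n" "N \<in> mats A n"
  shows "(\<lambda>i j. f (mat_mult A M N i j)) = mat_mult B (\<lambda>i j. f (M i j)) (\<lambda>i j. f (N i j))"
  using dom.mats_carrier[OF assms(1)] dom.mats_carrier[OF assms(2)]
  by (intro ext) (simp add: dom.mat_mult_nsum[OF assms(1)] cod.mat_mult_nsum[OF hom_mats[OF assms(1)]]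
      hom_nsum hom_mult)

lemma hom_mat_hom: "cstar_hom (mat_alg A n) (mat_alg B n) (\<lambda>M i j. f (M i j))"
proof (intro cstar_hom.intro cstar_hom_axioms.intro dom.mat_cstar cod.mat_cstar)
  show "star_hom (mat_alg A n) (mat_alg B n) (\<lambda>M i j. f (M i j))"
    unfolding star_hom_def linear_map_def
    by (auto simp: hom_mats hom_add hom_smult hom_star dom.mats_carrier hom_mat_mult)
qed

lemma hom_dim_fun:
  assumes t: "\<tau> \<in> tracial_states B" and s: "\<sigma> \<in> tracial_states A"
    and ts: "\<And>x. x \<in> carrier A \<Longrightarrow> \<tau> (f x) = of_real c * \<sigma> x" and a: "a \<in> psd (mat_alg A n)"
  shows "dim_fun B \<tau> (\<lambda>i j. f (a i j)) = c * dim_fun A \<sigma> a"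
proof -
  interpret h: cstar_hom "mat_alg A n" "mat_alg B n" "\<lambda>M i j. f (M i j)" by (rule hom_mat_hom)
  have "(\<lambda>k. c * trace_fun \<sigma> n (cfc (mat_alg A n) a (root k))) \<longlonglongrightarrow> c * dim_fun A \<sigma> a"
    by (intro tendsto_mult_left dom.dim_fun_tendsto[OF s a])
  moreover have "\<forall>\<^sub>F k in sequentially. c * trace_fun \<sigma> n (cfc (mat_alg A n) a (root k))
      = trace_fun \<tau> n (cfc (mat_alg B n) (\<lambda>i j. f (a i j)) (root k))"
  proof (rule eventually_sequentiallyI[of 1])
    fix k :: nat assume k: "1 \<le> k"
    have m: "cfc (mat_alg A n) a (root k) \<in> mats A n"
      by (rule dom.mat_psd_mats[OF h.dom.cfc_root_psd[OF a]])
    show "c * trace_fun \<sigma> n (cfc (mat_alg A n) a (root k))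
      = trace_fun \<tau> n (cfc (mat_alg B n) (\<lambda>i j. f (a i j)) (root k))"
      by (simp add: h.hom_cfc_root[OF a k, symmetric] trace_fun_def ts dom.mats_carrier[OF m] sum_distrib_left)
  qed
  ultimately have "(\<lambda>k. trace_fun \<tau> n (cfc (mat_alg B n) (\<lambda>i j. f (a i j)) (root k))) \<longlonglongrightarrow> c * dim_fun A \<sigma> a"
    by (rule Lim_transform_eventually)
  with cod.dim_fun_tendsto(1)[OF t h.hom_psd[OF a]] show ?thesis by (rule LIMSEQ_unique)
qed

end

section \<open>Simple algebras\<close>

text \<open>The algebraic two-sided ideal, as finite sums of terms x z y; rule induction takes the
  place of induction on the number of terms.\<close>

inductive_set generated_ideal :: "('a, 'm) cstar_scheme \<Rightarrow> 'a \<Rightarrow> 'a set"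
  for A :: "('a, 'm) cstar_scheme" and z :: 'a where
  zero: "\<zero>\<^bsub>A\<^esub> \<in> generated_ideal A z"
| step: "\<lbrakk>w \<in> generated_ideal A z; x \<in> carrier A; y \<in> carrier A\<rbrakk>
    \<Longrightarrow> w \<oplus>\<^bsub>A\<^esub> x \<otimes>\<^bsub>A\<^esub> z \<otimes>\<^bsub>A\<^esub> y \<in> generated_ideal A z"

text \<open>V need not be a subspace, only lie in the span of finitely many elements; this passes to
  subsets.\<close>

definition finite_dim_set :: "('a, 'm) cstar_scheme \<Rightarrow> 'a set \<Rightarrow> bool" where
  "finite_dim_set A V \<longleftrightarrow> (\<exists>S. finite S \<and> S \<subseteq> carrier A \<and>
     (\<forall>a\<in>V. \<exists>c. a = (\<Oplus>\<^bsub>A\<^esub>s\<in>S. c s \<odot>\<^bsub>A\<^esub> s)))"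

context unital_cstar_algebra
begin

lemma closure_in_iff:
  assumes "S \<subseteq> carrier A"
  shows "a \<in> closure_in A S \<longleftrightarrow> a \<in> carrier A \<and> (\<forall>e>0. \<exists>s\<in>S. nrm A (s \<ominus> a) < e)"
proof
  assume a: "a \<in> closure_in A S"
  then obtain X where X: "\<And>n. X n \<in> S" "(\<lambda>n. nrm A (X n \<ominus> a)) \<longlonglongrightarrow> 0"
    by (auto simp: closure_in_def converges_to_def)
  have "\<exists>s\<in>S. nrm A (s \<ominus> a) < e" if "e > 0" for e
  proof -
    have "\<forall>\<^sub>F n in sequentially. nrm A (X n \<ominus> a) < e" using order_tendstoD(2)[OF X(2) that] .
    then show ?thesis using X(1) by (auto simp: eventually_sequentially)
  qed
  with a show "a \<in> carrier A \<and> (\<forall>e>0. \<exists>s\<in>S. nrm A (s \<ominus> a) < e)" by (simp add: closure_in_def)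
next
  assume a: "a \<in> carrier A \<and> (\<forall>e>0. \<exists>s\<in>S. nrm A (s \<ominus> a) < e)"
  then have "\<forall>n. \<exists>s\<in>S. nrm A (s \<ominus> a) < inverse (real (Suc n))" by simp
  then obtain X where X: "\<And>n. X n \<in> S" "\<And>n. nrm A (X n \<ominus> a) < inverse (real (Suc n))" by metis
  have "converges_to A X a"
    by (rule converges_cong_le[OF _ LIMSEQ_inverse_real_of_nat]) (use X a assms in \<open>auto intro: less_imp_le\<close>)
  with X a show "a \<in> closure_in A S" by (auto simp: closure_in_def)
qed

lemma generated_ideal_carrier: "\<lbrakk>w \<in> generated_ideal A z; z \<in> carrier A\<rbrakk> \<Longrightarrow> w \<in> carrier A"
  by (induction rule: generated_ideal.induct) auto

lemma generated_ideal_add: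
  assumes z: "z \<in> carrier A" and v: "v \<in> generated_ideal A z"
  shows "w \<in> generated_ideal A z \<Longrightarrow> v \<oplus> w \<in> generated_ideal A z"
proof (induction rule: generated_ideal.induct)
  case zero
  then show ?case using v generated_ideal_carrier[OF v z] by simp
next
  case (step w x y)
  have "v \<oplus> (w \<oplus> x \<otimes> z \<otimes> y) = (v \<oplus> w) \<oplus> x \<otimes> z \<otimes> y"
    using step z generated_ideal_carrier[OF v z] generated_ideal_carrier[OF step(1) z] by (simp add: a_assoc)
  then show ?case using generated_ideal.step[OF step.IH step.hyps(2,3)] by simp
qed

lemma generated_ideal_left:
  assumes z: "z \<in> carrier A" and a: "a \<in> carrier A"
  shows "w \<in> generated_ideal A z \<Longrightarrow> a \<otimes> w \<in> generated_ideal A z"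
proof (induction rule: generated_ideal.induct)
  case (step w x y)
  have "a \<otimes> (w \<oplus> x \<otimes> z \<otimes> y) = a \<otimes> w \<oplus> (a \<otimes> x) \<otimes> z \<otimes> y"
    using step z a generated_ideal_carrier[OF step(1) z] by (simp add: r_distr m_assoc)
  then show ?case using generated_ideal.step[OF step.IH, of "a \<otimes> x" y] step a by simp
qed (use a in \<open>simp add: generated_ideal.zero\<close>)

lemma generated_ideal_right:
  assumes z: "z \<in> carrier A" and a: "a \<in> carrier A"
  shows "w \<in> generated_ideal A z \<Longrightarrow> w \<otimes> a \<in> generated_ideal A z"
proof (induction rule: generated_ideal.induct)
  case (step w x y)
  have "(w \<oplus> x \<otimes> z \<otimes> y) \<otimes> a = w \<otimes> a \<oplus> x \<otimes> z \<otimes> (y \<otimes> a)"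
    using step z a generated_ideal_carrier[OF step(1) z] by (simp add: l_distr m_assoc)
  then show ?case using generated_ideal.step[OF step.IH, of x "y \<otimes> a"] step a by simp
qed (use a in \<open>simp add: generated_ideal.zero\<close>)

lemma generated_ideal_self:
  assumes "z \<in> carrier A" shows "z \<in> generated_ideal A z"
  using generated_ideal.step[OF generated_ideal.zero, of \<one> A \<one> z] assms by simp

lemma closure_generated_ideal:
  assumes z: "z \<in> carrier A"
  shows "ideal (closure_in A (generated_ideal A z)) A"
proof -
  let ?G = "generated_ideal A z" and ?I = "closure_in A (generated_ideal A z)"
  have sub: "?G \<subseteq> carrier A" using generated_ideal_carrier[OF _ z] by blast
  note iff = closure_in_iff[OF sub]
  have Ic: "?I \<subseteq> carrier A" by (auto simp: closure_in_def)
  have zero: "\<zero> \<in> ?I"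
    unfolding iff by (auto intro!: bexI[OF _ generated_ideal.zero] simp: a_minus_def)
  have mult: "a \<otimes> x \<in> ?I" "x \<otimes> a \<in> ?I" if x: "x \<in> ?I" and a: "a \<in> carrier A" for a x
  proof -
    have xc: "x \<in> carrier A" using x Ic by blast
    have "\<exists>s\<in>?G. nrm A (s \<ominus> a \<otimes> x) < e" "\<exists>s\<in>?G. nrm A (s \<ominus> x \<otimes> a) < e" if e: "e > 0" for e
    proof -
      have na: "nrm A a \<ge> 0" using a by (rule nrm_nonneg)
      then have "e / (nrm A a + 1) > 0" using e by simp
      then obtain s where s: "s \<in> ?G" "nrm A (s \<ominus> x) < e / (nrm A a + 1)" using x iff by blast
      have sc: "s \<in> carrier A" using s sub by blast
      have lt: "nrm A a * nrm A (s \<ominus> x) < e"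
      proof -
        have "nrm A a * nrm A (s \<ominus> x) \<le> nrm A a * (e / (nrm A a + 1))"
          using s(2) na by (intro mult_left_mono) auto
        also have "\<dots> < e" using na e by (simp add: field_simps)
        finally show ?thesis .
      qed
      have "a \<otimes> s \<ominus> a \<otimes> x = a \<otimes> (s \<ominus> x)" "s \<otimes> a \<ominus> x \<otimes> a = (s \<ominus> x) \<otimes> a"
        using a xc sc by algebra+
      then have "nrm A (a \<otimes> s \<ominus> a \<otimes> x) < e" "nrm A (s \<otimes> a \<ominus> x \<otimes> a) < e"
        using lt nrm_mult[of a "s \<ominus> x"] nrm_mult[of "s \<ominus> x" a] a xc sc by (simp_all add: mult.commute)
      then show "\<exists>s\<in>?G. nrm A (s \<ominus> a \<otimes> x) < e" "\<exists>s\<in>?G. nrm A (s \<ominus> x \<otimes> a) < e"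
        using generated_ideal_left[OF z a s(1)] generated_ideal_right[OF z a s(1)] by blast+
    qed
    then show "a \<otimes> x \<in> ?I" "x \<otimes> a \<in> ?I" unfolding iff using a xc by auto
  qed
  have add: "x \<oplus> y \<in> ?I" if x: "x \<in> ?I" and y: "y \<in> ?I" for x y
  proof -
    have c: "x \<in> carrier A" "y \<in> carrier A" using x y Ic by auto
    have "\<exists>s\<in>?G. nrm A (s \<ominus> (x \<oplus> y)) < e" if e: "e > 0" for e
    proof -
      obtain s t where st: "s \<in> ?G" "nrm A (s \<ominus> x) < e/2" "t \<in> ?G" "nrm A (t \<ominus> y) < e/2"
        using x y e unfolding iff by (meson half_gt_zero)
      have stc: "s \<in> carrier A" "t \<in> carrier A" using st sub by auto
      have "(s \<oplus> t) \<ominus> (x \<oplus> y) = (s \<ominus> x) \<oplus> (t \<ominus> y)" using stc c by algebra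
      then have "nrm A ((s \<oplus> t) \<ominus> (x \<oplus> y)) < e"
        using nrm_triangle[of "s \<ominus> x" "t \<ominus> y"] stc c st by simp
      then show ?thesis using generated_ideal_add[OF z st(1,3)] by blast
    qed
    then show ?thesis unfolding iff using c by auto
  qed
  have inv: "\<ominus> x \<in> ?I" if x: "x \<in> ?I" for x
    using mult(1)[OF x, of "\<ominus> \<one>"] x Ic by (auto simp: l_minus)
  show ?thesis
  proof (rule idealI[OF ring_axioms])
    show "subgroup ?I (add_monoid A)"
      by (rule add.subgroupI) (use Ic zero add inv in \<open>auto simp: a_inv_def\<close>)
  qed (use mult in auto)
qed

lemma closure_closure:
  assumes "S \<subseteq> carrier A"
  shows "closure_in A (closure_in A S) = closure_in A S"
proof -
  have c: "closure_in A S \<subseteq> carrier A" by (auto simp: closure_in_def)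
  show ?thesis
  proof (intro equalityI subsetI)
    fix a assume "a \<in> closure_in A (closure_in A S)"
    then have a: "a \<in> carrier A" "\<And>e. e > 0 \<Longrightarrow> \<exists>s\<in>closure_in A S. nrm A (s \<ominus> a) < e"
      using closure_in_iff[OF c] by auto
    have "\<exists>s\<in>S. nrm A (s \<ominus> a) < e" if e: "e > 0" for e
    proof -
      obtain t where t: "t \<in> closure_in A S" "nrm A (t \<ominus> a) < e/2" using a(2)[of "e/2"] e by auto
      then obtain s where s: "s \<in> S" "nrm A (s \<ominus> t) < e/2" "t \<in> carrier A"
        using closure_in_iff[OF assms] e half_gt_zero by blast
      then have "nrm A (s \<ominus> a) < e"
        using nrm_minus_triangle[of s t a] t a assms by auto
      with s show ?thesis by blast
    qed
    then show "a \<in> closure_in A S" using closure_in_iff[OF assms] a by blast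
  next
    fix a assume "a \<in> closure_in A S"
    then show "a \<in> closure_in A (closure_in A S)"
      using c by (auto simp: closure_in_def[of A "closure_in A S"] intro!: exI[of _ "\<lambda>_. a"])
  qed
qed

text \<open>If \<open>c\<close> is close to \<open>1\<close> then \<open>c\<^sup>*c - 1/2 \<ge> 0\<close>, so \<open>c\<^sup>*c\<close> has an inverse in the functional calculus.\<close>

lemma one_in_generated_ideal:
  assumes simple: "simple_cstar A" and z: "z \<in> carrier A" "z \<noteq> \<zero>"
  shows "\<one> \<in> generated_ideal A z"
proof -
  let ?G = "generated_ideal A z" and ?I = "closure_in A (generated_ideal A z)"
  have sub: "?G \<subseteq> carrier A" using generated_ideal_carrier[OF _ z(1)] by blast
  have "z \<in> ?I" unfolding closure_in_iff[OF sub] using z generated_ideal_self[OF z(1)]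
    by (auto intro!: bexI[of _ z] simp: a_minus_def r_neg)
  moreover have "?I = {\<zero>} \<or> ?I = carrier A"
    using simple closure_generated_ideal[OF z(1)] closure_closure[OF sub] unfolding simple_cstar_def by blast
  ultimately have "\<one> \<in> ?I" using z by auto
  \<comment> \<open>With \<parallel>s - 1\<parallel> < 1/5 one has \<parallel>s\<parallel> \<le>
    6/5, so s^* s differs from 1 by at most 6/25 + 1/5, which is below 1/2.\<close>
  then obtain s where s: "s \<in> ?G" "nrm A (s \<ominus> \<one>) < 1/5"
    unfolding closure_in_iff[OF sub] by (metis zero_less_divide_1_iff zero_less_numeral)
  have sc: "s \<in> carrier A" using s sub by blast
  define c where "c = star A s \<otimes> s"
  have c: "c \<in> psd A" using sc by (simp add: c_def)
  have cG: "c \<in> ?G" unfolding c_def using sc by (intro generated_ideal_left[OF z(1) _ s(1)]) auto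
  have cc: "c \<in> carrier A" using c by simp
  have ns: "nrm A s \<le> 6/5" using nrm_le_minus[OF sc one_closed] s(2) nrm_one_le by simp
  have "c \<ominus> \<one> = star A s \<otimes> (s \<ominus> \<one>) \<oplus> (star A s \<ominus> \<one>)"
    using sc by (simp add: c_def a_minus_def r_distr r_minus a_assoc l_neg flip: a_assoc[of "\<ominus> _"])
  also have "star A s \<ominus> \<one> = star A (s \<ominus> \<one>)" using sc by (simp add: star_minus)
  finally have "nrm A (c \<ominus> \<one>) \<le> 6/5 * (1/5) + 1/5"
    using sc s(2) ns nrm_triangle[of "star A s \<otimes> (s \<ominus> \<one>)" "star A (s \<ominus> \<one>)"]
      nrm_mult_le[of "star A s" "s \<ominus> \<one>" "6/5" "1/5"] by simp
  then have n2: "nrm A (c \<ominus> \<one>) \<le> 1/2" by simp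
  define d where "d = of_real (1/2) \<odot> \<one> \<oplus> (c \<ominus> \<one>)"
  have d: "d \<in> psd A" unfolding d_def using n2 c by (intro psd_const_minus) auto
  have ds: "d \<in> self_adjoint A" using d by simp
  have half: "of_real (1/2) \<odot> \<one> \<oplus> of_real (1/2) \<odot> \<one> = \<one>"
    using smult_plus[of \<one> "1/2" "1/2"] by simp
  have hc: "of_real (1/2) \<odot> \<one> \<in> carrier A" by simp
  have "d \<oplus> of_real (1/2) \<odot> \<one> = (of_real (1/2) \<odot> \<one> \<oplus> of_real (1/2) \<odot> \<one>) \<ominus> \<one> \<oplus> c"
    unfolding d_def using cc hc one_closed by algebra
  then have cd: "c = d \<oplus> of_real (1/2) \<odot> \<one>" unfolding half using cc by (simp add: a_minus_def r_neg)
  have c1: "continuous_on UNIV (\<lambda>t::real. t + 1/2)" "continuous_on UNIV (\<lambda>t::real. t)" "continuous_on UNIV (\<lambda>t::real. 1/2 :: real)"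
    by (intro continuous_intros)+
  \<comment> \<open>The maximum with 0 makes the inverse function continuous on the whole line; on
    the positive d it changes nothing.\<close>
  have "max t 0 + 1/2 \<noteq> (0::real)" for t using max.cobounded2[of 0 t] by linarith
  then have c2: "continuous_on UNIV (\<lambda>t::real. 1 / (max t 0 + 1/2))" by (intro continuous_intros) auto
  have "c = cfc A d (\<lambda>t. t + 1/2)" unfolding cfc_add[OF ds c1(2,3)] using ds by (simp add: cd cfc_id cfc_const)
  then have "c \<otimes> cfc A d (\<lambda>t. 1 / (max t 0 + 1/2)) = cfc A d (\<lambda>t. (t + 1/2) * (1 / (max t 0 + 1/2)))"
    using cfc_mult[OF ds c1(1) c2] by simp
  also have "\<dots> = cfc A d (\<lambda>_. 1)"
    using continuous_on_mult[OF c1(1) c2] by (intro cfc_cong_psd[OF d]) (auto simp: max_def)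
  also have "\<dots> = \<one>" using ds by (simp add: cfc_const)
  finally show ?thesis
    using generated_ideal_right[OF z(1) _ cG, of "cfc A d (\<lambda>t. 1 / (max t 0 + 1/2))"] ds c2 by simp
qed

text \<open>If u y v = 0 for all y, then u annihilates the ideal generated by v, which contains
  1.\<close>

lemma simple_prime:
  assumes simple: "simple_cstar A" and "u \<in> carrier A" "u \<noteq> \<zero>" "v \<in> carrier A" "v \<noteq> \<zero>"
  shows "\<exists>y\<in>carrier A. u \<otimes> y \<otimes> v \<noteq> \<zero>"
proof (rule ccontr)
  assume "\<not> ?thesis"
  then have n: "u \<otimes> y \<otimes> v = \<zero>" if "y \<in> carrier A" for y using that by blast
  have "u \<otimes> w = \<zero>" if "w \<in> generated_ideal A v" for w
    using that
  proof induction
    case (step w x y)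
    have "u \<otimes> (w \<oplus> x \<otimes> v \<otimes> y) = u \<otimes> w \<oplus> (u \<otimes> x \<otimes> v) \<otimes> y"
      using step assms generated_ideal_carrier[OF step(1)] by (simp add: r_distr m_assoc)
    then show ?case using step n by simp
  qed (use assms in simp)
  from this[OF one_in_generated_ideal[OF simple assms(4,5)]] assms show False by simp
qed

section \<open>Finite dimension and nilpotents in corners\<close>

lemma finite_dim_set_subset: "\<lbrakk>finite_dim_set A V; W \<subseteq> V\<rbrakk> \<Longrightarrow> finite_dim_set A W"
  unfolding finite_dim_set_def by blast

lemma finite_dim_set_add:
  assumes "finite_dim_set A V" "finite_dim_set A W"
  shows "finite_dim_set A {v \<oplus> w | v w. v \<in> V \<and> w \<in> W}"
proof -
  obtain S where S: "finite S" "S \<subseteq> carrier A" "\<And>a. a \<in> V \<Longrightarrow> \<exists>c. a = (\<Oplus>s\<in>S. c s \<odot> s)"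
    using assms(1) unfolding finite_dim_set_def by blast
  obtain T where T: "finite T" "T \<subseteq> carrier A" "\<And>a. a \<in> W \<Longrightarrow> \<exists>c. a = (\<Oplus>s\<in>T. c s \<odot> s)"
    using assms(2) unfolding finite_dim_set_def by blast
  have ext: "(\<Oplus>s\<in>U. c s \<odot> s) = (\<Oplus>s\<in>S \<union> T. (if s \<in> U then c s else 0) \<odot> s)"
    if "U \<subseteq> S \<union> T" for U c
    using that S T by (intro add.finprod_mono_neutral_cong_left) auto
  have "\<exists>c. v \<oplus> w = (\<Oplus>s\<in>S \<union> T. c s \<odot> s)" if vw: "v \<in> V" "w \<in> W" for v w
  proof -
    obtain c d where c: "v = (\<Oplus>s\<in>S. c s \<odot> s)" and d: "w = (\<Oplus>s\<in>T. d s \<odot> s)"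
      using S(3)[OF vw(1)] T(3)[OF vw(2)] by blast
    have "v \<oplus> w = (\<Oplus>s\<in>S \<union> T. (if s \<in> S then c s else 0) \<odot> s \<oplus> (if s \<in> T then d s else 0) \<odot> s)"
      unfolding c d using S T by (subst (1 2) ext) (auto intro!: finsum_addf[symmetric])
    also have "\<dots> = (\<Oplus>s\<in>S \<union> T. ((if s \<in> S then c s else 0) + (if s \<in> T then d s else 0)) \<odot> s)"
      using S T by (intro finsum_cong') (auto simp: smult_plus)
    finally show ?thesis
      by (rule exI[where x = "\<lambda>s. (if s \<in> S then c s else 0) + (if s \<in> T then d s else 0)"])
  qed
  then show ?thesis unfolding finite_dim_set_def
    using S T by (intro exI[of _ "S \<union> T"]) auto
qed

lemma finite_dim_set_line: "x \<in> carrier A \<Longrightarrow> finite_dim_set A {c \<odot> x | c. True}"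
  unfolding finite_dim_set_def by (intro exI[of _ "{x}"]) auto

text \<open>Write 1 as a sum of terms x_i e y_i on both sides of a. Then a = 1 a 1 is a sum of terms
  x_i (e y_i a x_j e) y_j, each a multiple of x_i e y_j, so these finitely many elements span. Each
  copy of 1 is treated by an induction over \<open>generated_ideal\<close>.\<close>

lemma finite_dim_of_minimal_projection:
  assumes simple: "simple_cstar A" and e: "e \<in> carrier A" "e \<noteq> \<zero>"
    and min: "\<And>y. y \<in> carrier A \<Longrightarrow> \<exists>c. e \<otimes> y \<otimes> e = c \<odot> e"
  shows "finite_dim_cstar A"
proof -
  \<comment> \<open>The right copy of 1 is built up, with x e b standing in front of it.\<close>
  have 1: "finite_dim_set A {x \<otimes> e \<otimes> b \<otimes> w | b. b \<in> carrier A}"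
    if w: "w \<in> generated_ideal A e" and x: "x \<in> carrier A" for x w
    using w
  proof induction
    case zero
    have "{x \<otimes> e \<otimes> b \<otimes> \<zero> | b. b \<in> carrier A} \<subseteq> {c \<odot> \<zero> | c. True}" using x e by auto
    then show ?case using finite_dim_set_line[OF zero_closed] finite_dim_set_subset by blast
  next
    case (step w x' y')
    have w: "w \<in> carrier A" by (rule generated_ideal_carrier[OF step(1) e(1)])
    have key: "\<exists>v u. x \<otimes> e \<otimes> b \<otimes> (w \<oplus> x' \<otimes> e \<otimes> y') = v \<oplus> u
       \<and> v \<in> {x \<otimes> e \<otimes> b \<otimes> w | b. b \<in> carrier A} \<and> u \<in> {c \<odot> (x \<otimes> e \<otimes> y') | c. True}"
      if b: "b \<in> carrier A" for b
    proof -
      obtain c where c: "e \<otimes> (b \<otimes> x') \<otimes> e = c \<odot> e" using min[of "b \<otimes> x'"] b step by auto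
      have "x \<otimes> e \<otimes> b \<otimes> (w \<oplus> x' \<otimes> e \<otimes> y')
          = x \<otimes> e \<otimes> b \<otimes> w \<oplus> x \<otimes> (e \<otimes> (b \<otimes> x') \<otimes> e) \<otimes> y'"
        using x e b w step by (simp add: r_distr m_assoc)
      also have "x \<otimes> (e \<otimes> (b \<otimes> x') \<otimes> e) \<otimes> y' = c \<odot> (x \<otimes> e \<otimes> y')"
        unfolding c using x e step by (simp add: smult_mult_left smult_mult_right)
      finally show ?thesis using b by blast
    qed
    have "x \<otimes> e \<otimes> y' \<in> carrier A" using x e step by simp
    from finite_dim_set_add[OF step.IH finite_dim_set_line[OF this]] show ?case
    proof (rule finite_dim_set_subset, intro subsetI)
      fix t assume "t \<in> {x \<otimes> e \<otimes> b \<otimes> (w \<oplus> x' \<otimes> e \<otimes> y') | b. b \<in> carrier A}"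
      then obtain b where "b \<in> carrier A" "t = x \<otimes> e \<otimes> b \<otimes> (w \<oplus> x' \<otimes> e \<otimes> y')" by blast
      with key[of b] show "t \<in> {v \<oplus> u | v u. v \<in> {x \<otimes> e \<otimes> b \<otimes> w | b. b \<in> carrier A}
          \<and> u \<in> {c \<odot> (x \<otimes> e \<otimes> y') | c. True}}" by blast
    qed
  qed
  \<comment> \<open>The left copy is built up; each new term is covered by the first induction taken
    at the unit.\<close>
  have 2: "finite_dim_set A {w \<otimes> a \<otimes> \<one> | a. a \<in> carrier A}" if w: "w \<in> generated_ideal A e" for w
    using w
  proof induction
    case zero
    have "{\<zero> \<otimes> a \<otimes> \<one> | a. a \<in> carrier A} \<subseteq> {c \<odot> \<zero> | c. True}" by auto
    then show ?case using finite_dim_set_line[OF zero_closed] finite_dim_set_subset by blast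
  next
    case (step w x y)
    have w: "w \<in> carrier A" by (rule generated_ideal_carrier[OF step(1) e(1)])
    have key: "\<exists>v u. (w \<oplus> x \<otimes> e \<otimes> y) \<otimes> a \<otimes> \<one> = v \<oplus> u
       \<and> v \<in> {w \<otimes> a \<otimes> \<one> | a. a \<in> carrier A} \<and> u \<in> {x \<otimes> e \<otimes> b \<otimes> \<one> | b. b \<in> carrier A}"
      if a: "a \<in> carrier A" for a
    proof -
      have "(w \<oplus> x \<otimes> e \<otimes> y) \<otimes> a \<otimes> \<one> = w \<otimes> a \<otimes> \<one> \<oplus> x \<otimes> e \<otimes> (y \<otimes> a) \<otimes> \<one>"
        using e a w step by (simp add: l_distr m_assoc)
      moreover have "y \<otimes> a \<in> carrier A" using a step by simp
      ultimately show ?thesis using a by blast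
    qed
    from finite_dim_set_add[OF step.IH 1[OF one_in_generated_ideal[OF simple e] step(2)]] show ?case
    proof (rule finite_dim_set_subset, intro subsetI)
      fix t assume "t \<in> {(w \<oplus> x \<otimes> e \<otimes> y) \<otimes> a \<otimes> \<one> | a. a \<in> carrier A}"
      then obtain a where "a \<in> carrier A" "t = (w \<oplus> x \<otimes> e \<otimes> y) \<otimes> a \<otimes> \<one>" by blast
      with key[of a] show "t \<in> {v \<oplus> u | v u. v \<in> {w \<otimes> a \<otimes> \<one> | a. a \<in> carrier A}
          \<and> u \<in> {x \<otimes> e \<otimes> b \<otimes> \<one> | b. b \<in> carrier A}}" by blast
    qed
  qed
  have "{\<one> \<otimes> a \<otimes> \<one> | a. a \<in> carrier A} = carrier A"
  proof (intro equalityI subsetI)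
    fix x assume "x \<in> carrier A"
    then show "x \<in> {\<one> \<otimes> a \<otimes> \<one> | a. a \<in> carrier A}" by (intro CollectI exI[of _ x]) simp
  qed auto
  then have "finite_dim_set A (carrier A)" using 2[OF one_in_generated_ideal[OF simple e]] by simp
  then show ?thesis unfolding finite_dim_set_def finite_dim_cstar_def .
qed

text \<open>h is its cut-down plus min(h, s), and the norm of the latter is at most s.\<close>

lemma cut_nonzero:
  assumes h: "h \<in> psd A" and s: "0 \<le> s" "s < nrm A h"
  shows "cfc A h (\<lambda>t. max 0 (t - s)) \<noteq> \<zero>"
proof
  assume 0: "cfc A h (\<lambda>t. max 0 (t - s)) = \<zero>"
  have hs: "h \<in> self_adjoint A" using h by simp
  have c: "continuous_on UNIV (\<lambda>t. max 0 (t - s))" "continuous_on UNIV (\<lambda>t. min t s)"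
    by (intro continuous_intros)+
  have "(\<lambda>t. max 0 (t - s) + min t s) = (\<lambda>t. t)" by (auto simp: fun_eq_iff max_def min_def)
  then have "h = cfc A h (\<lambda>t. max 0 (t - s) + min t s)" using cfc_id[OF hs] by simp
  also have "\<dots> = cfc A h (\<lambda>t. min t s)"
    using cfc_add[OF hs c] 0 hs c by simp
  finally have "nrm A h \<le> s"
    using nrm_cfc_psd_le[OF h c(2), of s] s by simp
  with s show False by simp
qed

text \<open>The equation y 0 = h y says that y intertwines 0 and h, so F(h) y = y F(0) = 0.\<close>

lemma cfc_annihilate:
  assumes "h \<in> self_adjoint A" "y \<in> carrier A" "h \<otimes> y = \<zero>" "continuous_on UNIV F" "F 0 = 0"
  shows "cfc A h F \<otimes> y = \<zero>"
proof -
  have "y \<otimes> cfc A \<zero> F = cfc A h F \<otimes> y"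
    using assms by (intro cfc_intertwine) auto
  moreover have "cfc A \<zero> F = \<zero>"
    using cfc_cong[OF self_adjoint_zero assms(4) continuous_on_const[of _ 0]] assms(5) cfc_const[of \<zero> 0]
    by simp
  ultimately show ?thesis using assms by simp
qed

text \<open>A self-adjoint u is the difference of the positive elements \<parallel>u\<parallel> + u
  and \<parallel>u\<parallel>.\<close>

lemma psd_decomposition:
  assumes "y \<in> carrier A"
  obtains p q r s where "p \<in> psd A" "q \<in> psd A" "r \<in> psd A" "s \<in> psd A" "y = (p \<ominus> q) \<oplus> \<i> \<odot> (r \<ominus> s)"
proof -
  obtain u v where uv: "u \<in> self_adjoint A" "v \<in> self_adjoint A" "y = u \<oplus> \<i> \<odot> v"
    using cartesian_decomposition[OF assms] .
  have d: "(of_real t \<odot> \<one> \<oplus> u) \<ominus> of_real t \<odot> \<one> = u" if "u \<in> carrier A" for u t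
    using that smult_carrier[OF one_closed, of "of_real t"] by algebra
  have n: "of_real (nrm A u) \<odot> \<one> \<in> psd A" if "u \<in> carrier A" for u
    using that by (simp add: nrm_nonneg)
  show ?thesis
    by (rule that[of "of_real (nrm A u) \<odot> \<one> \<oplus> u" "of_real (nrm A u) \<odot> \<one>"
          "of_real (nrm A v) \<odot> \<one> \<oplus> v" "of_real (nrm A v) \<odot> \<one>"])
      (use uv in \<open>simp_all add: d n psd_const_minus\<close>)
qed

text \<open>If \<open>c\<close> had two nonzero spectral values, then disjoint bump functions \<open>u\<close>, \<open>v\<close> of \<open>c\<close>
  and primeness would produce the nonzero square-zero element \<open>u y v\<close>.\<close>

lemma square_eq_of_no_nilpotents:
  assumes simple: "simple_cstar A" and z: "z \<in> carrier A"
    and nil: "\<And>x. \<lbrakk>x \<in> carrier A; (z \<otimes> x \<otimes> z) \<otimes> (z \<otimes> x \<otimes> z) = \<zero>\<rbrakk> \<Longrightarrow> z \<otimes> x \<otimes> z = \<zero>"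
    and c: "c \<in> psd A" and c': "c' \<in> carrier A" "c = z \<otimes> c' \<otimes> z"
  shows "c \<otimes> c = of_real (nrm A c) \<odot> c"
proof (cases "c = \<zero>")
  case False
  define M where "M = nrm A c"
  have cs: "c \<in> self_adjoint A" and cc: "c \<in> carrier A" using c by auto
  have M: "M > 0" using False nrm_eq_zero[OF cc] nrm_nonneg[OF cc] unfolding M_def by linarith
  note ci = continuous_intros
  have v0: "cfc A c (\<lambda>t. t * max 0 (s - t) * t) = \<zero>" if s: "0 < s" "s < M" for s
  proof (rule ccontr)
    assume v: "cfc A c (\<lambda>t. t * max 0 (s - t) * t) \<noteq> \<zero>"
    have cu: "continuous_on UNIV (\<lambda>t. max 0 (t - s))" and cv: "continuous_on UNIV (\<lambda>t. max 0 (s - t))"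
      by (intro ci)+
    \<comment> \<open>The outer factors t place u and v in c A c and hence in z A z, where the
      assumption on nilpotents applies.\<close>
    define p q u v where "p = cfc A c (\<lambda>t. max 0 (t - s))" and "q = cfc A c (\<lambda>t. max 0 (s - t))"
      and "u = cfc A c (\<lambda>t. t * max 0 (t - s) * t)" and "v = cfc A c (\<lambda>t. t * max 0 (s - t) * t)"
    have pq: "p \<in> carrier A" "q \<in> carrier A" using cs cu cv by (auto simp: p_def q_def)
    have ue: "u = c \<otimes> p \<otimes> c" and ve: "v = c \<otimes> q \<otimes> c"
      unfolding u_def v_def p_def q_def using cs cu cv
      by (simp_all add: cfc_mult cfc_id continuous_on_mult continuous_on_id)
    have uv: "u \<in> carrier A" "v \<in> carrier A" using ue ve cc pq by auto
    have "u \<noteq> \<zero>"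
    proof
      assume u: "u = \<zero>"
      have cm: "continuous_on UNIV (\<lambda>t. 1 / (max t s * max t s))"
      proof -
        have "max t s * max t s \<noteq> 0" for t using s(1) max.cobounded2[of s t] by auto
        then show ?thesis by (intro ci) auto
      qed
      have cu2: "continuous_on UNIV (\<lambda>t. t * max 0 (t - s) * t)" by (intro ci)
      have "(\<lambda>t. max 0 (t - s)) = (\<lambda>t. 1 / (max t s * max t s) * (t * max 0 (t - s) * t))"
        using s(1) by (auto simp: fun_eq_iff max_def)
      then have "p = cfc A c (\<lambda>t. 1 / (max t s * max t s)) \<otimes> u"
        unfolding p_def u_def using cfc_mult[OF cs cm cu2] by simp
      then have "p = \<zero>" using u cs cm by simp
      then show False using cut_nonzero[OF c, of s] s by (simp add: p_def M_def)
    qed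
    moreover have "v \<noteq> \<zero>" using v by (simp add: v_def)
    ultimately obtain y where y: "y \<in> carrier A" "u \<otimes> y \<otimes> v \<noteq> \<zero>"
      using simple_prime[OF simple] uv by blast
    have "v \<otimes> u = cfc A c (\<lambda>t. (t * max 0 (s - t) * t) * (t * max 0 (t - s) * t))"
      unfolding u_def v_def by (rule cfc_mult[OF cs, symmetric]) (intro ci)+
    also have "(\<lambda>t. (t * max 0 (s - t) * t) * (t * max 0 (t - s) * t)) = (\<lambda>_. 0)"
      by (auto simp: fun_eq_iff max_def)
    finally have vu: "v \<otimes> u = \<zero>" using cs by (simp add: cfc_const)
    \<comment> \<open>Obtained from u y v by stripping one z off each outer c = z c' z, so that z x
      z = u y v.\<close>
    define x where "x = c' \<otimes> z \<otimes> p \<otimes> c \<otimes> y \<otimes> c \<otimes> q \<otimes> z \<otimes> c'"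
    have x: "x \<in> carrier A" using c' z pq cc y by (simp add: x_def)
    have zx: "z \<otimes> x \<otimes> z = u \<otimes> y \<otimes> v"
    proof -
      have "u \<otimes> y \<otimes> v = (z \<otimes> c' \<otimes> z) \<otimes> p \<otimes> c \<otimes> y \<otimes> (c \<otimes> q \<otimes> (z \<otimes> c' \<otimes> z))"
        unfolding ue ve by (simp flip: c'(2))
      then show ?thesis using c'(1) z pq cc y by (simp add: x_def m_assoc)
    qed
    have "(u \<otimes> y \<otimes> v) \<otimes> (u \<otimes> y \<otimes> v) = u \<otimes> y \<otimes> (v \<otimes> u) \<otimes> (y \<otimes> v)"
      using uv y by (simp add: m_assoc)
    then have "(z \<otimes> x \<otimes> z) \<otimes> (z \<otimes> x \<otimes> z) = \<zero>" unfolding zx vu using uv y by simp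
    from nil[OF x this] y(2) show False by (simp add: zx)
  qed
  have cw: "continuous_on UNIV (\<lambda>t. t * (M - t) * t)" by (intro ci)
  have "nrm A (cfc A c (\<lambda>t. t * (M - t) * t)) \<le> 0"
  proof (rule field_le_epsilon)
    fix e :: real assume e: "e > 0"
    \<comment> \<open>On [0, M] the functions t^2 (M - t) and t^2 max(0, s - t) differ by at most
      M^2 (M - s), so s close to M gives an error below e; the maximum with M/2 keeps s
      positive.\<close>
    define s where "s = max (M / 2) (M - e / (M * M))"
    have "e / (M * M) > 0" using e M by simp
    then have s: "0 < s" "s < M" using M by (auto simp: s_def)
    have "M - s \<le> e / (M * M)" by (auto simp: s_def)
    then have Ms: "M * M * (M - s) \<le> e" using M by (simp add: field_simps)
    have cv: "continuous_on UNIV (\<lambda>t. t * max 0 (s - t) * t)" by (intro ci)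
    have "cfc A c (\<lambda>t. t * (M - t) * t) = cfc A c (\<lambda>t. t * (M - t) * t) \<ominus> cfc A c (\<lambda>t. t * max 0 (s - t) * t)"
      using v0[OF s] cs cw by (simp add: a_minus_def)
    also have "\<dots> = cfc A c (\<lambda>t. t * (M - t) * t - t * max 0 (s - t) * t)"
      by (rule cfc_minus[OF cs cw cv, symmetric])
    also have "nrm A \<dots> \<le> M * M * (M - s)"
    proof (rule nrm_cfc_psd_le[OF c])
      fix t assume t: "0 \<le> t" "t \<le> nrm A c"
      have "t * (M - t) * t - t * max 0 (s - t) * t = (t * t) * ((M - t) - max 0 (s - t))"
        by (simp add: algebra_simps)
      also have "\<bar>\<dots>\<bar> = (t * t) * \<bar>(M - t) - max 0 (s - t)\<bar>" by (simp add: abs_mult)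
      also have "\<dots> \<le> (M * M) * (M - s)"
        using t s unfolding M_def[symmetric] by (intro mult_mono) (auto simp: max_def)
      finally show "\<bar>t * (M - t) * t - t * max 0 (s - t) * t\<bar> \<le> M * M * (M - s)" .
    qed (intro ci)
    finally show "nrm A (cfc A c (\<lambda>t. t * (M - t) * t)) \<le> 0 + e" using Ms by simp
  qed
  then have w0: "cfc A c (\<lambda>t. t * (M - t) * t) = \<zero>"
    using nrm_nonneg nrm_eq_zero cs cw by (metis cfc_carrier order_antisym)
  \<comment> \<open>y = c (M - c) is self-adjoint, and y^2 contains the factor just shown to vanish;
    so y = 0, which is the claim.\<close>
  define y where "y = cfc A c (\<lambda>t. t * (M - t))"
  have cy: "continuous_on UNIV (\<lambda>t. t * (M - t))" "continuous_on UNIV (\<lambda>t. M - t)" by (intro ci)+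
  have ys: "y \<in> self_adjoint A" unfolding y_def using cs cy by simp
  have "y \<otimes> y = cfc A c (\<lambda>t. (t * (M - t) * t) * (M - t))"
    unfolding y_def using cfc_mult[OF cs cy(1) cy(1)] by (simp add: mult.assoc)
  also have "\<dots> = \<zero>" unfolding cfc_mult[OF cs cw cy(2)] w0 using cs cy by simp
  finally have "y = \<zero>" using nrm_square[OF ys] nrm_eq_zero[of y] ys by simp
  moreover have "y = of_real M \<odot> c \<ominus> c \<otimes> c"
  proof -
    have "y = c \<otimes> cfc A c (\<lambda>t. M - t)"
      unfolding y_def using cfc_mult[OF cs continuous_on_id cy(2)] cs by (simp add: cfc_id)
    also have "cfc A c (\<lambda>t. M - t) = of_real M \<odot> \<one> \<ominus> c"
      using cfc_minus[OF cs continuous_on_const continuous_on_id, of M] cs by (simp add: cfc_id cfc_const)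
    finally show ?thesis using cc by (simp add: a_minus_def r_distr r_minus)
  qed
  ultimately show ?thesis using cc minus_eq_zero_iff[of "of_real M \<odot> c" "c \<otimes> c"] by (simp add: M_def)
qed simp

text \<open>If z A z had no nonzero square-zero elements, then h^2 = \<parallel>h\<parallel> h for
  every positive h = z c z. In particular e = z^2 / \<parallel>z^2\<parallel> is a projection. For h
  = e y e with y positive the equation holds for h and for h + e, and comparing both makes h a
  multiple of e. Then e A e is one-dimensional and A is finite-dimensional.\<close>

lemma nilpotent_exists:
  assumes simple: "simple_cstar A" and fd: "\<not> finite_dim_cstar A"
    and z: "z \<in> psd A" "z \<noteq> \<zero>"
  obtains x where "x \<in> carrier A" "z \<otimes> x \<otimes> z \<noteq> \<zero>" "(z \<otimes> x \<otimes> z) \<otimes> (z \<otimes> x \<otimes> z) = \<zero>"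
proof (rule ccontr)
  assume "\<not> thesis"
  then have nil: "z \<otimes> x \<otimes> z = \<zero>" if "x \<in> carrier A" "(z \<otimes> x \<otimes> z) \<otimes> (z \<otimes> x \<otimes> z) = \<zero>" for x
    using that \<open>\<And>x. \<lbrakk>x \<in> carrier A; z \<otimes> x \<otimes> z \<noteq> \<zero>; z \<otimes> x \<otimes> z \<otimes> (z \<otimes> x \<otimes> z) = \<zero>\<rbrakk> \<Longrightarrow> thesis\<close> by blast
  have zc: "z \<in> carrier A" and zs: "star A z = z" using z by auto
  have sq: "c \<otimes> c = of_real (nrm A c) \<odot> c"
    if "c \<in> psd A" "c' \<in> carrier A" "c = z \<otimes> c' \<otimes> z" for c c'
    by (rule square_eq_of_no_nilpotents[OF simple zc _ that]) (rule nil)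
  define Z M where "Z = z \<otimes> z" and "M = nrm A Z"
  have Zp: "Z \<in> psd A" using z by (simp add: Z_def)
  have Zc: "Z \<in> carrier A" using zc by (simp add: Z_def)
  have M: "M > 0" unfolding M_def Z_def using nrm_square[of z] z zc nrm_eq_zero[OF zc] by simp
  have "Z = z \<otimes> \<one> \<otimes> z" using zc by (simp add: Z_def)
  from sq[OF Zp one_closed this] have ZZ: "Z \<otimes> Z = of_real M \<odot> Z" by (simp add: M_def)
  define e where "e = of_real (1/M) \<odot> Z"
  have ep: "e \<in> psd A" unfolding e_def using Zp M by (intro psd_smult) auto
  have ec: "e \<in> carrier A" using ep by simp
  have ee: "e \<otimes> e = e" using M Zc by (simp add: e_def smult_mult_left smult_mult_right ZZ)
  have e0: "e \<noteq> \<zero>"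
    using M Zc nrm_eq_zero[OF Zc] by (simp add: e_def smult_eq_zero_iff M_def)
  have ez: "e = z \<otimes> (of_real (1/M) \<odot> \<one>) \<otimes> z" using zc by (simp add: e_def Z_def smult_mult_left)
  have psd_case: "\<exists>c. e \<otimes> y \<otimes> e = c \<odot> e" if y: "y \<in> psd A" for y
  proof -
    have yc: "y \<in> carrier A" using y by simp
    define h where "h = e \<otimes> y \<otimes> e"
    have h: "h \<in> psd A" using conj_psd[OF y ec] ep by (simp add: h_def)
    have hc: "h \<in> carrier A" using h by simp
    define h' where "h' = (of_real (1/M) \<odot> z) \<otimes> y \<otimes> (of_real (1/M) \<odot> z)"
    have h'c: "h' \<in> carrier A" using zc yc by (simp add: h'_def)
    have hz: "h = z \<otimes> h' \<otimes> z"
      using zc yc by (simp add: h_def h'_def e_def Z_def smult_mult_left smult_mult_right m_assoc)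
    have hez: "h \<oplus> e = z \<otimes> (h' \<oplus> of_real (1/M) \<odot> \<one>) \<otimes> z"
      using hz ez zc h'c by (simp add: r_distr l_distr)
    have s: "h \<otimes> h = of_real (nrm A h) \<odot> h" by (rule sq[OF h h'c hz])
    let ?t = "nrm A (h \<oplus> e)"
    have t: "(h \<oplus> e) \<otimes> (h \<oplus> e) = of_real ?t \<odot> (h \<oplus> e)"
      by (rule sq[OF _ _ hez]) (use h ep h'c in auto)
    have he: "h \<otimes> e = h" "e \<otimes> h = h"
      using yc ec ee by (simp_all add: h_def m_assoc) (simp add: ee flip: m_assoc)
    have "(h \<oplus> e) \<otimes> (h \<oplus> e) = (h \<otimes> h \<oplus> (h \<oplus> h)) \<oplus> e"
      using hc ec he ee by (simp add: r_distr l_distr a_assoc)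
    then have "of_real ?t \<odot> (h \<oplus> e) = of_real (nrm A h + 2) \<odot> h \<oplus> e"
      using t s hc by (simp add: smult_double smult_plus)
    then have "of_real ?t \<odot> h \<oplus> of_real ?t \<odot> e = of_real (nrm A h + 2) \<odot> h \<oplus> e"
      using hc ec by (simp add: smult_add)
    moreover have "of_real (?t - (nrm A h + 2)) \<odot> h \<ominus> of_real (1 - ?t) \<odot> e
      = (of_real ?t \<odot> h \<oplus> of_real ?t \<odot> e) \<ominus> (of_real (nrm A h + 2) \<odot> h \<oplus> e)"
    proof -
      define a b d where "a = of_real ?t \<odot> h" and "b = of_real ?t \<odot> e" and "d = of_real (nrm A h + 2) \<odot> h"
      have c: "a \<in> carrier A" "b \<in> carrier A" "d \<in> carrier A" using hc ec by (auto simp: a_def b_def d_def)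
      have "of_real (?t - (nrm A h + 2)) \<odot> h = a \<ominus> d" "of_real (1 - ?t) \<odot> e = e \<ominus> b"
        using hc ec by (simp_all only: of_real_diff smult_diff a_def b_def d_def) simp
      then show ?thesis unfolding a_def[symmetric] b_def[symmetric] d_def[symmetric]
        using c ec by simp algebra
    qed
    \<comment> \<open>This determines h unless the left coefficient vanishes; in that case the right
      one vanishes too, as e is nonzero, and 1 = t = \<parallel>h\<parallel> + 2 is absurd.\<close>
    ultimately have rel: "of_real (?t - (nrm A h + 2)) \<odot> h = of_real (1 - ?t) \<odot> e"
      using hc ec by (subst minus_eq_zero_iff[symmetric]) (auto simp: a_minus_def r_neg)
    show ?thesis
    proof (cases "?t = nrm A h + 2")
      case True
      then have "of_real (1 - ?t) \<odot> e = \<zero>" using rel hc by simp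
      then have "of_real (1 - ?t) = (0 :: complex)" using e0 smult_eq_zero_iff[OF ec] by blast
      then have "?t = 1" by (simp only: of_real_eq_0_iff)
      then show ?thesis using True nrm_nonneg[OF hc] by linarith
    next
      case False
      let ?r = "?t - (nrm A h + 2)"
      have "h = of_real (1 / ?r) \<odot> (of_real ?r \<odot> h)" using False hc
        by (simp only: smult_smult of_real_mult[symmetric]) simp
      also have "\<dots> = (of_real (1 / ?r) * of_real (1 - ?t)) \<odot> e" unfolding rel using ec by simp
      finally show ?thesis unfolding h_def by blast
    qed
  qed
  have "\<exists>c. e \<otimes> y \<otimes> e = c \<odot> e" if y: "y \<in> carrier A" for y
  proof -
    obtain p q r s where d: "p \<in> psd A" "q \<in> psd A" "r \<in> psd A" "s \<in> psd A" "y = (p \<ominus> q) \<oplus> \<i> \<odot> (r \<ominus> s)"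
      using psd_decomposition[OF y] .
    obtain a b c d' where c: "e \<otimes> p \<otimes> e = a \<odot> e" "e \<otimes> q \<otimes> e = b \<odot> e" "e \<otimes> r \<otimes> e = c \<odot> e" "e \<otimes> s \<otimes> e = d' \<odot> e"
      using psd_case d by metis
    have "e \<otimes> y \<otimes> e = (e \<otimes> p \<otimes> e \<ominus> e \<otimes> q \<otimes> e) \<oplus> \<i> \<odot> (e \<otimes> r \<otimes> e \<ominus> e \<otimes> s \<otimes> e)"
      unfolding d(5) using d(1-4) ec
      by (simp add: a_minus_def r_distr l_distr r_minus l_minus smult_mult_left smult_mult_right)
    also have "\<dots> = ((a - b) + \<i> * (c - d')) \<odot> e"
      unfolding c using ec by (simp add: smult_plus smult_diff smult_minus ring_class.ring_distribs)
    finally show ?thesis by blast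
  qed
  with finite_dim_of_minimal_projection[OF simple ec e0] fd show False by blast
qed

end

section \<open>Elements of small trace\<close>

text \<open>For \<open>y\<^sub>i = b w\<^sub>i\<close> the elements \<open>y\<^sub>i y\<^sub>i\<^sup>*\<close> are pairwise orthogonal contractions with the trace of \<open>f\<close>,
  which forces \<open>\<tau>(f) \<le> 1/N\<close>; and \<open>z\<^sup>1\<^sup>/\<^sup>k \<le> f\<close> bounds the dimension of \<open>z\<close>.\<close>

definition small_witness ::
  "('a, 'm) cstar_scheme \<Rightarrow> 'a \<Rightarrow> nat \<Rightarrow> 'a \<Rightarrow> 'a \<Rightarrow> (nat \<Rightarrow> 'a) \<Rightarrow> bool" where
  "small_witness A b N z f w \<longleftrightarrow>
     z \<in> psd A \<and> z \<noteq> \<zero>\<^bsub>A\<^esub> \<and> nrm A z \<le> 1 \<and> f \<in> psd A \<and> nrm A f \<le> 1 \<and> f \<otimes>\<^bsub>A\<^esub> z = z \<and>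
     (\<forall>i. w i \<in> carrier A) \<and>
     (\<forall>i<N. \<forall>j<N. star A (b \<otimes>\<^bsub>A\<^esub> w i) \<otimes>\<^bsub>A\<^esub> (b \<otimes>\<^bsub>A\<^esub> w j) = (if i = j then f else \<zero>\<^bsub>A\<^esub>))"

context unital_cstar_algebra
begin

text \<open>The element y is a function of b that vanishes up to s and equals 1 from 2s on; it is
  divisible by b because it vanishes near 0. Then f = y^2 acts as a unit on the cut-down of b at 2s,
  and s = \<parallel>b\<parallel>/3 keeps this cut-down nonzero.\<close>

lemma small_witness_base:
  assumes b: "b \<in> psd A" "b \<noteq> \<zero>"
  shows "\<exists>z f w. small_witness A b 1 z f w"
proof -
  have bs: "b \<in> self_adjoint A" and bc: "b \<in> carrier A" using b by auto
  define T s where "T = nrm A b" and "s = T / 3"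
  have T: "T > 0" using b nrm_eq_zero[OF bc] nrm_nonneg[OF bc] unfolding T_def by linarith
  then have s: "s > 0" "2 * s < T" by (auto simp: s_def)
  let ?y = "\<lambda>t. min 1 (max 0 (t / s - 1))"
  have cy: "continuous_on UNIV ?y" using s by (intro continuous_intros) auto
  have cw: "continuous_on UNIV (\<lambda>t. ?y t / max t s)"
  proof -
    have "max t s \<noteq> 0" for t using s(1) max.cobounded2[of s t] by auto
    then show ?thesis using s by (intro continuous_intros) auto
  qed
  have cz: "continuous_on UNIV (\<lambda>t. max 0 (t - 2 * s))" by (intro continuous_intros)
  define y where "y = cfc A b ?y"
  have y: "y \<in> self_adjoint A" using bs cy by (simp add: y_def)
  define w where "w = cfc A b (\<lambda>t. ?y t / max t s)"
  have wc: "w \<in> carrier A" using bs cw by (simp add: w_def)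
  have "(\<lambda>t. t * (?y t / max t s)) = ?y"
    using s by (auto simp: fun_eq_iff max_def min_def)
  then have bw: "b \<otimes> w = y"
    unfolding w_def y_def using cfc_mult[OF bs continuous_on_id cw] bs by (simp add: cfc_id)
  define z0 where "z0 = cfc A b (\<lambda>t. max 0 (t - 2 * s))"
  have z0: "z0 \<in> psd A" unfolding z0_def by (rule cfc_psd_psd[OF b(1) cz]) simp
  have "nrm A z0 \<le> T"
    unfolding z0_def using s T by (intro nrm_cfc_psd_le[OF b(1) cz]) (auto simp: T_def)
  define z where "z = of_real (1 / T) \<odot> z0"
  have yy: "y \<otimes> y = cfc A b (\<lambda>t. ?y t * ?y t)"
    unfolding y_def by (rule cfc_mult[OF bs cy cy, symmetric])
  have "y \<otimes> y \<otimes> z0 = cfc A b (\<lambda>t. ?y t * ?y t * max 0 (t - 2 * s))"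
    unfolding yy z0_def using cfc_mult[OF bs continuous_on_mult[OF cy cy] cz] by simp
  also have "(\<lambda>t. ?y t * ?y t * max 0 (t - 2 * s)) = (\<lambda>t. max 0 (t - 2 * s))"
  proof
    fix t
    show "?y t * ?y t * max 0 (t - 2 * s) = max 0 (t - 2 * s)"
    proof (cases "t \<le> 2 * s")
      case False
      then have "2 \<le> t / s" using s by (simp add: pos_le_divide_eq)
      then have "?y t = 1" by simp
      then show ?thesis by simp
    qed simp
  qed
  finally have yz: "y \<otimes> y \<otimes> z0 = z0" by (simp add: z0_def)
  have "small_witness A b 1 z (y \<otimes> y) (\<lambda>_. w)"
    unfolding small_witness_def
  proof (intro conjI)
    show "z \<in> psd A" unfolding z_def using z0 T by (intro psd_smult) auto
    show "z \<noteq> \<zero>"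
      using cut_nonzero[OF b(1), of "2 * s"] s T z0 by (simp add: z_def smult_eq_zero_iff z0_def[symmetric] T_def)
    show "nrm A z \<le> 1" using \<open>nrm A z0 \<le> T\<close> T z0 by (simp add: z_def nrm_smult norm_divide)
    show "y \<otimes> y \<in> psd A" using y by simp
    show "nrm A (y \<otimes> y) \<le> 1"
      unfolding yy using cy by (intro nrm_cfc_le[OF bs]) (auto intro!: continuous_on_mult simp: abs_mult mult_le_one)
    show "y \<otimes> y \<otimes> z = z" using yz z0 y by (simp add: z_def smult_mult_right)
    have "star A y \<otimes> y = y \<otimes> y" using y by simp
    then show "\<forall>i<1. \<forall>j<1. star A (b \<otimes> w) \<otimes> (b \<otimes> w) = (if i = (j::nat) then y \<otimes> y else \<zero>)"
      by (simp add: bw)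
    show "\<forall>i::nat. w \<in> carrier A" using wc by simp
  qed
  then show ?thesis by blast
qed

text \<open>A square-zero x0 in z A z satisfies h x0 = 0 for h = x0^* x0. Normalize x0 to x with x^*
  x = f' and let r = f'^(1/2). As r is a function of h vanishing at 0, r x = 0. So x and r have the
  common square f' and orthogonal ranges, and f acts as a unit on both; replacing each w_i by w_i x
  and w_i r doubles the family.\<close>

lemma small_witness_double:
  assumes simple: "simple_cstar A" and fd: "\<not> finite_dim_cstar A"
    and b: "b \<in> carrier A" and sw: "small_witness A b N z f w"
  shows "\<exists>z f w. small_witness A b (N + N) z f w"
proof -
  have z: "z \<in> psd A" "z \<noteq> \<zero>" and f: "f \<in> psd A" and fz: "f \<otimes> z = z"
    and w: "w i \<in> carrier A"
    and ww: "\<lbrakk>i < N; j < N\<rbrakk> \<Longrightarrow> star A (b \<otimes> w i) \<otimes> (b \<otimes> w j) = (if i = j then f else \<zero>)" for i j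
    using sw unfolding small_witness_def by auto
  have zc: "z \<in> carrier A" and fc: "f \<in> carrier A" using z f by auto
  have zf: "z \<otimes> f = z"
  proof -
    have "z \<otimes> f = star A (f \<otimes> z)" using zc fc z f by (simp add: star_mult)
    then show ?thesis using fz z by simp
  qed
  obtain x' where x': "x' \<in> carrier A" "z \<otimes> x' \<otimes> z \<noteq> \<zero>" "(z \<otimes> x' \<otimes> z) \<otimes> (z \<otimes> x' \<otimes> z) = \<zero>"
    using nilpotent_exists[OF simple fd z] .
  define x0 where "x0 = z \<otimes> x' \<otimes> z"
  have x0: "x0 \<in> carrier A" "x0 \<noteq> \<zero>" "x0 \<otimes> x0 = \<zero>" using x' zc by (auto simp: x0_def)
  define h where "h = star A x0 \<otimes> x0"
  have h: "h \<in> psd A" using x0 by (simp add: h_def)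
  have hs: "h \<in> self_adjoint A" and hc: "h \<in> carrier A" using h by auto
  have h0: "h \<noteq> \<zero>" using x0(2) star_mult_self_eq_zero[OF x0(1)] unfolding h_def by blast
  have hx0: "h \<otimes> x0 = \<zero>" using x0 by (simp add: h_def m_assoc)
  have fx0: "f \<otimes> x0 = x0" using fc zc x'(1) fz by (simp add: x0_def flip: m_assoc)
  have x0f: "x0 \<otimes> f = x0" using fc zc x'(1) zf by (simp add: x0_def m_assoc)
  have hf: "h \<otimes> (\<one> \<ominus> f) = \<zero>"
    using hc fc x0 x0f by (simp add: a_minus_def r_distr r_minus) (simp add: h_def m_assoc r_neg)
  define T s where "T = nrm A h" and "s = T / 2"
  have T: "T > 0" using h0 nrm_eq_zero[OF hc] nrm_nonneg[OF hc] unfolding T_def by linarith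
  then have s: "s > 0" "s < T" by (auto simp: s_def)
  have ms: "max t s > 0" for t using s(1) max.cobounded2[of s t] by linarith
  \<comment> \<open>With g(t) = t^(-1/2) the product x0 g(h) would be the polar part of x0.
    Replacing t by max t s keeps g continuous and yields f'(t) = t / max t s, which equals 1 on the
    support of the new z.\<close>
  let ?g = "\<lambda>t. 1 / sqrt (max t s)" and ?r = "\<lambda>t. sqrt (max 0 t / max t s)"
  have ms': "max t s \<noteq> 0" for t using ms[of t] by simp
  have cg: "continuous_on UNIV ?g" using ms' by (intro continuous_intros) auto
  have cr: "continuous_on UNIV ?r" using ms' by (intro continuous_intros) auto
  have cf: "continuous_on UNIV (\<lambda>t. max 0 t / max t s)" using ms' by (intro continuous_intros) auto
  have cz: "continuous_on UNIV (\<lambda>t. max 0 (t - s))" by (intro continuous_intros)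
  define G r f' where "G = cfc A h ?g" and "r = cfc A h ?r" and "f' = cfc A h (\<lambda>t. max 0 t / max t s)"
  have Gs: "G \<in> self_adjoint A" and rs: "r \<in> self_adjoint A" using hs cg cr by (auto simp: G_def r_def)
  have Gc: "G \<in> carrier A" and rc: "r \<in> carrier A" using Gs rs by auto
  have f': "f' \<in> psd A" unfolding f'_def by (rule cfc_psd[OF hs cf]) (use ms in \<open>simp add: less_imp_le\<close>)
  define x where "x = x0 \<otimes> G"
  have xc: "x \<in> carrier A" using x0 Gc by (simp add: x_def)
  have rr: "r \<otimes> r = f'"
  proof -
    have "(\<lambda>t. ?r t * ?r t) = (\<lambda>t. max 0 t / max t s)" using ms by (simp add: less_imp_le)
    then show ?thesis unfolding r_def f'_def using cfc_mult[OF hs cr cr] by simp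
  qed
  have xx: "star A x \<otimes> x = f'"
  proof -
    have "star A x \<otimes> x = G \<otimes> h \<otimes> G" using x0 Gc Gs by (simp add: x_def star_mult h_def m_assoc)
    also have "\<dots> = cfc A h (\<lambda>t. ?g t * t * ?g t)"
      by (simp only: G_def cfc_mult[OF hs continuous_on_mult[OF cg continuous_on_id] cg]
          cfc_mult[OF hs cg continuous_on_id] cfc_id[OF hs])
    also have "\<dots> = f'" unfolding f'_def
    proof (rule cfc_cong_psd[OF h _ cf])
      show "continuous_on UNIV (\<lambda>t. ?g t * t * ?g t)" by (intro continuous_on_mult cg continuous_on_id)
      fix t :: real assume "0 \<le> t" "t \<le> nrm A h"
      have "?g t * t * ?g t = t * (1 / (sqrt (max t s) * sqrt (max t s)))" by (simp add: field_simps)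
      also have "\<dots> = max 0 t / max t s" using \<open>0 \<le> t\<close> ms[of t] by simp
      finally show "?g t * t * ?g t = max 0 t / max t s" .
    qed
    finally show ?thesis .
  qed
  have rx0: "r \<otimes> x0 = \<zero>" unfolding r_def by (rule cfc_annihilate[OF hs x0(1) hx0 cr]) simp
  have rx: "r \<otimes> x = \<zero>" using rx0 rc x0 Gc by (simp add: x_def flip: m_assoc)
  have xr: "star A x \<otimes> r = \<zero>"
  proof -
    have "star A x \<otimes> r = star A (r \<otimes> x)" using rc xc rs by (simp add: star_mult)
    then show ?thesis using rx by simp
  qed
  have "r \<otimes> (\<one> \<ominus> f) = \<zero>" unfolding r_def by (rule cfc_annihilate[OF hs _ hf cr]) (use fc in simp_all)
  then have "r \<ominus> r \<otimes> f = \<zero>" using rc fc by (simp add: a_minus_def r_distr r_minus)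
  then have rf: "r \<otimes> f = r" using rc fc by (simp add: minus_eq_zero_iff)
  have fr: "f \<otimes> r = r"
  proof -
    have "f \<otimes> r = star A (r \<otimes> f)" using rc fc rs f by (simp add: star_mult)
    then show ?thesis using rf rs by simp
  qed
  have fx: "f \<otimes> x = x" using fx0 fc x0 Gc by (simp add: x_def flip: m_assoc)
  define z0 where "z0 = cfc A h (\<lambda>t. max 0 (t - s))"
  have z0: "z0 \<in> psd A" unfolding z0_def by (rule cfc_psd_psd[OF h cz]) simp
  have nz0: "nrm A z0 \<le> T"
    unfolding z0_def using s T by (intro nrm_cfc_psd_le[OF h cz]) (auto simp: T_def)
  have "f' \<otimes> z0 = cfc A h (\<lambda>t. max 0 t / max t s * max 0 (t - s))"
    unfolding f'_def z0_def by (rule cfc_mult[OF hs cf cz, symmetric])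
  also have "(\<lambda>t. max 0 t / max t s * max 0 (t - s)) = (\<lambda>t. max 0 (t - s))"
    using s(1) by (auto simp: fun_eq_iff max_def)
  finally have f'z0: "f' \<otimes> z0 = z0" by (simp add: z0_def)
  define z' where "z' = of_real (1 / T) \<odot> z0"
  define w' where "w' i = (if i < N then w i \<otimes> x else w (i - N) \<otimes> r)" for i
  have conj: "star A (b \<otimes> (w i \<otimes> u)) \<otimes> (b \<otimes> (w j \<otimes> v)) = (if i = j then star A u \<otimes> (f \<otimes> v) else \<zero>)"
    if "i < N" "j < N" "u \<in> carrier A" "v \<in> carrier A" for i j u v
  proof -
    have "star A (b \<otimes> (w i \<otimes> u)) \<otimes> (b \<otimes> (w j \<otimes> v))
        = star A u \<otimes> (star A (b \<otimes> w i) \<otimes> (b \<otimes> w j)) \<otimes> v"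
      using that b w by (simp add: star_mult m_assoc)
    then show ?thesis using that ww[of i j] fc by (auto simp: m_assoc)
  qed
  have "small_witness A b (N + N) z' f' w'"
    unfolding small_witness_def
  proof (intro conjI allI impI)
    show "z' \<in> psd A" unfolding z'_def using z0 T by (intro psd_smult) auto
    show "z' \<noteq> \<zero>"
      using cut_nonzero[OF h, of s] s T z0 by (simp add: z'_def smult_eq_zero_iff z0_def[symmetric] T_def)
    show "nrm A z' \<le> 1" using nz0 T z0 by (simp add: z'_def nrm_smult norm_divide)
    show "nrm A f' \<le> 1" unfolding f'_def
      by (rule nrm_cfc_le[OF hs cf]) (use ms s in \<open>auto simp: max_def field_simps\<close>)
    show "f' \<otimes> z' = z'" using f'z0 z0 f' by (simp add: z'_def smult_mult_right)
    show "w' i \<in> carrier A" for i using w xc rc by (simp add: w'_def)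
    fix i j assume "i < N + N" "j < N + N"
    then show "star A (b \<otimes> w' i) \<otimes> (b \<otimes> w' j) = (if i = j then f' else \<zero>)"
      using xc rc rs fx fr xx rr xr rx by (auto simp: w'_def conj)
  qed (rule f')
  then show ?thesis by blast
qed

lemma small_witness_exists:
  assumes simple: "simple_cstar A" and fd: "\<not> finite_dim_cstar A" and b: "b \<in> psd A" "b \<noteq> \<zero>"
  shows "\<exists>z f w. small_witness A b (2 ^ m) z f w"
proof (induction m)
  case 0
  then show ?case using small_witness_base[OF b] by simp
next
  case (Suc m)
  then obtain z f w where "small_witness A b (2 ^ m) z f w" by blast
  from small_witness_double[OF simple fd _ this] b show ?case by (simp add: mult_2)
qed

text \<open>The sum s of the elements y_i y_i^* has as its square the sum of y_i f y_i^*, which is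
  at most s because f \<le> 1; hence s \<le> 1. By the trace property s has N times the trace of
  f.\<close>

lemma small_witness_trace:
  assumes t: "\<tau> \<in> tracial_states A" and b: "b \<in> carrier A" and sw: "small_witness A b N z f w"
  shows "real N * Re (\<tau> f) \<le> 1"
proof -
  have f: "f \<in> psd A" "nrm A f \<le> 1" and w: "w i \<in> carrier A"
    and ww: "\<lbrakk>i < N; j < N\<rbrakk> \<Longrightarrow> star A (b \<otimes> w i) \<otimes> (b \<otimes> w j) = (if i = j then f else \<zero>)" for i j
    using sw unfolding small_witness_def by auto
  have fc: "f \<in> carrier A" using f by simp
  define y where "y i = b \<otimes> w i" for i
  have y [simp]: "y i \<in> carrier A" for i using b w by (simp add: y_def)
  have yy: "\<lbrakk>i < N; j < N\<rbrakk> \<Longrightarrow> star A (y i) \<otimes> y j = (if i = j then f else \<zero>)" for i j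
    using ww by (simp add: y_def)
  define s where "s = nsum A (\<lambda>i. y i \<otimes> star A (y i)) N"
  have s: "s \<in> psd A" unfolding s_def by (intro nsum_psd) simp
  have "s \<otimes> s = nsum A (\<lambda>i. nsum A (\<lambda>j. y i \<otimes> star A (y i) \<otimes> (y j \<otimes> star A (y j))) N) N"
    unfolding s_def by (simp add: nsum_ldistr nsum_rdistr) (rule nsum_swap, simp)
  also have "\<dots> = nsum A (\<lambda>i. y i \<otimes> f \<otimes> star A (y i)) N"
  proof (rule nsum_cong)
    fix i assume i: "i < N"
    have "nsum A (\<lambda>j. y i \<otimes> star A (y i) \<otimes> (y j \<otimes> star A (y j))) N
        = nsum A (\<lambda>j. if j = i then y i \<otimes> f \<otimes> star A (y i) else \<zero>) N"
    proof (rule nsum_cong)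
      fix j assume j: "j < N"
      have "y i \<otimes> star A (y i) \<otimes> (y j \<otimes> star A (y j)) = y i \<otimes> (star A (y i) \<otimes> y j) \<otimes> star A (y j)"
        by (simp add: m_assoc)
      then show "y i \<otimes> star A (y i) \<otimes> (y j \<otimes> star A (y j)) = (if j = i then y i \<otimes> f \<otimes> star A (y i) else \<zero>)"
        using yy[OF i j] by auto
    qed
    then show "nsum A (\<lambda>j. y i \<otimes> star A (y i) \<otimes> (y j \<otimes> star A (y j))) N = y i \<otimes> f \<otimes> star A (y i)"
      using i fc by (simp add: nsum_delta)
  qed
  finally have ss: "s \<ominus> s \<otimes> s = nsum A (\<lambda>i. y i \<otimes> star A (y i) \<ominus> y i \<otimes> f \<otimes> star A (y i)) N"
    using fc by (simp add: s_def nsum_minus)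
  have "y i \<otimes> star A (y i) \<ominus> y i \<otimes> f \<otimes> star A (y i) \<in> psd A" for i
    using conj_psd_le_nrm[OF f, of "star A (y i)"] fc by (simp add: star_star)
  then have "s \<ominus> s \<otimes> s \<in> psd A" unfolding ss by (intro nsum_psd)
  then have s1: "\<one> \<ominus> s \<in> psd A" by (rule psd_le_one_of_square[OF s])
  have "Re (\<tau> (nsum A (\<lambda>i. y i \<otimes> star A (y i)) M)) = real M * Re (\<tau> f)" if "M \<le> N" for M
    using that
  proof (induction M)
    case (Suc M)
    have "\<tau> (y M \<otimes> star A (y M)) = \<tau> f"
      using tracial_state_mult_commute[OF t, of "y M" "star A (y M)"] yy[of M M] Suc.prems by simp
    with Suc show ?case by (simp add: tracial_state_add[OF t] algebra_simps)
  qed (simp add: tracial_state_zero[OF t])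
  then have "Re (\<tau> s) = real N * Re (\<tau> f)" by (simp add: s_def)
  moreover have "Re (\<tau> s) \<le> Re (\<tau> \<one>)"
    by (rule positive_functional_mono[OF tracial_state_functional[OF t] s1]) (use s in auto)
  ultimately show ?thesis by (simp add: tracial_state_one[OF t])
qed

section \<open>Compactness of the trace space and the uniform gap\<close>

lemma tracial_state_psd_bound:
  assumes t: "\<tau> \<in> tracial_states A" and p: "p \<in> psd A"
  shows "cmod (\<tau> p) \<le> nrm A p"
proof -
  have "Re (\<tau> p) \<le> Re (\<tau> (of_real (nrm A p) \<odot> \<one>))"
    by (rule positive_functional_mono[OF tracial_state_functional[OF t] psd_const_minus(1)]) (use p in auto)
  then have "Re (\<tau> p) \<le> nrm A p"
    by (simp add: tracial_state_smult[OF t] tracial_state_one[OF t])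
  moreover have "\<tau> p = of_real (Re (\<tau> p))"
    using tracial_state_real[OF t p] by (simp add: complex_is_Real_iff complex_eq_iff)
  ultimately show ?thesis using tracial_state_nonneg[OF t p] by (metis abs_of_nonneg norm_of_real)
qed

lemma tracial_states_bounded:
  assumes x: "x \<in> carrier A"
  shows "\<exists>K. \<forall>\<tau>\<in>tracial_states A. cmod (\<tau> x) \<le> K"
proof -
  obtain p q r s where d: "p \<in> psd A" "q \<in> psd A" "r \<in> psd A" "s \<in> psd A" "x = (p \<ominus> q) \<oplus> \<i> \<odot> (r \<ominus> s)"
    using psd_decomposition[OF x] .
  have "cmod (\<tau> x) \<le> nrm A p + nrm A q + (nrm A r + nrm A s)" if t: "\<tau> \<in> tracial_states A" for \<tau>
  proof -
    have m: "\<tau> (a \<ominus> b) = \<tau> a - \<tau> b" if "a \<in> carrier A" "b \<in> carrier A" for a b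
      using tracial_state_add[OF t, of a "(- 1) \<odot> b"] tracial_state_smult[OF t, of b "- 1"] that
      by (simp add: a_minus_def smult_uminus)
    have "\<tau> x = (\<tau> p - \<tau> q) + \<i> * (\<tau> r - \<tau> s)"
      unfolding d(5) using d(1-4) by (simp add: tracial_state_add[OF t] tracial_state_smult[OF t] m)
    also have "cmod \<dots> \<le> (cmod (\<tau> p) + cmod (\<tau> q)) + (cmod (\<tau> r) + cmod (\<tau> s))"
      by (rule order_trans[OF norm_triangle_ineq])
        (auto simp: norm_mult intro!: add_mono norm_triangle_ineq4)
    also have "\<dots> \<le> nrm A p + nrm A q + (nrm A r + nrm A s)"
      using d tracial_state_psd_bound[OF t] by (intro add_mono) auto
    finally show ?thesis .
  qed
  then show ?thesis by blast
qed

text \<open>Pointwise bounds place all traces in a product of discs, which is compact by Tychonoff.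
  The index set may be uncountable, so a cluster point is reached along a filter finer than
  \<open>sequentially\<close> instead of a subsequence. The defining properties of a trace pass to
  pointwise limits.\<close>

lemma tracial_states_compact:
  fixes T :: "nat \<Rightarrow> 'a \<Rightarrow> complex"
  assumes T: "\<And>m. T m \<in> tracial_states A"
  obtains \<sigma> G where "\<sigma> \<in> tracial_states A" "G \<noteq> bot" "G \<le> sequentially"
    "\<And>x. x \<in> carrier A \<Longrightarrow> ((\<lambda>m. T m x) \<longlongrightarrow> \<sigma> x) G"
proof -
  obtain K where K: "\<And>x \<tau>. \<lbrakk>x \<in> carrier A; \<tau> \<in> tracial_states A\<rbrakk> \<Longrightarrow> cmod (\<tau> x) \<le> K x"
    using tracial_states_bounded by metis
  \<comment> \<open>Outside the carrier the values of T are uncontrolled; they are set to 0, with a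
    disc of radius 0 as the factor.\<close>
  define t where "t m x = (if x \<in> carrier A then T m x else 0)" for m x
  let ?S = "PiE UNIV (\<lambda>x. cball (0::complex) (if x \<in> carrier A then K x else 0))"
  have "compactin (product_topology (\<lambda>_. euclidean) UNIV) ?S"
    by (subst compactin_PiE) (simp add: compactin_euclidean_iff)
  then have S: "compact ?S" by (simp add: euclidean_product_topology compactin_euclidean_iff)
  have "eventually (\<lambda>x. x \<in> ?S) (filtermap t sequentially)"
    using K T by (simp add: eventually_filtermap t_def PiE_iff)
  moreover have "filtermap t sequentially \<noteq> bot" by (simp add: filtermap_bot_iff)
  ultimately obtain \<sigma> where \<sigma>: "inf (nhds \<sigma>) (filtermap t sequentially) \<noteq> bot"
    using S unfolding compact_filter by blast
  define G where "G = inf sequentially (filtercomap t (nhds \<sigma>))"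
  have G: "G \<noteq> bot"
  proof
    assume "G = bot"
    then have "eventually (\<lambda>_. False) G" by simp
    then obtain P Q where PQ: "eventually P sequentially" "eventually Q (filtercomap t (nhds \<sigma>))"
      "\<And>m. P m \<and> Q m \<Longrightarrow> False"
      unfolding G_def eventually_inf by blast
    then obtain R where R: "eventually R (nhds \<sigma>)" "\<And>m. R (t m) \<Longrightarrow> Q m"
      unfolding eventually_filtercomap by blast
    have "eventually (\<lambda>x. \<not> R x) (filtermap t sequentially)"
      unfolding eventually_filtermap by (rule eventually_mono[OF PQ(1)]) (use PQ(3) R(2) in blast)
    then have "eventually (\<lambda>_. False) (inf (nhds \<sigma>) (filtermap t sequentially))"
      unfolding eventually_inf using R(1) by blast
    then show False using \<sigma> by (simp add: eventually_False)
  qed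
  have lim: "((\<lambda>m. T m x) \<longlongrightarrow> \<sigma> x) G" if x: "x \<in> carrier A" for x
  proof -
    have "(t \<longlongrightarrow> \<sigma>) G" unfolding filterlim_iff_le_filtercomap G_def by simp
    moreover have "((\<lambda>f :: 'a \<Rightarrow> complex. f x) \<longlongrightarrow> \<sigma> x) (at \<sigma>)"
      using continuous_on_product_coordinates[of x] by (auto simp: continuous_on_def)
    ultimately have "((\<lambda>m. t m x) \<longlongrightarrow> \<sigma> x) G" by (rule tendsto_compose[rotated])
    then show ?thesis using x by (simp add: t_def)
  qed
  have "\<sigma> \<in> tracial_states A"
    unfolding tracial_states_def
  proof (intro CollectI conjI ballI allI impI)
    fix x y assume x: "x \<in> carrier A" and y: "y \<in> carrier A"
    show "\<sigma> (x \<oplus> y) = \<sigma> x + \<sigma> y"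
      using tendsto_unique[OF G lim[of "x \<oplus> y"] tendsto_add[OF lim[OF x] lim[OF y], folded tracial_state_add[OF T x y]]]
        x y by simp
    show "\<sigma> (x \<otimes> y) = \<sigma> (y \<otimes> x)"
      using tendsto_unique[OF G lim[of "x \<otimes> y"] lim[of "y \<otimes> x", folded tracial_state_mult_commute[OF T x y]]]
        x y by simp
  next
    fix c x assume x: "x \<in> carrier A"
    show "\<sigma> (c \<odot> x) = c * \<sigma> x"
      using tendsto_unique[OF G lim[of "c \<odot> x"] tendsto_mult[OF tendsto_const[of c] lim[OF x], folded tracial_state_smult[OF T x]]]
        x by simp
  next
    fix x assume "positive A x"
    then have x: "x \<in> psd A" by (simp add: positive_iff_psd)
    then have xc: "x \<in> carrier A" by simp
    have "((\<lambda>m. Im (T m x)) \<longlongrightarrow> Im (\<sigma> x)) G" by (rule tendsto_Im[OF lim[OF xc]])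
    moreover have "Im (T m x) = 0" for m
      using tracial_state_real[OF T x] by (simp add: complex_is_Real_iff)
    ultimately have "((\<lambda>_. 0) \<longlongrightarrow> Im (\<sigma> x)) G" by simp
    then have "Im (\<sigma> x) = 0" using tendsto_unique[OF G _ tendsto_const[of "0 :: real"]] by blast
    then show "\<sigma> x \<in> \<real>" by (simp add: complex_is_Real_iff)
    show "0 \<le> Re (\<sigma> x)"
      by (rule tendsto_lowerbound[OF tendsto_Re[OF lim[OF xc]] _ G])
        (simp add: tracial_state_nonneg[OF T x])
  next
    show "\<sigma> \<one> = 1"
      using tendsto_unique[OF G lim[OF one_closed]] tendsto_const[of "1 :: complex" G]
      by (simp add: tracial_state_one[OF T])
  qed
  then show ?thesis using that[OF _ G _ lim] by (simp add: G_def)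
qed

text \<open>Let d denote the dimension at a given trace. Without a gap there are traces with d(b) <
  d(a') + 1/(m + 1). Ranks are not continuous in the trace, but \<tau>(b^(1/k)) \<le> S^(1/k) d(b)
  and d(a') \<le> (1/e)^(1/k) \<tau>(a^(1/k)) enclose them between continuous quantities. Passing to
  a cluster trace \<sigma> at fixed k, and then letting k grow, gives d(b) \<le> d(a) at
  \<sigma>.\<close>

lemma dim_fun_gap:
  assumes a: "a \<in> psd (mat_alg A n)" and b: "b \<in> psd (mat_alg A n)" and e: "e > 0"
    and lt: "\<And>\<tau>. \<tau> \<in> tracial_states A \<Longrightarrow> dim_fun A \<tau> a < dim_fun A \<tau> b"
  obtains \<eta> where "\<eta> > 0" "\<And>\<tau>. \<tau> \<in> tracial_states A \<Longrightarrow>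
    dim_fun A \<tau> (cfc (mat_alg A n) a (\<lambda>t. max 0 (t - e))) + \<eta> \<le> dim_fun A \<tau> b"
proof (rule ccontr)
  interpret M: unital_cstar_algebra "mat_alg A n" by (rule mat_cstar)
  let ?D = "mat_alg A n"
  define a' where "a' = cfc ?D a (\<lambda>t. max 0 (t - e))"
  have a': "a' \<in> psd ?D"
    unfolding a'_def by (rule M.cfc_psd_psd[OF a]) (auto intro!: continuous_intros)
  assume "\<not> thesis"
  then have "\<exists>\<tau>\<in>tracial_states A. dim_fun A \<tau> b < dim_fun A \<tau> a' + \<eta>" if "\<eta> > 0" for \<eta>
    using that \<open>\<And>\<eta>. \<lbrakk>0 < \<eta>; \<And>\<tau>. \<tau> \<in> tracial_states A \<Longrightarrow> _ \<tau> \<eta>\<rbrakk> \<Longrightarrow> thesis\<close> unfolding a'_def by (meson not_le)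
  then have "\<exists>\<tau>\<in>tracial_states A. dim_fun A \<tau> b < dim_fun A \<tau> a' + inverse (real (Suc m))" for m
    by simp
  then obtain T where T: "\<And>m. T m \<in> tracial_states A"
    "\<And>m. dim_fun A (T m) b < dim_fun A (T m) a' + inverse (real (Suc m))" by metis
  obtain \<sigma> G where \<sigma>: "\<sigma> \<in> tracial_states A" and G: "G \<noteq> bot" "G \<le> sequentially"
    and lim: "\<And>x. x \<in> carrier A \<Longrightarrow> ((\<lambda>m. T m x) \<longlongrightarrow> \<sigma> x) G"
    using tracial_states_compact[of T] T(1) by blast
  have limt: "((\<lambda>m. trace_fun (T m) n M) \<longlongrightarrow> trace_fun \<sigma> n M) G" if "M \<in> mats A n" for M
    unfolding trace_fun_def by (intro tendsto_sum tendsto_Re lim mats_carrier[OF that])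
  define S where "S = max 1 (nrm ?D b)"
  have S: "S > 0" "nrm ?D b \<le> S" by (auto simp: S_def)
  have cm: "cfc ?D x (root k) \<in> mats A n" if "x \<in> psd ?D" for x k
    by (rule mat_psd_mats[OF M.cfc_root_psd[OF that]])
  have main: "trace_fun \<sigma> n (cfc ?D b (root k)) \<le> root k S * (root k (1 / e) * trace_fun \<sigma> n (cfc ?D a (root k)))"
    if k: "k \<ge> 1" for k
  proof (rule tendsto_le[OF G(1) _ limt[OF cm[OF b]]])
    have "((\<lambda>m. inverse (real (Suc m))) \<longlongrightarrow> 0) G"
      using LIMSEQ_inverse_real_of_nat G(2) by (rule tendsto_mono[rotated])
    then have "((\<lambda>m. root k S * (root k (1 / e) * trace_fun (T m) n (cfc ?D a (root k)) + inverse (real (Suc m))))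
       \<longlongrightarrow> root k S * (root k (1 / e) * trace_fun \<sigma> n (cfc ?D a (root k)) + 0)) G"
      by (intro tendsto_intros limt[OF cm[OF a]])
    then show "((\<lambda>m. root k S * (root k (1 / e) * trace_fun (T m) n (cfc ?D a (root k)) + inverse (real (Suc m))))
       \<longlongrightarrow> root k S * (root k (1 / e) * trace_fun \<sigma> n (cfc ?D a (root k)))) G" by simp
    show "\<forall>\<^sub>F m in G. trace_fun (T m) n (cfc ?D b (root k))
        \<le> root k S * (root k (1 / e) * trace_fun (T m) n (cfc ?D a (root k)) + inverse (real (Suc m)))"
    proof (rule always_eventually, rule allI)
      fix m
      note F = trace_fun_functional[OF T(1)[of m], of n]
      have "trace_fun (T m) n (cfc ?D b (root k)) \<le> root k S * dim_fun A (T m) b"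
        using M.rank_fun_ge[OF F b S(2,1) k] by (simp add: dim_fun_tendsto(2)[OF T(1) b])
      also have "\<dots> \<le> root k S * (dim_fun A (T m) a' + inverse (real (Suc m)))"
        using T(2)[of m] S(1) k by (intro mult_left_mono) auto
      also have "dim_fun A (T m) a' \<le> root k (1 / e) * trace_fun (T m) n (cfc ?D a (root k))"
        using M.rank_fun_cut_le[OF F a e k]
        unfolding a'_def[symmetric] dim_fun_tendsto(2)[OF T(1)[of m] a'] .
      finally show "trace_fun (T m) n (cfc ?D b (root k))
        \<le> root k S * (root k (1 / e) * trace_fun (T m) n (cfc ?D a (root k)) + inverse (real (Suc m)))"
        using S(1) k by (simp add: mult_left_mono)
    qed
  qed
  have "(\<lambda>k. root k S * (root k (1 / e) * trace_fun \<sigma> n (cfc ?D a (root k)))) \<longlonglongrightarrow> 1 * (1 * dim_fun A \<sigma> a)"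
    using S e by (intro tendsto_mult LIMSEQ_root_const dim_fun_tendsto(1)[OF \<sigma> a]) auto
  then have "dim_fun A \<sigma> b \<le> 1 * (1 * dim_fun A \<sigma> a)"
    by (rule LIMSEQ_le[OF dim_fun_tendsto(1)[OF \<sigma> b]]) (use main in blast)
  with lt[OF \<sigma>] show False by simp
qed

end

section \<open>The sequence algebra\<close>

definition asymp_eq :: "('a, 'm) cstar_scheme \<Rightarrow> (nat \<Rightarrow> 'a) \<Rightarrow> (nat \<Rightarrow> 'a) \<Rightarrow> bool" where
  "asymp_eq A x y \<longleftrightarrow> (\<lambda>n. nrm A (x n \<ominus>\<^bsub>A\<^esub> y n)) \<longlonglongrightarrow> 0"

text \<open>The quotient map, through which identities in A_\<infinity> become identities of
  sequences up to \<open>asymp_eq\<close>.\<close>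

definition seq_class :: "('a, 'm) cstar_scheme \<Rightarrow> (nat \<Rightarrow> 'a) \<Rightarrow> (nat \<Rightarrow> 'a) set" where
  "seq_class A x = c0 A +>\<^bsub>linf A\<^esub> x"

lemma linf_simps [simp]:
  "mult (linf A) = (\<lambda>x y n. x n \<otimes>\<^bsub>A\<^esub> y n)"
  "one (linf A) = (\<lambda>n. \<one>\<^bsub>A\<^esub>)"
  "zero (linf A) = (\<lambda>n. \<zero>\<^bsub>A\<^esub>)"
  "add (linf A) = (\<lambda>x y n. x n \<oplus>\<^bsub>A\<^esub> y n)"
  "module.smult (linf A) = (\<lambda>c x n. c \<odot>\<^bsub>A\<^esub> x n)"
  "star (linf A) = (\<lambda>x n. star A (x n))"
  "nrm (linf A) = (\<lambda>x. SUP n. nrm A (x n))"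
  by (simp_all add: linf_def)

context unital_cstar_algebra
begin

lemma linfI: "\<lbrakk>\<And>n. x n \<in> carrier A; \<And>n. nrm A (x n) \<le> K\<rbrakk> \<Longrightarrow> x \<in> carrier (linf A)"
  by (auto simp: linf_def)

lemma linf_entry: "x \<in> carrier (linf A) \<Longrightarrow> x n \<in> carrier A"
  by (simp add: linf_def)

lemma linf_bound:
  assumes "x \<in> carrier (linf A)"
  obtains K where "K \<ge> 0" "\<And>n. nrm A (x n) \<le> K"
proof -
  obtain K where K: "\<And>n. nrm A (x n) \<le> K" using assms by (auto simp: linf_def)
  show ?thesis by (rule that[OF _ K]) (use order_trans[OF nrm_nonneg[OF linf_entry[OF assms]] K] in blast)
qed

lemma linf_const [simp]: "a \<in> carrier A \<Longrightarrow> (\<lambda>n. a) \<in> carrier (linf A)"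
  by (rule linfI) auto

lemma linf_add [simp]:
  assumes "x \<in> carrier (linf A)" "y \<in> carrier (linf A)" shows "(\<lambda>n. x n \<oplus> y n) \<in> carrier (linf A)"
proof -
  obtain K L where "\<And>n. nrm A (x n) \<le> K" "\<And>n. nrm A (y n) \<le> L" using linf_bound assms by metis
  then have KL: "nrm A (x n \<oplus> y n) \<le> K + L" for n
    using order_trans[OF nrm_triangle[OF linf_entry[OF assms(1)] linf_entry[OF assms(2)]] add_mono] by blast
  show ?thesis using linf_entry[OF assms(1)] linf_entry[OF assms(2)]
    by (intro linfI[OF _ KL]) auto
qed

lemma linf_mult [simp]:
  assumes "x \<in> carrier (linf A)" "y \<in> carrier (linf A)" shows "(\<lambda>n. x n \<otimes> y n) \<in> carrier (linf A)"
proof -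
  obtain K L where "\<And>n. nrm A (x n) \<le> K" "\<And>n. nrm A (y n) \<le> L" using linf_bound assms by metis
  then show ?thesis using linf_entry[OF assms(1)] linf_entry[OF assms(2)]
    by (intro linfI[of _ "K * L"]) (auto intro: nrm_mult_le)
qed

lemma linf_smult [simp]:
  assumes "x \<in> carrier (linf A)" shows "(\<lambda>n. c \<odot> x n) \<in> carrier (linf A)"
proof -
  obtain K where "\<And>n. nrm A (x n) \<le> K" using linf_bound assms by metis
  then show ?thesis using linf_entry[OF assms]
    by (intro linfI[of _ "cmod c * K"]) (auto simp: nrm_smult mult_left_mono)
qed

lemma linf_star [simp]:
  assumes "x \<in> carrier (linf A)" shows "(\<lambda>n. star A (x n)) \<in> carrier (linf A)"
proof -
  obtain K where "\<And>n. nrm A (x n) \<le> K" using linf_bound assms by metis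
  then show ?thesis using linf_entry[OF assms] by (intro linfI[of _ K]) auto
qed

lemma linf_a_inv [simp]: "x \<in> carrier (linf A) \<Longrightarrow> (\<lambda>n. \<ominus> x n) \<in> carrier (linf A)"
  using linf_smult[of x "- 1"] by (simp add: linf_entry flip: a_inv_smult)

lemma linf_minus [simp]:
  "\<lbrakk>x \<in> carrier (linf A); y \<in> carrier (linf A)\<rbrakk> \<Longrightarrow> (\<lambda>n. x n \<ominus> y n) \<in> carrier (linf A)"
  by (simp add: a_minus_def)

lemma linf_ring: "ring (linf A)"
proof (rule ringI)
  show "abelian_group (linf A)"
  proof (rule abelian_groupI)
    fix x assume x: "x \<in> carrier (linf A)"
    show "\<exists>y\<in>carrier (linf A). y \<oplus>\<^bsub>linf A\<^esub> x = \<zero>\<^bsub>linf A\<^esub>"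
      using x by (intro bexI[of _ "\<lambda>n. \<ominus> x n"]) (auto simp: l_neg linf_entry)
  qed (auto simp: linf_entry a_ac)
  show "monoid (linf A)" by (rule monoidI) (auto simp: linf_entry m_assoc)
qed (auto simp: linf_entry l_distr r_distr)

lemma linf_a_inv_eq: "x \<in> carrier (linf A) \<Longrightarrow> \<ominus>\<^bsub>linf A\<^esub> x = (\<lambda>n. \<ominus> x n)"
  by (rule abelian_group.minus_equality[OF ring.is_abelian_group[OF linf_ring]])
    (auto simp: l_neg linf_entry)

lemma c0_carrier: "x \<in> c0 A \<Longrightarrow> x n \<in> carrier A"
  by (simp add: c0_def)

lemma c0_linf: assumes "x \<in> c0 A" shows "x \<in> carrier (linf A)"
proof -
  have "Bseq (\<lambda>n. nrm A (x n))"
    using assms unfolding c0_def by (intro convergent_imp_Bseq) (auto simp: convergent_def)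
  then obtain K where "\<And>n. nrm A (x n) \<le> K" unfolding Bseq_def by (metis abs_le_D1 real_norm_def)
  then show ?thesis using c0_carrier[OF assms] by (intro linfI)
qed

lemma c0_I_le:
  assumes "\<And>n. x n \<in> carrier A" "\<And>n. nrm A (x n) \<le> e n" "e \<longlonglongrightarrow> 0"
  shows "x \<in> c0 A"
  unfolding c0_def using assms
  by (auto intro!: tendsto_sandwich[OF _ _ tendsto_const assms(3)] simp: nrm_nonneg)

lemma c0_add: assumes "x \<in> c0 A" "y \<in> c0 A" shows "(\<lambda>n. x n \<oplus> y n) \<in> c0 A"
proof (rule c0_I_le)
  have "(\<lambda>n. nrm A (x n) + nrm A (y n)) \<longlonglongrightarrow> 0 + 0"
    using assms unfolding c0_def by (intro tendsto_add) auto
  then show "(\<lambda>n. nrm A (x n) + nrm A (y n)) \<longlonglongrightarrow> 0" by simp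
qed (use assms c0_carrier nrm_triangle in auto)

lemma c0_mult:
  assumes "x \<in> c0 A" "y \<in> carrier (linf A)"
  shows "(\<lambda>n. x n \<otimes> y n) \<in> c0 A" "(\<lambda>n. y n \<otimes> x n) \<in> c0 A"
proof -
  obtain K where K: "\<And>n. nrm A (y n) \<le> K" using linf_bound[OF assms(2)] by metis
  have c: "x n \<in> carrier A" "y n \<in> carrier A" for n using assms c0_carrier linf_entry by auto
  have "(\<lambda>n. nrm A (x n) * K) \<longlonglongrightarrow> 0 * K"
    using assms unfolding c0_def by (intro tendsto_mult) auto
  then have l: "(\<lambda>n. nrm A (x n) * K) \<longlonglongrightarrow> 0" by simp
  show "(\<lambda>n. x n \<otimes> y n) \<in> c0 A" "(\<lambda>n. y n \<otimes> x n) \<in> c0 A"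
    by (rule c0_I_le[OF _ _ l];
        use c K nrm_mult_le[OF c(1) c(2) order_refl K] nrm_mult_le[OF c(2) c(1) K order_refl] in
        \<open>simp add: mult.commute\<close>)+
qed

lemma c0_a_inv: "x \<in> c0 A \<Longrightarrow> (\<lambda>n. \<ominus> x n) \<in> c0 A"
  by (simp add: c0_def)

lemma c0_smult: assumes "x \<in> c0 A" shows "(\<lambda>n. c \<odot> x n) \<in> c0 A"
proof -
  have "(\<lambda>n. cmod c * nrm A (x n)) \<longlonglongrightarrow> cmod c * 0"
    using assms unfolding c0_def by (intro tendsto_mult) auto
  then show ?thesis using assms by (simp add: c0_def nrm_smult)
qed

lemma c0_zero: "(\<lambda>n. \<zero>) \<in> c0 A"
  by (simp add: c0_def)

lemma c0_ideal: "ideal (c0 A) (linf A)"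
proof (rule idealI[OF linf_ring])
  interpret L: ring "linf A" by (rule linf_ring)
  show "subgroup (c0 A) (add_monoid (linf A))"
  proof (rule L.add.subgroupI)
    fix x assume x: "x \<in> c0 A"
    then show "\<ominus>\<^bsub>linf A\<^esub> x \<in> c0 A"
      using linf_a_inv_eq[OF c0_linf[OF x]] c0_a_inv[OF x] by simp
  qed (use c0_linf c0_zero c0_add in auto)
qed (use c0_mult in auto)

lemma asymp_eq_iff_c0:
  "\<lbrakk>x \<in> carrier (linf A); y \<in> carrier (linf A)\<rbrakk> \<Longrightarrow> asymp_eq A x y \<longleftrightarrow> (\<lambda>n. x n \<ominus> y n) \<in> c0 A"
  by (simp add: asymp_eq_def c0_def linf_entry)

lemma mem_seq_class:
  assumes x: "x \<in> carrier (linf A)"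
  shows "y \<in> seq_class A x \<longleftrightarrow> y \<in> carrier (linf A) \<and> asymp_eq A y x"
proof
  assume "y \<in> seq_class A x"
  then obtain h where h: "h \<in> c0 A" "y = (\<lambda>n. h n \<oplus> x n)"
    unfolding seq_class_def a_r_coset_def' by auto
  have "h n \<oplus> x n \<ominus> x n = h n" for n
    using c0_carrier[OF h(1)] linf_entry[OF x] by (simp add: a_minus_def a_assoc r_neg)
  then show "y \<in> carrier (linf A) \<and> asymp_eq A y x"
    using h x c0_linf[OF h(1)] by (simp add: asymp_eq_iff_c0)
next
  assume y: "y \<in> carrier (linf A) \<and> asymp_eq A y x"
  have "y = (\<lambda>n. (y n \<ominus> x n) \<oplus> x n)"
    using linf_entry[OF x] y linf_entry[of y] by (simp add: a_minus_def a_assoc l_neg)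
  moreover have "(\<lambda>n. y n \<ominus> x n) \<in> c0 A" using y x asymp_eq_iff_c0 by blast
  ultimately show "y \<in> seq_class A x"
    unfolding seq_class_def a_r_coset_def' by (intro UN_I[of "\<lambda>n. y n \<ominus> x n"]) auto
qed

lemma seq_alg_simps:
  "carrier (seq_alg A) = carrier (linf A Quot c0 A)"
  "mult (seq_alg A) = mult (linf A Quot c0 A)"
  "one (seq_alg A) = one (linf A Quot c0 A)"
  "zero (seq_alg A) = zero (linf A Quot c0 A)"
  "add (seq_alg A) = add (linf A Quot c0 A)"
  by (simp_all add: seq_alg_def cstar_quotient_def)

lemma seq_alg_ring: "ring (seq_alg A)"
proof -
  interpret Q: ring "linf A Quot c0 A" by (rule ideal.quotient_is_ring[OF c0_ideal])
  show ?thesis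
  proof (rule ringI)
    show "abelian_group (seq_alg A)"
    proof (rule abelian_groupI)
      fix x assume "x \<in> carrier (seq_alg A)"
      then show "\<exists>y\<in>carrier (seq_alg A). y \<oplus>\<^bsub>seq_alg A\<^esub> x = \<zero>\<^bsub>seq_alg A\<^esub>"
        using Q.add.l_inv_ex[of x] by (simp add: seq_alg_simps)
    qed (simp_all add: seq_alg_simps Q.a_ac)
    show "monoid (seq_alg A)" by (rule monoidI) (simp_all add: seq_alg_simps Q.m_assoc)
  qed (simp_all add: seq_alg_simps Q.l_distr Q.r_distr)
qed

lemma seq_class_cong:
  assumes "x \<in> carrier (linf A)" "y \<in> carrier (linf A)" "asymp_eq A x y"
  shows "seq_class A x = seq_class A y"
proof -
  interpret L: ideal "c0 A" "linf A" by (rule c0_ideal)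
  have "x \<in> seq_class A y" using assms by (simp add: mem_seq_class)
  from L.a_repr_independence[OF this[unfolded seq_class_def] assms(2) L.a_subgroup]
  show ?thesis by (simp add: seq_class_def)
qed

lemma
  assumes x: "x \<in> carrier (linf A)"
  shows seq_class_carrier [simp]: "seq_class A x \<in> carrier (seq_alg A)"
    and seq_class_star: "star (seq_alg A) (seq_class A x) = seq_class A (\<lambda>n. star A (x n))"
    and seq_class_smult: "c \<odot>\<^bsub>seq_alg A\<^esub> seq_class A x = seq_class A (\<lambda>n. c \<odot> x n)"
    and self_mem_seq_class: "x \<in> seq_class A x"
proof -
  note h = ideal.rcos_ring_hom[OF c0_ideal]
  show "seq_class A x \<in> carrier (seq_alg A)"
    unfolding seq_class_def seq_alg_simps using ring_hom_closed[OF h x] .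
  show self: "x \<in> seq_class A x"
    using x linf_entry[OF x] by (simp add: mem_seq_class asymp_eq_def a_minus_def r_neg)
  show "star (seq_alg A) (seq_class A x) = seq_class A (\<lambda>n. star A (x n))"
  proof -
    have "(\<lambda>n. star A (y n)) \<in> seq_class A (\<lambda>n. star A (x n))" if y: "y \<in> seq_class A x" for y
    proof -
      have y: "y \<in> carrier (linf A)" "asymp_eq A y x" using y x by (auto simp: mem_seq_class)
      then show ?thesis using x linf_entry[OF x] linf_entry[OF y(1)]
        by (simp add: mem_seq_class asymp_eq_def flip: star_minus)
    qed
    moreover have "y \<in> (\<lambda>x n. star A (x n)) ` seq_class A x" if "y \<in> seq_class A (\<lambda>n. star A (x n))" for y
    proof (rule image_eqI)
      have y: "y \<in> carrier (linf A)" "asymp_eq A y (\<lambda>n. star A (x n))" using that x by (auto simp: mem_seq_class)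
      have yc: "y n \<in> carrier A" for n using linf_entry[OF y(1)] .
      show "y = (\<lambda>n. star A (star A (y n)))" using yc by (simp add: star_star)
      have "nrm A (star A (y n) \<ominus> x n) = nrm A (y n \<ominus> star A (x n))" for n
      proof -
        have "star A (y n) \<ominus> x n = star A (y n \<ominus> star A (x n))"
          using yc linf_entry[OF x] by (simp add: star_minus star_star)
        then show ?thesis using yc linf_entry[OF x] by simp
      qed
      then show "(\<lambda>n. star A (y n)) \<in> seq_class A x"
        using y x by (simp add: mem_seq_class asymp_eq_def)
    qed
    ultimately show ?thesis
      by (auto simp: seq_alg_def cstar_quotient_def)
  qed
  show "c \<odot>\<^bsub>seq_alg A\<^esub> seq_class A x = seq_class A (\<lambda>n. c \<odot> x n)"
  proof -
    \<comment> \<open>Every representative gives the same coset, so the union in the definition of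
      the scalar multiple collapses, also for c = 0.\<close>
    have eq: "seq_class A (\<lambda>n. c \<odot> y n) = seq_class A (\<lambda>n. c \<odot> x n)" if "y \<in> seq_class A x" for y
    proof (rule seq_class_cong)
      have y: "y \<in> carrier (linf A)" "asymp_eq A y x" using that x by (auto simp: mem_seq_class)
      then have "(\<lambda>n. c \<odot> (y n \<ominus> x n)) \<in> c0 A" using x by (intro c0_smult) (simp add: asymp_eq_iff_c0)
      moreover have "c \<odot> (y n \<ominus> x n) = c \<odot> y n \<ominus> c \<odot> x n" for n
        using linf_entry[OF x] linf_entry[OF y(1)] by (simp add: smult_minus)
      ultimately show "asymp_eq A (\<lambda>n. c \<odot> y n) (\<lambda>n. c \<odot> x n)" using x y by (simp add: asymp_eq_iff_c0)
      show "(\<lambda>n. c \<odot> y n) \<in> carrier (linf A)" using y by simp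
    qed (use x in simp)
    have "c \<odot>\<^bsub>seq_alg A\<^esub> seq_class A x = (\<Union>y\<in>seq_class A x. seq_class A (\<lambda>n. c \<odot> y n))"
      by (simp add: seq_alg_def cstar_quotient_def seq_class_def)
    also have "\<dots> = (\<Union>y\<in>seq_class A x. seq_class A (\<lambda>n. c \<odot> x n))"
      by (rule SUP_cong[OF refl eq])
    finally show ?thesis using self by auto
  qed
qed

lemma
  assumes "x \<in> carrier (linf A)" "y \<in> carrier (linf A)"
  shows seq_class_mult: "seq_class A x \<otimes>\<^bsub>seq_alg A\<^esub> seq_class A y = seq_class A (\<lambda>n. x n \<otimes> y n)"
    and seq_class_add: "seq_class A x \<oplus>\<^bsub>seq_alg A\<^esub> seq_class A y = seq_class A (\<lambda>n. x n \<oplus> y n)"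
    and seq_class_eq_iff: "seq_class A x = seq_class A y \<longleftrightarrow> asymp_eq A x y"
proof -
  note h = ideal.rcos_ring_hom[OF c0_ideal]
  show "seq_class A x \<otimes>\<^bsub>seq_alg A\<^esub> seq_class A y = seq_class A (\<lambda>n. x n \<otimes> y n)"
    unfolding seq_class_def seq_alg_simps using ring_hom_mult[OF h assms] by simp
  show "seq_class A x \<oplus>\<^bsub>seq_alg A\<^esub> seq_class A y = seq_class A (\<lambda>n. x n \<oplus> y n)"
    unfolding seq_class_def seq_alg_simps using ring_hom_add[OF h assms] by simp
  show "seq_class A x = seq_class A y \<longleftrightarrow> asymp_eq A x y"
  proof
    assume "seq_class A x = seq_class A y"
    then show "asymp_eq A x y" using self_mem_seq_class[OF assms(1)] mem_seq_class[OF assms(2)] by blast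
  next
    assume "asymp_eq A x y"
    then show "seq_class A x = seq_class A y" by (rule seq_class_cong[OF assms])
  qed
qed

lemma seq_class_one: "\<one>\<^bsub>seq_alg A\<^esub> = seq_class A (\<lambda>n. \<one>)"
  unfolding seq_class_def seq_alg_simps by (simp add: FactRing_def)

lemma seq_class_zero: "\<zero>\<^bsub>seq_alg A\<^esub> = seq_class A (\<lambda>n. \<zero>)"
proof -
  interpret L: ideal "c0 A" "linf A" by (rule c0_ideal)
  show ?thesis unfolding seq_class_def seq_alg_simps
    using L.a_rcos_const[OF c0_zero] by (simp add: FactRing_def)
qed

lemma seq_class_minus:
  assumes "x \<in> carrier (linf A)" "y \<in> carrier (linf A)"
  shows "seq_class A x \<ominus>\<^bsub>seq_alg A\<^esub> seq_class A y = seq_class A (\<lambda>n. x n \<ominus> y n)"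
proof -
  interpret Q: ring "seq_alg A" by (rule seq_alg_ring)
  have "seq_class A (\<lambda>n. \<ominus> y n) \<oplus>\<^bsub>seq_alg A\<^esub> seq_class A y = \<zero>\<^bsub>seq_alg A\<^esub>"
    using assms linf_entry[OF assms(2)] by (simp add: seq_class_add seq_class_zero l_neg)
  then have "\<ominus>\<^bsub>seq_alg A\<^esub> seq_class A y = seq_class A (\<lambda>n. \<ominus> y n)"
    using assms by (intro Q.minus_equality) auto
  then show ?thesis using assms by (simp add: a_minus_def seq_class_add)
qed

lemma seq_alg_carrierE:
  assumes "X \<in> carrier (seq_alg A)"
  obtains x where "x \<in> carrier (linf A)" "X = seq_class A x"
  using assms unfolding seq_alg_simps seq_class_def by (auto simp: FactRing_def A_RCOSETS_def')

lemma const_seq_eq: "const_seq A a = seq_class A (\<lambda>n. a)"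
  by (simp add: const_seq_def seq_class_def)

text \<open>The quotient norm is an infimum, so some representative has supremum norm below e; the
  given one differs from it by a null sequence. This is the passage from the norm of A_\<infinity>
  to norms in A.\<close>

lemma seq_class_nrm_less:
  assumes x: "x \<in> carrier (linf A)" and lt: "nrm (seq_alg A) (seq_class A x) < e"
  shows "\<forall>\<^sub>F n in sequentially. nrm A (x n) < e"
proof -
  have "nrm (seq_alg A) (seq_class A x) = Inf (nrm (linf A) ` seq_class A x)"
    by (simp add: seq_alg_def cstar_quotient_def)
  moreover have "nrm (linf A) ` seq_class A x \<noteq> {}" using self_mem_seq_class[OF x] by auto
  ultimately obtain r where "r \<in> nrm (linf A) ` seq_class A x" "r < e"
    using lt cInf_lessD[of "nrm (linf A) ` seq_class A x" e] by auto
  then obtain y where y: "y \<in> seq_class A x" "nrm (linf A) y < e" by auto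
  have yl: "y \<in> carrier (linf A)" and as: "asymp_eq A y x" using y x mem_seq_class by auto
  define S where "S = (SUP n. nrm A (y n))"
  obtain K where K: "\<And>n. nrm A (y n) \<le> K" using linf_bound[OF yl] by metis
  have yS: "nrm A (y n) \<le> S" for n
    unfolding S_def by (rule cSUP_upper) (auto intro!: bdd_aboveI[of _ K] simp: K)
  have S: "S < e" using y(2) by (simp add: S_def)
  have "\<forall>\<^sub>F n in sequentially. nrm A (y n \<ominus> x n) < e - S"
    using as S unfolding asymp_eq_def by (intro order_tendstoD) auto
  then show ?thesis
  proof (rule eventually_mono)
    fix n assume "nrm A (y n \<ominus> x n) < e - S"
    then show "nrm A (x n) < e"
      using nrm_le_minus[OF linf_entry[OF x] linf_entry[OF yl], of n n] yS[of n]
        nrm_minus_commute[OF linf_entry[OF x] linf_entry[OF yl], of n n] by simp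
  qed
qed

end

section \<open>Approximation across a central splitting\<close>

text \<open>The left factor is built from \<open>L = \<rho>\<^sub>1\<gamma>\<close> and \<open>L' = \<rho>\<^sub>2\<gamma> + \<tau>(1 - \<gamma>)\<close>, the right one from \<open>M = \<gamma>\<sigma>\<^sub>1\<close>
  and \<open>M' = \<gamma>\<sigma>\<^sub>2 + (1 - \<gamma>)\<mu>\<close>: up to the errors, \<open>L\<beta>M = \<alpha>\<gamma>\<close> and \<open>L'\<beta>M' = \<zeta>\<close>, and the mixed terms vanish.\<close>

lemma (in ring) corner_identity:
  assumes c [simp]: "\<alpha> \<in> carrier R" "\<beta> \<in> carrier R" "\<zeta> \<in> carrier R" "\<gamma> \<in> carrier R" "\<tau> \<in> carrier R" "\<mu> \<in> carrier R"
    "\<rho>\<^sub>1 \<in> carrier R" "\<rho>\<^sub>2 \<in> carrier R" "\<sigma>\<^sub>1 \<in> carrier R" "\<sigma>\<^sub>2 \<in> carrier R" "\<upsilon> \<in> carrier R" "\<omega> \<in> carrier R" "\<theta> \<in> carrier R"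
    "\<epsilon>\<^sub>1\<^sub>1 \<in> carrier R" "\<epsilon>\<^sub>1\<^sub>2 \<in> carrier R" "\<epsilon>\<^sub>2\<^sub>1 \<in> carrier R" "\<epsilon>\<^sub>2\<^sub>2 \<in> carrier R"
    and gg: "\<gamma> \<otimes> \<gamma> = \<gamma>" and gb: "\<gamma> \<otimes> \<beta> = \<beta> \<otimes> \<gamma>" and gm: "\<gamma> \<otimes> \<mu> = \<mu> \<otimes> \<gamma>"
    and e11: "\<rho>\<^sub>1 \<otimes> (\<beta> \<otimes> \<gamma>) \<otimes> \<sigma>\<^sub>1 = \<alpha> \<otimes> \<gamma> \<oplus> \<epsilon>\<^sub>1\<^sub>1"
    and e12: "\<rho>\<^sub>1 \<otimes> (\<beta> \<otimes> \<gamma>) \<otimes> \<sigma>\<^sub>2 = \<epsilon>\<^sub>1\<^sub>2"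
    and e21: "\<rho>\<^sub>2 \<otimes> (\<beta> \<otimes> \<gamma>) \<otimes> \<sigma>\<^sub>1 = \<epsilon>\<^sub>2\<^sub>1"
    and e22: "\<rho>\<^sub>2 \<otimes> (\<beta> \<otimes> \<gamma>) \<otimes> \<sigma>\<^sub>2 = \<zeta> \<otimes> \<gamma> \<oplus> \<epsilon>\<^sub>2\<^sub>2"
    and tbm: "\<tau> \<otimes> \<beta> \<otimes> \<mu> = \<zeta>"
    and split: "\<one> \<ominus> \<gamma> = \<upsilon> \<otimes> \<zeta> \<otimes> \<omega> \<oplus> \<theta>"
  shows "(\<rho>\<^sub>1 \<otimes> \<gamma> \<oplus> (\<alpha> \<otimes> \<upsilon>) \<otimes> (\<rho>\<^sub>2 \<otimes> \<gamma> \<oplus> \<tau> \<otimes> (\<one> \<ominus> \<gamma>))) \<otimes> \<beta>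
      \<otimes> (\<gamma> \<otimes> \<sigma>\<^sub>1 \<oplus> (\<gamma> \<otimes> \<sigma>\<^sub>2 \<oplus> (\<one> \<ominus> \<gamma>) \<otimes> \<mu>) \<otimes> \<omega>) \<ominus> \<alpha>
    = \<epsilon>\<^sub>1\<^sub>1 \<oplus> \<epsilon>\<^sub>1\<^sub>2 \<otimes> \<omega> \<oplus> (\<alpha> \<otimes> \<upsilon>) \<otimes> \<epsilon>\<^sub>2\<^sub>1 \<oplus> (\<alpha> \<otimes> \<upsilon>) \<otimes> \<epsilon>\<^sub>2\<^sub>2 \<otimes> \<omega> \<ominus> \<alpha> \<otimes> \<theta>"
proof -
  define \<kappa> where "\<kappa> = \<one> \<ominus> \<gamma>"
  have k [simp]: "\<kappa> \<in> carrier R" by (simp add: \<kappa>_def)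
  have gk: "\<gamma> \<otimes> \<kappa> = \<zero>" "\<kappa> \<otimes> \<gamma> = \<zero>"
    by (simp_all add: \<kappa>_def a_minus_def r_distr l_distr r_minus l_minus gg r_neg)
  have kk: "\<kappa> \<otimes> \<kappa> = \<kappa>"
    using gk(2) by (subst (2) \<kappa>_def) (simp add: a_minus_def r_distr r_minus)
  have kb: "\<kappa> \<otimes> \<beta> = \<beta> \<otimes> \<kappa>" and km: "\<kappa> \<otimes> \<mu> = \<mu> \<otimes> \<kappa>"
    by (simp_all add: \<kappa>_def a_minus_def r_distr l_distr r_minus l_minus gb gm)
  have g1: "\<gamma> \<otimes> \<beta> \<otimes> \<gamma> = \<beta> \<otimes> \<gamma>" by (simp add: gb m_assoc gg)
  have g2: "\<gamma> \<otimes> \<beta> \<otimes> \<kappa> = \<zero>" by (simp add: gb m_assoc gk)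
  have g3: "\<kappa> \<otimes> \<beta> \<otimes> \<gamma> = \<zero>" by (simp add: kb m_assoc gk)
  have g4: "\<kappa> \<otimes> \<beta> \<otimes> \<kappa> = \<beta> \<otimes> \<kappa>" by (simp add: kb m_assoc kk)
  have corner: "(x \<otimes> \<gamma>) \<otimes> \<beta> \<otimes> (\<gamma> \<otimes> y) = x \<otimes> (\<beta> \<otimes> \<gamma>) \<otimes> y"
    if "x \<in> carrier R" "y \<in> carrier R" for x y
  proof -
    have "(x \<otimes> \<gamma>) \<otimes> \<beta> \<otimes> (\<gamma> \<otimes> y) = x \<otimes> (\<gamma> \<otimes> \<beta> \<otimes> \<gamma>) \<otimes> y" using that by (simp add: m_assoc)
    then show ?thesis unfolding g1 .
  qed
  have off1: "(x \<otimes> \<gamma>) \<otimes> \<beta> \<otimes> (\<kappa> \<otimes> y) = \<zero>" if "x \<in> carrier R" "y \<in> carrier R" for x y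
  proof -
    have "(x \<otimes> \<gamma>) \<otimes> \<beta> \<otimes> (\<kappa> \<otimes> y) = x \<otimes> (\<gamma> \<otimes> \<beta> \<otimes> \<kappa>) \<otimes> y" using that by (simp add: m_assoc)
    then show ?thesis unfolding g2 using that by simp
  qed
  have off2: "(x \<otimes> \<kappa>) \<otimes> \<beta> \<otimes> (\<gamma> \<otimes> y) = \<zero>" if "x \<in> carrier R" "y \<in> carrier R" for x y
  proof -
    have "(x \<otimes> \<kappa>) \<otimes> \<beta> \<otimes> (\<gamma> \<otimes> y) = x \<otimes> (\<kappa> \<otimes> \<beta> \<otimes> \<gamma>) \<otimes> y" using that by (simp add: m_assoc)
    then show ?thesis unfolding g3 using that by simp
  qed
  have "(\<tau> \<otimes> \<kappa>) \<otimes> \<beta> \<otimes> (\<kappa> \<otimes> \<mu>) = \<tau> \<otimes> (\<kappa> \<otimes> \<beta> \<otimes> \<kappa>) \<otimes> \<mu>" by (simp add: m_assoc)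
  also have "\<dots> = \<tau> \<otimes> \<beta> \<otimes> \<mu> \<otimes> \<kappa>" unfolding g4 by (simp add: m_assoc km)
  also have "\<dots> = \<zeta> \<ominus> \<zeta> \<otimes> \<gamma>" unfolding tbm by (simp add: \<kappa>_def a_minus_def r_distr r_minus)
  finally have tk: "(\<tau> \<otimes> \<kappa>) \<otimes> \<beta> \<otimes> (\<kappa> \<otimes> \<mu>) = \<zeta> \<ominus> \<zeta> \<otimes> \<gamma>" .
  define L L' M M' where "L = \<rho>\<^sub>1 \<otimes> \<gamma>" and "L' = \<rho>\<^sub>2 \<otimes> \<gamma> \<oplus> \<tau> \<otimes> \<kappa>"
    and "M = \<gamma> \<otimes> \<sigma>\<^sub>1" and "M' = \<gamma> \<otimes> \<sigma>\<^sub>2 \<oplus> \<kappa> \<otimes> \<mu>"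
  have lc [simp]: "L \<in> carrier R" "L' \<in> carrier R" "M \<in> carrier R" "M' \<in> carrier R"
    by (simp_all add: L_def L'_def M_def M'_def)
  have s1: "L \<otimes> \<beta> \<otimes> M = \<alpha> \<otimes> \<gamma> \<oplus> \<epsilon>\<^sub>1\<^sub>1" unfolding L_def M_def by (simp only: corner c e11)
  have s2: "L \<otimes> \<beta> \<otimes> M' = \<epsilon>\<^sub>1\<^sub>2"
  proof -
    have "L \<otimes> \<beta> \<otimes> M' = L \<otimes> \<beta> \<otimes> (\<gamma> \<otimes> \<sigma>\<^sub>2) \<oplus> L \<otimes> \<beta> \<otimes> (\<kappa> \<otimes> \<mu>)"
      by (simp add: M'_def r_distr)
    then show ?thesis unfolding L_def by (simp only: corner off1 c e12 r_zero)
  qed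
  have s3: "L' \<otimes> \<beta> \<otimes> M = \<epsilon>\<^sub>2\<^sub>1"
  proof -
    have "L' \<otimes> \<beta> \<otimes> M = (\<rho>\<^sub>2 \<otimes> \<gamma>) \<otimes> \<beta> \<otimes> M \<oplus> (\<tau> \<otimes> \<kappa>) \<otimes> \<beta> \<otimes> M"
      by (simp add: L'_def l_distr)
    then show ?thesis unfolding M_def by (simp only: corner off2 c e21 r_zero)
  qed
  have s4: "L' \<otimes> \<beta> \<otimes> M' = \<zeta> \<oplus> \<epsilon>\<^sub>2\<^sub>2"
  proof -
    have "L' \<otimes> \<beta> \<otimes> M' = ((\<rho>\<^sub>2 \<otimes> \<gamma>) \<otimes> \<beta> \<otimes> (\<gamma> \<otimes> \<sigma>\<^sub>2) \<oplus> (\<rho>\<^sub>2 \<otimes> \<gamma>) \<otimes> \<beta> \<otimes> (\<kappa> \<otimes> \<mu>))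
        \<oplus> ((\<tau> \<otimes> \<kappa>) \<otimes> \<beta> \<otimes> (\<gamma> \<otimes> \<sigma>\<^sub>2) \<oplus> (\<tau> \<otimes> \<kappa>) \<otimes> \<beta> \<otimes> (\<kappa> \<otimes> \<mu>))"
      by (simp add: L'_def M'_def l_distr r_distr a_ac)
    also have "\<dots> = ((\<zeta> \<otimes> \<gamma> \<oplus> \<epsilon>\<^sub>2\<^sub>2) \<oplus> \<zero>) \<oplus> (\<zero> \<oplus> (\<zeta> \<ominus> \<zeta> \<otimes> \<gamma>))"
      by (simp only: corner off1 off2 tk c e22)
    also have "\<dots> = \<zeta> \<oplus> \<epsilon>\<^sub>2\<^sub>2" using c by algebra
    finally show ?thesis .
  qed
  define U where "U = \<alpha> \<otimes> \<upsilon>"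
  have U [simp]: "U \<in> carrier R" by (simp add: U_def)
  have "\<alpha> = \<alpha> \<otimes> \<gamma> \<oplus> \<alpha> \<otimes> \<kappa>"
    by (simp add: \<kappa>_def a_minus_def r_distr r_minus) (simp add: a_lcomm r_neg)
  then have al: "\<alpha> = \<alpha> \<otimes> \<gamma> \<oplus> \<alpha> \<otimes> (\<upsilon> \<otimes> \<zeta> \<otimes> \<omega> \<oplus> \<theta>)"
    unfolding \<kappa>_def split .
  have "(L \<oplus> U \<otimes> L') \<otimes> \<beta> \<otimes> (M \<oplus> M' \<otimes> \<omega>) = L \<otimes> \<beta> \<otimes> M \<oplus> (L \<otimes> \<beta> \<otimes> M') \<otimes> \<omega>
      \<oplus> U \<otimes> (L' \<otimes> \<beta> \<otimes> M) \<oplus> U \<otimes> (L' \<otimes> \<beta> \<otimes> M') \<otimes> \<omega>"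
    using lc U c by algebra
  also have "\<dots> = (\<alpha> \<otimes> \<gamma> \<oplus> \<epsilon>\<^sub>1\<^sub>1) \<oplus> \<epsilon>\<^sub>1\<^sub>2 \<otimes> \<omega> \<oplus> U \<otimes> \<epsilon>\<^sub>2\<^sub>1 \<oplus> U \<otimes> (\<zeta> \<oplus> \<epsilon>\<^sub>2\<^sub>2) \<otimes> \<omega>"
    unfolding s1 s2 s3 s4 ..
  finally have "(L \<oplus> U \<otimes> L') \<otimes> \<beta> \<otimes> (M \<oplus> M' \<otimes> \<omega>) \<ominus> \<alpha>
      = ((\<alpha> \<otimes> \<gamma> \<oplus> \<epsilon>\<^sub>1\<^sub>1) \<oplus> \<epsilon>\<^sub>1\<^sub>2 \<otimes> \<omega> \<oplus> U \<otimes> \<epsilon>\<^sub>2\<^sub>1 \<oplus> U \<otimes> (\<zeta> \<oplus> \<epsilon>\<^sub>2\<^sub>2) \<otimes> \<omega>)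
        \<ominus> (\<alpha> \<otimes> \<gamma> \<oplus> \<alpha> \<otimes> (\<upsilon> \<otimes> \<zeta> \<otimes> \<omega> \<oplus> \<theta>))"
    using al by metis
  also have "\<dots> = \<epsilon>\<^sub>1\<^sub>1 \<oplus> \<epsilon>\<^sub>1\<^sub>2 \<otimes> \<omega> \<oplus> U \<otimes> \<epsilon>\<^sub>2\<^sub>1 \<oplus> U \<otimes> \<epsilon>\<^sub>2\<^sub>2 \<otimes> \<omega> \<ominus> \<alpha> \<otimes> \<theta>"
    unfolding U_def using c by algebra
  finally show ?thesis unfolding L_def L'_def M_def M'_def U_def \<kappa>_def .
qed

text \<open>The amplification \<open>x \<otimes> 1\<^sub>n\<close>.\<close>

definition diag_mat :: "('a, 'm) cstar_scheme \<Rightarrow> nat \<Rightarrow> 'a \<Rightarrow> 'a mat" where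
  "diag_mat A n x = (\<lambda>i j. if i = j \<and> i < n then x else \<zero>\<^bsub>A\<^esub>)"

context unital_cstar_algebra
begin

lemma diag_mat_mats [simp]: "x \<in> carrier A \<Longrightarrow> diag_mat A n x \<in> mats A n"
  by (rule matsI) (auto simp: diag_mat_def)

lemma diag_mat_mult_left:
  assumes x: "x \<in> carrier A" and M: "M \<in> mats A n"
  shows "mat_mult A (diag_mat A n x) M = (\<lambda>i j. x \<otimes> M i j)"
proof (rule mats_eqI[of _ n])
  show "(\<lambda>i j. x \<otimes> M i j) \<in> mats A n" using x M by (auto simp: mats_def)
  fix i j assume ij: "i < n" "j < n"
  have "nsum A (\<lambda>k. diag_mat A n x i k \<otimes> M k j) n = nsum A (\<lambda>k. if k = i then x \<otimes> M k j else \<zero>) n"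
    using ij mats_carrier[OF M] by (intro nsum_cong) (auto simp: diag_mat_def)
  then show "mat_mult A (diag_mat A n x) M i j = x \<otimes> M i j"
    using ij x mats_carrier[OF M] by (simp add: mat_mult_nsum[OF diag_mat_mats[OF x]] nsum_delta')
qed (use x M in auto)

lemma diag_mat_mult_right:
  assumes x: "x \<in> carrier A" and M: "M \<in> mats A n"
  shows "mat_mult A M (diag_mat A n x) = (\<lambda>i j. M i j \<otimes> x)"
proof (rule mats_eqI[of _ n])
  show "(\<lambda>i j. M i j \<otimes> x) \<in> mats A n" using x M by (auto simp: mats_def)
  fix i j assume ij: "i < n" "j < n"
  have dc: "diag_mat A n x k j \<in> carrier A" for k j using x by (simp add: diag_mat_def)
  have "nsum A (\<lambda>k. M i k \<otimes> diag_mat A n x k j) n = nsum A (\<lambda>k. if k = j then M i k \<otimes> x else \<zero>) n"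
    using ij mats_carrier[OF M] by (intro nsum_cong) (auto simp: diag_mat_def)
  then show "mat_mult A M (diag_mat A n x) i j = M i j \<otimes> x"
    using ij x mats_carrier[OF M] dc by (simp add: mat_mult_nsum[OF M] nsum_delta')
qed (use x M in auto)

lemma diag_mat_hom: "cstar_hom A (mat_alg A n) (diag_mat A n)"
proof (intro cstar_hom.intro cstar_hom_axioms.intro mat_cstar)
  show "star_hom A (mat_alg A n) (diag_mat A n)"
    unfolding star_hom_def linear_map_def
  proof (intro conjI ballI allI)
    fix x y assume "x \<in> carrier A" "y \<in> carrier A"
    then show "diag_mat A n (x \<otimes> y) = diag_mat A n x \<otimes>\<^bsub>mat_alg A n\<^esub> diag_mat A n y"
      by (simp add: diag_mat_mult_left) (auto simp: diag_mat_def fun_eq_iff)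
  qed (auto simp: diag_mat_def fun_eq_iff intro!: matsI split: if_splits)
qed unfold_locales

lemma mat_norm_le_entries:
  assumes "M \<in> mats A n" "\<And>i j. \<lbrakk>i < n; j < n\<rbrakk> \<Longrightarrow> nrm A (M i j) \<le> d"
  shows "mat_norm A M \<le> real n * (real n * d)"
proof -
  have "(\<Sum>i<n. \<Sum>k<n. nrm A (M i k)) \<le> (\<Sum>i<n. \<Sum>k<n. d)" using assms(2) by (intro sum_mono) auto
  then show ?thesis using mat_norm_le_sum[OF assms(1)] by simp
qed

lemma mat_norm_diag_le:
  assumes "x \<in> carrier A" shows "mat_norm A (diag_mat A n x) \<le> real n * (real n * nrm A x)"
  by (rule mat_norm_le_entries[OF diag_mat_mats[OF assms]])
    (use assms in \<open>simp add: diag_mat_def nrm_nonneg\<close>)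

lemma mat_linfI:
  assumes X: "\<And>m. X m \<in> mats A n" and e: "\<And>i j. \<lbrakk>i < n; j < n\<rbrakk> \<Longrightarrow> (\<lambda>m. X m i j) \<in> carrier (linf A)"
  shows "X \<in> carrier (linf (mat_alg A n))"
proof -
  have "\<forall>i j. \<exists>K. i < n \<longrightarrow> j < n \<longrightarrow> (\<forall>m. nrm A (X m i j) \<le> K)" using linf_bound[OF e] by metis
  then obtain K where K: "\<And>i j m. \<lbrakk>i < n; j < n\<rbrakk> \<Longrightarrow> nrm A (X m i j) \<le> K i j" by metis
  have "mat_norm A (X m) \<le> (\<Sum>i<n. \<Sum>j<n. K i j)" for m
    by (rule order_trans[OF mat_norm_le_sum[OF X]]) (intro sum_mono K; simp)
  then show ?thesis
    by (intro unital_cstar_algebra.linfI[OF mat_cstar, of X n "\<Sum>i<n. \<Sum>j<n. K i j"]) (simp_all add: X)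
qed

lemma mat_asymp_eqI:
  assumes X: "\<And>m. X m \<in> mats A n" and Y: "\<And>m. Y m \<in> mats A n"
    and e: "\<And>i j. \<lbrakk>i < n; j < n\<rbrakk> \<Longrightarrow> asymp_eq A (\<lambda>m. X m i j) (\<lambda>m. Y m i j)"
  shows "asymp_eq (mat_alg A n) X Y"
proof -
  have l: "(\<lambda>m. \<Sum>i<n. \<Sum>j<n. nrm A (X m i j \<ominus> Y m i j)) \<longlonglongrightarrow> (\<Sum>i<n. \<Sum>j<n. 0)"
    using e unfolding asymp_eq_def by (intro tendsto_sum) auto
  have d: "(\<lambda>i j. X m i j \<ominus> Y m i j) \<in> mats A n" for m
    using X[of m] Y[of m] by (auto simp: mats_def a_minus_def)
  show ?thesis unfolding asymp_eq_def
  proof (rule tendsto_sandwich[OF _ _ tendsto_const])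
    show "(\<lambda>m. \<Sum>i<n. \<Sum>j<n. nrm A (X m i j \<ominus> Y m i j)) \<longlonglongrightarrow> 0" using l by simp
  qed (simp_all add: mat_minus[OF Y] mat_norm_le_sum[OF d] mat_norm_nonneg[OF d])
qed

lemma nsum_seq_class:
  "(\<And>k. f k \<in> carrier (linf A))
   \<Longrightarrow> nsum (seq_alg A) (\<lambda>k. seq_class A (f k)) n = seq_class A (\<lambda>m. nsum A (\<lambda>k. f k m) n)
     \<and> (\<lambda>m. nsum A (\<lambda>k. f k m) n) \<in> carrier (linf A)"
  by (induction n) (simp_all add: seq_class_zero seq_class_add)

end

text \<open>\<open>corner_identity\<close> is applied to classes in the sequence algebra. For
  representatives it holds up to a null sequence, for which the strict inequality in the last
  assumption leaves room; one large index then supplies x and y.\<close>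

lemma (in unital_cstar_algebra) corner_approximation:
  assumes c [simp]: "a \<in> carrier A" "b \<in> carrier A" "z \<in> carrier A" "t \<in> carrier A" "u \<in> carrier A"
    and l [simp]: "G \<in> carrier (linf A)" "R\<^sub>1 \<in> carrier (linf A)" "R\<^sub>2 \<in> carrier (linf A)"
      "S\<^sub>1 \<in> carrier (linf A)" "S\<^sub>2 \<in> carrier (linf A)" "V \<in> carrier (linf A)" "W \<in> carrier (linf A)"
      "Th \<in> carrier (linf A)" "E\<^sub>1\<^sub>1 \<in> carrier (linf A)" "E\<^sub>1\<^sub>2 \<in> carrier (linf A)"
      "E\<^sub>2\<^sub>1 \<in> carrier (linf A)" "E\<^sub>2\<^sub>2 \<in> carrier (linf A)"
    and gg: "seq_class A G \<otimes>\<^bsub>seq_alg A\<^esub> seq_class A G = seq_class A G"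
    and gc: "\<And>x. x \<in> carrier A \<Longrightarrow>
      seq_class A G \<otimes>\<^bsub>seq_alg A\<^esub> const_seq A x = const_seq A x \<otimes>\<^bsub>seq_alg A\<^esub> seq_class A G"
    and e11: "seq_class A R\<^sub>1 \<otimes>\<^bsub>seq_alg A\<^esub> (const_seq A b \<otimes>\<^bsub>seq_alg A\<^esub> seq_class A G) \<otimes>\<^bsub>seq_alg A\<^esub> seq_class A S\<^sub>1
      = const_seq A a \<otimes>\<^bsub>seq_alg A\<^esub> seq_class A G \<oplus>\<^bsub>seq_alg A\<^esub> seq_class A E\<^sub>1\<^sub>1"
    and e12: "seq_class A R\<^sub>1 \<otimes>\<^bsub>seq_alg A\<^esub> (const_seq A b \<otimes>\<^bsub>seq_alg A\<^esub> seq_class A G) \<otimes>\<^bsub>seq_alg A\<^esub> seq_class A S\<^sub>2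
      = seq_class A E\<^sub>1\<^sub>2"
    and e21: "seq_class A R\<^sub>2 \<otimes>\<^bsub>seq_alg A\<^esub> (const_seq A b \<otimes>\<^bsub>seq_alg A\<^esub> seq_class A G) \<otimes>\<^bsub>seq_alg A\<^esub> seq_class A S\<^sub>1
      = seq_class A E\<^sub>2\<^sub>1"
    and e22: "seq_class A R\<^sub>2 \<otimes>\<^bsub>seq_alg A\<^esub> (const_seq A b \<otimes>\<^bsub>seq_alg A\<^esub> seq_class A G) \<otimes>\<^bsub>seq_alg A\<^esub> seq_class A S\<^sub>2
      = const_seq A z \<otimes>\<^bsub>seq_alg A\<^esub> seq_class A G \<oplus>\<^bsub>seq_alg A\<^esub> seq_class A E\<^sub>2\<^sub>2"
    and tbu: "t \<otimes> b \<otimes> u = z"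
    and split: "\<one>\<^bsub>seq_alg A\<^esub> \<ominus>\<^bsub>seq_alg A\<^esub> seq_class A G
      = seq_class A V \<otimes>\<^bsub>seq_alg A\<^esub> const_seq A z \<otimes>\<^bsub>seq_alg A\<^esub> seq_class A W \<oplus>\<^bsub>seq_alg A\<^esub> seq_class A Th"
    and bd: "\<forall>\<^sub>F m in sequentially. nrm A (E\<^sub>1\<^sub>1 m) \<le> d" "\<forall>\<^sub>F m in sequentially. nrm A (E\<^sub>1\<^sub>2 m) \<le> d"
      "\<forall>\<^sub>F m in sequentially. nrm A (E\<^sub>2\<^sub>1 m) \<le> d" "\<forall>\<^sub>F m in sequentially. nrm A (E\<^sub>2\<^sub>2 m) \<le> d"
      "\<forall>\<^sub>F m in sequentially. nrm A (Th m) \<le> th" "\<And>m. nrm A (V m) \<le> K" "\<And>m. nrm A (W m) \<le> L"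
    and lt: "d + d * L + nrm A a * K * d + nrm A a * K * d * L + nrm A a * th < e"
  shows "\<exists>x\<in>carrier A. \<exists>y\<in>carrier A. nrm A (x \<otimes> b \<otimes> y \<ominus> a) < e"
proof -
  interpret Q: ring "seq_alg A" by (rule seq_alg_ring)
  have cc [simp]: "const_seq A x \<in> carrier (seq_alg A)" if "x \<in> carrier A" for x
    using that by (simp add: const_seq_eq)
  define X where "X m = R\<^sub>1 m \<otimes> G m \<oplus> (a \<otimes> V m) \<otimes> (R\<^sub>2 m \<otimes> G m \<oplus> t \<otimes> (\<one> \<ominus> G m))" for m
  define Y where "Y m = G m \<otimes> S\<^sub>1 m \<oplus> (G m \<otimes> S\<^sub>2 m \<oplus> (\<one> \<ominus> G m) \<otimes> u) \<otimes> W m" for m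
  \<comment> \<open>F represents the right-hand side of \<open>corner_identity\<close>; its five
    terms are bounded by the five summands of the last assumption.\<close>
  define F where "F m = E\<^sub>1\<^sub>1 m \<oplus> E\<^sub>1\<^sub>2 m \<otimes> W m \<oplus> (a \<otimes> V m) \<otimes> E\<^sub>2\<^sub>1 m \<oplus> (a \<otimes> V m) \<otimes> E\<^sub>2\<^sub>2 m \<otimes> W m \<ominus> a \<otimes> Th m" for m
  have Xl: "X \<in> carrier (linf A)" and Yl: "Y \<in> carrier (linf A)" and Fl: "F \<in> carrier (linf A)"
    unfolding X_def Y_def F_def by simp_all
  have tbq: "const_seq A t \<otimes>\<^bsub>seq_alg A\<^esub> const_seq A b \<otimes>\<^bsub>seq_alg A\<^esub> const_seq A u = const_seq A z"
    by (simp add: const_seq_eq seq_class_mult tbu)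
  have "seq_class A (\<lambda>m. X m \<otimes> b \<otimes> Y m \<ominus> a) = seq_class A F"
  proof -
    note id = Q.corner_identity[of "const_seq A a" "const_seq A b" "const_seq A z" "seq_class A G"
        "const_seq A t" "const_seq A u" "seq_class A R\<^sub>1" "seq_class A R\<^sub>2" "seq_class A S\<^sub>1" "seq_class A S\<^sub>2"
        "seq_class A V" "seq_class A W" "seq_class A Th" "seq_class A E\<^sub>1\<^sub>1" "seq_class A E\<^sub>1\<^sub>2"
        "seq_class A E\<^sub>2\<^sub>1" "seq_class A E\<^sub>2\<^sub>2", OF _ _ _ _ _ _ _ _ _ _ _ _ _ _ _ _ _ gg gc[OF c(2)] gc[OF c(5)]
        e11 e12 e21 e22 tbq split]
    show ?thesis
      unfolding X_def Y_def F_def using id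
      by (simp add: const_seq_eq seq_class_mult seq_class_add seq_class_minus seq_class_one)
  qed
  then have as: "asymp_eq A (\<lambda>m. X m \<otimes> b \<otimes> Y m \<ominus> a) F"
    using Xl Yl Fl by (subst (asm) seq_class_eq_iff) simp_all
  define s where "s = d + d * L + nrm A a * K * d + nrm A a * K * d * L + nrm A a * th"
  have "\<forall>\<^sub>F m in sequentially. nrm A (X m \<otimes> b \<otimes> Y m \<ominus> a \<ominus> F m) < e - s"
    using as lt unfolding asymp_eq_def s_def by (intro order_tendstoD) auto
  then have "\<forall>\<^sub>F m in sequentially. nrm A (X m \<otimes> b \<otimes> Y m \<ominus> a) < e"
    using bd(1-5)
  proof eventually_elim
    fix m
    assume diff: "nrm A (X m \<otimes> b \<otimes> Y m \<ominus> a \<ominus> F m) < e - s"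
      and b: "nrm A (E\<^sub>1\<^sub>1 m) \<le> d" "nrm A (E\<^sub>1\<^sub>2 m) \<le> d" "nrm A (E\<^sub>2\<^sub>1 m) \<le> d" "nrm A (E\<^sub>2\<^sub>2 m) \<le> d" "nrm A (Th m) \<le> th"
    note le = linf_entry[OF l(1)] linf_entry[OF l(6)] linf_entry[OF l(7)] linf_entry[OF l(8)] linf_entry[OF l(9)]
      linf_entry[OF l(10)] linf_entry[OF l(11)] linf_entry[OF l(12)]
    note [simp] = le
    have XY [simp]: "X m \<in> carrier A" "Y m \<in> carrier A" "F m \<in> carrier A"
      using linf_entry[OF Xl] linf_entry[OF Yl] linf_entry[OF Fl] by auto
    have aV: "nrm A (a \<otimes> V m) \<le> nrm A a * K" by (intro nrm_mult_le bd) auto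
    have "nrm A (F m) \<le> s"
      unfolding F_def s_def
      by (intro order_trans[OF nrm_minus_le] order_trans[OF nrm_triangle] add_mono nrm_mult_le aV b bd(7)) auto
    then show "nrm A (X m \<otimes> b \<otimes> Y m \<ominus> a) < e"
      using nrm_le_minus[of "X m \<otimes> b \<otimes> Y m \<ominus> a" "F m"] diff by simp
  qed
  then obtain m where "nrm A (X m \<otimes> b \<otimes> Y m \<ominus> a) < e" by (auto simp: eventually_sequentially)
  then show ?thesis using linf_entry[OF Xl] linf_entry[OF Yl] by blast
qed

section \<open>Lifting a splitting to sequences of matrices\<close>

locale corner_splitting = cstar_hom A B \<phi>
  for A :: "('a, 'm) cstar_scheme" and B :: "('b, 'n) cstar_scheme" and \<phi> +
  fixes \<psi> :: "'b \<Rightarrow> (nat \<Rightarrow> 'a) set" and G :: "nat \<Rightarrow> 'a"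
  assumes psi: "star_hom B (seq_alg A) \<psi>"
    and G [simp]: "G \<in> carrier (linf A)"
    and G_idem: "seq_class A G \<otimes>\<^bsub>seq_alg A\<^esub> seq_class A G = seq_class A G"
    and G_central: "x \<in> carrier A \<Longrightarrow>
      seq_class A G \<otimes>\<^bsub>seq_alg A\<^esub> const_seq A x = const_seq A x \<otimes>\<^bsub>seq_alg A\<^esub> seq_class A G"
    and psi_phi: "x \<in> carrier A \<Longrightarrow> \<psi> (\<phi> x) = const_seq A x \<otimes>\<^bsub>seq_alg A\<^esub> seq_class A G"
begin

text \<open>An arbitrary lift, chosen element by element; its algebraic relations hold only
  asymptotically.\<close>

definition Psi :: "'b \<Rightarrow> nat \<Rightarrow> 'a" where
  "Psi y = (SOME x. x \<in> carrier (linf A) \<and> seq_class A x = \<psi> y)"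

lemma Psi:
  assumes "y \<in> carrier B"
  shows Psi_linf [simp]: "Psi y \<in> carrier (linf A)" and seq_class_Psi: "seq_class A (Psi y) = \<psi> y"
proof -
  have "\<psi> y \<in> carrier (seq_alg A)" by (rule star_hom_carrier[OF psi assms])
  then have "\<exists>x. x \<in> carrier (linf A) \<and> seq_class A x = \<psi> y"
    by (metis dom.seq_alg_carrierE)
  from someI_ex[OF this] show "Psi y \<in> carrier (linf A)" "seq_class A (Psi y) = \<psi> y"
    unfolding Psi_def by blast+
qed

lemma asymp_Psi_iff:
  "\<lbrakk>y \<in> carrier B; x \<in> carrier (linf A)\<rbrakk> \<Longrightarrow> asymp_eq A (Psi y) x \<longleftrightarrow> \<psi> y = seq_class A x"
  by (simp add: seq_class_Psi flip: dom.seq_class_eq_iff)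

lemma psi_zero: "\<psi> \<zero>\<^bsub>B\<^esub> = \<zero>\<^bsub>seq_alg A\<^esub>"
proof -
  \<comment> \<open>Homogeneity is used at the scalar 0, where scalar multiplication of cosets
    yields the zero class.\<close>
  have "\<psi> \<zero>\<^bsub>B\<^esub> = \<psi> (0 \<odot>\<^bsub>B\<^esub> \<zero>\<^bsub>B\<^esub>)" by simp
  also have "\<dots> = 0 \<odot>\<^bsub>seq_alg A\<^esub> \<psi> \<zero>\<^bsub>B\<^esub>" by (simp only: star_hom_smult[OF psi cod.zero_closed])
  also have "\<dots> = seq_class A (\<lambda>n. 0 \<odot>\<^bsub>A\<^esub> Psi \<zero>\<^bsub>B\<^esub> n)"
    by (simp add: dom.seq_class_smult flip: seq_class_Psi)
  also have "(\<lambda>n. 0 \<odot>\<^bsub>A\<^esub> Psi \<zero>\<^bsub>B\<^esub> n) = (\<lambda>n. \<zero>\<^bsub>A\<^esub>)"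
    using dom.linf_entry[OF Psi_linf[OF cod.zero_closed]] by simp
  finally show ?thesis by (simp add: dom.seq_class_zero)
qed

lemma psi_mult_class:
  "\<lbrakk>x \<in> carrier B; y \<in> carrier B\<rbrakk> \<Longrightarrow> \<psi> (x \<otimes>\<^bsub>B\<^esub> y) = seq_class A (\<lambda>n. Psi x n \<otimes>\<^bsub>A\<^esub> Psi y n)"
  using dom.seq_class_mult[of "Psi x" "Psi y"] by (simp add: star_hom_mult[OF psi] seq_class_Psi)

lemma psi_add_class:
  "\<lbrakk>x \<in> carrier B; y \<in> carrier B\<rbrakk> \<Longrightarrow> \<psi> (x \<oplus>\<^bsub>B\<^esub> y) = seq_class A (\<lambda>n. Psi x n \<oplus>\<^bsub>A\<^esub> Psi y n)"
  using dom.seq_class_add[of "Psi x" "Psi y"] by (simp add: star_hom_add[OF psi] seq_class_Psi)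

lemma psi_smult_class:
  "x \<in> carrier B \<Longrightarrow> \<psi> (c \<odot>\<^bsub>B\<^esub> x) = seq_class A (\<lambda>n. c \<odot>\<^bsub>A\<^esub> Psi x n)"
  using dom.seq_class_smult[of "Psi x" c] by (simp add: star_hom_smult[OF psi] seq_class_Psi)

lemma psi_star_class:
  "x \<in> carrier B \<Longrightarrow> \<psi> (star B x) = seq_class A (\<lambda>n. star A (Psi x n))"
  using dom.seq_class_star[of "Psi x"] by (simp add: star_hom_star[OF psi] seq_class_Psi)

text \<open>With \<open>w\<^sup>2 = 1 - y\<^sup>*y\<close> the lifts satisfy \<open>\<parallel>Y\<parallel>\<^sup>2 \<le> \<parallel>Y\<^sup>*Y + W\<^sup>*W\<parallel>\<close>, which is
  asymptotically the norm of the approximate projection lifting \<open>\<psi> 1\<close>.\<close>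

lemma Psi_nrm_le_2:
  assumes y: "y \<in> carrier B" "nrm B y \<le> 1"
  shows "\<forall>\<^sub>F n in sequentially. nrm A (Psi y n) \<le> 2"
proof -
  let ?Q = "seq_alg A"
  have p: "star B y \<otimes>\<^bsub>B\<^esub> y \<in> psd B" using y by simp
  have "nrm B (star B y \<otimes>\<^bsub>B\<^esub> y) \<le> 1" using y cod.nrm_nonneg[OF y(1)] by (simp add: cod.cstar_identity power_le_one)
  then have "of_real 1 \<odot>\<^bsub>B\<^esub> \<one>\<^bsub>B\<^esub> \<ominus>\<^bsub>B\<^esub> star B y \<otimes>\<^bsub>B\<^esub> y \<in> psd B" using p by (intro cod.psd_const_minus) auto
  then obtain w where w: "w \<in> psd B" "w \<otimes>\<^bsub>B\<^esub> w = \<one>\<^bsub>B\<^esub> \<ominus>\<^bsub>B\<^esub> star B y \<otimes>\<^bsub>B\<^esub> y"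
    using cod.psd_sqrt by (metis cod.smult_1 cod.one_closed of_real_1)
  have wc: "w \<in> carrier B" and ws: "star B w = w" using w(1) by auto
  have sum: "star B y \<otimes>\<^bsub>B\<^esub> y \<oplus>\<^bsub>B\<^esub> star B w \<otimes>\<^bsub>B\<^esub> w = \<one>\<^bsub>B\<^esub>"
  proof -
    have "star B y \<otimes>\<^bsub>B\<^esub> y \<oplus>\<^bsub>B\<^esub> (\<one>\<^bsub>B\<^esub> \<ominus>\<^bsub>B\<^esub> star B y \<otimes>\<^bsub>B\<^esub> y) = \<one>\<^bsub>B\<^esub>"
      using y cod.star_closed[OF y(1)] cod.m_closed[of "star B y" y] cod.one_closed
      by (simp add: a_minus_def cod.a_lcomm cod.r_neg)
    then show ?thesis using w ws by simp
  qed
  let ?s = "\<lambda>x n. star A (Psi x n) \<otimes>\<^bsub>A\<^esub> Psi x n"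
  have ss: "\<psi> (star B x \<otimes>\<^bsub>B\<^esub> x) = seq_class A (?s x)" if "x \<in> carrier B" for x
    using that psi_star_class[OF that] seq_class_Psi[OF that]
      dom.seq_class_mult[of "\<lambda>n. star A (Psi x n)" "Psi x"]
    by (simp add: star_hom_mult[OF psi])
  have "\<psi> \<one>\<^bsub>B\<^esub> = seq_class A (\<lambda>n. ?s y n \<oplus>\<^bsub>A\<^esub> ?s w n)"
    unfolding sum[symmetric] using y wc by (simp add: star_hom_add[OF psi] ss dom.seq_class_add)
  then have 1: "asymp_eq A (Psi \<one>\<^bsub>B\<^esub>) (\<lambda>n. ?s y n \<oplus>\<^bsub>A\<^esub> ?s w n)"
    using y wc by (simp add: asymp_Psi_iff)
  have "\<psi> \<one>\<^bsub>B\<^esub> = seq_class A (?s \<one>\<^bsub>B\<^esub>)" using ss[of "\<one>\<^bsub>B\<^esub>"] by simp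
  then have 2: "asymp_eq A (Psi \<one>\<^bsub>B\<^esub>) (?s \<one>\<^bsub>B\<^esub>)" by (simp add: asymp_Psi_iff)
  have "\<forall>\<^sub>F n in sequentially. nrm A (Psi \<one>\<^bsub>B\<^esub> n \<ominus>\<^bsub>A\<^esub> (?s y n \<oplus>\<^bsub>A\<^esub> ?s w n)) < 1"
    using 1 unfolding asymp_eq_def by (rule order_tendstoD) simp
  moreover have "\<forall>\<^sub>F n in sequentially. nrm A (Psi \<one>\<^bsub>B\<^esub> n \<ominus>\<^bsub>A\<^esub> ?s \<one>\<^bsub>B\<^esub> n) < 1"
    using 2 unfolding asymp_eq_def by (rule order_tendstoD) simp
  ultimately show ?thesis
  proof eventually_elim
    fix n
    assume a1: "nrm A (Psi \<one>\<^bsub>B\<^esub> n \<ominus>\<^bsub>A\<^esub> (?s y n \<oplus>\<^bsub>A\<^esub> ?s w n)) < 1"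
      and a2: "nrm A (Psi \<one>\<^bsub>B\<^esub> n \<ominus>\<^bsub>A\<^esub> ?s \<one>\<^bsub>B\<^esub> n) < 1"
    define q where "q = Psi \<one>\<^bsub>B\<^esub> n"
    have c [simp]: "q \<in> carrier A" "Psi y n \<in> carrier A" "Psi w n \<in> carrier A"
      unfolding q_def using y wc dom.linf_entry Psi_linf by auto
    \<comment> \<open>q lifts \<psi>(1), so it is asymptotically equal to q^* q. Thus
      \<parallel>q\<parallel>^2 \<le> \<parallel>q\<parallel> + 1, which forces
      \<parallel>q\<parallel> \<le> 2; below, the lift of y has squared norm at most
      \<parallel>q\<parallel> + 1 \<le> 4.\<close>
    have "(nrm A q)\<^sup>2 = nrm A (star A q \<otimes>\<^bsub>A\<^esub> q)" by (simp add: dom.cstar_identity)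
    also have "\<dots> \<le> nrm A q + 1"
      using dom.nrm_le_minus[of "star A q \<otimes>\<^bsub>A\<^esub> q" q] dom.nrm_minus_commute[of "star A q \<otimes>\<^bsub>A\<^esub> q" q] a2
      by (simp add: q_def[symmetric])
    finally have q2: "nrm A q \<le> 2"
    proof -
      assume h: "(nrm A q)\<^sup>2 \<le> nrm A q + 1"
      show ?thesis
      proof (rule ccontr)
        assume "\<not> ?thesis"
        then have "2 * nrm A q < nrm A q * nrm A q" by simp
        with h \<open>\<not> ?thesis\<close> show False by (simp add: power2_eq_square)
      qed
    qed
    have "(nrm A (Psi y n))\<^sup>2 = nrm A (?s y n)" by (simp add: dom.cstar_identity)
    also have "\<dots> \<le> nrm A (?s y n \<oplus>\<^bsub>A\<^esub> ?s w n)"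
    proof (rule dom.nrm_mono)
      have "(?s y n \<oplus>\<^bsub>A\<^esub> ?s w n) \<ominus>\<^bsub>A\<^esub> ?s y n = ?s w n"
        using dom.m_closed[OF dom.star_closed[OF c(2)] c(2)] dom.m_closed[OF dom.star_closed[OF c(3)] c(3)]
        by (simp add: a_minus_def dom.a_ac dom.r_neg dom.r_neg1 dom.r_neg2)
      then show "(?s y n \<oplus>\<^bsub>A\<^esub> ?s w n) \<ominus>\<^bsub>A\<^esub> ?s y n \<in> psd A" by simp
    qed simp_all
    also have "\<dots> \<le> nrm A q + 1"
      using dom.nrm_le_minus[of "?s y n \<oplus>\<^bsub>A\<^esub> ?s w n" q]
        dom.nrm_minus_commute[of "?s y n \<oplus>\<^bsub>A\<^esub> ?s w n" q] a1
      by (simp add: q_def[symmetric])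
    finally have "(nrm A (Psi y n))\<^sup>2 \<le> 2\<^sup>2" using q2 by simp
    then show "nrm A (Psi y n) \<le> 2" by (rule power2_le_imp_le) simp
  qed
qed

text \<open>The unit ball contributes 2d after rescaling, and a third d absorbs the asymptotic
  difference between the lift of y and the rescaled lift. A constant factor serves in place of
  contractivity of \<psi>, since d is free.\<close>

lemma Psi_nrm_le:
  assumes y: "y \<in> carrier B" "nrm B y \<le> d" and d: "d > 0"
  shows "\<forall>\<^sub>F n in sequentially. nrm A (Psi y n) \<le> 3 * d"
proof -
  define y' where "y' = of_real (1/d) \<odot>\<^bsub>B\<^esub> y"
  have y': "y' \<in> carrier B" "nrm B y' \<le> 1" using y d by (auto simp: y'_def cod.nrm_smult norm_divide)
  have "y = of_real d \<odot>\<^bsub>B\<^esub> y'" using y d by (simp add: y'_def)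
  then have "\<psi> y = seq_class A (\<lambda>n. of_real d \<odot>\<^bsub>A\<^esub> Psi y' n)"
    using psi_smult_class[OF y'(1), of "of_real d"] by metis
  then have "asymp_eq A (Psi y) (\<lambda>n. of_real d \<odot>\<^bsub>A\<^esub> Psi y' n)" using y y' by (simp add: asymp_Psi_iff)
  then have "\<forall>\<^sub>F n in sequentially. nrm A (Psi y n \<ominus>\<^bsub>A\<^esub> of_real d \<odot>\<^bsub>A\<^esub> Psi y' n) < d"
    unfolding asymp_eq_def using d by (rule order_tendstoD)
  then show ?thesis using Psi_nrm_le_2[OF y']
  proof eventually_elim
    case (elim n)
    have c: "Psi y n \<in> carrier A" "Psi y' n \<in> carrier A" using y y' dom.linf_entry Psi_linf by auto
    have "nrm A (Psi y n) \<le> d * nrm A (Psi y' n) + d"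
      using dom.nrm_le_minus[of "Psi y n" "of_real d \<odot>\<^bsub>A\<^esub> Psi y' n"] elim(1) c d by (simp add: dom.nrm_smult)
    also have "d * nrm A (Psi y' n) \<le> d * 2" using elim(2) d by (intro mult_left_mono) auto
    finally show ?case by simp
  qed
qed

text \<open>A matrix over A_\<infinity> is handled as the class of a sequence of matrices over A.
  Entries outside the n x n block are set to zero explicitly, because the lift of zero is only known
  to be a null sequence.\<close>

definition Psi_mat :: "nat \<Rightarrow> 'b mat \<Rightarrow> nat \<Rightarrow> 'a mat" where
  "Psi_mat n M m = (\<lambda>i j. if i < n \<and> j < n then Psi (M i j) m else \<zero>\<^bsub>A\<^esub>)"

lemma Psi_mat_mats: "M \<in> mats B n \<Longrightarrow> Psi_mat n M m \<in> mats A n"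
  by (rule dom.matsI) (auto simp: Psi_mat_def cod.mats_carrier dom.linf_entry)

lemma Psi_mat_linf [simp]: "M \<in> mats B n \<Longrightarrow> Psi_mat n M \<in> carrier (linf (mat_alg A n))"
  by (rule dom.mat_linfI[OF Psi_mat_mats]) (auto simp: Psi_mat_def cod.mats_carrier)

lemma Psi_mat_class_eqI:
  assumes M: "M \<in> mats B n" and X: "X \<in> carrier (linf (mat_alg A n))" "\<And>m. X m \<in> mats A n"
    and e: "\<And>i j. \<lbrakk>i < n; j < n\<rbrakk> \<Longrightarrow> (\<lambda>m. X m i j) \<in> carrier (linf A) \<and> \<psi> (M i j) = seq_class A (\<lambda>m. X m i j)"
  shows "seq_class (mat_alg A n) (Psi_mat n M) = seq_class (mat_alg A n) X"
proof -
  interpret D: unital_cstar_algebra "mat_alg A n" by (rule dom.mat_cstar)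
  have "asymp_eq (mat_alg A n) (Psi_mat n M) X"
  proof (rule dom.mat_asymp_eqI[OF Psi_mat_mats[OF M] X(2)])
    fix i j assume ij: "i < n" "j < n"
    then show "asymp_eq A (\<lambda>m. Psi_mat n M m i j) (\<lambda>m. X m i j)"
      using e[OF ij] asymp_Psi_iff[OF cod.mats_carrier[OF M]] by (simp add: Psi_mat_def)
  qed
  then show ?thesis using D.seq_class_eq_iff[OF Psi_mat_linf[OF M] X(1)] by simp
qed

lemma Psi_mat_add:
  assumes M: "M \<in> mats B n" and N: "N \<in> mats B n"
  shows "seq_class (mat_alg A n) (Psi_mat n (\<lambda>i j. M i j \<oplus>\<^bsub>B\<^esub> N i j))
    = seq_class (mat_alg A n) (Psi_mat n M) \<oplus>\<^bsub>seq_alg (mat_alg A n)\<^esub> seq_class (mat_alg A n) (Psi_mat n N)"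
proof -
  interpret D: unital_cstar_algebra "mat_alg A n" by (rule dom.mat_cstar)
  have MN: "(\<lambda>i j. M i j \<oplus>\<^bsub>B\<^esub> N i j) \<in> mats B n" using M N by (auto simp: mats_def)
  note mc = cod.mats_carrier[OF M] cod.mats_carrier[OF N]
  have l: "(\<lambda>m. Psi_mat n M m \<oplus>\<^bsub>mat_alg A n\<^esub> Psi_mat n N m) \<in> carrier (linf (mat_alg A n))"
    using M N by (intro D.linf_add) auto
  show ?thesis unfolding D.seq_class_add[OF Psi_mat_linf[OF M] Psi_mat_linf[OF N]]
  proof (rule Psi_mat_class_eqI[OF MN l])
    fix m show "Psi_mat n M m \<oplus>\<^bsub>mat_alg A n\<^esub> Psi_mat n N m \<in> mats A n"
      using D.linf_entry[OF l] by simp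
  next
    fix i j assume "i < n" "j < n"
    then show "(\<lambda>m. (Psi_mat n M m \<oplus>\<^bsub>mat_alg A n\<^esub> Psi_mat n N m) i j) \<in> carrier (linf A)
      \<and> \<psi> (M i j \<oplus>\<^bsub>B\<^esub> N i j) = seq_class A (\<lambda>m. (Psi_mat n M m \<oplus>\<^bsub>mat_alg A n\<^esub> Psi_mat n N m) i j)"
      using mc by (simp add: Psi_mat_def psi_add_class)
  qed
qed

lemma psi_nsum: "(\<And>k. f k \<in> carrier B) \<Longrightarrow> \<psi> (nsum B f n) = nsum (seq_alg A) (\<lambda>k. \<psi> (f k)) n"
  by (induction n) (simp_all add: psi_zero star_hom_add[OF psi])

lemma Psi_mat_mult:
  assumes M: "M \<in> mats B n" and N: "N \<in> mats B n"
  shows "seq_class (mat_alg A n) (Psi_mat n (mat_mult B M N))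
    = seq_class (mat_alg A n) (Psi_mat n M) \<otimes>\<^bsub>seq_alg (mat_alg A n)\<^esub> seq_class (mat_alg A n) (Psi_mat n N)"
proof -
  interpret D: unital_cstar_algebra "mat_alg A n" by (rule dom.mat_cstar)
  note mc [simp] = cod.mats_carrier[OF M] cod.mats_carrier[OF N]
  have l: "(\<lambda>m. Psi_mat n M m \<otimes>\<^bsub>mat_alg A n\<^esub> Psi_mat n N m) \<in> carrier (linf (mat_alg A n))"
    using M N by (intro D.linf_mult) auto
  show ?thesis unfolding D.seq_class_mult[OF Psi_mat_linf[OF M] Psi_mat_linf[OF N]]
  proof (rule Psi_mat_class_eqI[OF cod.mats_mult[OF M N] l])
    fix m show "Psi_mat n M m \<otimes>\<^bsub>mat_alg A n\<^esub> Psi_mat n N m \<in> mats A n"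
      using D.linf_entry[OF l] by simp
  next
    fix i j assume ij: "i < n" "j < n"
    let ?f = "\<lambda>k m. Psi (M i k) m \<otimes>\<^bsub>A\<^esub> Psi (N k j) m"
    have f: "?f k \<in> carrier (linf A)" for k by simp
    have e: "(\<lambda>m. (Psi_mat n M m \<otimes>\<^bsub>mat_alg A n\<^esub> Psi_mat n N m) i j) = (\<lambda>m. nsum A (\<lambda>k. ?f k m) n)"
    proof
      fix m
      have "nsum A (\<lambda>k. Psi_mat n M m i k \<otimes>\<^bsub>A\<^esub> Psi_mat n N m k j) n = nsum A (\<lambda>k. ?f k m) n"
        using ij by (intro dom.nsum_cong) (simp add: Psi_mat_def)
      then show "(Psi_mat n M m \<otimes>\<^bsub>mat_alg A n\<^esub> Psi_mat n N m) i j = nsum A (\<lambda>k. ?f k m) n"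
        using dom.mats_carrier[OF Psi_mat_mats[OF N]] by (simp add: dom.mat_mult_nsum[OF Psi_mat_mats[OF M]])
    qed
    have "\<psi> (mat_mult B M N i j) = nsum (seq_alg A) (\<lambda>k. seq_class A (?f k)) n"
      by (simp add: cod.mat_mult_nsum[OF M] psi_nsum psi_mult_class)
    then show "(\<lambda>m. (Psi_mat n M m \<otimes>\<^bsub>mat_alg A n\<^esub> Psi_mat n N m) i j) \<in> carrier (linf A)
      \<and> \<psi> (mat_mult B M N i j) = seq_class A (\<lambda>m. (Psi_mat n M m \<otimes>\<^bsub>mat_alg A n\<^esub> Psi_mat n N m) i j)"
      unfolding e using dom.nsum_seq_class[of ?f n, OF f] by simp
  qed
qed

definition diag_G :: "nat \<Rightarrow> nat \<Rightarrow> 'a mat" where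
  "diag_G n m = diag_mat A n (G m)"

lemma diag_linf [simp]: "X \<in> carrier (linf A) \<Longrightarrow> (\<lambda>m. diag_mat A n (X m)) \<in> carrier (linf (mat_alg A n))"
proof (rule dom.mat_linfI)
  fix i j assume X: "X \<in> carrier (linf A)" and "i < n" "j < n"
  then show "(\<lambda>m. diag_mat A n (X m) i j) \<in> carrier (linf A)"
    by (cases "i = j") (simp_all add: diag_mat_def)
qed (simp add: dom.linf_entry)

lemma diag_class_cong:
  assumes "X \<in> carrier (linf A)" "Y \<in> carrier (linf A)" "seq_class A X = seq_class A Y"
  shows "seq_class (mat_alg A n) (\<lambda>m. diag_mat A n (X m)) = seq_class (mat_alg A n) (\<lambda>m. diag_mat A n (Y m))"
proof (rule unital_cstar_algebra.seq_class_cong[OF dom.mat_cstar])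
  show "asymp_eq (mat_alg A n) (\<lambda>m. diag_mat A n (X m)) (\<lambda>m. diag_mat A n (Y m))"
  proof (rule dom.mat_asymp_eqI)
    fix i j
    show "asymp_eq A (\<lambda>m. diag_mat A n (X m) i j) (\<lambda>m. diag_mat A n (Y m) i j)"
      using assms dom.seq_class_eq_iff[OF assms(1,2)]
      by (cases "i = j"; cases "i < n") (auto simp: diag_mat_def asymp_eq_def a_minus_def)
  qed (use assms dom.linf_entry in auto)
qed (use assms in auto)

lemma Psi_mat_phi:
  assumes M: "M \<in> mats A n"
  shows "seq_class (mat_alg A n) (Psi_mat n (\<lambda>i j. \<phi> (M i j)))
    = const_seq (mat_alg A n) M \<otimes>\<^bsub>seq_alg (mat_alg A n)\<^esub> seq_class (mat_alg A n) (diag_G n)"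
proof -
  interpret D: unital_cstar_algebra "mat_alg A n" by (rule dom.mat_cstar)
  note mc [simp] = dom.mats_carrier[OF M] dom.linf_entry[OF G]
  have gl: "diag_G n \<in> carrier (linf (mat_alg A n))" using diag_linf[OF G] by (simp add: diag_G_def[abs_def])
  have Ml: "(\<lambda>m. M) \<in> carrier (linf (mat_alg A n))" using M by (intro D.linf_const) simp
  have l: "(\<lambda>m. M \<otimes>\<^bsub>mat_alg A n\<^esub> diag_G n m) \<in> carrier (linf (mat_alg A n))"
    using D.linf_mult[OF Ml gl] .
  show ?thesis unfolding D.const_seq_eq D.seq_class_mult[OF Ml gl]
  proof (rule Psi_mat_class_eqI[OF hom_mats[OF M] l])
    fix m show "M \<otimes>\<^bsub>mat_alg A n\<^esub> diag_G n m \<in> mats A n" using D.linf_entry[OF l] by simp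
  next
    fix i j assume "i < n" "j < n"
    have "(M \<otimes>\<^bsub>mat_alg A n\<^esub> diag_G n m) i j = M i j \<otimes>\<^bsub>A\<^esub> G m" for m
      using M by (simp add: diag_G_def dom.diag_mat_mult_right)
    then show "(\<lambda>m. (M \<otimes>\<^bsub>mat_alg A n\<^esub> diag_G n m) i j) \<in> carrier (linf A) \<and>
      \<psi> (\<phi> (M i j)) = seq_class A (\<lambda>m. (M \<otimes>\<^bsub>mat_alg A n\<^esub> diag_G n m) i j)"
      by (simp add: psi_phi dom.const_seq_eq dom.seq_class_mult)
  qed
qed

text \<open>By centrality of G in each entry, both products represent the image of the matrix of
  entries \<phi>(M i j).\<close>

lemma diag_G_central:
  assumes M: "M \<in> mats A n"
  shows "seq_class (mat_alg A n) (diag_G n) \<otimes>\<^bsub>seq_alg (mat_alg A n)\<^esub> const_seq (mat_alg A n) M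
    = const_seq (mat_alg A n) M \<otimes>\<^bsub>seq_alg (mat_alg A n)\<^esub> seq_class (mat_alg A n) (diag_G n)"
proof -
  interpret D: unital_cstar_algebra "mat_alg A n" by (rule dom.mat_cstar)
  note mc [simp] = dom.mats_carrier[OF M] dom.linf_entry[OF G]
  have gl: "diag_G n \<in> carrier (linf (mat_alg A n))" using diag_linf[OF G] by (simp add: diag_G_def[abs_def])
  have Ml: "(\<lambda>m. M) \<in> carrier (linf (mat_alg A n))" using M by (intro D.linf_const) simp
  have l: "(\<lambda>m. diag_G n m \<otimes>\<^bsub>mat_alg A n\<^esub> M) \<in> carrier (linf (mat_alg A n))"
    using D.linf_mult[OF gl Ml] .
  show ?thesis unfolding Psi_mat_phi[OF M, symmetric] unfolding D.const_seq_eq D.seq_class_mult[OF gl Ml]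
  proof (rule Psi_mat_class_eqI[OF hom_mats[OF M] l, symmetric])
    fix m show "diag_G n m \<otimes>\<^bsub>mat_alg A n\<^esub> M \<in> mats A n" using D.linf_entry[OF l] by simp
  next
    fix i j assume "i < n" "j < n"
    have "(diag_G n m \<otimes>\<^bsub>mat_alg A n\<^esub> M) i j = G m \<otimes>\<^bsub>A\<^esub> M i j" for m
      using M by (simp add: diag_G_def dom.diag_mat_mult_left)
    then show "(\<lambda>m. (diag_G n m \<otimes>\<^bsub>mat_alg A n\<^esub> M) i j) \<in> carrier (linf A) \<and>
      \<psi> (\<phi> (M i j)) = seq_class A (\<lambda>m. (diag_G n m \<otimes>\<^bsub>mat_alg A n\<^esub> M) i j)"
      using G_central[of "M i j"] by (simp add: psi_phi dom.const_seq_eq dom.seq_class_mult)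
  qed
qed

lemma Psi_mat_nrm_le:
  assumes M: "M \<in> mats B n" and d: "d > 0" and e: "\<And>i j. \<lbrakk>i < n; j < n\<rbrakk> \<Longrightarrow> nrm B (M i j) \<le> d"
  shows "\<forall>\<^sub>F m in sequentially. mat_norm A (Psi_mat n M m) \<le> real n * (real n * (3 * d))"
proof -
  have "\<forall>\<^sub>F m in sequentially. \<forall>i\<in>{..<n}. \<forall>j\<in>{..<n}. nrm A (Psi (M i j) m) \<le> 3 * d"
    using e d by (intro eventually_ball_finite ballI Psi_nrm_le cod.mats_carrier[OF M]) auto
  then show ?thesis
  proof (rule eventually_mono)
    fix m assume "\<forall>i\<in>{..<n}. \<forall>j\<in>{..<n}. nrm A (Psi (M i j) m) \<le> 3 * d"
    then show "mat_norm A (Psi_mat n M m) \<le> real n * (real n * (3 * d))"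
      by (intro dom.mat_norm_le_entries[OF Psi_mat_mats[OF M]]) (simp add: Psi_mat_def)
  qed
qed

end

text \<open>As 1 - g = v^* v is a projection, it equals v^* p v for p = v v^*, and p is close to z Y
  z; so 1 - g is v^* z W with W = Y z v, up to \<open>Th\<close>. The order of choices matters:
  \<open>d\<^sub>0\<close> fixes Y, hence W and its bound L, and d, which depends on L, is chosen
  only then, before the blocks over B are obtained. The errors share e equally:
  \<open>S\<^sub>0 * d\<^sub>0\<close> bounds the contribution of \<open>Th\<close> and
  \<open>S\<^sub>1 * d\<close> that of the four blocks.\<close>

lemma (in corner_splitting) splitting_approximation:
  assumes a: "a \<in> mats A n" and b: "b \<in> mats A n" and z: "z \<in> carrier A"
    and t: "t \<in> mats A n" and u: "u \<in> mats A n"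
    and tbu: "mat_mult A (mat_mult A t b) u = diag_mat A n z"
    and V: "V \<in> carrier (linf A)"
    and VV: "\<one>\<^bsub>seq_alg A\<^esub> \<ominus>\<^bsub>seq_alg A\<^esub> seq_class A G = seq_class A (\<lambda>m. star A (V m) \<otimes>\<^bsub>A\<^esub> V m)"
    and her: "\<And>d. d > 0 \<Longrightarrow> \<exists>Y\<in>carrier (linf A).
      \<forall>\<^sub>F m in sequentially. nrm A (V m \<otimes>\<^bsub>A\<^esub> star A (V m) \<ominus>\<^bsub>A\<^esub> z \<otimes>\<^bsub>A\<^esub> Y m \<otimes>\<^bsub>A\<^esub> z) < d"
    and blocks: "\<And>d. d > 0 \<Longrightarrow> \<exists>r\<^sub>1\<in>mats B n. \<exists>r\<^sub>2\<in>mats B n. \<exists>s\<^sub>1\<in>mats B n. \<exists>s\<^sub>2\<in>mats B n.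
      \<forall>i<n. \<forall>j<n.
        nrm B (mat_mult B (mat_mult B r\<^sub>1 (\<lambda>i j. \<phi> (b i j))) s\<^sub>1 i j \<ominus>\<^bsub>B\<^esub> \<phi> (a i j)) \<le> d \<and>
        nrm B (mat_mult B (mat_mult B r\<^sub>1 (\<lambda>i j. \<phi> (b i j))) s\<^sub>2 i j) \<le> d \<and>
        nrm B (mat_mult B (mat_mult B r\<^sub>2 (\<lambda>i j. \<phi> (b i j))) s\<^sub>1 i j) \<le> d \<and>
        nrm B (mat_mult B (mat_mult B r\<^sub>2 (\<lambda>i j. \<phi> (b i j))) s\<^sub>2 i j \<ominus>\<^bsub>B\<^esub> \<phi> (diag_mat A n z i j)) \<le> d"
    and e: "e > 0"
  shows "\<exists>x\<in>mats A n. \<exists>y\<in>mats A n. mat_norm A (\<lambda>i j. mat_mult A (mat_mult A x b) y i j \<ominus>\<^bsub>A\<^esub> a i j) < e"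
proof -
  let ?D = "mat_alg A n" and ?\<Phi> = "\<lambda>M i j. \<phi> (M i j)"
  let ?Q = "seq_alg A" and ?QD = "seq_alg ?D"
  interpret D: unital_cstar_algebra ?D by (rule dom.mat_cstar)
  interpret Q: ring ?Q by (rule dom.seq_alg_ring)
  interpret QD: ring ?QD by (rule D.seq_alg_ring)
  interpret dg: cstar_hom A ?D "diag_mat A n" by (rule dom.diag_mat_hom)
  have [simp]: "V m \<in> carrier A" "G m \<in> carrier A" for m using dom.linf_entry V G by auto
  obtain KV where KV: "KV \<ge> 0" "\<And>m. nrm A (V m) \<le> KV" using dom.linf_bound[OF V] by metis
  define na where "na = mat_norm A a"
  have na: "na \<ge> 0" unfolding na_def by (rule dom.mat_norm_nonneg[OF a])
  define S\<^sub>0 where "S\<^sub>0 = na * (real n * (real n * (KV * KV)))"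
  have S0: "S\<^sub>0 \<ge> 0" using na KV by (simp add: S\<^sub>0_def)
  define d\<^sub>0 where "d\<^sub>0 = e / (2 * (S\<^sub>0 + 1))"
  have d0: "d\<^sub>0 > 0" using S0 e by (simp add: d\<^sub>0_def)
  have S0d0: "S\<^sub>0 * d\<^sub>0 < e / 2" using S0 e by (simp add: d\<^sub>0_def field_simps)
  obtain Y where Y: "Y \<in> carrier (linf A)"
    "\<forall>\<^sub>F m in sequentially. nrm A (V m \<otimes>\<^bsub>A\<^esub> star A (V m) \<ominus>\<^bsub>A\<^esub> z \<otimes>\<^bsub>A\<^esub> Y m \<otimes>\<^bsub>A\<^esub> z) < d\<^sub>0"
    using her[OF d0] by blast
  have [simp]: "Y m \<in> carrier A" for m using dom.linf_entry Y by auto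
  note [simp] = z
  define W where "W m = Y m \<otimes>\<^bsub>A\<^esub> z \<otimes>\<^bsub>A\<^esub> V m" for m
  define Th where "Th m = star A (V m) \<otimes>\<^bsub>A\<^esub> (V m \<otimes>\<^bsub>A\<^esub> star A (V m) \<ominus>\<^bsub>A\<^esub> z \<otimes>\<^bsub>A\<^esub> Y m \<otimes>\<^bsub>A\<^esub> z) \<otimes>\<^bsub>A\<^esub> V m" for m
  have Wl: "W \<in> carrier (linf A)" and Thl: "Th \<in> carrier (linf A)" and Vsl: "(\<lambda>m. star A (V m)) \<in> carrier (linf A)"
    unfolding W_def Th_def using V Y z by simp_all
  have [simp]: "W m \<in> carrier A" "Th m \<in> carrier A" for m using dom.linf_entry Wl Thl by auto
  let ?V' = "\<lambda>m. diag_mat A n (star A (V m))" and ?W' = "\<lambda>m. diag_mat A n (W m)" and ?T' = "\<lambda>m. diag_mat A n (Th m)"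
  obtain K where K: "K \<ge> 0" "\<And>m. nrm ?D (?V' m) \<le> K" using D.linf_bound[OF diag_linf[OF Vsl]] by metis
  obtain L where L: "L \<ge> 0" "\<And>m. nrm ?D (?W' m) \<le> L" using D.linf_bound[OF diag_linf[OF Wl]] by metis
  define S\<^sub>1 where "S\<^sub>1 = real n * (real n * 3) * (1 + L + na * K + na * K * L)"
  have S1: "S\<^sub>1 \<ge> 0" using na K L by (simp add: S\<^sub>1_def)
  define d where "d = e / (2 * (S\<^sub>1 + 1))"
  have d: "d > 0" using S1 e by (simp add: d_def)
  have S1d: "S\<^sub>1 * d < e / 2" using S1 e by (simp add: d_def field_simps)
  obtain r\<^sub>1 r\<^sub>2 s\<^sub>1 s\<^sub>2 where rs: "r\<^sub>1 \<in> mats B n" "r\<^sub>2 \<in> mats B n" "s\<^sub>1 \<in> mats B n" "s\<^sub>2 \<in> mats B n"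
    and bl: "\<forall>i<n. \<forall>j<n.
        nrm B (mat_mult B (mat_mult B r\<^sub>1 (?\<Phi> b)) s\<^sub>1 i j \<ominus>\<^bsub>B\<^esub> \<phi> (a i j)) \<le> d \<and>
        nrm B (mat_mult B (mat_mult B r\<^sub>1 (?\<Phi> b)) s\<^sub>2 i j) \<le> d \<and>
        nrm B (mat_mult B (mat_mult B r\<^sub>2 (?\<Phi> b)) s\<^sub>1 i j) \<le> d \<and>
        nrm B (mat_mult B (mat_mult B r\<^sub>2 (?\<Phi> b)) s\<^sub>2 i j \<ominus>\<^bsub>B\<^esub> \<phi> (diag_mat A n z i j)) \<le> d"
    using blocks[OF d] by (elim bexE)
  define P where "P r s = mat_mult B (mat_mult B r (?\<Phi> b)) s" for r s
  have P: "P r s \<in> mats B n" if "r \<in> mats B n" "s \<in> mats B n" for r s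
    unfolding P_def using that hom_mats[OF b] by simp
  have gl: "diag_G n \<in> carrier (linf ?D)" using diag_linf[OF G] by (simp add: diag_G_def[abs_def])
  have Pclass: "seq_class ?D (Psi_mat n r) \<otimes>\<^bsub>?QD\<^esub> (const_seq ?D b \<otimes>\<^bsub>?QD\<^esub> seq_class ?D (diag_G n)) \<otimes>\<^bsub>?QD\<^esub> seq_class ?D (Psi_mat n s)
      = seq_class ?D (Psi_mat n (P r s))" if "r \<in> mats B n" "s \<in> mats B n" for r s
    unfolding P_def using that hom_mats[OF b] by (simp add: Psi_mat_mult Psi_mat_phi[OF b, symmetric])
  define E where "E r s M = (\<lambda>i j. P r s i j \<ominus>\<^bsub>B\<^esub> \<phi> (M i j))" for r s M
  have E: "E r s M \<in> mats B n" if "r \<in> mats B n" "s \<in> mats B n" "M \<in> mats A n" for r s M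
    using P[OF that(1,2)] hom_mats[OF that(3)] by (auto simp: E_def mats_def a_minus_def)
  have Eclass: "seq_class ?D (Psi_mat n (P r s))
      = const_seq ?D M \<otimes>\<^bsub>?QD\<^esub> seq_class ?D (diag_G n) \<oplus>\<^bsub>?QD\<^esub> seq_class ?D (Psi_mat n (E r s M))"
    if "r \<in> mats B n" "s \<in> mats B n" "M \<in> mats A n" for r s M
  proof -
    have canc: "x = y \<oplus>\<^bsub>B\<^esub> (x \<ominus>\<^bsub>B\<^esub> y)" if "x \<in> carrier B" "y \<in> carrier B" for x y
      using that by algebra
    have "P r s i j = \<phi> (M i j) \<oplus>\<^bsub>B\<^esub> E r s M i j" for i j
      unfolding E_def using cod.mats_carrier[OF P[OF that(1,2)], of i j] cod.mats_carrier[OF hom_mats[OF that(3)], of i j]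
      by (rule canc)
    then have "P r s = (\<lambda>i j. \<phi> (M i j) \<oplus>\<^bsub>B\<^esub> E r s M i j)" by (intro ext)
    then show ?thesis
      using Psi_mat_add[OF hom_mats[OF that(3)] E[OF that]] by (simp add: Psi_mat_phi[OF that(3)])
  qed
  have gg: "seq_class ?D (diag_G n) \<otimes>\<^bsub>?QD\<^esub> seq_class ?D (diag_G n) = seq_class ?D (diag_G n)"
  proof -
    have "seq_class ?D (diag_G n) \<otimes>\<^bsub>?QD\<^esub> seq_class ?D (diag_G n) = seq_class ?D (\<lambda>m. diag_mat A n (G m \<otimes>\<^bsub>A\<^esub> G m))"
      by (simp only: D.seq_class_mult[OF gl gl] diag_G_def dg.hom_mult[symmetric] \<open>\<And>m. G m \<in> carrier A\<close>)
    also have "\<dots> = seq_class ?D (\<lambda>m. diag_mat A n (G m))"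
      using G_idem dom.seq_class_mult[OF G G] by (intro diag_class_cong) auto
    finally show ?thesis by (simp add: diag_G_def[abs_def])
  qed
  have split0: "\<one>\<^bsub>?Q\<^esub> \<ominus>\<^bsub>?Q\<^esub> seq_class A G = seq_class A (\<lambda>m. star A (V m) \<otimes>\<^bsub>A\<^esub> z \<otimes>\<^bsub>A\<^esub> W m \<oplus>\<^bsub>A\<^esub> Th m)"
  proof -
    let ?k = "\<one>\<^bsub>?Q\<^esub> \<ominus>\<^bsub>?Q\<^esub> seq_class A G" and ?g = "seq_class A G"
    have gc: "?g \<in> carrier ?Q" by simp
    have "?k \<otimes>\<^bsub>?Q\<^esub> ?k = (\<one>\<^bsub>?Q\<^esub> \<otimes>\<^bsub>?Q\<^esub> \<one>\<^bsub>?Q\<^esub> \<ominus>\<^bsub>?Q\<^esub> \<one>\<^bsub>?Q\<^esub> \<otimes>\<^bsub>?Q\<^esub> ?g) \<ominus>\<^bsub>?Q\<^esub> (?g \<otimes>\<^bsub>?Q\<^esub> \<one>\<^bsub>?Q\<^esub> \<ominus>\<^bsub>?Q\<^esub> ?g \<otimes>\<^bsub>?Q\<^esub> ?g)"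
      using gc Q.one_closed by algebra
    also have "\<dots> = ?k" unfolding G_idem using gc by (simp add: a_minus_def Q.r_neg)
    finally have kk: "?k \<otimes>\<^bsub>?Q\<^esub> ?k = ?k" .
    have "(\<lambda>m. star A (V m) \<otimes>\<^bsub>A\<^esub> z \<otimes>\<^bsub>A\<^esub> W m \<oplus>\<^bsub>A\<^esub> Th m)
        = (\<lambda>m. (star A (V m) \<otimes>\<^bsub>A\<^esub> V m) \<otimes>\<^bsub>A\<^esub> (star A (V m) \<otimes>\<^bsub>A\<^esub> V m))"
    proof
      fix m
      have "vs \<otimes>\<^bsub>A\<^esub> z \<otimes>\<^bsub>A\<^esub> (y \<otimes>\<^bsub>A\<^esub> z \<otimes>\<^bsub>A\<^esub> v) \<oplus>\<^bsub>A\<^esub> vs \<otimes>\<^bsub>A\<^esub> (v \<otimes>\<^bsub>A\<^esub> vs \<ominus>\<^bsub>A\<^esub> z \<otimes>\<^bsub>A\<^esub> y \<otimes>\<^bsub>A\<^esub> z) \<otimes>\<^bsub>A\<^esub> v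
        = (vs \<otimes>\<^bsub>A\<^esub> v) \<otimes>\<^bsub>A\<^esub> (vs \<otimes>\<^bsub>A\<^esub> v)"
        if "v \<in> carrier A" "vs \<in> carrier A" "y \<in> carrier A" for v vs y
        using that z by algebra
      then show "star A (V m) \<otimes>\<^bsub>A\<^esub> z \<otimes>\<^bsub>A\<^esub> W m \<oplus>\<^bsub>A\<^esub> Th m
        = (star A (V m) \<otimes>\<^bsub>A\<^esub> V m) \<otimes>\<^bsub>A\<^esub> (star A (V m) \<otimes>\<^bsub>A\<^esub> V m)"
        unfolding W_def Th_def by simp
    qed
    then have "seq_class A (\<lambda>m. star A (V m) \<otimes>\<^bsub>A\<^esub> z \<otimes>\<^bsub>A\<^esub> W m \<oplus>\<^bsub>A\<^esub> Th m) = ?k \<otimes>\<^bsub>?Q\<^esub> ?k"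
      unfolding VV using V Vsl by (simp add: dom.seq_class_mult)
    then show ?thesis using kk by simp
  qed
  have split: "\<one>\<^bsub>?QD\<^esub> \<ominus>\<^bsub>?QD\<^esub> seq_class ?D (diag_G n)
      = seq_class ?D ?V' \<otimes>\<^bsub>?QD\<^esub> const_seq ?D (diag_mat A n z) \<otimes>\<^bsub>?QD\<^esub> seq_class ?D ?W' \<oplus>\<^bsub>?QD\<^esub> seq_class ?D ?T'"
  proof -
    have one: "\<one>\<^bsub>?D\<^esub> = diag_mat A n \<one>\<^bsub>A\<^esub>" by (simp add: diag_mat_def)
    have minus: "diag_mat A n \<one>\<^bsub>A\<^esub> \<ominus>\<^bsub>?D\<^esub> diag_mat A n (G m) = diag_mat A n (\<one>\<^bsub>A\<^esub> \<ominus>\<^bsub>A\<^esub> G m)" for m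
      by (subst dom.mat_minus[OF dom.diag_mat_mats]) (simp_all add: diag_mat_def fun_eq_iff a_minus_def)
    have onel: "(\<lambda>m. diag_mat A n \<one>\<^bsub>A\<^esub>) \<in> carrier (linf ?D)" by (rule diag_linf) simp
    have zl: "(\<lambda>m. diag_mat A n z) \<in> carrier (linf ?D)" by (rule diag_linf) simp
    have "\<one>\<^bsub>?QD\<^esub> \<ominus>\<^bsub>?QD\<^esub> seq_class ?D (diag_G n) = seq_class ?D (\<lambda>m. diag_mat A n (\<one>\<^bsub>A\<^esub> \<ominus>\<^bsub>A\<^esub> G m))"
      unfolding D.seq_class_one one D.seq_class_minus[OF onel gl] unfolding diag_G_def minus ..
    also have "\<dots> = seq_class ?D (\<lambda>m. diag_mat A n (star A (V m) \<otimes>\<^bsub>A\<^esub> z \<otimes>\<^bsub>A\<^esub> W m \<oplus>\<^bsub>A\<^esub> Th m))"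
    proof (rule diag_class_cong)
      show "seq_class A (\<lambda>m. \<one>\<^bsub>A\<^esub> \<ominus>\<^bsub>A\<^esub> G m) = seq_class A (\<lambda>m. star A (V m) \<otimes>\<^bsub>A\<^esub> z \<otimes>\<^bsub>A\<^esub> W m \<oplus>\<^bsub>A\<^esub> Th m)"
        using split0 by (simp add: dom.seq_class_one dom.seq_class_minus)
    qed (use Vsl Wl Thl in simp_all)
    also have "(\<lambda>m. diag_mat A n (star A (V m) \<otimes>\<^bsub>A\<^esub> z \<otimes>\<^bsub>A\<^esub> W m \<oplus>\<^bsub>A\<^esub> Th m))
        = (\<lambda>m. ?V' m \<otimes>\<^bsub>?D\<^esub> diag_mat A n z \<otimes>\<^bsub>?D\<^esub> ?W' m \<oplus>\<^bsub>?D\<^esub> ?T' m)"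
      by (rule ext) (simp only: dg.hom_add dg.hom_mult dom.star_closed dom.m_closed z
          \<open>\<And>m. V m \<in> carrier A\<close> \<open>\<And>m. W m \<in> carrier A\<close> \<open>\<And>m. Th m \<in> carrier A\<close>)
    also have "seq_class ?D \<dots> = seq_class ?D ?V' \<otimes>\<^bsub>?QD\<^esub> const_seq ?D (diag_mat A n z) \<otimes>\<^bsub>?QD\<^esub> seq_class ?D ?W' \<oplus>\<^bsub>?QD\<^esub> seq_class ?D ?T'"
      unfolding D.const_seq_eq D.seq_class_mult[OF diag_linf[OF Vsl] zl]
        D.seq_class_mult[OF D.linf_mult[OF diag_linf[OF Vsl] zl] diag_linf[OF Wl]]
        D.seq_class_add[OF D.linf_mult[OF D.linf_mult[OF diag_linf[OF Vsl] zl] diag_linf[OF Wl]] diag_linf[OF Thl]] ..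
    finally show ?thesis .
  qed
  let ?d = "real n * (real n * (3 * d))" and ?th = "real n * (real n * (KV * d\<^sub>0 * KV))"
  have bd: "\<forall>\<^sub>F m in sequentially. nrm ?D (Psi_mat n M m) \<le> ?d"
    if "M \<in> mats B n" "\<And>i j. \<lbrakk>i < n; j < n\<rbrakk> \<Longrightarrow> nrm B (M i j) \<le> d" for M
    using Psi_mat_nrm_le[OF that(1) d that(2)] by simp
  have bth: "\<forall>\<^sub>F m in sequentially. nrm ?D (?T' m) \<le> ?th"
    using Y(2)
  proof (rule eventually_mono)
    fix m assume h: "nrm A (V m \<otimes>\<^bsub>A\<^esub> star A (V m) \<ominus>\<^bsub>A\<^esub> z \<otimes>\<^bsub>A\<^esub> Y m \<otimes>\<^bsub>A\<^esub> z) < d\<^sub>0"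
    have "nrm A (Th m) \<le> KV * d\<^sub>0 * KV"
      unfolding Th_def using KV(2)[of m] h by (intro dom.nrm_mult_le) auto
    then have "real n * (real n * nrm A (Th m)) \<le> ?th" by (intro mult_left_mono) auto
    then show "nrm ?D (?T' m) \<le> ?th" using dom.mat_norm_diag_le[of "Th m" n] by simp
  qed
  have lt: "?d + ?d * L + nrm ?D a * K * ?d + nrm ?D a * K * ?d * L + nrm ?D a * ?th < e"
  proof -
    have "?d + ?d * L + nrm ?D a * K * ?d + nrm ?D a * K * ?d * L = S\<^sub>1 * d"
      by (simp add: S\<^sub>1_def na_def algebra_simps)
    moreover have "nrm ?D a * ?th = S\<^sub>0 * d\<^sub>0" by (simp add: S\<^sub>0_def na_def algebra_simps)
    ultimately show ?thesis using S1d S0d0 by linarith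
  qed
  have zc: "diag_mat A n z \<in> mats A n" by simp
  have bl': "\<lbrakk>i < n; j < n\<rbrakk> \<Longrightarrow> nrm B (E r\<^sub>1 s\<^sub>1 a i j) \<le> d" "\<lbrakk>i < n; j < n\<rbrakk> \<Longrightarrow> nrm B (P r\<^sub>1 s\<^sub>2 i j) \<le> d"
    "\<lbrakk>i < n; j < n\<rbrakk> \<Longrightarrow> nrm B (P r\<^sub>2 s\<^sub>1 i j) \<le> d" "\<lbrakk>i < n; j < n\<rbrakk> \<Longrightarrow> nrm B (E r\<^sub>2 s\<^sub>2 (diag_mat A n z) i j) \<le> d" for i j
    using bl by (auto simp only: E_def P_def)
  note m = E[OF rs(1,3) a] P[OF rs(1,4)] P[OF rs(2,3)] E[OF rs(2,4) zc]
  have cm: "x \<in> carrier ?D" if "x \<in> mats A n" for x using that by simp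
  have gc: "seq_class ?D (diag_G n) \<otimes>\<^bsub>?QD\<^esub> const_seq ?D x = const_seq ?D x \<otimes>\<^bsub>?QD\<^esub> seq_class ?D (diag_G n)"
    if "x \<in> carrier ?D" for x
    using that unfolding mat_alg_simps by (rule diag_G_central)
  have tbu': "t \<otimes>\<^bsub>?D\<^esub> b \<otimes>\<^bsub>?D\<^esub> u = diag_mat A n z" using tbu by simp
  have "\<exists>x\<in>carrier ?D. \<exists>y\<in>carrier ?D. nrm ?D (x \<otimes>\<^bsub>?D\<^esub> b \<otimes>\<^bsub>?D\<^esub> y \<ominus>\<^bsub>?D\<^esub> a) < e"
    by (rule D.corner_approximation[OF cm[OF a] cm[OF b] cm[OF zc] cm[OF t] cm[OF u] gl
          Psi_mat_linf[OF rs(1)] Psi_mat_linf[OF rs(2)] Psi_mat_linf[OF rs(3)] Psi_mat_linf[OF rs(4)]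
          diag_linf[OF Vsl] diag_linf[OF Wl] diag_linf[OF Thl]
          Psi_mat_linf[OF m(1)] Psi_mat_linf[OF m(2)] Psi_mat_linf[OF m(3)] Psi_mat_linf[OF m(4)]
          gg gc trans[OF Pclass[OF rs(1,3)] Eclass[OF rs(1,3) a]] Pclass[OF rs(1,4)] Pclass[OF rs(2,3)]
          trans[OF Pclass[OF rs(2,4)] Eclass[OF rs(2,4) zc]] tbu' split
          bd[OF m(1) bl'(1)] bd[OF m(2) bl'(2)] bd[OF m(3) bl'(3)] bd[OF m(4) bl'(4)] bth K(2) L(2) lt])
  then show ?thesis by (simp add: dom.mat_minus[OF a])
qed

section \<open>Transfer of strict comparison\<close>

definition block_sum :: "('a, 'm) cstar_scheme \<Rightarrow> nat \<Rightarrow> 'a mat \<Rightarrow> 'a mat \<Rightarrow> 'a mat" where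
  "block_sum A n M N = (\<lambda>i j. if i < n \<and> j < n then M i j
     else if n \<le> i \<and> n \<le> j then N (i - n) (j - n) else \<zero>\<^bsub>A\<^esub>)"

lemma (in ring) nsum_split:
  assumes "\<And>k. f k \<in> carrier R"
  shows "nsum R f (n + m) = nsum R f n \<oplus> nsum R (\<lambda>k. f (n + k)) m"
  using assms by (induction m) (simp_all add: a_assoc)

lemma trace_fun_block_sum:
  "trace_fun \<tau> (n + m) (block_sum A n M N) = trace_fun \<tau> n M + trace_fun \<tau> m N"
proof -
  have "(\<Sum>i<n + m. Re (\<tau> (block_sum A n M N i i)))
      = (\<Sum>i<n. Re (\<tau> (block_sum A n M N i i))) + (\<Sum>i<m. Re (\<tau> (block_sum A n M N (n + i) (n + i))))"
    by (induction m) simp_all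
  then show ?thesis by (simp add: trace_fun_def block_sum_def)
qed

context unital_cstar_algebra
begin

lemma block_sum_mats [simp, intro]:
  "\<lbrakk>M \<in> mats A n; N \<in> mats A m\<rbrakk> \<Longrightarrow> block_sum A n M N \<in> mats A (n + m)"
proof (rule matsI)
  assume M: "M \<in> mats A n" and N: "N \<in> mats A m"
  fix i j
  show "block_sum A n M N i j \<in> carrier A" by (simp add: block_sum_def mats_carrier[OF M] mats_carrier[OF N])
  show "block_sum A n M N i j = \<zero>" if "\<not> (i < n + m \<and> j < n + m)"
  proof (cases "n \<le> i \<and> n \<le> j")
    case True
    then have "\<not> (i - n < m \<and> j - n < m)" using that by arith
    then show ?thesis using mats_zero[OF N] True by (simp add: block_sum_def)
  next
    case False
    then show ?thesis using that by (auto simp: block_sum_def)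
  qed
qed

lemma block_sum_mult:
  assumes M: "M \<in> mats A n" "M' \<in> mats A n" and N: "N \<in> mats A m" "N' \<in> mats A m"
  shows "mat_mult A (block_sum A n M N) (block_sum A n M' N') = block_sum A n (mat_mult A M M') (mat_mult A N N')"
proof (intro ext)
  fix i j
  note [simp] = mats_carrier[OF M(1)] mats_carrier[OF M(2)] mats_carrier[OF N(1)] mats_carrier[OF N(2)]
    mats_carrier[OF block_sum_mats[OF M(1) N(1)]] mats_carrier[OF block_sum_mats[OF M(2) N(2)]]
  define f where "f k = block_sum A n M N i k \<otimes> block_sum A n M' N' k j" for k
  have "mat_mult A (block_sum A n M N) (block_sum A n M' N') i j = nsum A f (n + m)"
    unfolding f_def by (rule mat_mult_nsum[OF block_sum_mats[OF M(1) N(1)]]) simp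
  also have "\<dots> = nsum A f n \<oplus> nsum A (\<lambda>k. f (n + k)) m" by (rule nsum_split) (simp add: f_def)
  also have "nsum A f n = nsum A (\<lambda>k. if i < n \<and> j < n then M i k \<otimes> M' k j else \<zero>) n"
    by (rule nsum_cong) (auto simp: f_def block_sum_def)
  also have "nsum A (\<lambda>k. f (n + k)) m = nsum A (\<lambda>k. if n \<le> i \<and> n \<le> j then N (i - n) k \<otimes> N' k (j - n) else \<zero>) m"
    by (rule nsum_cong) (auto simp: f_def block_sum_def)
  finally show "mat_mult A (block_sum A n M N) (block_sum A n M' N') i j
      = block_sum A n (mat_mult A M M') (mat_mult A N N') i j"
    by (cases "i < n"; cases "j < n")
      (simp_all add: block_sum_def[of _ _ "mat_mult A M M'"] mat_mult_nsum[OF M(1)] mat_mult_nsum[OF N(1)])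
qed

lemma block_sum_psd:
  assumes M: "M \<in> psd (mat_alg A n)" and N: "N \<in> psd (mat_alg A m)"
  shows "block_sum A n M N \<in> psd (mat_alg A (n + m))"
proof -
  obtain X where X: "X \<in> mats A n" "M = mat_mult A (\<lambda>i j. star A (X j i)) X"
    using M by (auto simp: mat_psd_iff positive_def)
  obtain Y where Y: "Y \<in> mats A m" "N = mat_mult A (\<lambda>i j. star A (Y j i)) Y"
    using N by (auto simp: mat_psd_iff positive_def)
  have "(\<lambda>i j. star A (block_sum A n X Y j i)) = block_sum A n (\<lambda>i j. star A (X j i)) (\<lambda>i j. star A (Y j i))"
    by (auto simp: block_sum_def fun_eq_iff)
  then have "block_sum A n M N = mat_mult A (\<lambda>i j. star A (block_sum A n X Y j i)) (block_sum A n X Y)"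
    using block_sum_mult[OF mats_star[OF X(1)] X(1) mats_star[OF Y(1)] Y(1)] X(2) Y(2) by simp
  moreover have "mat_mult A (\<lambda>i j. star A (block_sum A n X Y j i)) (block_sum A n X Y) \<in> mats A (n + m)"
    using mats_star block_sum_mats[OF X(1) Y(1)] by blast
  ultimately show ?thesis using block_sum_mats[OF X(1) Y(1)] by (auto simp: mat_psd_iff positive_def)
qed

lemma block_sum_pow:
  fixes k :: nat
  assumes M: "M \<in> mats A n" and N: "N \<in> mats A m"
  shows "block_sum A n M N [^]\<^bsub>mat_alg A (n + m)\<^esub> k
    = block_sum A n (M [^]\<^bsub>mat_alg A n\<^esub> k) (N [^]\<^bsub>mat_alg A m\<^esub> k)"
proof (induction k)
  case 0
  show ?case by (auto simp: block_sum_def nat_pow_def fun_eq_iff)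
next
  case (Suc k)
  interpret D: unital_cstar_algebra "mat_alg A n" by (rule mat_cstar)
  interpret E: unital_cstar_algebra "mat_alg A m" by (rule mat_cstar)
  have "M [^]\<^bsub>mat_alg A n\<^esub> k \<in> mats A n" "N [^]\<^bsub>mat_alg A m\<^esub> k \<in> mats A m"
    using D.nat_pow_closed[of M k] E.nat_pow_closed[of N k] M N by simp_all
  then show ?case using Suc M N by (simp add: block_sum_mult nat_pow_def)
qed

text \<open>The block sum of the roots is a positive root of the block sum, and such roots are
  unique.\<close>

lemma block_sum_root:
  assumes M: "M \<in> psd (mat_alg A n)" and N: "N \<in> psd (mat_alg A m)" and k: "k \<ge> 1"
  shows "cfc (mat_alg A (n + m)) (block_sum A n M N) (root k)
    = block_sum A n (cfc (mat_alg A n) M (root k)) (cfc (mat_alg A m) N (root k))"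
proof -
  interpret D: unital_cstar_algebra "mat_alg A n" by (rule mat_cstar)
  interpret E: unital_cstar_algebra "mat_alg A m" by (rule mat_cstar)
  interpret F: unital_cstar_algebra "mat_alg A (n + m)" by (rule mat_cstar)
  define X Y where "X = cfc (mat_alg A n) M (root k)" and "Y = cfc (mat_alg A m) N (root k)"
  have X: "X \<in> psd (mat_alg A n)" "X [^]\<^bsub>mat_alg A n\<^esub> k = M" unfolding X_def using M k by (simp_all add: D.cfc_root_pow)
  have Y: "Y \<in> psd (mat_alg A m)" "Y [^]\<^bsub>mat_alg A m\<^esub> k = N" unfolding Y_def using N k by (simp_all add: E.cfc_root_pow)
  have "block_sum A n X Y [^]\<^bsub>mat_alg A (n + m)\<^esub> k = block_sum A n M N"
    using X Y by (simp add: block_sum_pow mat_psd_mats)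
  then show ?thesis using F.cfc_root_unique[OF block_sum_psd[OF X(1) Y(1)] k] by (simp add: X_def Y_def)
qed

lemma dim_fun_block_sum:
  assumes t: "\<tau> \<in> tracial_states A" and M: "M \<in> psd (mat_alg A n)" and N: "N \<in> psd (mat_alg A m)"
  shows "dim_fun A \<tau> (block_sum A n M N) = dim_fun A \<tau> M + dim_fun A \<tau> N"
proof -
  let ?r = "\<lambda>n M k. trace_fun \<tau> n (cfc (mat_alg A n) M (root k))"
  have "(\<lambda>k. ?r n M k + ?r m N k) \<longlonglongrightarrow> dim_fun A \<tau> M + dim_fun A \<tau> N"
    by (intro tendsto_add dim_fun_tendsto t M N)
  moreover have "\<forall>\<^sub>F k in sequentially. ?r n M k + ?r m N k = ?r (n + m) (block_sum A n M N) k"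
    using eventually_ge_at_top[of 1]
    by (rule eventually_mono) (simp add: block_sum_root[OF M N] trace_fun_block_sum)
  ultimately have "?r (n + m) (block_sum A n M N) \<longlonglongrightarrow> dim_fun A \<tau> M + dim_fun A \<tau> N"
    by (rule Lim_transform_eventually)
  then show ?thesis using dim_fun_tendsto(1)[OF t block_sum_psd[OF M N]] LIMSEQ_unique by blast
qed

lemma dim_fun_nonneg:
  assumes t: "\<tau> \<in> tracial_states A" and a: "a \<in> psd (mat_alg A n)"
  shows "0 \<le> dim_fun A \<tau> a"
proof (rule LIMSEQ_le_const[OF dim_fun_tendsto(1)[OF t a]])
  interpret D: unital_cstar_algebra "mat_alg A n" by (rule mat_cstar)
  have "0 \<le> trace_fun \<tau> n (cfc (mat_alg A n) a (root k))" for k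
    using trace_fun_functional[OF t, of n] D.cfc_root_psd[OF a, of k] unfolding positive_functional_def by blast
  then show "\<exists>N. \<forall>k\<ge>N. 0 \<le> trace_fun \<tau> n (cfc (mat_alg A n) a (root k))" by blast
qed

lemma dim_fun_zero:
  assumes t: "\<tau> \<in> tracial_states A"
  shows "dim_fun A \<tau> (\<lambda>i j. \<zero>) = 0"
proof -
  interpret D: unital_cstar_algebra "mat_alg A 0" by (rule mat_cstar)
  have "(\<lambda>i j. \<zero>) \<in> psd (mat_alg A 0)" using D.psd_zero by simp
  from dim_fun_tendsto(1)[OF t this] show ?thesis by (simp add: trace_fun_def LIMSEQ_const_iff)
qed

lemma dim_fun_diag_le:
  assumes t: "\<tau> \<in> tracial_states A" and z: "z \<in> psd A" "nrm A z \<le> 1"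
    and f: "f \<in> psd A" "nrm A f \<le> 1" "f \<otimes> z = z"
  shows "dim_fun A \<tau> (diag_mat A n z) \<le> real n * Re (\<tau> f)"
proof -
  interpret dg: cstar_hom A "mat_alg A n" "diag_mat A n" by (rule diag_mat_hom)
  note l = dim_fun_tendsto(1)[OF t dg.hom_psd[OF z(1)]]
  have "trace_fun \<tau> n (cfc (mat_alg A n) (diag_mat A n z) (root k)) \<le> real n * Re (\<tau> f)" if k: "k \<ge> 1" for k
  proof -
    have "trace_fun \<tau> n (cfc (mat_alg A n) (diag_mat A n z) (root k)) = real n * Re (\<tau> (cfc A z (root k)))"
      unfolding dg.hom_cfc_root[OF z(1) k, symmetric] by (simp add: trace_fun_def diag_mat_def)
    also have "\<dots> \<le> real n * Re (\<tau> f)"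
      using positive_functional_mono[OF tracial_state_functional[OF t] cfc_root_le[OF z f k]] z f
      by (intro mult_left_mono) auto
    finally show ?thesis .
  qed
  then show ?thesis by (intro LIMSEQ_le_const2[OF l]) auto
qed

section \<open>Arithmetic with matrices of varying size\<close>

lemma mat_inf_simps [simp]:
  "carrier (mat_inf A) = (\<Union>n. mats A n)" "mult (mat_inf A) = mat_mult A"
  "zero (mat_inf A) = (\<lambda>i j. \<zero>)" "add (mat_inf A) = (\<lambda>M N i j. M i j \<oplus> N i j)"
  "nrm (mat_inf A) = mat_norm A"
  by (simp_all add: mat_inf_def mat_alg_def)

text \<open>No ring structure has been set up on \<open>mat_inf A\<close>, so the additive inverse
  is computed from its definite description.\<close>

lemma mat_inf_minus:
  assumes N: "N \<in> mats A n"
  shows "M \<ominus>\<^bsub>mat_inf A\<^esub> N = (\<lambda>i j. M i j \<ominus> N i j)"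
proof -
  note [simp] = mats_carrier[OF N]
  have "\<ominus>\<^bsub>mat_inf A\<^esub> N = (\<lambda>i j. \<ominus> N i j)"
    unfolding a_inv_def[of "mat_inf A"] m_inv_def
  proof (rule the_equality)
    have "(\<lambda>i j. \<ominus> N i j) \<in> mats A n" using N by (auto simp: mats_def)
    then show "(\<lambda>i j. \<ominus> N i j) \<in> carrier (add_monoid (mat_inf A)) \<and>
        N \<otimes>\<^bsub>add_monoid (mat_inf A)\<^esub> (\<lambda>i j. \<ominus> N i j) = \<one>\<^bsub>add_monoid (mat_inf A)\<^esub> \<and>
        (\<lambda>i j. \<ominus> N i j) \<otimes>\<^bsub>add_monoid (mat_inf A)\<^esub> N = \<one>\<^bsub>add_monoid (mat_inf A)\<^esub>"
      by (auto simp: r_neg l_neg)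
  next
    fix Y
    assume "Y \<in> carrier (add_monoid (mat_inf A)) \<and> N \<otimes>\<^bsub>add_monoid (mat_inf A)\<^esub> Y = \<one>\<^bsub>add_monoid (mat_inf A)\<^esub> \<and>
        Y \<otimes>\<^bsub>add_monoid (mat_inf A)\<^esub> N = \<one>\<^bsub>add_monoid (mat_inf A)\<^esub>"
    then have Y: "Y i j \<in> carrier A" "Y i j \<oplus> N i j = \<zero>" for i j
      by (auto simp: mats_def fun_eq_iff)
    then have "Y i j = \<ominus> N i j" for i j using minus_equality[OF Y(2)[of i j]] by simp
    then show "Y = (\<lambda>i j. \<ominus> N i j)" by (intro ext)
  qed
  then show ?thesis by (simp add: a_minus_def)
qed

text \<open>Since b is supported in the n x n block, r b s uses only the first n columns of r and
  the first n rows of s. Each n x n block of the product, at any offset, therefore arises from n x n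
  cuts of r and s.\<close>

lemma mat_mult_cut:
  assumes r: "r \<in> mats A N" and s: "s \<in> mats A N" and b: "b \<in> mats A n" and n: "n \<le> N" and ij: "i < n" "j < n"
  shows "mat_mult A (mat_mult A (\<lambda>i k. if i < n \<and> k < n then r (p + i) k else \<zero>) b)
      (\<lambda>l j. if l < n \<and> j < n then s l (q + j) else \<zero>) i j
    = mat_mult A (mat_mult A r b) s (p + i) (q + j)"
proof -
  let ?r = "\<lambda>i k. if i < n \<and> k < n then r (p + i) k else \<zero>" and ?s = "\<lambda>l j. if l < n \<and> j < n then s l (q + j) else \<zero>"
  note [simp] = mats_carrier[OF r] mats_carrier[OF s] mats_carrier[OF b]
  have r': "?r \<in> mats A n" and s': "?s \<in> mats A n" by (rule matsI; auto)+
  have rb': "mat_mult A ?r b \<in> mats A n" and rb: "mat_mult A r b \<in> mats A N"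
    using r' b mats_mono[OF b n] r by auto
  note [simp] = mats_carrier[OF rb] mats_carrier[OF rb'] mats_carrier[OF s']
  have eq: "mat_mult A ?r b i l = mat_mult A r b (p + i) l" for l
  proof -
    have "mat_mult A r b (p + i) l = nsum A (\<lambda>k. r (p + i) k \<otimes> b k l) N" by (rule mat_mult_nsum[OF r]) simp
    also have "\<dots> = nsum A (\<lambda>k. r (p + i) k \<otimes> b k l) n"
      using mats_zero[OF b] by (intro nsum_extend n) simp_all
    also have "\<dots> = mat_mult A ?r b i l"
      using ij by (subst mat_mult_nsum[OF r']) (auto intro: nsum_cong)
    finally show ?thesis ..
  qed
  have z: "mat_mult A r b (p + i) l = \<zero>" if "n \<le> l" for l
    using mats_zero[OF rb', of i l] that by (simp add: eq)
  have "mat_mult A (mat_mult A r b) s (p + i) (q + j) = nsum A (\<lambda>l. mat_mult A r b (p + i) l \<otimes> s l (q + j)) N"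
    by (rule mat_mult_nsum[OF rb]) simp
  also have "\<dots> = nsum A (\<lambda>l. mat_mult A r b (p + i) l \<otimes> s l (q + j)) n"
    using z by (intro nsum_extend n) simp_all
  also have "\<dots> = mat_mult A (mat_mult A ?r b) ?s i j"
    using ij by (subst mat_mult_nsum[OF rb']) (auto simp: eq intro: nsum_cong)
  finally show ?thesis ..
qed

text \<open>With b = X^* X the diagonal entry at p is the sum over k of the squares of the entries X
  k p, and it vanishes only if column p of X does.\<close>

lemma mat_psd_diag_nonzero:
  assumes b: "b \<in> psd (mat_alg A n)" "b \<noteq> (\<lambda>i j. \<zero>)"
  obtains p where "p < n" "b p p \<noteq> \<zero>"
proof -
  obtain X where X: "X \<in> mats A n" "b = mat_mult A (\<lambda>i j. star A (X j i)) X"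
    using b(1) by (auto simp: mat_psd_iff positive_def)
  note [simp] = mats_carrier[OF X(1)]
  have b_eq: "b i j = nsum A (\<lambda>k. star A (X k i) \<otimes> X k j) n" for i j
    unfolding X(2) by (subst mat_mult_nsum[OF mats_star[OF X(1)]]) simp_all
  have False if z: "\<And>p. p < n \<Longrightarrow> b p p = \<zero>"
  proof -
    have "X k p = \<zero>" if kp: "k < n" "p < n" for k p
    proof -
      have "nrm A (star A (X k p) \<otimes> X k p) \<le> nrm A (nsum A (\<lambda>k. star A (X k p) \<otimes> X k p) n)"
        by (rule nrm_mono[OF _ nsum_term_le[OF _ kp(1)]]) simp_all
      also have "\<dots> = 0" using z[OF kp(2)] b_eq by (simp add: nrm_eq_zero)
      finally have "(nrm A (X k p))\<^sup>2 \<le> 0" by (simp add: cstar_identity)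
      then show ?thesis by (simp add: nrm_eq_zero)
    qed
    then have "b i j = \<zero>" for i j unfolding b_eq
      using mats_zero[OF X(1)] by (subst nsum_cong[where g = "\<lambda>k. \<zero>"]) (metis r_null star_closed mats_carrier[OF X(1)], simp)
    then have "b = (\<lambda>i j. \<zero>)" by (intro ext)
    with b(2) show False by simp
  qed
  then show ?thesis using that by blast
qed

text \<open>t has a single nonzero column and u a single nonzero row, both at p, so b enters only
  through b p p. Orthogonality of the elements b p p w_i makes the product diagonal, with entries f
  z = z.\<close>

lemma diag_mat_factorization:
  assumes b: "b \<in> mats A n" and p: "p < n" and z: "z \<in> carrier A" and f: "f \<otimes> z = z"
    and w: "\<And>i. w i \<in> carrier A"
    and ww: "\<And>i j. \<lbrakk>i < n; j < n\<rbrakk> \<Longrightarrow> star A (b p p \<otimes> w i) \<otimes> (b p p \<otimes> w j) = (if i = j then f else \<zero>)"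
  obtains t u where "t \<in> mats A n" "u \<in> mats A n" "mat_mult A (mat_mult A t b) u = diag_mat A n z"
proof
  define t where "t i k = (if i < n \<and> k = p then star A (b p p \<otimes> w i) else \<zero>)" for i k
  define u where "u l j = (if l = p \<and> j < n then w j \<otimes> z else \<zero>)" for l j
  note [simp] = mats_carrier[OF b] w z
  show t: "t \<in> mats A n" and u: "u \<in> mats A n" using p by (auto simp: t_def u_def intro!: matsI split: if_splits)
  note [simp] = mats_carrier[OF t] mats_carrier[OF u]
  have tb: "mat_mult A t b i j = star A (b p p \<otimes> w i) \<otimes> b p j" if "i < n" for i j
  proof -
    have "mat_mult A t b i j = nsum A (\<lambda>k. t i k \<otimes> b k j) n" by (rule mat_mult_nsum[OF t]) simp
    also have "\<dots> = nsum A (\<lambda>k. if k = p then star A (b p p \<otimes> w i) \<otimes> b k j else \<zero>) n"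
      using that by (intro nsum_cong) (simp add: t_def)
    finally show ?thesis using p by (simp add: nsum_delta')
  qed
  have tbm: "mat_mult A t b \<in> mats A n" using t b by simp
  show "mat_mult A (mat_mult A t b) u = diag_mat A n z"
  proof (rule mats_eqI)
    fix i j assume ij: "i < n" "j < n"
    have "mat_mult A (mat_mult A t b) u i j = nsum A (\<lambda>l. mat_mult A t b i l \<otimes> u l j) n"
      by (rule mat_mult_nsum[OF tbm]) simp
    also have "\<dots> = nsum A (\<lambda>l. if l = p then mat_mult A t b i l \<otimes> (w j \<otimes> z) else \<zero>) n"
      using ij mats_carrier[OF tbm] by (intro nsum_cong) (simp add: u_def)
    also have "\<dots> = (star A (b p p \<otimes> w i) \<otimes> b p p) \<otimes> (w j \<otimes> z)"
      using p ij mats_carrier[OF tbm] by (simp add: nsum_delta' tb)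
    also have "\<dots> = (star A (b p p \<otimes> w i) \<otimes> (b p p \<otimes> w j)) \<otimes> z" by (simp add: m_assoc)
    also have "\<dots> = diag_mat A n z i j" using ij by (simp add: ww f diag_mat_def)
    finally show "mat_mult A (mat_mult A t b) u i j = diag_mat A n z i j" .
  qed (use tbm u in simp_all)
qed

text \<open>Every representative differs from the constant sequence by a null sequence, so a
  subsequence tending to 0 would force \<parallel>z\<parallel> = 0.\<close>

lemma const_seq_pp:
  assumes z: "z \<in> psd A" "z \<noteq> \<zero>"
  shows "const_seq A z \<in> seq_alg_pp A" and "const_seq A z \<noteq> \<zero>\<^bsub>seq_alg A\<^esub>"
proof -
  obtain s where s: "s \<in> carrier A" "z = star A s \<otimes> s"
    using z(1) unfolding positive_iff_psd[symmetric] positive_def by blast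
  have zc: "z \<in> carrier A" and nz: "nrm A z > 0" using z nrm_eq_zero nrm_nonneg by (auto simp: less_le)
  have ns: "\<not> (\<lambda>n. nrm A (x (k n))) \<longlonglongrightarrow> 0" if x: "x \<in> const_seq A z" and k: "strict_mono k" for x and k :: "nat \<Rightarrow> nat"
  proof
    assume l: "(\<lambda>n. nrm A (x (k n))) \<longlonglongrightarrow> 0"
    have xl: "x \<in> carrier (linf A)" "(\<lambda>n. nrm A (x n \<ominus> z)) \<longlonglongrightarrow> 0"
      using x zc by (auto simp: const_seq_eq mem_seq_class asymp_eq_def)
    have "(\<lambda>n. nrm A (x (k n)) + nrm A (x (k n) \<ominus> z)) \<longlonglongrightarrow> 0 + 0"
      using LIMSEQ_subseq_LIMSEQ[OF xl(2) k] l by (intro tendsto_add) (auto simp: o_def)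
    moreover have "nrm A z \<le> nrm A (x (k n)) + nrm A (x (k n) \<ominus> z)" for n
      using nrm_le_minus[of z "x (k n)"] zc linf_entry[OF xl(1)] by (simp add: nrm_minus_commute add.commute)
    ultimately have "nrm A z \<le> 0 + 0" by (intro LIMSEQ_le_const) auto
    then show False using nz by simp
  qed
  have pos: "positive (seq_alg A) (const_seq A z)"
    unfolding positive_def const_seq_eq using s zc
    by (auto simp: seq_class_star seq_class_mult intro!: bexI[of _ "seq_class A (\<lambda>n. s)"])
  show "const_seq A z \<in> seq_alg_pp A" using pos ns by (auto simp: seq_alg_pp_def)
  show "const_seq A z \<noteq> \<zero>\<^bsub>seq_alg A\<^esub>"
    using nz zc by (simp add: const_seq_eq seq_class_zero seq_class_eq_iff asymp_eq_def LIMSEQ_const_iff a_minus_def)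
qed

lemma hereditary_seq_class:
  assumes z: "z \<in> carrier A" and v: "V \<in> carrier (linf A)"
    and p: "seq_class A V \<in> hereditary (seq_alg A) (const_seq A z)" and e: "e > 0"
  shows "\<exists>Y\<in>carrier (linf A). \<forall>\<^sub>F m in sequentially. nrm A (V m \<ominus> z \<otimes> Y m \<otimes> z) < e"
proof -
  obtain X where X: "\<And>k. X k \<in> (\<lambda>y. const_seq A z \<otimes>\<^bsub>seq_alg A\<^esub> y \<otimes>\<^bsub>seq_alg A\<^esub> const_seq A z) ` carrier (seq_alg A)"
    "converges_to (seq_alg A) X (seq_class A V)"
    using p by (auto simp: hereditary_def closure_in_def)
  have "\<forall>\<^sub>F k in sequentially. nrm (seq_alg A) (X k \<ominus>\<^bsub>seq_alg A\<^esub> seq_class A V) < e"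
    using X(2) e unfolding converges_to_def by (rule order_tendstoD)
  then obtain k where k: "nrm (seq_alg A) (X k \<ominus>\<^bsub>seq_alg A\<^esub> seq_class A V) < e"
    by (auto simp: eventually_sequentially)
  obtain y where y: "y \<in> carrier (seq_alg A)" "X k = const_seq A z \<otimes>\<^bsub>seq_alg A\<^esub> y \<otimes>\<^bsub>seq_alg A\<^esub> const_seq A z"
    using X(1)[of k] by auto
  obtain Y where Y: "Y \<in> carrier (linf A)" "y = seq_class A Y" using y(1) by (rule seq_alg_carrierE)
  have "X k \<ominus>\<^bsub>seq_alg A\<^esub> seq_class A V = seq_class A (\<lambda>m. z \<otimes> Y m \<otimes> z \<ominus> V m)"
    unfolding y(2) Y(2) const_seq_eq using z Y(1) v by (simp add: seq_class_mult seq_class_minus)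
  then have "\<forall>\<^sub>F m in sequentially. nrm A (z \<otimes> Y m \<otimes> z \<ominus> V m) < e"
    using k z Y(1) v by (intro seq_class_nrm_less) simp_all
  then show ?thesis
    using z linf_entry[OF Y(1)] linf_entry[OF v] by (intro bexI[OF _ Y(1)]) (simp add: nrm_minus_commute[of "V _"])
qed

text \<open>Otherwise \<tau> vanishes on q A q, because 0 \<le> q y q \<le> \<parallel>y\<parallel>
  q for positive y. Since x q y = (x q)(q y), the trace property carries this to the ideal generated
  by q, which contains 1.\<close>

lemma tracial_state_projection_pos:
  assumes simple: "simple_cstar A" and t: "\<tau> \<in> tracial_states A"
    and q: "q \<in> carrier A" "star A q = q" "q \<otimes> q = q" "q \<noteq> \<zero>"
  shows "0 < Re (\<tau> q)"
proof (rule ccontr)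
  assume neg: "\<not> 0 < Re (\<tau> q)"
  note F = tracial_state_functional[OF t]
  have eq0: "\<tau> x = 0" if "x \<in> psd A" "Re (\<tau> x) \<le> 0" for x
    using tracial_state_real[OF t that(1)] tracial_state_nonneg[OF t that(1)] that(2)
    by (auto simp: complex_eq_iff complex_is_Real_iff)
  have cut: "\<tau> (q \<otimes> y \<otimes> q) = 0" if y: "y \<in> psd A" for y
  proof (rule eq0)
    have yc: "y \<in> carrier A" using y by simp
    show "q \<otimes> y \<otimes> q \<in> psd A" using conj_psd[OF y q(1)] q by simp
    have "of_real (nrm A y) \<odot> q \<ominus> q \<otimes> y \<otimes> q \<in> psd A"
      using conj_psd_le_nrm[OF y order_refl q(1)] q by simp
    then have "Re (\<tau> (q \<otimes> y \<otimes> q)) \<le> Re (\<tau> (of_real (nrm A y) \<odot> q))"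
      using q yc by (intro positive_functional_mono[OF F]) simp_all
    also have "\<dots> = nrm A y * Re (\<tau> q)" using q by (simp add: tracial_state_smult[OF t])
    also have "\<dots> \<le> 0" using neg nrm_nonneg[OF yc] by (simp add: mult_nonneg_nonpos)
    finally show "Re (\<tau> (q \<otimes> y \<otimes> q)) \<le> 0" .
  qed
  have tm: "\<tau> (x \<ominus> y) = \<tau> x - \<tau> y" if "x \<in> carrier A" "y \<in> carrier A" for x y
  proof -
    have "\<tau> x = \<tau> ((x \<ominus> y) \<oplus> y)" using that by (simp add: a_minus_def a_assoc l_neg)
    also have "\<dots> = \<tau> (x \<ominus> y) + \<tau> y" using that by (simp add: tracial_state_add[OF t])
    finally show ?thesis by simp
  qed
  have cut': "\<tau> (q \<otimes> y \<otimes> q) = 0" if y: "y \<in> carrier A" for y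
  proof -
    obtain a b c d where d: "a \<in> psd A" "b \<in> psd A" "c \<in> psd A" "d \<in> psd A" "y = (a \<ominus> b) \<oplus> \<i> \<odot> (c \<ominus> d)"
      by (rule psd_decomposition[OF y])
    have [simp]: "a \<in> carrier A" "b \<in> carrier A" "c \<in> carrier A" "d \<in> carrier A" using d by simp_all
    have dist: "q \<otimes> (x \<ominus> y) \<otimes> q = q \<otimes> x \<otimes> q \<ominus> q \<otimes> y \<otimes> q" if "x \<in> carrier A" "y \<in> carrier A" for x y
      using that q(1) by algebra
    have "q \<otimes> y \<otimes> q = (q \<otimes> a \<otimes> q \<ominus> q \<otimes> b \<otimes> q) \<oplus> \<i> \<odot> (q \<otimes> c \<otimes> q \<ominus> q \<otimes> d \<otimes> q)"
      unfolding d(5) using q(1)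
      by (simp add: r_distr l_distr smult_mult_left smult_mult_right dist)
    then show ?thesis
      using q(1) d(1-4) by (simp add: tracial_state_add[OF t] tracial_state_smult[OF t] tm cut)
  qed
  have "\<tau> w = 0" if "w \<in> generated_ideal A q" for w
    using that
  proof induction
    case zero
    show ?case by (rule tracial_state_zero[OF t])
  next
    case (step w x y)
    have "w \<in> carrier A" using step(1) q(1) by (rule generated_ideal_carrier)
    have "x \<otimes> q \<otimes> y = (x \<otimes> q) \<otimes> (q \<otimes> y)"
      using step q by (metis m_assoc m_closed)
    then have "\<tau> (x \<otimes> q \<otimes> y) = \<tau> ((q \<otimes> y) \<otimes> (x \<otimes> q))"
      using step q by (simp add: tracial_state_mult_commute[OF t, of "x \<otimes> q"])
    also have "(q \<otimes> y) \<otimes> (x \<otimes> q) = q \<otimes> (y \<otimes> x) \<otimes> q" using step q by (simp add: m_assoc)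
    finally have "\<tau> (x \<otimes> q \<otimes> y) = 0" using step cut' by simp
    then show ?case using step q \<open>w \<in> carrier A\<close> by (simp add: tracial_state_add[OF t])
  qed
  then show False using one_in_generated_ideal[OF simple q(1,4)] tracial_state_one[OF t] by fastforce
qed

text \<open>With no traces the premise of strict comparison holds vacuously for the unit and 0. Then
  the unit is a limit of products r 0 s, and 1 = 0.\<close>

lemma strict_comparison_tracial_states:
  assumes "strict_comparison A" and "carrier A \<noteq> {\<zero>}"
  shows "tracial_states A \<noteq> {}"
proof
  assume e: "tracial_states A = {}"
  interpret D: unital_cstar_algebra "mat_alg A 1" by (rule mat_cstar)
  define I where "I = diag_mat A 1 \<one>"
  have I: "I \<in> psd (mat_alg A 1)" "(\<lambda>i j. \<zero>) \<in> psd (mat_alg A 1)"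
    using D.psd_one D.psd_zero by (simp_all add: I_def diag_mat_def)
  then have "cuntz_below (mat_inf A) I (\<lambda>i j. \<zero>)"
    using assms(1) e unfolding strict_comparison_def positive_mat_inf_iff by blast
  then obtain r s where rs: "\<And>k. \<exists>n. r k \<in> mats A n" "\<And>k. \<exists>n. s k \<in> mats A n"
    "converges_to (mat_inf A) (\<lambda>k. mat_mult A (mat_mult A (r k) (\<lambda>i j. \<zero>)) (s k)) I"
    unfolding cuntz_below_def by auto
  have z: "mat_mult A (mat_mult A (r k) (\<lambda>i j. \<zero>)) (s k) = (\<lambda>i j. \<zero>)" for k
  proof -
    obtain n n' where n: "r k \<in> mats A n" "s k \<in> mats A n'" using rs(1,2) by metis
    have "mat_mult A (r k) (\<lambda>i j. \<zero>) = (\<lambda>i j. \<zero>)"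
      using mats_carrier[OF n(1)] by (intro ext) (simp add: mat_mult_nsum[OF n(1)])
    then show ?thesis by (simp add: mat_mult_def)
  qed
  have Im: "I \<in> mats A 1" by (simp add: I_def)
  have "(\<lambda>k::nat. mat_norm A (\<lambda>i j. \<zero> \<ominus> I i j)) \<longlonglongrightarrow> 0"
    using rs(3) by (simp add: converges_to_def z mat_inf_minus[OF Im])
  then have "mat_norm A (\<lambda>i j. \<zero> \<ominus> I i j) = 0" by (simp add: LIMSEQ_const_iff)
  moreover have "(\<lambda>i j. \<zero> \<ominus> I i j) \<in> mats A 1" using Im by (auto simp: mats_def a_minus_def)
  ultimately have "\<zero> \<ominus> I 0 0 = \<zero>" using mat_norm_eq_zero by (metis (no_types))
  then have "\<one> = \<zero>" by (simp add: I_def diag_mat_def a_minus_def)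
  then show False using assms(2) by (metis one_zeroD)
qed

end

section \<open>Using the tracially sequentially split homomorphism\<close>

context cstar_hom
begin

text \<open>The constant is c = \<tau>(f(1)); f(1) is a nonzero projection, on which a trace of a
  simple algebra is positive.\<close>

lemma pullback_tracial_state:
  assumes simple: "simple_cstar B" and ne: "f \<one>\<^bsub>A\<^esub> \<noteq> \<zero>\<^bsub>B\<^esub>" and t: "\<tau> \<in> tracial_states B"
  obtains \<sigma> c where "\<sigma> \<in> tracial_states A" "c > 0"
    "\<And>x. x \<in> carrier A \<Longrightarrow> \<tau> (f x) = of_real c * \<sigma> x"
proof
  define c where "c = Re (\<tau> (f \<one>\<^bsub>A\<^esub>))"
  show c: "c > 0" unfolding c_def
    by (rule cod.tracial_state_projection_pos[OF simple t]) (simp_all add: ne hom_mult[symmetric] hom_star[symmetric])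
  have tc: "\<tau> (f \<one>\<^bsub>A\<^esub>) = of_real c"
    using cod.tracial_state_real[OF t hom_psd[OF dom.psd_one]] by (simp add: c_def complex_eq_iff complex_is_Real_iff)
  show "(\<lambda>x. \<tau> (f x) / of_real c) \<in> tracial_states A"
  proof -
    have "\<tau> (f x) / of_real c \<in> \<real> \<and> 0 \<le> Re (\<tau> (f x) / of_real c)" if "x \<in> psd A" for x
      using cod.tracial_state_real[OF t hom_psd[OF that]] cod.tracial_state_nonneg[OF t hom_psd[OF that]] c
      by (auto simp: Re_divide_of_real)
    then show ?thesis
      using c tc unfolding tracial_states_def dom.positive_iff_psd
      by (auto simp: hom_add hom_smult hom_mult cod.tracial_state_add[OF t] cod.tracial_state_smult[OF t]
          add_divide_distrib cod.tracial_state_mult_commute[OF t])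
  qed
  show "\<tau> (f x) = of_real c * (\<tau> (f x) / of_real c)" for x using c by simp
qed

text \<open>The hypothesis at the constant sequence z, restated for representatives: V lifts the
  partial isometry from 1 - g to a projection in the hereditary subalgebra, and membership there
  becomes a norm estimate at large indices.\<close>

lemma splitting_exists:
  assumes tss: "tracially_sequentially_split A B f" and z: "z \<in> psd A" "z \<noteq> \<zero>\<^bsub>A\<^esub>"
  obtains \<psi> G V where "corner_splitting A B f \<psi> G" "seq_class A G \<noteq> \<zero>\<^bsub>seq_alg A\<^esub>" "V \<in> carrier (linf A)"
    "\<one>\<^bsub>seq_alg A\<^esub> \<ominus>\<^bsub>seq_alg A\<^esub> seq_class A G = seq_class A (\<lambda>m. star A (V m) \<otimes>\<^bsub>A\<^esub> V m)"
    "\<forall>d>0. \<exists>Y\<in>carrier (linf A).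
      \<forall>\<^sub>F m in sequentially. nrm A (V m \<otimes>\<^bsub>A\<^esub> star A (V m) \<ominus>\<^bsub>A\<^esub> z \<otimes>\<^bsub>A\<^esub> Y m \<otimes>\<^bsub>A\<^esub> z) < d"
proof -
  obtain \<psi> g p where g: "star_hom B (seq_alg A) \<psi>" "projection (seq_alg A) g" "g \<noteq> \<zero>\<^bsub>seq_alg A\<^esub>" "g \<in> central_seq_alg A"
    "\<forall>a\<in>carrier A. \<psi> (f a) = const_seq A a \<otimes>\<^bsub>seq_alg A\<^esub> g"
    and p: "p \<in> hereditary (seq_alg A) (const_seq A z)"
      "murray_von_neumann (seq_alg A) (\<one>\<^bsub>seq_alg A\<^esub> \<ominus>\<^bsub>seq_alg A\<^esub> g) p"
    using tss[unfolded tracially_sequentially_split_def, THEN conjunct2, rule_format, OF dom.const_seq_pp[OF z]]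
    by (elim exE conjE bexE) (rule that)
  obtain v where v: "v \<in> carrier (seq_alg A)" "star (seq_alg A) v \<otimes>\<^bsub>seq_alg A\<^esub> v = \<one>\<^bsub>seq_alg A\<^esub> \<ominus>\<^bsub>seq_alg A\<^esub> g"
    "v \<otimes>\<^bsub>seq_alg A\<^esub> star (seq_alg A) v = p"
    using p(2) unfolding murray_von_neumann_def by blast
  obtain G where G: "G \<in> carrier (linf A)" "g = seq_class A G"
    using g(2) dom.seq_alg_carrierE unfolding projection_def by metis
  obtain V where V: "V \<in> carrier (linf A)" "v = seq_class A V" using v(1) by (rule dom.seq_alg_carrierE)
  have cs: "corner_splitting A B f \<psi> G"
  proof unfold_locales
    show "seq_class A G \<otimes>\<^bsub>seq_alg A\<^esub> const_seq A x = const_seq A x \<otimes>\<^bsub>seq_alg A\<^esub> seq_class A G" if "x \<in> carrier A" for x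
      using g(4) that unfolding central_seq_alg_def G(2) by simp
  qed (use g G in \<open>auto simp: projection_def\<close>)
  have VV: "star (seq_alg A) v \<otimes>\<^bsub>seq_alg A\<^esub> v = seq_class A (\<lambda>m. star A (V m) \<otimes>\<^bsub>A\<^esub> V m)"
    "p = seq_class A (\<lambda>m. V m \<otimes>\<^bsub>A\<^esub> star A (V m))"
    unfolding v(3)[symmetric] V(2) using V(1) by (simp_all add: dom.seq_class_star dom.seq_class_mult)
  show ?thesis
  proof (rule that[OF cs _ V(1)])
    show "\<forall>d>0. \<exists>Y\<in>carrier (linf A).
        \<forall>\<^sub>F m in sequentially. nrm A (V m \<otimes>\<^bsub>A\<^esub> star A (V m) \<ominus>\<^bsub>A\<^esub> z \<otimes>\<^bsub>A\<^esub> Y m \<otimes>\<^bsub>A\<^esub> z) < d"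
      using p(1) V(1) z(1) unfolding VV(2) by (intro allI impI dom.hereditary_seq_class) simp_all
  qed (use g(3) G v(2) VV in simp_all)
qed

end

lemma (in unital_cstar_algebra) nrm_cfc_cut_minus:
  assumes a: "a \<in> psd A" and e: "e \<ge> 0"
  shows "nrm A (cfc A a (\<lambda>t. max 0 (t - e)) \<ominus> a) \<le> e"
proof -
  have c: "continuous_on UNIV (\<lambda>t. max 0 (t - e))" "continuous_on UNIV (\<lambda>t::real. t)" by (intro continuous_intros)+
  have "cfc A a (\<lambda>t. max 0 (t - e)) \<ominus> a = cfc A a (\<lambda>t. max 0 (t - e) - t)"
    using a by (simp add: cfc_minus[OF _ c] cfc_id)
  also have "nrm A \<dots> \<le> e"
    by (rule nrm_cfc_psd_le[OF a]) (use e in \<open>auto intro!: continuous_intros\<close>)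
  finally show ?thesis .
qed

context cstar_hom
begin

text \<open>Otherwise g = \<psi>(f(1)) would be zero in the splitting obtained for z = 1.\<close>

lemma hom_one_nonzero:
  assumes tss: "tracially_sequentially_split A B f" and ne: "\<one>\<^bsub>A\<^esub> \<noteq> \<zero>\<^bsub>A\<^esub>"
  shows "f \<one>\<^bsub>A\<^esub> \<noteq> \<zero>\<^bsub>B\<^esub>"
proof
  assume 0: "f \<one>\<^bsub>A\<^esub> = \<zero>\<^bsub>B\<^esub>"
  obtain \<psi> G V where s: "corner_splitting A B f \<psi> G" "seq_class A G \<noteq> \<zero>\<^bsub>seq_alg A\<^esub>"
    using splitting_exists[OF tss dom.psd_one ne] by metis
  interpret corner_splitting A B f \<psi> G by (rule s(1))
  have "\<psi> \<zero>\<^bsub>B\<^esub> = seq_class A G"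
    using psi_phi[of "\<one>\<^bsub>A\<^esub>"] dom.linf_entry[OF G]
    by (simp add: 0 dom.const_seq_eq dom.seq_class_mult)
  then show False using s(2) psi_zero by simp
qed

lemma cuntz_approximation:
  assumes sA: "simple_cstar A" and sB: "simple_cstar B" and fd: "\<not> finite_dim_cstar A"
    and tss: "tracially_sequentially_split A B f" and comp: "strict_comparison B"
    and a: "a \<in> psd (mat_alg A n)" and b: "b \<in> psd (mat_alg A n)"
    and lt: "\<And>\<tau>. \<tau> \<in> tracial_states A \<Longrightarrow> dim_fun A \<tau> a < dim_fun A \<tau> b"
    and e: "e > 0"
  shows "\<exists>x\<in>mats A n. \<exists>y\<in>mats A n. mat_norm A (\<lambda>i j. mat_mult A (mat_mult A x b) y i j \<ominus>\<^bsub>A\<^esub> a i j) < e"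
proof -
  let ?D = "mat_alg A n" and ?\<Phi> = "\<lambda>M i j. f (M i j)"
  interpret D: unital_cstar_algebra ?D by (rule dom.mat_cstar)
  interpret dg: cstar_hom A ?D "diag_mat A n" by (rule dom.diag_mat_hom)
  interpret \<Phi>: cstar_hom ?D "mat_alg B n" ?\<Phi> by (rule hom_mat_hom)
  interpret \<Phi>2: cstar_hom "mat_alg A (n + n)" "mat_alg B (n + n)" ?\<Phi> by (rule hom_mat_hom)
  have neA: "\<one>\<^bsub>A\<^esub> \<noteq> \<zero>\<^bsub>A\<^esub>" using sA dom.one_zeroD by (auto simp: simple_cstar_def)
  \<comment> \<open>Traces of B exist by strict comparison, and they pull back to traces of A; one
    of these shows that b is nonzero.\<close>
  note pull = pullback_tracial_state[OF sB hom_one_nonzero[OF tss neA]]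
  obtain \<tau>\<^sub>0 where "\<tau>\<^sub>0 \<in> tracial_states B"
    using cod.strict_comparison_tracial_states[OF comp] sB by (auto simp: simple_cstar_def)
  then obtain \<sigma>\<^sub>0 where s0: "\<sigma>\<^sub>0 \<in> tracial_states A" using pull by metis
  have "b \<noteq> (\<lambda>i j. \<zero>\<^bsub>A\<^esub>)"
    using lt[OF s0] dom.dim_fun_nonneg[OF s0 a] dom.dim_fun_zero[OF s0] by auto
  then obtain p where p: "p < n" "b p p \<noteq> \<zero>\<^bsub>A\<^esub>" using dom.mat_psd_diag_nonzero[OF b] by metis
  \<comment> \<open>Half of e is spent on the cut-down, the other half on approximating a'.\<close>
  define a' where "a' = cfc ?D a (\<lambda>t. max 0 (t - e / 2))"
  have a': "a' \<in> psd ?D" unfolding a'_def using a by (intro D.cfc_psd_psd) (auto intro!: continuous_intros)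
  have aa': "mat_norm A (\<lambda>i j. a' i j \<ominus>\<^bsub>A\<^esub> a i j) \<le> e / 2"
    using D.nrm_cfc_cut_minus[OF a, of "e / 2"] e by (simp add: a'_def dom.mat_minus[OF dom.mat_psd_mats[OF a]])
  obtain \<eta> where \<eta>: "\<eta> > 0" "\<And>\<tau>. \<tau> \<in> tracial_states A \<Longrightarrow> dim_fun A \<tau> a' + \<eta> \<le> dim_fun A \<tau> b"
    unfolding a'_def using dom.dim_fun_gap[OF a b half_gt_zero[OF e] lt] by metis
  \<comment> \<open>Two demands on 2^m: it must supply n elements w_i for the factorization of the
    diagonal matrix of z, and n / 2^m must be at most \<eta>/2, which bounds the dimension of that
    matrix at every trace. Only half of \<eta> is used, so that the inequality stays strict.\<close>
  obtain m :: nat where m: "max (real n) (2 * real n / \<eta>) < real m" using reals_Archimedean2 by blast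
  have m2: "real m < 2 ^ m" by (rule of_nat_less_two_power)
  have mn: "n \<le> 2 ^ m"
  proof -
    have "real n < 2 ^ m" using m m2 by linarith
    then show ?thesis by (metis less_imp_le of_nat_less_iff of_nat_numeral of_nat_power)
  qed
  have m\<eta>: "real n \<le> \<eta> / 2 * 2 ^ m"
  proof -
    have "2 * real n / \<eta> < 2 ^ m" using m m2 by linarith
    then show ?thesis using \<eta>(1) by (simp add: field_simps)
  qed
  obtain z g w where sw: "small_witness A (b p p) (2 ^ m) z g w"
    using dom.small_witness_exists[OF sA fd dom.mat_psd_diag[OF b] p(2)] by metis
  have z: "z \<in> psd A" "z \<noteq> \<zero>\<^bsub>A\<^esub>" "nrm A z \<le> 1" and g: "g \<in> psd A" "nrm A g \<le> 1" "g \<otimes>\<^bsub>A\<^esub> z = z"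
    and w: "\<And>i. w i \<in> carrier A"
    and ww: "\<And>i j. \<lbrakk>i < 2 ^ m; j < 2 ^ m\<rbrakk> \<Longrightarrow> star A (b p p \<otimes>\<^bsub>A\<^esub> w i) \<otimes>\<^bsub>A\<^esub> (b p p \<otimes>\<^bsub>A\<^esub> w j) = (if i = j then g else \<zero>\<^bsub>A\<^esub>)"
    using sw unfolding small_witness_def by blast+
  have bm: "b \<in> mats A n" and am: "a \<in> mats A n" and a'm: "a' \<in> mats A n" using a b a' by (auto intro: dom.mat_psd_mats)
  have zc: "z \<in> carrier A" using z by simp
  obtain t u where tu: "t \<in> mats A n" "u \<in> mats A n" "mat_mult A (mat_mult A t b) u = diag_mat A n z"
    using dom.diag_mat_factorization[OF bm p(1) zc g(3) w ww] mn by (metis less_le_trans)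
  obtain \<psi> G V where s: "corner_splitting A B f \<psi> G" "seq_class A G \<noteq> \<zero>\<^bsub>seq_alg A\<^esub>" and V: "V \<in> carrier (linf A)"
    "\<one>\<^bsub>seq_alg A\<^esub> \<ominus>\<^bsub>seq_alg A\<^esub> seq_class A G = seq_class A (\<lambda>m. star A (V m) \<otimes>\<^bsub>A\<^esub> V m)"
    and her: "\<forall>d>0. \<exists>Y\<in>carrier (linf A).
      \<forall>\<^sub>F m in sequentially. nrm A (V m \<otimes>\<^bsub>A\<^esub> star A (V m) \<ominus>\<^bsub>A\<^esub> z \<otimes>\<^bsub>A\<^esub> Y m \<otimes>\<^bsub>A\<^esub> z) < d"
    by (rule splitting_exists[OF tss z(1,2)]) (rule that)
  define c where "c = block_sum A n a' (diag_mat A n z)"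
  have c: "c \<in> psd (mat_alg A (n + n))" unfolding c_def by (rule dom.block_sum_psd[OF a' dg.hom_psd[OF z(1)]])
  have \<Phi>c: "?\<Phi> c \<in> psd (mat_alg B (n + n))" by (rule \<Phi>2.hom_psd[OF c])
  have "dim_fun B \<tau> (?\<Phi> c) < dim_fun B \<tau> (?\<Phi> b)" if t: "\<tau> \<in> tracial_states B" for \<tau>
  proof -
    obtain \<sigma> k where \<sigma>: "\<sigma> \<in> tracial_states A" "k > 0" "\<And>x. x \<in> carrier A \<Longrightarrow> \<tau> (f x) = of_real k * \<sigma> x"
      using pull[OF t] by metis
    have "real n * Re (\<sigma> g) \<le> \<eta> / 2 * 2 ^ m * Re (\<sigma> g)"
      using m\<eta> dom.tracial_state_nonneg[OF \<sigma>(1) g(1)] by (intro mult_right_mono) auto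
    also have "\<dots> = \<eta> / 2 * (real (2 ^ m) * Re (\<sigma> g))" by simp
    also have "\<dots> \<le> \<eta> / 2 * 1"
      using dom.small_witness_trace[OF \<sigma>(1) dom.mats_carrier[OF bm] sw] \<eta>(1) by (intro mult_left_mono) auto
    finally have "dim_fun A \<sigma> c \<le> dim_fun A \<sigma> a' + \<eta> / 2"
      using dom.dim_fun_diag_le[OF \<sigma>(1) z(1,3) g, of n] dom.dim_fun_block_sum[OF \<sigma>(1) a' dg.hom_psd[OF z(1)]]
      by (simp add: c_def)
    then have "dim_fun A \<sigma> c < dim_fun A \<sigma> b" using \<eta>(1) \<eta>(2)[OF \<sigma>(1)] by simp
    then show ?thesis using \<sigma>(2)
      by (simp add: hom_dim_fun[OF t \<sigma>(1,3) c] hom_dim_fun[OF t \<sigma>(1,3) b])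
  qed
  then have "cuntz_below (mat_inf B) (?\<Phi> c) (?\<Phi> b)"
    using comp \<Phi>c \<Phi>.hom_psd[OF b] unfolding strict_comparison_def cod.positive_mat_inf_iff by blast
  then obtain r s where rs: "\<And>k. \<exists>N. r k \<in> mats B N" "\<And>k. \<exists>N. s k \<in> mats B N"
    and lim: "(\<lambda>k. mat_norm B (\<lambda>i j. mat_mult B (mat_mult B (r k) (?\<Phi> b)) (s k) i j \<ominus>\<^bsub>B\<^esub> f (c i j))) \<longlonglongrightarrow> 0"
    unfolding cuntz_below_def converges_to_def by (auto simp: cod.mat_inf_minus[OF cod.mat_psd_mats[OF \<Phi>c]])
  have blocks: "\<exists>r\<^sub>1\<in>mats B n. \<exists>r\<^sub>2\<in>mats B n. \<exists>s\<^sub>1\<in>mats B n. \<exists>s\<^sub>2\<in>mats B n.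
      \<forall>i<n. \<forall>j<n.
        nrm B (mat_mult B (mat_mult B r\<^sub>1 (?\<Phi> b)) s\<^sub>1 i j \<ominus>\<^bsub>B\<^esub> f (a' i j)) \<le> d \<and>
        nrm B (mat_mult B (mat_mult B r\<^sub>1 (?\<Phi> b)) s\<^sub>2 i j) \<le> d \<and>
        nrm B (mat_mult B (mat_mult B r\<^sub>2 (?\<Phi> b)) s\<^sub>1 i j) \<le> d \<and>
        nrm B (mat_mult B (mat_mult B r\<^sub>2 (?\<Phi> b)) s\<^sub>2 i j \<ominus>\<^bsub>B\<^esub> f (diag_mat A n z i j)) \<le> d" if d: "d > 0" for d
  proof -
    have "\<forall>\<^sub>F k in sequentially. mat_norm B (\<lambda>i j. mat_mult B (mat_mult B (r k) (?\<Phi> b)) (s k) i j \<ominus>\<^bsub>B\<^esub> f (c i j)) < d"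
      using lim d by (rule order_tendstoD)
    then obtain k where k: "mat_norm B (\<lambda>i j. mat_mult B (mat_mult B (r k) (?\<Phi> b)) (s k) i j \<ominus>\<^bsub>B\<^esub> f (c i j)) < d"
      by (auto simp: eventually_sequentially)
    obtain N\<^sub>1 N\<^sub>2 where N12: "r k \<in> mats B N\<^sub>1" "s k \<in> mats B N\<^sub>2" using rs by metis
    \<comment> \<open>A common size for r and s that also contains the 2n x 2n block sum.\<close>
    define N where "N = max (n + n) (max N\<^sub>1 N\<^sub>2)"
    have rN: "r k \<in> mats B N" and sN: "s k \<in> mats B N" using N12 by (auto simp: N_def intro: cod.mats_mono)
    have nN: "n \<le> N" "n + n \<le> N" by (auto simp: N_def)
    have \<Phi>b: "?\<Phi> b \<in> mats B n" by (rule hom_mats[OF bm])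
    define P where "P = mat_mult B (mat_mult B (r k) (?\<Phi> b)) (s k)"
    have PN: "P \<in> mats B N" unfolding P_def using rN sN cod.mats_mono[OF \<Phi>b nN(1)] by simp
    have cN: "?\<Phi> c \<in> mats B N" using cod.mats_mono[OF cod.mat_psd_mats[OF \<Phi>c] nN(2)] .
    have "(\<lambda>i j. P i j \<ominus>\<^bsub>B\<^esub> f (c i j)) \<in> mats B N"
      using PN cN by (auto simp: mats_def a_minus_def)
    then have entry: "nrm B (P i j \<ominus>\<^bsub>B\<^esub> f (c i j)) \<le> d" for i j
      using cod.nrm_entry_le_mat_norm[of _ N i j] k unfolding P_def by fastforce
    \<comment> \<open>Row cuts of r and column cuts of s; the offsets 0 and n select the four n x n
      blocks of the product.\<close>
    define R S where "R q = (\<lambda>i l. if i < n \<and> l < n then r k (q + i) l else \<zero>\<^bsub>B\<^esub>)"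
      and "S q = (\<lambda>l j. if l < n \<and> j < n then s k l (q + j) else \<zero>\<^bsub>B\<^esub>)" for q
    have RS: "R q \<in> mats B n" "S q \<in> mats B n" for q
      unfolding R_def S_def using cod.mats_carrier[OF rN] cod.mats_carrier[OF sN] by (auto intro!: cod.matsI split: if_splits)
    have cut: "mat_mult B (mat_mult B (R q) (?\<Phi> b)) (S q') i j = P (q + i) (q' + j)" if "i < n" "j < n" for q q' i j
      unfolding R_def S_def P_def by (rule cod.mat_mult_cut[OF rN sN \<Phi>b nN(1) that])
    have "nrm B (P i j \<ominus>\<^bsub>B\<^esub> f (a' i j)) \<le> d \<and> nrm B (P i (n + j)) \<le> d \<and> nrm B (P (n + i) j) \<le> d \<and>
        nrm B (P (n + i) (n + j) \<ominus>\<^bsub>B\<^esub> f (diag_mat A n z i j)) \<le> d" if "i < n" "j < n" for i j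
      using entry[of i j] entry[of i "n + j"] entry[of "n + i" j] entry[of "n + i" "n + j"] that cod.mats_carrier[OF PN]
      by (simp add: c_def block_sum_def a_minus_def)
    then show ?thesis
      using RS cut by (intro bexI[of _ "R 0"] bexI[of _ "R n"] bexI[of _ "S 0"] bexI[of _ "S n"]) simp_all
  qed
  interpret corner_splitting A B f \<psi> G by (rule s(1))
  obtain x y where xy: "x \<in> mats A n" "y \<in> mats A n"
    "mat_norm A (\<lambda>i j. mat_mult A (mat_mult A x b) y i j \<ominus>\<^bsub>A\<^esub> a' i j) < e / 2"
    using splitting_approximation[OF a'm bm zc tu(1,2,3) V her[rule_format] blocks half_gt_zero[OF e]] by blast
  have "mat_norm A (\<lambda>i j. mat_mult A (mat_mult A x b) y i j \<ominus>\<^bsub>A\<^esub> a i j) < e"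
    using D.nrm_minus_triangle[of "mat_mult A (mat_mult A x b) y" a' a] xy bm am a'm aa'
    by (simp add: dom.mat_minus)
  then show ?thesis using xy by blast
qed

text \<open>Both matrices are placed in a common size n, and the approximations for e = 1/(k + 1)
  form the sequences required by Cuntz subequivalence.\<close>

lemma strict_comparison_pullback:
  assumes sA: "simple_cstar A" and sB: "simple_cstar B" and fd: "\<not> finite_dim_cstar A"
    and tss: "tracially_sequentially_split A B f" and comp: "strict_comparison B"
  shows "strict_comparison A"
  unfolding strict_comparison_def
proof (intro allI impI)
  fix a b
  assume h: "positive (mat_inf A) a \<and> positive (mat_inf A) b \<and> (\<forall>\<tau>\<in>tracial_states A. dim_fun A \<tau> a < dim_fun A \<tau> b)"
  then obtain n\<^sub>1 n\<^sub>2 where "a \<in> psd (mat_alg A n\<^sub>1)" "b \<in> psd (mat_alg A n\<^sub>2)"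
    unfolding dom.positive_mat_inf_iff by blast
  then have ab: "a \<in> psd (mat_alg A (max n\<^sub>1 n\<^sub>2))" "b \<in> psd (mat_alg A (max n\<^sub>1 n\<^sub>2))"
    by (auto intro: dom.mat_psd_mono)
  define n where "n = max n\<^sub>1 n\<^sub>2"
  have lt: "dim_fun A \<tau> a < dim_fun A \<tau> b" if "\<tau> \<in> tracial_states A" for \<tau> using h that by blast
  define P where "P k x y \<longleftrightarrow> x \<in> mats A n \<and> y \<in> mats A n \<and>
      mat_norm A (\<lambda>i j. mat_mult A (mat_mult A x b) y i j \<ominus>\<^bsub>A\<^esub> a i j) < inverse (real (Suc k))" for k x y
  have "\<exists>x y. P k x y" for k
    using cuntz_approximation[OF sA sB fd tss comp ab[folded n_def] lt, of "inverse (real (Suc k))"]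
    unfolding P_def by fastforce
  then obtain x y where "P k (x k) (y k)" for k by metis
  then have xy: "\<And>k. x k \<in> mats A n" "\<And>k. y k \<in> mats A n"
    "\<And>k. mat_norm A (\<lambda>i j. mat_mult A (mat_mult A (x k) b) (y k) i j \<ominus>\<^bsub>A\<^esub> a i j) < inverse (real (Suc k))"
    unfolding P_def by blast+
  have am: "a \<in> mats A n" and bm: "b \<in> mats A n" using ab by (auto simp: n_def intro: dom.mat_psd_mats)
  have d: "(\<lambda>i j. mat_mult A (mat_mult A (x k) b) (y k) i j \<ominus>\<^bsub>A\<^esub> a i j) \<in> mats A n" for k
    using dom.mats_mult[OF dom.mats_mult[OF xy(1) bm] xy(2)] am by (auto simp: mats_def a_minus_def)
  have "(\<lambda>k. mat_norm A (\<lambda>i j. mat_mult A (mat_mult A (x k) b) (y k) i j \<ominus>\<^bsub>A\<^esub> a i j)) \<longlonglongrightarrow> 0"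
    by (rule tendsto_sandwich[OF _ _ tendsto_const LIMSEQ_inverse_real_of_nat])
      (rule always_eventually allI dom.mat_norm_nonneg[OF d] less_imp_le[OF xy(3)])+
  then show "cuntz_below (mat_inf A) a b"
    unfolding cuntz_below_def converges_to_def using xy(1,2)
    by (intro exI[of _ x] exI[of _ y]) (auto simp: dom.mat_inf_minus[OF am])
qed

end

theorem theorem2p26:
  fixes A :: "'a cstar" and B :: "'b cstar" and \<phi> :: "'a \<Rightarrow> 'b"
  assumes "unital_cstar_algebra A" and "unital_cstar_algebra B"
    and "stably_finite A" and "stably_finite B"
    and "simple_cstar A" and "simple_cstar B"
    and "nuclear_cstar A \<or> exact_cstar A" and "nuclear_cstar B \<or> exact_cstar B"
    and "separable_cstar A" and "separable_cstar B"
    and "\<not> finite_dim_cstar A" and "\<not> finite_dim_cstar B"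
    and "tracially_sequentially_split A B \<phi>"
    and "strict_comparison B"
  shows "strict_comparison A"
proof -
  have "star_hom A B \<phi>" using assms(13) by (simp add: tracially_sequentially_split_def)
  then interpret cstar_hom A B \<phi> by (intro cstar_hom.intro cstar_hom_axioms.intro assms(1,2))
  show ?thesis by (rule strict_comparison_pullback[OF assms(5,6,11,13,14)])
qed

end
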